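(* Let $G$ be a finite non-solvable $\mathbf{GC}^*$-group. Then $G = G'$.
   Context: Galois automorphisms act on characters by $\chi^\alpha(g)=\chi(g)^\alpha$; two irreducible characters of $G$ are Galois conjugate if one is the image of the other under some element of $\mathrm{Gal}(\mathbb{Q}_n|\mathbb{Q})$ with $|G|$ dividing $n$. A finite group is a $\mathbf{GC}^*$-group if any two of its non-linear irreducible characters of the same degree are Galois conjugate. *)

theory Defs
  imports "HOL-Algebra.Solvable_Groups" "Jordan_Normal_Form.Matrix"
    "HOL-Computational_Algebra.Polynomial"
begin

definition is_rep :: "('a, 'b) monoid_scheme \<Rightarrow> nat \<Rightarrow> ('a \<Rightarrow> complex mat) \<Rightarrow> bool" where
  "is_rep G d \<rho> \<longleftrightarrow>
     (\<forall>g \<in> carrier G. \<rho> g \<in> carrier_mat d d) \<and>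
     \<rho> \<one>\<^bsub>G\<^esub> = 1\<^sub>m d \<and>
     (\<forall>g \<in> carrier G. \<forall>h \<in> carrier G. \<rho> (g \<otimes>\<^bsub>G\<^esub> h) = \<rho> g * \<rho> h)"

definition is_invariant_subspace ::
  "('a, 'b) monoid_scheme \<Rightarrow> nat \<Rightarrow> ('a \<Rightarrow> complex mat) \<Rightarrow> complex vec set \<Rightarrow> bool" where
  "is_invariant_subspace G d \<rho> W \<longleftrightarrow>
     W \<subseteq> carrier_vec d \<and> 0\<^sub>v d \<in> W \<and>
     (\<forall>v \<in> W. \<forall>w \<in> W. v + w \<in> W) \<and>
     (\<forall>c. \<forall>v \<in> W. c \<cdot>\<^sub>v v \<in> W) \<and>
     (\<forall>g \<in> carrier G. \<forall>w \<in> W. \<rho> g *\<^sub>v w \<in> W)"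

definition is_irred_rep :: "('a, 'b) monoid_scheme \<Rightarrow> nat \<Rightarrow> ('a \<Rightarrow> complex mat) \<Rightarrow> bool" where
  "is_irred_rep G d \<rho> \<longleftrightarrow> is_rep G d \<rho> \<and> d > 0 \<and>
     (\<forall>W. is_invariant_subspace G d \<rho> W \<longrightarrow> W = {0\<^sub>v d} \<or> W = carrier_vec d)"

definition mat_trace :: "complex mat \<Rightarrow> complex" where
  "mat_trace A = (\<Sum>i < dim_row A. A $$ (i, i))"

definition character :: "('a, 'b) monoid_scheme \<Rightarrow> ('a \<Rightarrow> complex mat) \<Rightarrow> 'a \<Rightarrow> complex" where
  "character G \<rho> = (\<lambda>g. if g \<in> carrier G then mat_trace (\<rho> g) else 0)"

definition irr_char :: "('a, 'b) monoid_scheme \<Rightarrow> ('a \<Rightarrow> complex) \<Rightarrow> bool" where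
  "irr_char G \<chi> \<longleftrightarrow> (\<exists>d \<rho>. is_irred_rep G d \<rho> \<and> \<chi> = character G \<rho>)"

definition char_degree :: "('a, 'b) monoid_scheme \<Rightarrow> ('a \<Rightarrow> complex) \<Rightarrow> complex" where
  "char_degree G \<chi> = \<chi> \<one>\<^bsub>G\<^esub>"

definition cyclotomic_field :: "nat \<Rightarrow> complex set" where
  "cyclotomic_field n = {poly (map_poly of_rat p) (cis (2 * pi / real n)) | p :: rat poly. True}"

text \<open>Elements of \<open>Gal(\<Q>_n | \<Q>)\<close>: field automorphisms of \<open>\<Q>_n\<close>
  (they automatically fix \<open>\<Q>\<close>).\<close>
definition galois_cyclotomic :: "nat \<Rightarrow> (complex \<Rightarrow> complex) set" where
  "galois_cyclotomic n = {\<sigma>. bij_betw \<sigma> (cyclotomic_field n) (cyclotomic_field n) \<and>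
      \<sigma> 1 = 1 \<and>
      (\<forall>x \<in> cyclotomic_field n. \<forall>y \<in> cyclotomic_field n.
          \<sigma> (x + y) = \<sigma> x + \<sigma> y \<and> \<sigma> (x * y) = \<sigma> x * \<sigma> y)}"

definition galois_conjugate :: "('a, 'b) monoid_scheme \<Rightarrow> ('a \<Rightarrow> complex) \<Rightarrow> ('a \<Rightarrow> complex) \<Rightarrow> bool" where
  "galois_conjugate G \<chi> \<psi> \<longleftrightarrow>
     (\<exists>n. n > 0 \<and> card (carrier G) dvd n \<and>
        (\<exists>\<sigma> \<in> galois_cyclotomic n. \<forall>g \<in> carrier G. \<psi> g = \<sigma> (\<chi> g)))"

definition GC_star_group :: "('a, 'b) monoid_scheme \<Rightarrow> bool" where
  "GC_star_group G \<longleftrightarrow> group G \<and> finite (carrier G) \<and>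
     (\<forall>\<chi> \<psi>. irr_char G \<chi> \<and> irr_char G \<psi> \<and> char_degree G \<chi> \<noteq> 1 \<and>
        char_degree G \<chi> = char_degree G \<psi> \<longrightarrow> galois_conjugate G \<chi> \<psi>)"

end

theory Submission
 imports Defs "HOL-Algebra.Sylow" "HOL-Algebra.Multiplicative_Group" "HOL-Combinatorics.Perm" "HOL-Number_Theory.Cong"
  "HOL-Computational_Algebra.Primes" "Jordan_Normal_Form.Spectral_Radius" "Jordan_Normal_Form.Determinant"
begin

text \<open>Suppose \<open>G' < G\<close> and let \<open>\<nu>\<close> be a linear character of prime order \<open>p\<close>. A Galois automorphism acts on a
 character as \<open>g \<mapsto> g\<^sup>k\<close> with \<open>k\<close> prime to \<open>|G|\<close>, so non-linear characters of equal degree have equal sums over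
 every subgroup. Comparing the determinants of \<open>\<chi>\<close> and \<open>\<nu>\<chi>\<close> shows that \<open>p\<close> divides the degree of every
 non-linear \<open>\<chi>\<close>. Let \<open>K\<close> be the subgroup generated by the elements of order prime to \<open>p\<close>, and \<open>P\<close> a Sylow
 \<open>p\<close>-subgroup. Invariant characters of \<open>K\<close> of degree prime to \<open>p\<close> extend to \<open>G\<close>, hence are linear, and counting
 \<open>|K|\<close> as a sum of squares of degrees modulo \<open>p\<close> gives that \<open>p\<close> does not divide \<open>|K|\<close>. For a non-linear
 character \<open>\<theta>\<close> of \<open>K\<close> with stabilizer \<open>KQ\<close>, \<open>Q \<le> P\<close>, the characters of \<open>G\<close> induced from the extensions of \<open>\<theta>\<close>
 to \<open>KQ\<close> have equal sums over \<open>P\<close>, so all linear characters of \<open>Q\<close> are equally frequent in an extension of \<open>\<theta>\<close>,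
 which forces \<open>Q = 1\<close>. Consequently an element of order \<open>p\<close> centralizes no non-trivial element of \<open>K'\<close>, and \<open>K'\<close>
 is solvable by Thompson's theorem on fixed-point-free automorphisms of prime order.\<close>

section \<open>Finite subgroups of a group type\<close>

text \<open>The long part is the appeal to Thompson's theorem. It is reached by transfer, which
  gives Frobenius' criterion for a normal \<open>q\<close>-complement, and by Thompson's criterion
  through the Thompson subgroup and the centre of a Sylow \<open>q\<close>-subgroup. The latter is
  for odd \<open>q\<close>, since the argument on quadratic action divides by 2; this does no harm,
  because a group without odd prime divisors is a 2-group and hence solvable. The inductions pass to
  quotients as well as to subgroups. To keep the type fixed, groups are finite subsets of a type of
  class \<open>grp\<close>, and quotients as well as the given group are realised inside
  \<open>nat perm\<close>, the finitely supported permutations of the natural numbers. The step from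
  trivial stabilizers to missing fixed points is this: for \<open>x\<close> of order
  \<open>p\<close> and \<open>y\<close> in \<open>K'\<close> all irreducible characters of
  \<open>G\<close> agree at \<open>x\<close> and \<open>x * y\<close>, so the two are conjugate; if
  \<open>y\<close> commutes with \<open>x\<close>, then \<open>y\<close> has order dividing
  \<open>p\<close> in a group of order prime to \<open>p\<close>.\<close>

class grp = monoid_mult + inverse +
 assumes grp_left_inverse [simp]: "inverse a * a = 1"
begin

lemma grp_inverse_mult_cancel [simp]: "inverse a * (a * b) = b"
 by (simp flip: mult.assoc)

lemma grp_right_inverse [simp]: "a * inverse a = 1"
 by (metis grp_inverse_mult_cancel grp_left_inverse mult_1_right)

lemma grp_mult_inverse_cancel [simp]: "a * (inverse a * b) = b"
 by (simp flip: mult.assoc)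

lemma grp_left_cancel [simp]: "a * b = a * c \<longleftrightarrow> b = c"
 by (metis grp_inverse_mult_cancel)

lemma grp_right_cancel [simp]: "b * a = c * a \<longleftrightarrow> b = c"
 by (metis grp_right_inverse mult.assoc mult_1_right)

lemma grp_inverse_unique: "a * b = 1 \<Longrightarrow> inverse a = b"
 by (metis grp_inverse_mult_cancel mult_1_right)

lemma grp_inverse_one [simp]: "inverse 1 = 1"
 by (rule grp_inverse_unique) simp

lemma grp_inverse_inverse [simp]: "inverse (inverse a) = a"
 by (rule grp_inverse_unique) simp

lemma grp_inverse_mult [simp]: "inverse (a * b) = inverse b * inverse a"
 by (rule grp_inverse_unique) (simp add: mult.assoc)

lemma grp_inverse_eq_iff [simp]: "inverse a = inverse b \<longleftrightarrow> a = b"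
 by (metis grp_inverse_inverse)

lemma grp_inverse_eq_1_iff [simp]: "inverse a = 1 \<longleftrightarrow> a = 1"
 by (metis grp_inverse_inverse grp_inverse_one)

lemma grp_mult_eq_left [simp]: "a * b = a \<longleftrightarrow> b = 1"
 by (metis grp_left_cancel mult_1_right)

lemma grp_mult_eq_right [simp]: "b * a = a \<longleftrightarrow> b = 1"
 by (metis grp_right_cancel mult_1_left)

definition cj :: "'a \<Rightarrow> 'a \<Rightarrow> 'a" where
 "cj g x = g * x * inverse g"

lemma cj_one [simp]: "cj 1 x = x" "cj g 1 = 1"
 by (simp_all add: cj_def)

lemma cj_mult: "cj g (x * y) = cj g x * cj g y"
 by (simp add: cj_def mult.assoc)

lemma cj_comp: "cj (g * h) x = cj g (cj h x)"
 by (simp add: cj_def mult.assoc)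

lemma cj_cancel [simp]: "cj g (cj (inverse g) x) = x" "cj (inverse g) (cj g x) = x"
 by (simp_all flip: cj_comp)

lemma cj_inj [simp]: "cj g x = cj g y \<longleftrightarrow> x = y"
 by (simp add: cj_def)

lemma cj_power: "cj g (x ^ n) = cj g x ^ n"
 by (induction n) (simp_all add: cj_mult)

lemma cj_inverse: "cj g (inverse x) = inverse (cj g x)"
 by (simp add: cj_def mult.assoc)

lemma cj_eq_iff: "cj g x = x \<longleftrightarrow> g * x = x * g"
 by (metis cj_def grp_mult_inverse_cancel grp_right_inverse mult.assoc mult_1_right)

lemma cj_eq_1 [simp]: "cj g x = 1 \<longleftrightarrow> x = 1"
 by (metis cj_inj cj_one(2))

lemma inj_cj [simp]: "inj_on (cj g) A"
 by (auto intro: inj_onI)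

text \<open>Finiteness makes closure under inverses automatic.\<close>

definition subgrp :: "'a set \<Rightarrow> bool" where
 "subgrp H \<longleftrightarrow> finite H \<and> 1 \<in> H \<and> (\<forall>x\<in>H. \<forall>y\<in>H. x * y \<in> H)"

lemma subgrp_one [simp]: "subgrp H \<Longrightarrow> 1 \<in> H"
 and subgrp_mult: "subgrp H \<Longrightarrow> x \<in> H \<Longrightarrow> y \<in> H \<Longrightarrow> x * y \<in> H"
 and subgrp_finite [simp]: "subgrp H \<Longrightarrow> finite H"
 unfolding subgrp_def by blast+

lemma subgrpI: "finite H \<Longrightarrow> 1 \<in> H \<Longrightarrow> (\<And>x y. x \<in> H \<Longrightarrow> y \<in> H \<Longrightarrow> x * y \<in> H) \<Longrightarrow> subgrp H"
 unfolding subgrp_def by blast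

lemma subgrp_power: "subgrp H \<Longrightarrow> x \<in> H \<Longrightarrow> x ^ n \<in> H"
 by (induction n) (auto simp: subgrp_mult)

lemma subgrp_inverse: assumes "subgrp H" "x \<in> H" shows "inverse x \<in> H"
proof -
 have "(*) x ` H \<subseteq> H" using assms by (auto simp: subgrp_mult)
 moreover have "inj_on ((*) x) H" by (auto intro: inj_onI)
 ultimately have "(*) x ` H = H" using assms by (intro endo_inj_surj) auto
 then obtain y where "y \<in> H" "x * y = 1" using assms by (metis imageE subgrp_one)
 then show ?thesis using grp_inverse_unique by blast
qed

lemmas subgrp_closed = subgrp_one subgrp_mult subgrp_inverse subgrp_power

lemma subgrp_cj: "subgrp H \<Longrightarrow> g \<in> H \<Longrightarrow> x \<in> H \<Longrightarrow> cj g x \<in> H"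
 by (simp add: cj_def subgrp_closed)

lemma subgrp_mult_left_iff: "subgrp H \<Longrightarrow> x \<in> H \<Longrightarrow> x * y \<in> H \<longleftrightarrow> y \<in> H"
 by (metis grp_inverse_mult_cancel subgrp_inverse subgrp_mult)

lemma subgrp_mult_right_iff: "subgrp H \<Longrightarrow> x \<in> H \<Longrightarrow> y * x \<in> H \<longleftrightarrow> y \<in> H"
 by (metis grp_right_inverse mult.assoc mult_1_right subgrp_inverse subgrp_mult)

lemma subgrp_inverse_iff: "subgrp H \<Longrightarrow> inverse x \<in> H \<longleftrightarrow> x \<in> H"
 by (metis grp_inverse_inverse subgrp_inverse)

lemma subgrp_trivial [simp]: "subgrp {1}"
 by (rule subgrpI) auto

lemma subgrp_Int: "subgrp H \<Longrightarrow> subgrp K \<Longrightarrow> subgrp (H \<inter> K)"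
 by (rule subgrpI) (auto simp: subgrp_mult)

lemma subgrp_cj_image: "subgrp H \<Longrightarrow> subgrp (cj g ` H)"
 by (rule subgrpI) (auto simp: subgrp_mult image_iff simp flip: cj_mult, metis cj_one(2) subgrp_one)

lemma card_cj_image [simp]: "card (cj g ` H) = card H"
 by (simp add: card_image)

lemma subgrp_card_pos [simp]: "subgrp H \<Longrightarrow> card H > 0"
 by (metis card_gt_0_iff empty_iff subgrp_def)

lemma subgrp_nonempty [simp]: "subgrp H \<Longrightarrow> H \<noteq> {}"
 by (metis empty_iff subgrp_one)

text \<open>The bridge to HOL-Algebra: Lagrange and Sylow are imported through it, and the
  representations of a subgroup \<open>H\<close> are those of \<open>mon H\<close>.\<close>

definition mon :: "'a set \<Rightarrow> 'a monoid" where
 "mon H = \<lparr>carrier = H, monoid.mult = (*), one = 1\<rparr>"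

lemma mon_simps [simp]: "carrier (mon H) = H" "x \<otimes>\<^bsub>mon H\<^esub> y = x * y" "\<one>\<^bsub>mon H\<^esub> = 1"
 by (simp_all add: mon_def)

lemma group_mon: "subgrp H \<Longrightarrow> group (mon H)"
proof (rule groupI)
 fix x assume "subgrp H" "x \<in> carrier (mon H)"
 then show "\<exists>y\<in>carrier (mon H). y \<otimes>\<^bsub>mon H\<^esub> x = \<one>\<^bsub>mon H\<^esub>"
  by (intro bexI[of _ "inverse x"]) (auto simp: subgrp_inverse)
qed (auto simp: subgrp_closed mult.assoc)

lemma mon_pow: "x [^]\<^bsub>mon H\<^esub> (n::nat) = x ^ n"
 by (induction n) (simp_all add: nat_pow_def power_commutes)

lemma subgroup_mon: 
 assumes "subgrp H" "subgrp K" "K \<subseteq> H" shows "subgroup K (mon H)"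
proof -
 interpret group "mon H" using assms by (simp add: group_mon)
 show ?thesis
 proof (rule subgroupI)
  fix a assume "a \<in> K"
  then have "inv\<^bsub>mon H\<^esub> a = inverse a"
   using assms by (intro inv_equality) (auto simp: subgrp_closed)
  then show "inv\<^bsub>mon H\<^esub> a \<in> K" using \<open>a \<in> K\<close> assms by (simp add: subgrp_closed)
 next
  show "K \<noteq> {}" using subgrp_one[OF assms(2)] by blast
 qed (use assms in \<open>auto simp: subgrp_closed\<close>)
qed

lemma subgrp_if_subgroup_mon: "subgrp H \<Longrightarrow> subgroup K (mon H) \<Longrightarrow> subgrp K"
 using subgroup.subset[of K "mon H"] subgroup.m_closed[of K "mon H"] subgroup.one_closed[of K "mon H"]
 by (intro subgrpI) (auto dest: finite_subset)

lemma subgrp_card_dvd: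
 assumes "subgrp H" "subgrp K" "K \<subseteq> H" shows "card K dvd card H"
 using group.lagrange[OF group_mon[OF assms(1)] subgroup_mon[OF assms]]
 by (metis dvd_triv_right mon_simps(1) Coset.order_def)

lemma subgrp_power_card:
 assumes "subgrp H" "x \<in> H" shows "x ^ card H = 1"
 using group.pow_order_eq_1[OF group_mon[OF assms(1)], of x] assms
 by (simp add: mon_pow Coset.order_def)

lemma sylow_ex:
 assumes "subgrp H" "prime p"
 shows "\<exists>P. subgrp P \<and> P \<subseteq> H \<and> card P = p ^ multiplicity p (card H)"
proof -
 have nz: "card H \<noteq> 0" using assms by (metis less_irrefl subgrp_card_pos)
 define m where "m = card H div p ^ multiplicity p (card H)"
 have eq: "Coset.order (mon H) = p ^ multiplicity p (card H) * m"
  unfolding Coset.order_def m_def by (simp add: multiplicity_dvd)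
 have "\<exists>P. subgroup P (mon H) \<and> card P = p ^ multiplicity p (card H)"
  by (rule sylow_thm[OF assms(2) group_mon[OF assms(1)] eq]) (use assms in simp)
 then obtain P where P: "subgroup P (mon H)" "card P = p ^ multiplicity p (card H)" by blast
 have "P \<subseteq> H" using subgroup.subset[OF P(1)] by simp
 then show ?thesis using P subgrp_if_subgroup_mon[OF assms(1) P(1)] by blast
qed

end

lemma multiplicity_pos_iff_dvd: "prime p \<Longrightarrow> n \<noteq> 0 \<Longrightarrow> multiplicity p n > 0 \<longleftrightarrow> p dvd (n::nat)"
 using prime_multiplicity_gt_zero_iff by blast

subsection \<open>Actions\<close>

definition acts :: "'g::grp set \<Rightarrow> 'b set \<Rightarrow> ('g \<Rightarrow> 'b \<Rightarrow> 'b) \<Rightarrow> bool" where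
 "acts H \<Omega> f \<longleftrightarrow> (\<forall>g\<in>H. \<forall>w\<in>\<Omega>. f g w \<in> \<Omega>) \<and> (\<forall>w\<in>\<Omega>. f 1 w = w) \<and>
  (\<forall>g\<in>H. \<forall>h\<in>H. \<forall>w\<in>\<Omega>. f (g * h) w = f g (f h w))"

lemma orbit_stabilizer:
 assumes H: "subgrp H" and f: "acts H \<Omega> f" and w: "w \<in> \<Omega>"
 shows "card ((\<lambda>g. f g w) ` H) * card {g\<in>H. f g w = w} = card H"
proof -
 have fib: "card {g\<in>H. f g w = v} = card {g\<in>H. f g w = w}" if v: "v \<in> (\<lambda>g. f g w) ` H" for v
 proof -
  obtain g0 where g0: "g0 \<in> H" "v = f g0 w" using v by auto
  have "{g\<in>H. f g w = v} = (*) g0 ` {g\<in>H. f g w = w}"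
  proof (intro equalityI subsetI)
   fix g assume g: "g \<in> {g\<in>H. f g w = v}"
   have "f (inverse g0 * g) w = f (inverse g0) (f g0 w)"
    using f H g g0 w by (simp add: acts_def subgrp_inverse)
   also have "\<dots> = f (inverse g0 * g0) w" 
    using f H g0 w unfolding acts_def by (metis subgrp_inverse)
   also have "\<dots> = w" using f w by (simp add: acts_def)
   finally show "g \<in> (*) g0 ` {g\<in>H. f g w = w}"
    using g g0 H by (intro image_eqI[of _ _ "inverse g0 * g"]) (auto simp: subgrp_closed)
  next
   fix g assume "g \<in> (*) g0 ` {g\<in>H. f g w = w}"
   then show "g \<in> {g\<in>H. f g w = v}" using f g0 H w by (auto simp: acts_def subgrp_closed)
  qed
  then show ?thesis by (simp add: card_image inj_on_def)
 qed
 have "card H = (\<Sum>v\<in>(\<lambda>g. f g w) ` H. card {g\<in>H. f g w = v})"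
  using sum.image_gen[of H "\<lambda>_. 1::nat" "\<lambda>g. f g w"] H by simp
 also have "\<dots> = card ((\<lambda>g. f g w) ` H) * card {g\<in>H. f g w = w}"
  using fib by simp
 finally show ?thesis by simp
qed

text \<open>A non-trivial orbit has size divisible by \<open>p\<close> and constant weight, so it
  can be removed without changing the sum modulo \<open>p\<close>. Weights are carried along because
  \<open>gcs_coprime_residual\<close> sums squares of character degrees; the constant weight 1 gives
  the usual count of fixed points.\<close>

lemma weighted_fixed_points_cong:
 assumes H: "subgrp H" "card H = p ^ k" "prime p" and fin: "finite \<Omega>" and f: "acts H \<Omega> f"
  and wt: "\<And>g w. g \<in> H \<Longrightarrow> w \<in> \<Omega> \<Longrightarrow> wt (f g w) = wt w"
 shows "[(\<Sum>w\<in>\<Omega>. wt w) = (\<Sum>w | w \<in> \<Omega> \<and> (\<forall>g\<in>H. f g w = w). wt w)] (mod (p::nat))"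
 using fin f wt
proof (induction "card \<Omega>" arbitrary: \<Omega> rule: less_induct)
 case less
 show ?case
 proof (cases "\<forall>w\<in>\<Omega>. \<forall>g\<in>H. f g w = w")
  case True
  then have "{w. w \<in> \<Omega> \<and> (\<forall>g\<in>H. f g w = w)} = \<Omega>" by auto
  then show ?thesis by simp
 next
  case False
  then obtain w g where wg: "w \<in> \<Omega>" "g \<in> H" "f g w \<noteq> w" by auto
  define Or where "Or = (\<lambda>g. f g w) ` H"
  have orb: "Or \<subseteq> \<Omega>" using less wg by (auto simp: Or_def acts_def)
  have wO: "w \<in> Or" using less wg H unfolding Or_def acts_def by (metis image_eqI subgrp_one)
  have "f g w \<in> Or" using wg by (auto simp: Or_def)
  have finO: "finite Or" using H by (simp add: Or_def)
  have "card Or \<noteq> 1" using \<open>f g w \<in> Or\<close> wO wg by (metis card_1_singletonE singletonD)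
  moreover have "card Or dvd p ^ k"
   using orbit_stabilizer[OF H(1) less.prems(2) wg(1)] H unfolding Or_def by (metis dvd_triv_left)
  ultimately have pO: "p dvd card Or" 
   using H(3) by (metis divides_primepow_nat dvd_power gr0I power_0)
  have inv: "f h v \<in> Or" if "h \<in> H" "v \<in> Or" for h v
  proof -
   obtain h' where h': "h' \<in> H" "v = f h' w" using \<open>v \<in> Or\<close> by (auto simp: Or_def)
   then have "f h v = f (h * h') w" using less.prems(2) wg that by (simp add: acts_def)
   then show ?thesis using that h' H by (auto simp: Or_def subgrp_mult)
  qed
  have sub: "acts H (\<Omega> - Or) f"
   unfolding acts_def
  proof (intro conjI ballI)
   fix h v assume h: "h \<in> H" and v: "v \<in> \<Omega> - Or"
   have "f h v \<notin> Or"
   proof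
    assume "f h v \<in> Or"
    then have "f (inverse h) (f h v) \<in> Or" using inv h H by (simp add: subgrp_inverse)
    moreover have "f (inverse h) (f h v) = v"
     using less.prems(2) h v H unfolding acts_def
     by (metis DiffD1 grp_left_inverse subgrp_inverse)
    ultimately show False using v by simp
   qed
   then show "f h v \<in> \<Omega> - Or" using less.prems(2) h v by (simp add: acts_def)
  qed (use less.prems(2) in \<open>auto simp: acts_def\<close>)
  have lt: "card (\<Omega> - Or) < card \<Omega>"
   using orb wO less.prems(1) by (intro psubset_card_mono) auto
  have IH: "[(\<Sum>w\<in>\<Omega> - Or. wt w) = (\<Sum>w | w \<in> \<Omega> - Or \<and> (\<forall>g\<in>H. f g w = w). wt w)] (mod p)"
   by (rule less.hyps[OF lt _ sub]) (use less.prems in auto)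
  have nofix: "{w. w \<in> \<Omega> - Or \<and> (\<forall>g\<in>H. f g w = w)} = {w. w \<in> \<Omega> \<and> (\<forall>g\<in>H. f g w = w)}"
  proof -
   have "v \<notin> Or" if "\<forall>g\<in>H. f g v = v" "v \<in> \<Omega>" for v
   proof
    assume "v \<in> Or"
    then obtain h where h: "h \<in> H" "v = f h w" by (auto simp: Or_def)
    have "w = f (inverse h) v"
     using less.prems(2) h wg H unfolding acts_def by (metis grp_left_inverse subgrp_inverse)
    then have "w = v" using that h H by (simp add: subgrp_inverse)
    then show False using that wg by auto
   qed
   then show ?thesis by auto
  qed
  have "(\<Sum>w\<in>\<Omega>. wt w) = (\<Sum>w\<in>\<Omega> - Or. wt w) + (\<Sum>w\<in>Or. wt w)"
   using sum.subset_diff[OF orb less.prems(1)] by simp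
  moreover have "(\<Sum>v\<in>Or. wt v) = (\<Sum>v\<in>Or. wt w)"
   using less.prems(3) wg by (intro sum.cong) (auto simp: Or_def)
  then have "[(\<Sum>v\<in>Or. wt v) = 0] (mod p)" using pO by (simp add: cong_0_iff)
  ultimately show ?thesis using IH nofix by (metis (no_types, lifting) add.right_neutral cong_add)
 qed
qed

lemma fixed_points_cong:
 assumes "subgrp H" "card H = p ^ k" "prime p" "finite \<Omega>" "acts H \<Omega> f"
 shows "[card \<Omega> = card {w\<in>\<Omega>. \<forall>g\<in>H. f g w = w}] (mod p)"
 using weighted_fixed_points_cong[OF assms, of "\<lambda>_. 1::nat"] by simp

lemma fixed_point_ex:
 assumes "subgrp H" "card H = p ^ k" "prime p" "finite \<Omega>" "acts H \<Omega> f" "\<not> p dvd card \<Omega>"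
 shows "\<exists>w\<in>\<Omega>. \<forall>g\<in>H. f g w = w"
proof -
 have "{w\<in>\<Omega>. \<forall>g\<in>H. f g w = w} \<noteq> {}"
  using fixed_points_cong[OF assms(1-5)] assms(6) by (metis card.empty cong_0_iff)
 then show ?thesis by auto
qed

lemma fixed_point_ex2:
 assumes "subgrp H" "card H = p ^ k" "prime p" "finite \<Omega>" "acts H \<Omega> f" "p dvd card \<Omega>"
  and "w0 \<in> \<Omega>" "\<forall>g\<in>H. f g w0 = w0"
 shows "\<exists>w\<in>\<Omega>. w \<noteq> w0 \<and> (\<forall>g\<in>H. f g w = w)"
proof -
 let ?F = "{w\<in>\<Omega>. \<forall>g\<in>H. f g w = w}"
 have "p dvd card ?F"
  using fixed_points_cong[OF assms(1-5)] assms(6) by (simp add: cong_dvd_iff)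
 then have "card ?F \<noteq> 1" using assms(3) by auto
 then have "?F \<noteq> {w0}" by (metis card_1_singleton_iff One_nat_def)
 then show ?thesis using assms(7,8) by auto
qed

subsection \<open>Cosets\<close>

definition lcosets :: "'g::grp set \<Rightarrow> 'g set \<Rightarrow> 'g set set" where
 "lcosets H P = (\<lambda>h. (*) h ` P) ` H"

lemma coset_eq_iff:
 assumes "subgrp P" shows "(*) g ` P = (*) h ` P \<longleftrightarrow> inverse g * h \<in> P"
proof
 assume "(*) g ` P = (*) h ` P"
 then have "h \<in> (*) g ` P" using assms by (metis image_eqI mult_1_right subgrp_one)
 then show "inverse g * h \<in> P" by auto
next
 assume a: "inverse g * h \<in> P"
 have "y \<in> (*) g ` P" if "y \<in> (*) h ` P" for y
 proof -
  obtain u where u: "u \<in> P" "y = h * u" using \<open>y \<in> (*) h ` P\<close> by auto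
  have "y = g * ((inverse g * h) * u)" using u by (simp add: mult.assoc)
  then show ?thesis using a u assms subgrp_mult by blast
 qed
 moreover have "y \<in> (*) h ` P" if "y \<in> (*) g ` P" for y
 proof -
  obtain u where u: "u \<in> P" "y = g * u" using \<open>y \<in> (*) g ` P\<close> by auto
  have "y = h * (inverse (inverse g * h) * u)" using u by (simp add: mult.assoc)
  then show ?thesis using a u assms subgrp_mult subgrp_inverse by blast
 qed
 ultimately show "(*) g ` P = (*) h ` P" by blast
qed

lemma coset_image: "(*) g ` ((*) h ` P) = (*) (g * h) ` (P :: 'g::grp set)"
 by (auto simp: image_image mult.assoc)

lemma acts_lcosets:
 assumes "subgrp H" "subgrp P" "K \<subseteq> H" shows "acts K (lcosets H P) (\<lambda>g C. (*) g ` C)"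
 unfolding acts_def lcosets_def
proof (intro conjI ballI)
 fix g C assume "g \<in> K" "C \<in> (\<lambda>h. (*) h ` P) ` H"
 then obtain h where "g \<in> H" "h \<in> H" "C = (*) h ` P" using assms by blast
 then show "(*) g ` C \<in> (\<lambda>h. (*) h ` P) ` H"
  using assms by (simp only: coset_image) (rule imageI, rule subgrp_mult)
qed (auto simp: image_image mult.assoc)

lemma card_lcosets:
 assumes "subgrp H" "subgrp P" "P \<subseteq> H" shows "card (lcosets H P) * card P = card H"
proof -
 have "(*) 1 ` P \<in> lcosets H P" unfolding lcosets_def using assms(1) subgrp_one by blast
 from orbit_stabilizer[OF assms(1) acts_lcosets[OF assms(1,2) order_refl] this]
 have "card ((\<lambda>g. (*) g ` P) ` H) * card {g \<in> H. (*) g ` P = P} = card H"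
  by (simp add: image_image)
 moreover have "{g \<in> H. (*) g ` P = P} = P"
  using coset_eq_iff[OF assms(2), of _ 1] assms by (auto simp: subgrp_inverse_iff)
 ultimately show ?thesis by (simp add: lcosets_def)
qed

lemma finite_lcosets [simp]: "subgrp H \<Longrightarrow> finite (lcosets H P)"
 by (simp add: lcosets_def)

subsection \<open>Elements of p-power and of p'-order\<close>

definition pel :: "nat \<Rightarrow> 'g::grp \<Rightarrow> bool" where
 "pel p x \<longleftrightarrow> (\<exists>k. x ^ p ^ k = 1)"

definition p'el :: "nat \<Rightarrow> 'g::grp \<Rightarrow> bool" where
 "p'el p x \<longleftrightarrow> (\<exists>m. coprime m p \<and> x ^ m = 1)"

definition pgrp :: "nat \<Rightarrow> 'g::grp set \<Rightarrow> bool" where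
 "pgrp p H \<longleftrightarrow> subgrp H \<and> (\<exists>k. card H = p ^ k)"

lemma pgrp_subgrp [simp]: "pgrp p H \<Longrightarrow> subgrp H" by (simp add: pgrp_def)

lemma power_coprime_eq_1:
 fixes x :: "'g::grp"
 assumes "x ^ m = 1" "x ^ n = 1" "coprime m n" shows "x = 1"
proof (cases "m = 0")
 case True then show ?thesis using assms by simp
next
 case False
 obtain u v where "m * u = n * v + gcd m n" using bezout_nat[OF False, of n] by blast
 then have e: "m * u = n * v + 1" using assms by simp
 have "x ^ (m * u) = x ^ (n * v + 1)" using e by simp
 then show ?thesis using assms by (simp add: power_mult)
qed

lemma pel_p'el_trivial: "prime p \<Longrightarrow> pel p x \<Longrightarrow> p'el p x \<Longrightarrow> x = 1"
 unfolding pel_def p'el_def by (metis coprime_power_right_iff power_coprime_eq_1)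

lemma pel_one [simp]: "pel p 1" by (simp add: pel_def)

lemma p'el_one [simp]: "p'el p 1" unfolding p'el_def by (rule exI[of _ 1]) simp

lemma pel_cj [simp]: "pel p (cj g x) \<longleftrightarrow> pel p x"
 by (simp add: pel_def flip: cj_power)

lemma p'el_cj [simp]: "p'el p (cj g x) \<longleftrightarrow> p'el p x"
 by (simp add: p'el_def flip: cj_power)

lemma p'el_power: "p'el p x \<Longrightarrow> p'el p (x ^ n)"
 unfolding p'el_def by (metis power_mult power_one mult.commute)

lemma pgrp_pel: "pgrp p H \<Longrightarrow> x \<in> H \<Longrightarrow> pel p x"
 unfolding pgrp_def pel_def by (metis subgrp_power_card)

lemma coprime_card_p'el: "subgrp H \<Longrightarrow> coprime (card H) p \<Longrightarrow> x \<in> H \<Longrightarrow> p'el p x"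
 unfolding p'el_def by (metis subgrp_power_card)

lemma coprime_prime_iff: "prime p \<Longrightarrow> coprime n p \<longleftrightarrow> \<not> p dvd (n::nat)"
 by (metis coprime_absorb_left coprime_commute not_prime_unit prime_imp_coprime)

lemma cauchy_pel:
 assumes "subgrp H" "prime p" "p dvd card H"
 obtains x where "x \<in> H" "x \<noteq> 1" "x ^ p = 1"
proof -
 obtain P where P: "subgrp P" "P \<subseteq> H" "card P = p ^ multiplicity p (card H)"
  using sylow_ex[OF assms(1,2)] by auto
 have "multiplicity p (card H) > 0" using assms
  by (metis multiplicity_pos_iff_dvd less_irrefl subgrp_card_pos)
 then have "card P > 1" using P assms(2) by (metis one_less_power prime_gt_1_nat)
 then obtain y where y: "y \<in> P" "y \<noteq> 1"
  by (metis One_nat_def P(1) card_1_singletonE card_le_Suc0_iff_eq leD subgrp_finite subgrp_one)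
 have "\<exists>k. y ^ p ^ k = 1" using subgrp_power_card[OF P(1) y(1)] P(3) by metis
 \<comment> \<open>With \<open>k\<close> minimal, the power of \<open>y\<close> with exponent
   \<open>p ^ (k - 1)\<close> is the required element of order \<open>p\<close>.\<close>
 define k where "k = (LEAST k. y ^ p ^ k = 1)"
 have k: "y ^ p ^ k = 1" unfolding k_def using \<open>\<exists>k. _\<close> by (rule LeastI_ex)
 have "k \<noteq> 0" using k y by (metis power_0 power_one_right)
 then obtain j where j: "k = Suc j" by (cases k) auto
 have "y ^ p ^ j \<noteq> 1" using not_less_Least[of j "\<lambda>k. y ^ p ^ k = 1"] j k_def by auto
 moreover have "(y ^ p ^ j) ^ p = 1" using k j by (simp add: power_mult[symmetric] mult.commute)
 moreover have "y ^ p ^ j \<in> H" using y P assms by (auto intro: subgrp_power)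
 ultimately show ?thesis using that by blast
qed

lemma p'el_imp_coprime_card:
 assumes "subgrp H" "prime p" "\<And>x. x \<in> H \<Longrightarrow> p'el p x" shows "coprime (card H) p"
proof (rule ccontr)
 assume "\<not> coprime (card H) p"
 then have "p dvd card H" using assms(2) by (simp add: coprime_prime_iff)
 then obtain x where "x \<in> H" "x \<noteq> 1" "x ^ p = 1" using cauchy_pel[OF assms(1,2)] by auto
 then show False using pel_p'el_trivial[OF assms(2), of x] assms(3) pel_def by (metis power_one_right)
qed

lemma pel_imp_pgrp:
 assumes "subgrp H" "prime p" "\<And>x. x \<in> H \<Longrightarrow> pel p x" shows "pgrp p H"
proof -
 have "r = p" if r: "prime r" "r dvd card H" for r
 proof -
  obtain x where x: "x \<in> H" "x \<noteq> 1" "x ^ r = 1" using cauchy_pel[OF assms(1) r] by auto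
  show "r = p"
  proof (rule ccontr)
   assume "r \<noteq> p"
   then have "coprime r p" using r assms(2) by (simp add: primes_coprime)
   then have "p'el p x" using x by (auto simp: p'el_def)
   then show False using pel_p'el_trivial assms x by blast
  qed
 qed
 note only = this
 have nz: "card H \<noteq> 0" using subgrp_card_pos[OF assms(1)] by linarith
 have nu: "\<not> is_unit p" using assms(2) by auto
 obtain y where y: "card H = p ^ multiplicity p (card H) * y" "\<not> p dvd y"
  using multiplicity_decompose'[OF nz nu] by blast
 have "y = 1"
 proof (rule ccontr)
  assume "y \<noteq> 1"
  then obtain r where r: "prime r" "r dvd y" using prime_factor_nat by blast
  then have "r dvd card H" by (subst y(1)) simp
  then show False using only[OF r(1)] r y by simp
 qed
 then have "\<exists>k. card H = p ^ k" using y by auto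
 then show ?thesis using assms(1) unfolding pgrp_def by blast
qed

subsection \<open>Normalizers, centralizers and products\<close>

text \<open>Normalizer and centralizer are taken in the whole type, so they may be infinite; inside
  a group \<open>H\<close> one works with \<open>H \<inter> nrm X\<close> and
  \<open>H \<inter> cent X\<close>.\<close>

definition nrm :: "'g::grp set \<Rightarrow> 'g set" where
 "nrm X = {g. cj g ` X = X}"

definition cent :: "'g::grp set \<Rightarrow> 'g set" where
 "cent X = {g. \<forall>x\<in>X. g * x = x * g}"

definition nsub :: "'g::grp set \<Rightarrow> 'g set \<Rightarrow> bool" where
 "nsub N H \<longleftrightarrow> subgrp N \<and> N \<subseteq> H \<and> (\<forall>g\<in>H. \<forall>x\<in>N. cj g x \<in> N)"

definition setmul :: "'g::grp set \<Rightarrow> 'g set \<Rightarrow> 'g set" where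
 "setmul A B = (\<lambda>(a, b). a * b) ` (A \<times> B)"

lemma nsubD: "nsub N H \<Longrightarrow> subgrp N" "nsub N H \<Longrightarrow> N \<subseteq> H"
  "nsub N H \<Longrightarrow> g \<in> H \<Longrightarrow> x \<in> N \<Longrightarrow> cj g x \<in> N"
 by (auto simp: nsub_def)

lemma nsubI: "subgrp N \<Longrightarrow> N \<subseteq> H \<Longrightarrow> (\<And>g x. g \<in> H \<Longrightarrow> x \<in> N \<Longrightarrow> cj g x \<in> N) \<Longrightarrow> nsub N H"
 by (auto simp: nsub_def)

lemma cj_image_eqI:
 assumes "finite X" "cj g ` X \<subseteq> X" shows "cj g ` X = X"
 using assms by (intro card_subset_eq) auto

lemma cj_image_comp: "cj (g * h) ` X = cj g ` cj h ` X"
 by (simp add: image_image cj_comp)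

lemma cj_image_one [simp]: "cj 1 ` X = X"
 by (simp add: image_def)

lemma nrm_mult: "g \<in> nrm X \<Longrightarrow> h \<in> nrm X \<Longrightarrow> g * h \<in> nrm X"
 by (simp add: nrm_def cj_image_comp)

lemma nrm_one [simp]: "1 \<in> nrm X" by (simp add: nrm_def)

lemma nrm_inverse: "g \<in> nrm X \<Longrightarrow> inverse g \<in> nrm X"
 unfolding nrm_def by (metis (mono_tags, lifting) cj_image_comp cj_image_one grp_left_inverse mem_Collect_eq)

lemma nrm_cj: "g \<in> nrm X \<Longrightarrow> x \<in> X \<Longrightarrow> cj g x \<in> X"
 by (auto simp: nrm_def)

lemma nrmI: "finite X \<Longrightarrow> (\<And>x. x \<in> X \<Longrightarrow> cj g x \<in> X) \<Longrightarrow> g \<in> nrm X"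
 using cj_image_eqI[of X g] unfolding nrm_def by blast

lemma subgrp_Int_nrm: "subgrp H \<Longrightarrow> subgrp (H \<inter> nrm X)"
 by (intro subgrpI) (auto simp: subgrp_mult nrm_mult)

lemma subgrp_le_nrm: "subgrp H \<Longrightarrow> H \<subseteq> nrm H"
 by (auto intro!: nrmI subgrp_cj)

lemma nsub_le_nrm: "nsub N H \<Longrightarrow> H \<subseteq> nrm N"
 by (auto intro!: nrmI dest: nsubD)

lemma nsub_Int_nrm: "subgrp X \<Longrightarrow> X \<subseteq> H \<Longrightarrow> subgrp H \<Longrightarrow> nsub X (H \<inter> nrm X)"
 using subgrp_le_nrm[of X] by (intro nsubI) (auto dest: nrm_cj)

lemma nrm_cj_image: "nrm (cj g ` X) = cj g ` nrm X"
proof (intro equalityI subsetI)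
 fix h assume "h \<in> nrm (cj g ` X)"
 then have "cj (h * g) ` X = cj g ` X" by (simp add: nrm_def cj_image_comp)
 then have "cj (inverse g * (h * g)) ` X = cj (inverse g * g) ` X" by (simp only: cj_image_comp)
 then have "cj (inverse g) h \<in> nrm X" by (simp add: nrm_def cj_def mult.assoc)
 then show "h \<in> cj g ` nrm X" by (metis cj_cancel(1) imageI)
next
 fix h assume "h \<in> cj g ` nrm X"
 then obtain u where u: "u \<in> nrm X" "h = cj g u" by auto
 have "h * g = g * u" by (simp add: u cj_def mult.assoc)
 then have "cj h ` cj g ` X = cj g ` cj u ` X" by (metis cj_image_comp)
 then show "h \<in> nrm (cj g ` X)" using u by (simp add: nrm_def)
qed

lemma cent_mult: "g \<in> cent X \<Longrightarrow> h \<in> cent X \<Longrightarrow> g * h \<in> cent X"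
 by (simp add: cent_def) (metis mult.assoc)

lemma cent_one [simp]: "1 \<in> cent X" by (simp add: cent_def)

lemma cent_iff_cj: "g \<in> cent X \<longleftrightarrow> (\<forall>x\<in>X. cj g x = x)"
 by (simp add: cent_def cj_eq_iff)

lemma cent_le_nrm: "cent X \<subseteq> nrm X"
 by (auto simp: cent_iff_cj nrm_def image_iff)

lemma cent_antimono: "X \<subseteq> Y \<Longrightarrow> cent Y \<subseteq> cent X"
 by (auto simp: cent_def)

lemma subgrp_Int_cent: "subgrp H \<Longrightarrow> subgrp (H \<inter> cent X)"
 by (intro subgrpI) (auto simp: subgrp_mult cent_mult)

lemma cent_cj_nrm:
 assumes "g \<in> nrm X" "c \<in> cent X" shows "cj g c \<in> cent X"
 unfolding cent_iff_cj
proof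
 fix x assume "x \<in> X"
 then have "cj (inverse g) x \<in> X" using assms nrm_inverse nrm_cj by blast
 then have "cj c (cj (inverse g) x) = cj (inverse g) x" using assms by (simp add: cent_iff_cj)
 then show "cj (cj g c) x = x" by (simp add: cj_def[of g c] cj_comp)
qed

lemma nsub_Int_cent:
 assumes "subgrp H" "\<And>g. g \<in> H \<Longrightarrow> g \<in> nrm X" shows "nsub (H \<inter> cent X) H"
 using assms by (intro nsubI subgrp_Int_cent) (auto simp: subgrp_cj cent_cj_nrm)

lemma setmulI: "a \<in> A \<Longrightarrow> b \<in> B \<Longrightarrow> a * b \<in> setmul A B"
 by (auto simp: setmul_def)

lemma setmulE: "x \<in> setmul A B \<Longrightarrow> (\<And>a b. a \<in> A \<Longrightarrow> b \<in> B \<Longrightarrow> x = a * b \<Longrightarrow> thesis) \<Longrightarrow> thesis"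
 by (auto simp: setmul_def)

lemma subgrp_setmul:
 assumes "subgrp A" "subgrp B" "\<And>b a. b \<in> B \<Longrightarrow> a \<in> A \<Longrightarrow> cj b a \<in> A"
 shows "subgrp (setmul A B)"
proof (rule subgrpI)
 show "1 \<in> setmul A B" using setmulI[of 1 A 1 B] assms by simp
 fix x y assume "x \<in> setmul A B" "y \<in> setmul A B"
 then obtain a b a' b' where *: "a \<in> A" "b \<in> B" "a' \<in> A" "b' \<in> B" "x = a * b" "y = a' * b'"
  by (auto elim!: setmulE)
 have "x * y = (a * cj b a') * (b * b')" by (simp add: * cj_def mult.assoc)
 then show "x * y \<in> setmul A B" using * assms by (auto intro!: setmulI simp: subgrp_mult)
qed (use assms in \<open>auto simp: setmul_def\<close>)

lemma setmul_subset: "subgrp H \<Longrightarrow> A \<subseteq> H \<Longrightarrow> B \<subseteq> H \<Longrightarrow> setmul A B \<subseteq> H"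
 by (auto simp: setmul_def intro!: subgrp_mult)

lemma setmul_left: "subgrp B \<Longrightarrow> A \<subseteq> setmul A B"
 using setmulI[of _ A 1 B] by auto

lemma setmul_right: "subgrp A \<Longrightarrow> B \<subseteq> setmul A B"
 using setmulI[of 1 A _ B] by auto

lemma card_setmul:
 assumes "subgrp A" "subgrp B"
 shows "card (setmul A B) * card (A \<inter> B) = card A * card B"
proof -
 have fib: "card {z \<in> A \<times> B. (\<lambda>(a, b). a * b) z = c} = card (A \<inter> B)" if c: "c \<in> setmul A B" for c
 proof -
  obtain a0 b0 where c': "a0 \<in> A" "b0 \<in> B" "c = a0 * b0" using c by (elim setmulE)
  have "{z \<in> A \<times> B. (\<lambda>(a, b). a * b) z = c} = (\<lambda>t. (a0 * t, inverse t * b0)) ` (A \<inter> B)"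
  proof (intro equalityI subsetI)
   fix z assume "z \<in> {z \<in> A \<times> B. (\<lambda>(a, b). a * b) z = c}"
   then obtain a b where z: "z = (a, b)" "a \<in> A" "b \<in> B" "a * b = a0 * b0" using c' by auto
   define t where "t = inverse a0 * a"
   have "b * inverse b0 = inverse a * a0 * (b0 * inverse b0)" 
    using z(4) by (metis grp_inverse_mult_cancel mult.assoc)
   then have t': "t = b0 * inverse b"
    unfolding t_def by (metis grp_inverse_inverse grp_inverse_mult grp_right_inverse mult_1_right)
   have "t \<in> A" unfolding t_def using z c' assms by (simp add: subgrp_closed)
   moreover have "t \<in> B" unfolding t' using z c' assms by (simp add: subgrp_closed)
   ultimately have "t \<in> A \<inter> B" by blast
   moreover have "z = (a0 * t, inverse t * b0)"
   proof -
    have "a0 * t = a" by (simp add: t_def)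
    moreover have "inverse t * b0 = b" by (simp add: t' mult.assoc)
    ultimately show ?thesis using z(1) by simp
   qed
   ultimately show "z \<in> (\<lambda>t. (a0 * t, inverse t * b0)) ` (A \<inter> B)" by blast
  qed (use c' assms in \<open>auto simp: subgrp_closed mult.assoc\<close>)
  moreover have "inj_on (\<lambda>t. (a0 * t, inverse t * b0)) (A \<inter> B)" by (auto intro: inj_onI)
  ultimately show ?thesis by (simp add: card_image)
 qed
 have "card (A \<times> B) = (\<Sum>c\<in>setmul A B. card {z \<in> A \<times> B. (\<lambda>(a, b). a * b) z = c})"
  using sum.image_gen[of "A \<times> B" "\<lambda>_. 1::nat" "\<lambda>(a, b). a * b"] assms by (simp add: setmul_def)
 also have "\<dots> = card (setmul A B) * card (A \<inter> B)" using fib by simp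
 finally show ?thesis by (simp add: card_cartesian_product)
qed

subsection \<open>Sylow subgroups\<close>

definition syl :: "nat \<Rightarrow> 'g::grp set \<Rightarrow> 'g set \<Rightarrow> bool" where
 "syl p H P \<longleftrightarrow> subgrp P \<and> P \<subseteq> H \<and> card P = p ^ multiplicity p (card H)"

lemma syl_ex: "subgrp H \<Longrightarrow> prime p \<Longrightarrow> \<exists>P. syl p H P"
 using sylow_ex[of H p] by (auto simp: syl_def)

lemma sylD: "syl p H P \<Longrightarrow> subgrp P" "syl p H P \<Longrightarrow> P \<subseteq> H" "syl p H P \<Longrightarrow> pgrp p P"
 "syl p H P \<Longrightarrow> card P = p ^ multiplicity p (card H)"
 unfolding syl_def pgrp_def by blast+

lemma not_dvd_card_lcosets_syl:
 assumes "subgrp H" "prime p" "syl p H P" shows "\<not> p dvd card (lcosets H P)"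
proof
 assume "p dvd card (lcosets H P)"
 then have "p ^ Suc (multiplicity p (card H)) dvd card (lcosets H P) * card P"
  using sylD(4)[OF assms(3)] by (simp add: mult_dvd_mono)
 then have "p ^ Suc (multiplicity p (card H)) dvd card H"
  using card_lcosets[of H P] assms sylD by metis
 moreover have "card H \<noteq> 0" using assms(1) by simp
 moreover have "\<not> is_unit p" using assms(2) by auto
 ultimately show False using power_dvd_iff_le_multiplicity[of "card H" p "Suc (multiplicity p (card H))"] by simp
qed

text \<open>\<open>Y\<close> permutes the cosets of \<open>P\<close> by left multiplication and
  their number is prime to \<open>p\<close>, so \<open>Y\<close> fixes a coset of some
  \<open>h\<close>; this means that \<open>Y\<close> lies in the conjugate of \<open>P\<close> by
  \<open>h\<close>.\<close>

lemma sylow_conj: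
 assumes H: "subgrp H" and p: "prime p" and P: "syl p H P" and Y: "pgrp p Y" "Y \<subseteq> H"
 shows "\<exists>h\<in>H. Y \<subseteq> cj h ` P"
proof -
 obtain k where k: "card Y = p ^ k" using Y(1) unfolding pgrp_def by blast
 obtain C where C: "C \<in> lcosets H P" "\<forall>y\<in>Y. (*) y ` C = C"
  using fixed_point_ex[OF pgrp_subgrp[OF Y(1)] k p finite_lcosets[OF H] acts_lcosets[OF H sylD(1)[OF P] Y(2)]
    not_dvd_card_lcosets_syl[OF H p P]] by blast
 obtain h where h: "h \<in> H" "C = (*) h ` P" using C(1) by (auto simp: lcosets_def)
 have "y \<in> cj h ` P" if y: "y \<in> Y" for y
 proof -
  have "(*) h ` P = (*) (y * h) ` P" using bspec[OF C(2) y] h(2) coset_image by metis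
  then have "inverse h * (y * h) \<in> P" using coset_eq_iff[OF sylD(1)[OF P]] by blast
  moreover have "y = cj h (inverse h * (y * h))" by (simp add: cj_def mult.assoc)
  ultimately show ?thesis by blast
 qed
 then show ?thesis using h by blast
qed

lemma syl_cj_image:
 assumes "subgrp H" "syl p H P" "h \<in> nrm H" shows "syl p H (cj h ` P)"
 using assms sylD[OF assms(2)] unfolding syl_def by (auto simp: subgrp_cj_image nrm_cj)

lemma sylow_conj_eq:
 assumes "subgrp H" "prime p" "syl p H P" "syl p H P'"
 shows "\<exists>h\<in>H. P' = cj h ` P"
proof -
 obtain h where h: "h \<in> H" "P' \<subseteq> cj h ` P" using sylow_conj[OF assms(1-3) sylD(3)[OF assms(4)] sylD(2)[OF assms(4)]] by blast
 have "card P' = card (cj h ` P)" using sylD(4)[OF assms(3)] sylD(4)[OF assms(4)] by simp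
 then have "P' = cj h ` P" using h(2) sylD(1)[OF assms(3)] by (intro card_subset_eq) auto
 then show ?thesis using h by blast
qed

lemma sylow_above:
 assumes "subgrp H" "prime p" "pgrp p Y" "Y \<subseteq> H"
 obtains P where "syl p H P" "Y \<subseteq> P"
proof -
 obtain P where P: "syl p H P" using syl_ex assms by blast
 obtain h where "h \<in> H" "Y \<subseteq> cj h ` P" using sylow_conj[OF assms(1,2) P assms(3,4)] by blast
 then show ?thesis using that syl_cj_image[OF assms(1) P] subgrp_le_nrm[OF assms(1)] by blast
qed

text \<open>The Sylow \<open>p\<close>-subgroups of \<open>H\<close> form one conjugacy class, so
  their number divides the order of \<open>H\<close> and is prime to \<open>r\<close>; the
  \<open>r\<close>-group \<open>X\<close> therefore fixes one of them.\<close>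

lemma invariant_sylow:
 assumes H: "subgrp H" and p: "prime p" and r: "prime r" and X: "pgrp r X" "X \<subseteq> nrm H" "\<not> r dvd card H"
 obtains P where "syl p H P" "X \<subseteq> nrm P"
proof -
 define \<Omega> where "\<Omega> = {P. syl p H P}"
 obtain P0 where P0: "syl p H P0" using syl_ex H p by blast
 have Om: "\<Omega> = (\<lambda>g. cj g ` P0) ` H"
  using sylow_conj_eq[OF H p P0] syl_cj_image[OF H P0] subgrp_le_nrm[OF H] unfolding \<Omega>_def by blast
 have actsN: "acts K \<Omega> (\<lambda>g P. cj g ` P)" if "K \<subseteq> nrm H" for K
  unfolding acts_def \<Omega>_def using that syl_cj_image[OF H] by (auto simp: cj_image_comp)
 have "card \<Omega> dvd card H"
  using Om orbit_stabilizer[OF H actsN[OF subgrp_le_nrm[OF H]], of P0] P0 unfolding \<Omega>_def by (metis dvd_triv_left mem_Collect_eq)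
 then have nd: "\<not> r dvd card \<Omega>" using X(3) dvd_trans by blast
 obtain k where k: "card X = r ^ k" using X(1) unfolding pgrp_def by blast
 have fin: "finite \<Omega>" using H Om by simp
 obtain P where P: "P \<in> \<Omega>" "\<forall>g\<in>X. cj g ` P = P"
  using fixed_point_ex[OF pgrp_subgrp[OF X(1)] k r fin actsN[OF X(2)] nd] by blast
 show ?thesis
 proof
  show "syl p H P" using P(1) unfolding \<Omega>_def by simp
  show "X \<subseteq> nrm P" using P(2) unfolding nrm_def by blast
 qed
qed

text \<open>The number of cosets of \<open>N\<close> in \<open>V\<close> is a power of
  \<open>q\<close> greater than 1 and \<open>N\<close> itself is a fixed coset, so \<open>A\<close>
  fixes another one. With \<open>N\<close> trivial this gives fixed elements, with \<open>A\<close>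
  equal to \<open>N\<close> it makes normalizers grow, and with \<open>N\<close> the normalizer of
  \<open>A\<close> in \<open>V\<close> it starts Thompson's replacement.\<close>

lemma fixed_coset:
 assumes q: "prime q" and A: "pgrp q A" and V: "pgrp q V" "A \<subseteq> nrm V" and N: "subgrp N" "N \<subset> V" "A \<subseteq> nrm N"
 shows "\<exists>v\<in>V - N. \<forall>a\<in>A. inverse v * cj a v \<in> N"
proof -
 have sV: "subgrp V" using V by simp
 have im: "cj a ` (*) v ` N = (*) (cj a v) ` N" if "a \<in> A" for a v
 proof -
  have "cj a ` N = N" using N(3) that by (auto simp: nrm_def)
  moreover have "cj a ` (*) v ` N = (*) (cj a v) ` cj a ` N" by (simp add: image_image cj_mult)
  ultimately show ?thesis by simp
 qed
 have ac: "acts A (lcosets V N) (\<lambda>a C. cj a ` C)"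
  unfolding acts_def
 proof (intro conjI ballI)
  fix a C assume a: "a \<in> A" and "C \<in> lcosets V N"
  then obtain v where v: "v \<in> V" "C = (*) v ` N" by (auto simp: lcosets_def)
  have "cj a v \<in> V" using V(2) a v nrm_cj by blast
  then show "cj a ` C \<in> lcosets V N" using im[OF a] v(2) by (simp add: lcosets_def)
 qed (simp_all add: cj_image_comp)
 obtain k where k: "card A = q ^ k" using A unfolding pgrp_def by blast
 obtain l where l: "card V = q ^ l" using V unfolding pgrp_def by blast
 have cc: "card (lcosets V N) * card N = q ^ l" using card_lcosets[OF sV N(1)] N(2) l by auto
 then have "card (lcosets V N) dvd q ^ l" by (metis dvd_triv_left)
 moreover have "card N < card V" using N(2) psubset_card_mono[of V N] sV by simp
 then have "card (lcosets V N) \<noteq> 1" using cc l by auto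
 ultimately have qd: "q dvd card (lcosets V N)" using q by (metis divides_primepow_nat dvd_power gr0I power_0)
 have N0: "N \<in> lcosets V N" unfolding lcosets_def by (rule image_eqI[of _ _ 1]) (use sV in auto)
 have N1: "\<forall>a\<in>A. cj a ` N = N" using N(3) by (auto simp: nrm_def)
 obtain C where C: "C \<in> lcosets V N" "C \<noteq> N" "\<forall>a\<in>A. cj a ` C = C"
  using fixed_point_ex2[OF pgrp_subgrp[OF A] k q finite_lcosets[OF sV] ac qd N0 N1] by blast
 obtain v where v: "v \<in> V" "C = (*) v ` N" using C(1) by (auto simp: lcosets_def)
 have "v \<notin> N"
 proof
  assume "v \<in> N"
  then have "(*) 1 ` N = (*) v ` N" using coset_eq_iff[OF N(1), of 1 v] by simp
  then show False using C(2) v(2) by simp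
 qed
 moreover have "inverse v * cj a v \<in> N" if "a \<in> A" for a
  using bspec[OF C(3) that] im[OF that] v(2) coset_eq_iff[OF N(1), of v "cj a v"] by metis
 ultimately show ?thesis using v by blast
qed

lemma fixed_element:
 assumes "prime q" "pgrp q A" "pgrp q V" "A \<subseteq> nrm V" "V \<noteq> {1}"
 shows "\<exists>v\<in>V. v \<noteq> 1 \<and> v \<in> cent A"
proof -
 have "1 \<in> V" using assms(3) by simp
 then have "{1} \<subset> V" using assms(5) by blast
 moreover have "A \<subseteq> nrm {1}" by (auto simp: nrm_def)
 ultimately obtain v where v: "v \<in> V - {1}" "\<forall>a\<in>A. inverse v * cj a v \<in> {1}"
  using fixed_coset[OF assms(1-4) subgrp_trivial] by blast
 have "v \<in> cent A" unfolding cent_def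
 proof (clarify)
  fix a assume "a \<in> A"
  then have "inverse v * cj a v = 1" using v(2) by blast
  then have "cj a v = v" by (metis grp_mult_inverse_cancel mult_1_right)
  then show "v * a = a * v" by (simp add: cj_eq_iff)
 qed
 then show ?thesis using v by blast
qed

lemma pgrp_subset:
 assumes "prime q" "pgrp q Q" "subgrp P" "P \<subseteq> Q" shows "pgrp q P"
 by (rule pel_imp_pgrp[OF assms(3,1)]) (use assms(4) pgrp_pel[OF assms(2)] in blast)

lemma normalizer_grows:
 assumes "prime q" "pgrp q Q" "subgrp P" "P \<subset> Q"
 shows "P \<subset> Q \<inter> nrm P"
proof -
 have pP: "pgrp q P" using pgrp_subset[OF assms(1-3)] assms(4) by blast
 have PQ: "P \<subseteq> nrm Q" using subgrp_le_nrm[OF pgrp_subgrp[OF assms(2)]] assms(4) by blast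
 obtain v where v: "v \<in> Q - P" "\<forall>a\<in>P. inverse v * cj a v \<in> P"
  using fixed_coset[OF assms(1) pP assms(2) PQ assms(3,4) subgrp_le_nrm[OF assms(3)]] by blast
 have "inverse v \<in> nrm P"
 proof (rule nrmI)
  fix a assume a: "a \<in> P"
  then have "inverse v * cj a v * a \<in> P" using v(2) subgrp_mult[OF assms(3)] by blast
  moreover have "inverse v * cj a v * a = cj (inverse v) a" by (simp add: cj_def mult.assoc)
  ultimately show "cj (inverse v) a \<in> P" by simp
 qed (use assms in auto)
 then have "v \<in> nrm P" using nrm_inverse[of "inverse v"] by simp
 then show ?thesis using v assms(4) subgrp_le_nrm[OF assms(3)] by blast
qed

lemma pgrp_setmul:
 assumes "prime q" "pgrp q A" "pgrp q B" "\<And>b a. b \<in> B \<Longrightarrow> a \<in> A \<Longrightarrow> cj b a \<in> A"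
 shows "pgrp q (setmul A B)"
proof -
 have s: "subgrp (setmul A B)" using assms by (intro subgrp_setmul) auto
 obtain k l where "card A = q ^ k" "card B = q ^ l" using assms unfolding pgrp_def by blast
 then have "card (setmul A B) dvd q ^ (k + l)"
  using card_setmul[of A B] assms by (metis dvd_triv_left pgrp_subgrp power_add)
 then show ?thesis using s assms(1) unfolding pgrp_def by (meson divides_primepow_nat)
qed

subsection \<open>Decomposition into q-part and q'-part\<close>

lemma power_cong_exp:
 fixes x :: "'g::grp"
 assumes "x ^ n = 1" "[a = b] (mod n)" shows "x ^ a = x ^ b"
proof -
 have "x ^ c = x ^ (c mod n)" for c
 proof -
  have "x ^ c = x ^ (n * (c div n) + c mod n)" by simp
  also have "\<dots> = x ^ (c mod n)" using assms(1) by (simp only: power_add power_mult) simp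
  finally show ?thesis .
 qed
 then show ?thesis using assms(2) unfolding cong_def by metis
qed

text \<open>The exponents solve congruences modulo the \<open>q\<close>-part and the
  \<open>q'\<close>-part of \<open>n\<close>: \<open>i\<close> is 1 modulo the first and 0 modulo
  the second, \<open>j\<close> the other way round. Being powers of \<open>x\<close>, both factors
  stay in every subgroup containing \<open>x\<close>.\<close>

lemma pq_decomp:
 fixes x :: "'g::grp"
 assumes "x ^ n = 1" "n \<noteq> 0" "prime q"
 obtains i j where "x = x ^ i * x ^ j" "pel q (x ^ i)" "p'el q (x ^ j)"
proof -
 have nu: "\<not> is_unit q" using assms(3) by auto
 obtain m where m: "n = q ^ multiplicity q n * m" "\<not> q dvd m"
  using multiplicity_decompose'[OF assms(2) nu] by blast
 define a where "a = q ^ multiplicity q n"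
 have cop: "coprime a m" unfolding a_def using m assms(3) by (simp add: prime_imp_coprime coprime_power_left_iff)
 obtain i where i: "[i = 1] (mod a)" "[i = 0] (mod m)" using binary_chinese_remainder_nat[OF cop] by blast
 obtain j where j: "[j = 0] (mod a)" "[j = 1] (mod m)" using binary_chinese_remainder_nat[OF cop] by blast
 have "[i + j = 1] (mod a)" "[i + j = 1] (mod m)"
  using cong_add[OF i(1) j(1)] cong_add[OF i(2) j(2)] by simp_all
 then have "[i + j = 1] (mod a * m)" using cop by (metis coprime_cong_mult_nat)
 then have "x ^ (i + j) = x ^ 1" using power_cong_exp[OF assms(1)] m(1) a_def by metis
 then have 1: "x = x ^ i * x ^ j" by (simp add: power_add)
 have "n dvd i * a" "n dvd j * m" using i(2) j(1) m(1) unfolding a_def[symmetric]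
  by (auto simp: cong_0_iff mult.commute mult_dvd_mono)
 then have "(x ^ i) ^ a = 1" "(x ^ j) ^ m = 1"
  using assms(1) by (auto simp flip: power_mult elim!: dvdE simp: power_mult[of x n])
 then have "pel q (x ^ i)" "p'el q (x ^ j)" unfolding pel_def p'el_def a_def
  using m(2) assms(3) by (auto simp: coprime_prime_iff)
 then show ?thesis using that 1 by blast
qed

lemma no_p'el_imp_pgrp:
 assumes "subgrp H" "prime q" "\<And>x. x \<in> H \<Longrightarrow> p'el q x \<Longrightarrow> x = 1"
 shows "pgrp q H"
proof (rule pel_imp_pgrp[OF assms(1,2)])
 fix x assume x: "x \<in> H"
 have "card H \<noteq> 0" using assms(1) by simp
 then obtain i j where "x = x ^ i * x ^ j" "pel q (x ^ i)" "p'el q (x ^ j)"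
  using pq_decomp[OF subgrp_power_card[OF assms(1) x] _ assms(2)] by blast
 moreover have "x ^ j = 1" using assms x calculation subgrp_power by blast
 ultimately show "pel q x" by (metis mult_1_right)
qed

subsection \<open>Homomorphisms and quotients\<close>

definition homo :: "'g::grp set \<Rightarrow> ('g \<Rightarrow> 'h::grp) \<Rightarrow> bool" where
 "homo H \<phi> \<longleftrightarrow> subgrp H \<and> (\<forall>x\<in>H. \<forall>y\<in>H. \<phi> (x * y) = \<phi> x * \<phi> y)"

definition ker :: "'g::grp set \<Rightarrow> ('g \<Rightarrow> 'h::grp) \<Rightarrow> 'g set" where
 "ker H \<phi> = {x\<in>H. \<phi> x = 1}"

context
 fixes H :: "'g::grp set" and \<phi> :: "'g \<Rightarrow> 'h::grp"
 assumes hom: "homo H \<phi>"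

begin

lemma homo_subgrp: "subgrp H" using hom by (simp add: homo_def)

lemma homo_mult: "x \<in> H \<Longrightarrow> y \<in> H \<Longrightarrow> \<phi> (x * y) = \<phi> x * \<phi> y" using hom by (simp add: homo_def)

lemma homo_one: "\<phi> 1 = 1"
 using homo_mult[of 1 1] homo_subgrp by (metis grp_mult_eq_left mult_1_right subgrp_one)

lemma homo_inverse: "x \<in> H \<Longrightarrow> \<phi> (inverse x) = inverse (\<phi> x)"
 by (metis grp_inverse_unique grp_right_inverse homo_mult homo_one homo_subgrp subgrp_inverse)

lemma homo_power: "x \<in> H \<Longrightarrow> \<phi> (x ^ n) = \<phi> x ^ n"
 by (induction n) (auto simp: homo_one homo_mult homo_subgrp subgrp_power)

lemma homo_cj: "g \<in> H \<Longrightarrow> x \<in> H \<Longrightarrow> \<phi> (cj g x) = cj (\<phi> g) (\<phi> x)"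
 by (simp add: cj_def homo_mult homo_inverse homo_subgrp subgrp_closed)

lemma homo_image_subgrp: assumes "subgrp K" "K \<subseteq> H" shows "subgrp (\<phi> ` K)"
proof (rule subgrpI)
 show "1 \<in> \<phi> ` K" using homo_one assms by (metis imageI subgrp_one)
 fix x y assume "x \<in> \<phi> ` K" "y \<in> \<phi> ` K"
 then obtain a b where ab: "a \<in> K" "b \<in> K" "x = \<phi> a" "y = \<phi> b" by blast
 have "a \<in> H" "b \<in> H" using ab assms(2) by blast+
 then have "x * y = \<phi> (a * b)" using homo_mult[of a b] ab by simp
 moreover have "a * b \<in> K" using ab assms(1) by (simp add: subgrp_mult)
 ultimately show "x * y \<in> \<phi> ` K" by blast
qed (use assms in auto)

lemma homo_preimage_subgrp: assumes "subgrp L" shows "subgrp {x\<in>H. \<phi> x \<in> L}"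
 by (rule subgrpI) (use assms homo_subgrp homo_one homo_mult in \<open>auto simp: subgrp_mult\<close>)

lemma homo_eq_iff: "x \<in> H \<Longrightarrow> y \<in> H \<Longrightarrow> \<phi> x = \<phi> y \<longleftrightarrow> inverse x * y \<in> ker H \<phi>"
 unfolding ker_def
 by (simp add: homo_mult homo_inverse homo_subgrp subgrp_closed)
  (metis grp_left_inverse grp_mult_inverse_cancel mult_1_right)

lemma ker_nsub: "nsub (ker H \<phi>) H"
 unfolding ker_def
 by (rule nsubI, rule subgrpI) (auto simp: homo_subgrp homo_one homo_mult homo_cj subgrp_mult subgrp_cj)

lemma card_homo_image:
 assumes "subgrp K" "K \<subseteq> H" shows "card (\<phi> ` K) * card (K \<inter> ker H \<phi>) = card K"
proof -
 \<comment> \<open>\<open>K\<close> acts on the whole codomain by left multiplication with images;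
   the orbit of 1 is the image of \<open>K\<close>, and the stabilizer of 1 is its part of the
   kernel.\<close>
 have "acts K UNIV (\<lambda>g. (*) (if g \<in> H then \<phi> g else 1))"
  unfolding acts_def using assms by (auto simp: homo_one homo_mult mult.assoc subsetD)
   (use homo_subgrp subgrp_mult in blast)+
 from orbit_stabilizer[OF assms(1) this, of 1]
 have "card ((\<lambda>g. (if g \<in> H then \<phi> g else 1)) ` K) * card {g \<in> K. (if g \<in> H then \<phi> g else 1) = 1} = card K"
  by simp
 moreover have "(\<lambda>g. (if g \<in> H then \<phi> g else 1)) ` K = \<phi> ` K" using assms by (intro image_cong) auto
 moreover have "{g \<in> K. (if g \<in> H then \<phi> g else 1) = 1} = K \<inter> ker H \<phi>" using assms by (auto simp: ker_def)
 ultimately show ?thesis by simp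
qed

lemma homo_pel: "x \<in> H \<Longrightarrow> pel q x \<Longrightarrow> pel q (\<phi> x)"
 unfolding pel_def by (metis homo_one homo_power)

lemma homo_p'el: "x \<in> H \<Longrightarrow> p'el q x \<Longrightarrow> p'el q (\<phi> x)"
 unfolding p'el_def by (metis homo_one homo_power)

lemma homo_image_pgrp: "prime q \<Longrightarrow> pgrp q P \<Longrightarrow> P \<subseteq> H \<Longrightarrow> pgrp q (\<phi> ` P)"
 by (rule pel_imp_pgrp) (auto intro!: homo_image_subgrp homo_pel dest: pgrp_pel)

text \<open>The \<open>q'\<close>-part of \<open>x\<close> is a lift: the image of the
  \<open>q\<close>-part is a \<open>q\<close>-element and, being a power of \<open>\<phi> x\<close>,
  also of order prime to \<open>q\<close>, hence 1.\<close>

lemma homo_lift_p'el: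
 assumes "x \<in> H" "p'el q (\<phi> x)" "prime q"
 obtains y where "y \<in> H" "p'el q y" "\<phi> y = \<phi> x"
proof -
 have "card H \<noteq> 0" using homo_subgrp by simp
 then obtain i j where ij: "x = x ^ i * x ^ j" "pel q (x ^ i)" "p'el q (x ^ j)"
  using pq_decomp[OF subgrp_power_card[OF homo_subgrp assms(1)] _ assms(3)] by blast
 have H': "x ^ i \<in> H" "x ^ j \<in> H" using assms homo_subgrp by (auto simp: subgrp_power)
 have "pel q (\<phi> (x ^ i))" "p'el q (\<phi> (x ^ i))"
  using homo_pel[OF H'(1) ij(2)] p'el_power[OF assms(2)] homo_power[OF assms(1)] by simp_all
 then have "\<phi> (x ^ i) = 1" using pel_p'el_trivial assms(3) by blast
 moreover have "\<phi> x = \<phi> (x ^ i) * \<phi> (x ^ j)" using ij(1) homo_mult[OF H'] by simp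
 ultimately have "\<phi> (x ^ j) = \<phi> x" by simp
 then show ?thesis using that H' ij by blast
qed

text \<open>The index of the image of \<open>Q\<close> divides the index of \<open>Q\<close>, hence
  is prime to \<open>q\<close>. Comparison with a Sylow subgroup above the image then leaves no room
  between the two.\<close>

lemma homo_image_syl:
 assumes "prime q" "syl q H Q" shows "syl q (\<phi> ` H) (\<phi> ` Q)"
proof -
 note QD = sylD[OF assms(2)]
 have "pgrp q (\<phi> ` Q)" using homo_image_pgrp assms QD by blast
 moreover have sH: "subgrp (\<phi> ` H)" using homo_image_subgrp homo_subgrp by blast
 ultimately obtain R where R: "syl q (\<phi> ` H) R" "\<phi> ` Q \<subseteq> R"
  using sylow_above[OF sH assms(1)] QD(2) by (metis image_mono)
 have c1: "card (lcosets H Q) * card Q = card H" using card_lcosets QD homo_subgrp by blast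
 have c2: "card (lcosets (\<phi> ` H) (\<phi> ` Q)) * card (\<phi> ` Q) = card (\<phi> ` H)"
  using card_lcosets[OF sH] QD by (metis \<open>pgrp q (\<phi> ` Q)\<close> image_mono pgrp_subgrp)
 have "\<not> q dvd card (lcosets (\<phi> ` H) (\<phi> ` Q))"
 proof
  assume d: "q dvd card (lcosets (\<phi> ` H) (\<phi> ` Q))"
  have e1: "card (\<phi> ` H) * card (ker H \<phi>) = card H"
   using card_homo_image[OF homo_subgrp order_refl] nsubD(2)[OF ker_nsub] by (simp add: Int_absorb1)
  have e2: "card (\<phi> ` Q) * card (Q \<inter> ker H \<phi>) = card Q" using card_homo_image[OF QD(1,2)] .
  have "card (Q \<inter> ker H \<phi>) dvd card (ker H \<phi>)"
   using subgrp_card_dvd[OF nsubD(1)[OF ker_nsub] subgrp_Int[OF QD(1) nsubD(1)[OF ker_nsub]] inf_le2] .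
  then obtain t where t: "card (ker H \<phi>) = card (Q \<inter> ker H \<phi>) * t" by (elim dvdE)
  have "card (lcosets H Q) * card Q = card (lcosets (\<phi> ` H) (\<phi> ` Q)) * t * card Q"
  proof -
   have "card H = card (lcosets (\<phi> ` H) (\<phi> ` Q)) * card (\<phi> ` Q) * (card (Q \<inter> ker H \<phi>) * t)"
    using e1 c2 t by metis
   also have "\<dots> = card (lcosets (\<phi> ` H) (\<phi> ` Q)) * t * (card (\<phi> ` Q) * card (Q \<inter> ker H \<phi>))"
    by (simp only: mult_ac)
   finally show ?thesis using c1 e2 by metis
  qed
  then have "card (lcosets (\<phi> ` H) (\<phi> ` Q)) * t = card (lcosets H Q)" using QD(1) by simp
  then have "q dvd card (lcosets H Q)" using d by (metis dvd_mult2)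
  then show False using not_dvd_card_lcosets_syl homo_subgrp assms by blast
 qed
 moreover have "card (lcosets (\<phi> ` H) (\<phi> ` Q)) = card (lcosets (\<phi> ` H) R) * (card R div card (\<phi> ` Q))"
 proof -
  have "card (lcosets (\<phi> ` H) R) * card R = card (\<phi> ` H)" using card_lcosets sH sylD[OF R(1)] by blast
  moreover have "card (\<phi> ` Q) dvd card R" using subgrp_card_dvd[OF sylD(1)[OF R(1)] _ R(2)] homo_image_subgrp QD by blast
  ultimately have "card (lcosets (\<phi> ` H) R) * (card R div card (\<phi> ` Q)) * card (\<phi> ` Q) = card (\<phi> ` H)"
   by (simp add: mult.assoc)
  then have "card (lcosets (\<phi> ` H) (\<phi> ` Q)) * card (\<phi> ` Q)
    = card (lcosets (\<phi> ` H) R) * (card R div card (\<phi> ` Q)) * card (\<phi> ` Q)" using c2 by simp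
  moreover have "card (\<phi> ` Q) \<noteq> 0" using QD(1) by simp
  ultimately show ?thesis by simp
 qed
 ultimately have nd: "\<not> q dvd card R div card (\<phi> ` Q)" by auto
 obtain k l where kl: "card R = q ^ k" "card (\<phi> ` Q) = q ^ l"
  using sylD(3)[OF R(1)] \<open>pgrp q (\<phi> ` Q)\<close> unfolding pgrp_def by blast
 have "k = l"
 proof (rule ccontr)
  assume "k \<noteq> l"
  moreover have "card (\<phi> ` Q) \<le> card R" using R(2) sylD(1)[OF R(1)] by (intro card_mono) auto
  then have "q ^ l \<le> q ^ k" using kl by simp
  then have "l \<le> k" using prime_gt_1_nat[OF assms(1)] by (metis power_le_imp_le_exp)
  ultimately have "l < k" by simp
  then have "card R div card (\<phi> ` Q) = q ^ (k - l)" using kl assms(1) by (simp add: power_diff prime_gt_0_nat)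
  then show False using nd \<open>l < k\<close> by simp
 qed
 then have "card (\<phi> ` Q) = card R" using kl by simp
 then have "\<phi> ` Q = R" using R(2) sylD(1)[OF R(1)] by (intro card_subset_eq) auto
 then show ?thesis using R by simp
qed

end

section \<open>Quotients as permutation groups\<close>

instance Perm.perm :: (type) grp
 by standard simp

text \<open>Carries a bijection of a finite set to the natural numbers along an injection
  \<open>e\<close> and extends it by the identity, which keeps the support finite. One type thus
  holds all quotients that the inductions produce.\<close>

definition perm_of :: "('b \<Rightarrow> nat) \<Rightarrow> 'b set \<Rightarrow> ('b \<Rightarrow> 'b) \<Rightarrow> nat perm" where
 "perm_of e \<Omega> F = Perm (\<lambda>i. if i \<in> e ` \<Omega> then e (F (inv_into \<Omega> e i)) else i)"

lemma perm_of_apply: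
 assumes "finite \<Omega>" "inj_on e \<Omega>" "bij_betw F \<Omega> \<Omega>"
 shows "Perm.apply (perm_of e \<Omega> F) i = (if i \<in> e ` \<Omega> then e (F (inv_into \<Omega> e i)) else i)"
proof -
 let ?f = "\<lambda>i. if i \<in> e ` \<Omega> then e (F (inv_into \<Omega> e i)) else i"
 have FO: "F w \<in> \<Omega>" if "w \<in> \<Omega>" for w using assms(3) that by (auto simp: bij_betw_def)
 have "bij_betw (\<lambda>i. e (F (inv_into \<Omega> e i))) (e ` \<Omega>) (e ` \<Omega>)"
  using bij_betw_trans[OF bij_betw_trans[OF bij_betw_inv_into[OF inj_on_imp_bij_betw[OF assms(2)]] assms(3)]
    inj_on_imp_bij_betw[OF assms(2)]] by (simp add: comp_def)
 then have "bij_betw ?f (e ` \<Omega>) (e ` \<Omega>)" by (rule bij_betw_cong[THEN iffD1, rotated]) auto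
 moreover have "bij_betw ?f (- (e ` \<Omega>)) (- (e ` \<Omega>))"
  by (rule bij_betw_cong[THEN iffD1, rotated, OF bij_betw_id]) auto
 ultimately have "bij_betw ?f (e ` \<Omega> \<union> - (e ` \<Omega>)) (e ` \<Omega> \<union> - (e ` \<Omega>))"
  by (rule bij_betw_combine) auto
 then have "bij ?f" by simp
 moreover have "finite {a. ?f a \<noteq> a}" using assms(1) by (rule_tac finite_subset[of _ "e ` \<Omega>"]) auto
 ultimately show ?thesis unfolding perm_of_def by (subst Perm_inverse) auto
qed

lemma perm_of_comp:
 assumes "finite \<Omega>" "inj_on e \<Omega>" "bij_betw F \<Omega> \<Omega>" "bij_betw F' \<Omega> \<Omega>"
  and "bij_betw K \<Omega> \<Omega>" "\<And>w. w \<in> \<Omega> \<Longrightarrow> K w = F (F' w)"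
 shows "perm_of e \<Omega> K = perm_of e \<Omega> F * perm_of e \<Omega> F'"
proof (rule perm_eqI)
 fix i
 have "F' w \<in> \<Omega>" if "w \<in> \<Omega>" for w using assms(4) that by (auto simp: bij_betw_def)
 then show "Perm.apply (perm_of e \<Omega> K) i = Perm.apply (perm_of e \<Omega> F * perm_of e \<Omega> F') i"
  using assms by (auto simp: apply_times perm_of_apply inv_into_into)
qed

lemma perm_of_eq_1_iff:
 assumes "finite \<Omega>" "inj_on e \<Omega>" "bij_betw F \<Omega> \<Omega>"
 shows "perm_of e \<Omega> F = 1 \<longleftrightarrow> (\<forall>w\<in>\<Omega>. F w = w)"
proof
 assume a: "perm_of e \<Omega> F = 1"
 show "\<forall>w\<in>\<Omega>. F w = w"
 proof
  fix w assume w: "w \<in> \<Omega>"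
  have "e (F w) = e w" using perm_of_apply[OF assms, of "e w"] a w assms(2) by simp
  moreover have "F w \<in> \<Omega>" using assms(3) w by (auto simp: bij_betw_def)
  ultimately show "F w = w" using assms(2) w by (auto dest: inj_onD)
 qed
qed (use assms in \<open>auto intro!: perm_eqI simp: perm_of_apply inv_into_into f_inv_into_f\<close>)

text \<open>The action of \<open>H\<close> on the cosets of \<open>N\<close> has kernel
  \<open>N\<close> because \<open>N\<close> is normal. The target type \<open>nat perm\<close> does
  not depend on \<open>H\<close>, so an induction over subgroups of \<open>nat perm\<close> may pass
  to quotients.\<close>

lemma quotient_ex:
 fixes H :: "'g::grp set"
 assumes "subgrp H" "nsub N H"
 obtains \<phi> :: "'g \<Rightarrow> nat perm" where "homo H \<phi>" "ker H \<phi> = N"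
proof -
 define \<Omega> where "\<Omega> = lcosets H N"
 have fin: "finite \<Omega>" unfolding \<Omega>_def using assms by simp
 obtain e :: "'g set \<Rightarrow> nat" where e: "inj_on e \<Omega>" using fin finite_imp_inj_to_nat_seg by blast
 define \<phi> where "\<phi> h = perm_of e \<Omega> ((`) ((*) h))" for h :: 'g
 note N = nsubD(1,2)[OF assms(2)]
 have ac: "acts H \<Omega> (\<lambda>g C. (*) g ` C)" unfolding \<Omega>_def using acts_lcosets[OF assms(1) N(1) order_refl] .
 have bij: "bij_betw ((`) ((*) h)) \<Omega> \<Omega>" if "h \<in> H" for h
  unfolding bij_betw_def
 proof
  have inj: "inj_on ((`) ((*) h)) \<Omega>" by (rule inj_onI) (simp add: inj_image_eq_iff inj_def)
  then show "inj_on ((`) ((*) h)) \<Omega>" .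
  show "(`) ((*) h) ` \<Omega> = \<Omega>"
   using ac that fin inj by (intro endo_inj_surj) (auto simp: acts_def)
 qed
 have "homo H \<phi>" unfolding homo_def
 proof (intro conjI ballI assms(1))
  fix x y assume xy: "x \<in> H" "y \<in> H"
  then show "\<phi> (x * y) = \<phi> x * \<phi> y" unfolding \<phi>_def
   using assms(1) by (intro perm_of_comp[OF fin e]) (auto simp: bij subgrp_mult coset_image image_image mult.assoc)
 qed
 moreover have "ker H \<phi> = N"
 proof (intro equalityI subsetI)
  fix x assume "x \<in> ker H \<phi>"
  then have x: "x \<in> H" "\<phi> x = 1" by (auto simp: ker_def)
  have "\<forall>C\<in>\<Omega>. (*) x ` C = C" using perm_of_eq_1_iff[OF fin e bij[OF x(1)]] x(2) unfolding \<phi>_def by simp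
  moreover have "(*) 1 ` N \<in> \<Omega>" unfolding \<Omega>_def lcosets_def by (rule imageI) (use assms(1) in simp)
  ultimately have "(*) x ` ((*) 1 ` N) = (*) 1 ` N" by (rule bspec)
  then have "(*) 1 ` N = (*) x ` N" by simp
  then show "x \<in> N" using coset_eq_iff[OF N(1), of 1 x] by simp
 next
  fix x assume x: "x \<in> N"
  have "(*) x ` C = C" if "C \<in> \<Omega>" for C
  proof -
   obtain h where h: "h \<in> H" "C = (*) h ` N" using \<open>C \<in> \<Omega>\<close> by (auto simp: \<Omega>_def lcosets_def)
   have "inverse h * (x * h) = cj (inverse h) x" by (simp add: cj_def mult.assoc)
   then have "inverse h * (x * h) \<in> N" using nsubD(3)[OF assms(2) subgrp_inverse[OF assms(1) h(1)] x] by simp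
   then show ?thesis using coset_eq_iff[OF N(1), of h "x * h"] h(2) coset_image by metis
  qed
  moreover have xH: "x \<in> H" using N x by blast
  ultimately have "\<phi> x = 1" using perm_of_eq_1_iff[OF fin e bij[OF xH]] unfolding \<phi>_def by simp
  then show "x \<in> ker H \<phi>" using xH by (simp add: ker_def)
 qed
 ultimately show ?thesis using that by blast
qed

subsection \<open>q-nilpotent groups\<close>

text \<open>\<open>qnil\<close> is \<open>q\<close>-nilpotency, i.e. existence of a normal \<open>q\<close>-complement, which is then \<open>core\<close>.\<close>

definition qnil :: "nat \<Rightarrow> 'g::grp set \<Rightarrow> bool" where
 "qnil q H \<longleftrightarrow> (\<forall>x\<in>H. \<forall>y\<in>H. p'el q x \<longrightarrow> p'el q y \<longrightarrow> p'el q (x * y))"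

definition core :: "nat \<Rightarrow> 'g::grp set \<Rightarrow> 'g set" where
 "core q H = {x\<in>H. p'el q x}"

lemma qnil_subset: "qnil q H \<Longrightarrow> K \<subseteq> H \<Longrightarrow> qnil q K"
 by (auto simp: qnil_def)

lemma pgrp_qnil:
 assumes "prime q" "pgrp q H" shows "qnil q H"
 unfolding qnil_def using assms pel_p'el_trivial pgrp_pel by (metis mult_1_right)

lemma core_nsub:
 assumes "subgrp H" "qnil q H" shows "nsub (core q H) H"
 unfolding core_def using assms
 by (intro nsubI subgrpI) (auto simp: qnil_def subgrp_mult subgrp_cj)

lemma core_coprime:
 assumes "subgrp H" "qnil q H" "prime q" shows "coprime (card (core q H)) q"
 using p'el_imp_coprime_card[OF nsubD(1)[OF core_nsub] assms(3)] assms by (auto simp: core_def)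

lemma syl_p'el:
 assumes "prime q" "prime r" "r \<noteq> q" "syl r H R" "x \<in> R" shows "p'el q x"
proof (rule coprime_card_p'el[OF sylD(1)[OF assms(4)] _ assms(5)])
 show "coprime (card R) q"
  unfolding sylD(4)[OF assms(4)] using assms primes_coprime[of r q] by (simp add: coprime_power_left_iff)
qed

text \<open>A prime \<open>r\<close> other than \<open>q\<close> dividing the index of
  \<open>N\<close> would, together with the full \<open>r\<close>-part already inside
  \<open>N\<close>, give the order of \<open>H\<close> one factor \<open>r\<close> too many.\<close>

lemma prime_power_index:
 assumes "subgrp H" "prime q" "subgrp N" "N \<subseteq> H" "\<And>r R. prime r \<Longrightarrow> r \<noteq> q \<Longrightarrow> syl r H R \<Longrightarrow> R \<subseteq> N"
 shows "\<exists>k. card H = card N * q ^ k"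
proof -
 have "card N dvd card H" using subgrp_card_dvd assms by blast
 then obtain t where t: "card H = card N * t" by (elim dvdE)
 have nz: "t \<noteq> 0" "card N \<noteq> 0" using t assms(1) by (metis card_0_eq mult_0_right subgrp_finite subgrp_nonempty, metis assms(3) card_0_eq subgrp_finite subgrp_nonempty)
 have only: "r = q" if r: "prime r" "r dvd t" for r
 proof (rule ccontr)
  assume "r \<noteq> q"
  obtain R where R: "syl r H R" using syl_ex[OF assms(1) r(1)] by blast
  have "R \<subseteq> N" using assms(5)[OF r(1) \<open>r \<noteq> q\<close> R] .
  then have "card R dvd card N" using subgrp_card_dvd assms(3) sylD(1)[OF R] by blast
  then have "r ^ multiplicity r (card H) dvd card N" using sylD(4)[OF R] by simp
  then have "r ^ Suc (multiplicity r (card H)) dvd card H" unfolding t using r(2) by (simp add: mult_dvd_mono mult.commute)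
  moreover have "card H \<noteq> 0" "\<not> is_unit r" using t nz r(1) by auto
  ultimately show False using power_dvd_iff_le_multiplicity[of "card H" r "Suc (multiplicity r (card H))"] by simp
 qed
 have nu: "\<not> is_unit q" using assms(2) by auto
 obtain y where y: "t = q ^ multiplicity q t * y" "\<not> q dvd y" using multiplicity_decompose'[OF nz(1) nu] by blast
 have "y = 1"
 proof (rule ccontr)
  assume "y \<noteq> 1"
  then obtain r where r: "prime r" "r dvd y" using prime_factor_nat by blast
  then have "r dvd t" by (subst y(1)) simp
  then show False using only[OF r(1)] r y by simp
 qed
 then show ?thesis using t y by (metis mult_1_right)
qed

text \<open>The two factors meet trivially and \<open>core q H\<close> has \<open>q\<close>-power
  index, so their product is at least as large as \<open>H\<close>.\<close>

lemma core_decomp: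
 assumes H: "subgrp H" and q: "qnil q H" "prime q" and Q: "syl q H Q"
 shows "setmul (core q H) Q = H"
proof -
 let ?C = "core q H"
 have C: "subgrp ?C" "?C \<subseteq> H" using nsubD(1,2)[OF core_nsub[OF H q(1)]] .
 have "R \<subseteq> ?C" if "prime r" "r \<noteq> q" "syl r H R" for r R
  using that syl_p'el[OF q(2)] sylD(2) unfolding core_def by blast
 then obtain k where k: "card H = card ?C * q ^ k" using prime_power_index[OF H q(2) C] by blast
 have "?C \<inter> Q = {1}"
  using pel_p'el_trivial[OF q(2)] pgrp_pel[OF sylD(3)[OF Q]] C(1) sylD(1)[OF Q] subgrp_one unfolding core_def by fastforce
 then have 1: "card (setmul ?C Q) = card ?C * card Q" using card_setmul[OF C(1) sylD(1)[OF Q]] by simp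
 have "q ^ k dvd card H" using k by simp
 then have "k \<le> multiplicity q (card H)"
  using power_dvd_iff_le_multiplicity[of "card H" q k] H q(2) by (metis card_0_eq not_prime_unit subgrp_finite subgrp_nonempty)
 then have "card H \<le> card (setmul ?C Q)" unfolding 1 sylD(4)[OF Q] using k q(2)
  by (metis mult_le_mono2 power_increasing prime_ge_1_nat)
 moreover have "setmul ?C Q \<subseteq> H" using setmul_subset[OF H C(2) sylD(2)[OF Q]] .
 ultimately show ?thesis using H by (metis card_seteq subgrp_finite)
qed

text \<open>The commutator of \<open>x\<close> and \<open>y\<close> lies both in the normal
  \<open>q\<close>-group \<open>X\<close> and in the normal \<open>q'\<close>-group
  \<open>core q H\<close>, so it is trivial.\<close>

lemma qnil_commute:
 assumes "subgrp H" "qnil q H" "prime q" "nsub X H" "pgrp q X" "x \<in> core q H" "y \<in> X"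
 shows "x * y = y * x"
proof -
 let ?z = "x * y * inverse x * inverse y"
 have xH: "x \<in> H" "y \<in> H" using assms nsubD(2) by (auto simp: core_def)
 have "?z = cj x y * inverse y" by (simp add: cj_def)
 then have "?z \<in> X" using assms xH nsubD[OF assms(4)] by (simp add: subgrp_closed)
 moreover have "?z = x * cj y (inverse x)" by (simp add: cj_def mult.assoc)
 then have "?z \<in> core q H" using assms xH nsubD[OF core_nsub[OF assms(1,2)]] by (simp add: subgrp_closed)
 ultimately have "?z = 1" using pel_p'el_trivial[OF assms(3)] pgrp_pel[OF assms(5)] by (auto simp: core_def)
 then have "cj x y = y" using \<open>?z = cj x y * inverse y\<close>
  by (metis grp_inverse_unique grp_inverse_inverse grp_inverse_mult mult_1_left mult_1_right grp_mult_inverse_cancel grp_right_cancel grp_right_inverse)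
 then show ?thesis by (simp add: cj_eq_iff)
qed

lemma qnil_image:
 assumes "homo H \<phi>" "qnil q K" "prime q" "K \<subseteq> H" "subgrp K" shows "qnil q (\<phi> ` K)"
 unfolding qnil_def
proof (intro ballI impI)
 fix x y assume xy: "x \<in> \<phi> ` K" "y \<in> \<phi> ` K" "p'el q x" "p'el q y"
 have hK: "homo K \<phi>" using assms unfolding homo_def by blast
 obtain a where a: "a \<in> K" "p'el q a" "\<phi> a = x" using homo_lift_p'el[OF hK _ _ assms(3)] xy(1,3) by (metis imageE)
 obtain b where b: "b \<in> K" "p'el q b" "\<phi> b = y" using homo_lift_p'el[OF hK _ _ assms(3)] xy(2,4) by (metis imageE)
 have "p'el q (a * b)" using assms(2) a b by (auto simp: qnil_def)
 then show "p'el q (x * y)" using homo_p'el[OF hK, of "a * b" q] homo_mult[OF hK] a b assms(5) by (simp add: subgrp_mult)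
qed

lemma qnil_conj: assumes "qnil q H" shows "qnil q (cj g ` H)"
 using assms unfolding qnil_def by (auto simp flip: cj_mult)

subsection \<open>Linear characters and cyclic subgroups\<close>

text \<open>Values outside \<open>H\<close> are unconstrained, whereas the members of
  \<open>Irr H\<close> below vanish there; \<open>lin_Irr\<close> and \<open>Irr_lin\<close> pass
  between the two.\<close>

definition lin :: "'g::grp set \<Rightarrow> ('g \<Rightarrow> complex) \<Rightarrow> bool" where
 "lin H \<mu> \<longleftrightarrow> (\<forall>x\<in>H. \<forall>y\<in>H. \<mu> (x * y) = \<mu> x * \<mu> y) \<and> \<mu> 1 = 1"

lemma lin_one: "lin H \<mu> \<Longrightarrow> \<mu> 1 = 1"
 and lin_mult: "lin H \<mu> \<Longrightarrow> x \<in> H \<Longrightarrow> y \<in> H \<Longrightarrow> \<mu> (x * y) = \<mu> x * \<mu> y"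
 by (simp_all add: lin_def)

lemma lin_power: "lin H \<mu> \<Longrightarrow> subgrp H \<Longrightarrow> x \<in> H \<Longrightarrow> \<mu> (x ^ n) = \<mu> x ^ n"
 by (induction n) (auto simp: lin_one lin_mult subgrp_power)

lemma lin_power_card: "lin H \<mu> \<Longrightarrow> subgrp H \<Longrightarrow> x \<in> H \<Longrightarrow> \<mu> x ^ card H = 1"
 by (metis lin_one lin_power subgrp_power_card)

lemma lin_nz: "lin H \<mu> \<Longrightarrow> subgrp H \<Longrightarrow> x \<in> H \<Longrightarrow> \<mu> x \<noteq> 0"
 by (metis lin_power_card power_0_left subgrp_card_pos less_irrefl zero_neq_one)

lemma lin_cj:
 assumes "lin H \<mu>" "subgrp H" "g \<in> H" "x \<in> H" shows "\<mu> (cj g x) = \<mu> x"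
proof -
 have "\<mu> (cj g x) * \<mu> g = \<mu> (cj g x * g)" using lin_mult[OF assms(1) subgrp_cj[OF assms(2-4)] assms(3)] by simp
 also have "cj g x * g = g * x" by (simp add: cj_def mult.assoc)
 also have "\<mu> (g * x) = \<mu> x * \<mu> g" using lin_mult[OF assms(1,3,4)] by simp
 finally show ?thesis using lin_nz[OF assms(1-3)] by simp
qed

lemma lin_ker_nsub: "lin H \<mu> \<Longrightarrow> subgrp H \<Longrightarrow> nsub {x\<in>H. \<mu> x = 1} H"
 by (intro nsubI subgrpI) (auto simp: lin_one lin_mult lin_cj subgrp_mult subgrp_cj)

lemma coprime_powers_1:
 fixes z :: complex assumes "z ^ m = 1" "z ^ n = 1" "coprime m n" shows "z = 1"
proof (cases "m = 0")
 case False
 obtain u v where "m * u = n * v + gcd m n" using bezout_nat[OF False, of n] by blast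
 then have "z ^ (m * u) = z ^ (n * v + 1)" using assms by simp
 then show ?thesis using assms by (simp add: power_mult)
qed (use assms in simp)

text \<open>For \<open>x ^ n = 1\<close> with \<open>n > 0\<close> this is the cyclic group
  generated by \<open>x\<close>; \<open>n\<close> may be any such exponent, for instance the order
  of an ambient group.\<close>

definition cyc :: "'g::grp \<Rightarrow> nat \<Rightarrow> 'g set" where
 "cyc x n = (\<lambda>i. x ^ i) ` {..<n}"

lemma cyc_subgrp:
 assumes "x ^ n = 1" "n > 0" shows "subgrp (cyc x n)" "x ^ i \<in> cyc x n"
proof -
 have mem: "x ^ i \<in> cyc x n" for i
 proof -
  have "x ^ i = x ^ (i mod n)" using power_cong_exp[OF assms(1), of i "i mod n"] by (simp add: cong_def)
  then show ?thesis unfolding cyc_def using assms(2) by auto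
 qed
 then show "x ^ i \<in> cyc x n" .
 show "subgrp (cyc x n)"
 proof (rule subgrpI)
  show "finite (cyc x n)" by (simp add: cyc_def)
  show "1 \<in> cyc x n" using mem[of 0] by simp
  fix a b assume "a \<in> cyc x n" "b \<in> cyc x n"
  then obtain i j where "a = x ^ i" "b = x ^ j" by (auto simp: cyc_def)
  then show "a * b \<in> cyc x n" using mem[of "i + j"] by (simp add: power_add)
 qed
qed

section \<open>Complex representations of finite groups\<close>

subsection \<open>Matrix preliminaries\<close>

lemma mat_mult_entry:
 assumes "A \<in> carrier_mat n m" "B \<in> carrier_mat m l" "i < n" "j < l"
 shows "(A * B) $$ (i, j) = (\<Sum>k<m. A $$ (i, k) * B $$ (k, j))"
 using assms by (auto simp: scalar_prod_def atLeast0LessThan)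

lemma mat_vec_entry:
 assumes "A \<in> carrier_mat n m" "v \<in> carrier_vec m" "i < n"
 shows "(A *\<^sub>v v) $ i = (\<Sum>k<m. A $$ (i, k) * v $ k)"
 using assms by (auto simp: scalar_prod_def atLeast0LessThan)

lemma mat_vec_unit:
 fixes A :: "complex mat"
 assumes "A \<in> carrier_mat n m" "i < n" "j < m"
 shows "(A *\<^sub>v unit_vec m j) $ i = A $$ (i, j)"
proof -
 have "(A *\<^sub>v unit_vec m j) $ i = (\<Sum>k<m. if k = j then A $$ (i, k) else 0)"
  unfolding mat_vec_entry[OF assms(1) unit_vec_carrier assms(2)]
  by (rule sum.cong) (use assms in \<open>auto simp: unit_vec_def\<close>)
 then show ?thesis using assms by simp
qed

lemma mat_trace_mult_comm:
 assumes "A \<in> carrier_mat n m" "B \<in> carrier_mat m n"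
 shows "mat_trace (A * B) = mat_trace (B * A)"
proof -
 have "mat_trace (A * B) = (\<Sum>i<n. \<Sum>k<m. A $$ (i, k) * B $$ (k, i))"
  unfolding mat_trace_def using assms by (auto intro!: sum.cong simp: mat_mult_entry[OF assms] simp del: index_mult_mat(1))
 also have "\<dots> = (\<Sum>k<m. \<Sum>i<n. B $$ (k, i) * A $$ (i, k))"
  by (subst sum.swap) (simp add: mult.commute)
 also have "\<dots> = mat_trace (B * A)"
  unfolding mat_trace_def using assms by (auto intro!: sum.cong simp: mat_mult_entry[OF assms(2,1)] simp del: index_mult_mat(1))
 finally show ?thesis .
qed

lemma mat_trace_one: "mat_trace (1\<^sub>m n) = of_nat n"
 by (simp add: mat_trace_def)

lemma mat_trace_smult: "mat_trace (c \<cdot>\<^sub>m A) = c * mat_trace A" if "A \<in> carrier_mat n n"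
 using that by (auto simp: mat_trace_def sum_distrib_left)

text \<open>Linear independence of the list \<open>ws\<close>, put in the form to which the
  dimension bound \<open>inj_matrix_dim\<close> applies.\<close>

definition inj_cols :: "nat \<Rightarrow> complex vec list \<Rightarrow> bool" where
 "inj_cols d ws \<longleftrightarrow> set ws \<subseteq> carrier_vec d \<and>
  (\<forall>v\<in>carrier_vec (length ws). mat_of_cols d ws *\<^sub>v v = 0\<^sub>v d \<longrightarrow> v = 0\<^sub>v (length ws))"

definition subsp :: "nat \<Rightarrow> complex vec set \<Rightarrow> bool" where
 "subsp d W \<longleftrightarrow> W \<subseteq> carrier_vec d \<and> 0\<^sub>v d \<in> W \<and> (\<forall>v\<in>W. \<forall>w\<in>W. v + w \<in> W) \<and> (\<forall>c. \<forall>v\<in>W. c \<cdot>\<^sub>v v \<in> W)"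

text \<open>If \<open>m\<close> exceeded \<open>d\<close>, filling up with zero rows would give an
  injective square matrix, so one of non-zero determinant, whose last row is zero.\<close>

lemma inj_matrix_dim:
 fixes A :: "complex mat"
 assumes A: "A \<in> carrier_mat d m" and inj: "\<And>v. v \<in> carrier_vec m \<Longrightarrow> A *\<^sub>v v = 0\<^sub>v d \<Longrightarrow> v = 0\<^sub>v m"
 shows "m \<le> d"
proof (rule ccontr)
 assume "\<not> m \<le> d"
 then have lt: "d < m" by simp
 define B where "B = mat m m (\<lambda>(i, j). if i < d then A $$ (i, j) else 0)"
 have B: "B \<in> carrier_mat m m" by (simp add: B_def)
 have ker: "v = 0\<^sub>v m" if v: "v \<in> carrier_vec m" "B *\<^sub>v v = 0\<^sub>v m" for v
 proof (rule inj[OF v(1)])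
  show "A *\<^sub>v v = 0\<^sub>v d"
  proof (rule eq_vecI)
   fix i assume i: "i < dim_vec (0\<^sub>v d :: complex vec)"
   have "(A *\<^sub>v v) $ i = (B *\<^sub>v v) $ i"
    using mat_vec_entry[OF A v(1), of i] mat_vec_entry[OF B v(1), of i] i lt by (simp add: B_def)
   then show "(A *\<^sub>v v) $ i = 0\<^sub>v d $ i" using v(2) i lt by simp
  qed (use A in auto)
 qed
 then have "det B \<noteq> 0" using det_0_iff_vec_prod_zero[OF B] by blast
 then have "det (transpose_mat B) \<noteq> 0" using det_transpose[OF B] by simp
 moreover have "transpose_mat B *\<^sub>v unit_vec m (m - 1) = 0\<^sub>v m"
 proof (rule eq_vecI)
  fix i assume i: "i < dim_vec (0\<^sub>v m :: complex vec)"
  have T: "transpose_mat B \<in> carrier_mat m m" using B by simp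
  have "(transpose_mat B *\<^sub>v unit_vec m (m - 1)) $ i = (\<Sum>k<m. transpose_mat B $$ (i, k) * unit_vec m (m - 1) $ k)"
   using mat_vec_entry[OF T] i by simp
  also have "\<dots> = 0" using i lt by (intro sum.neutral) (auto simp: B_def unit_vec_def)
  finally show "(transpose_mat B *\<^sub>v unit_vec m (m - 1)) $ i = 0\<^sub>v m $ i" using i by simp
 qed (simp add: B_def)
 moreover have "unit_vec m (m - 1) \<noteq> (0\<^sub>v m :: complex vec)"
 proof
  assume "unit_vec m (m - 1) = (0\<^sub>v m :: complex vec)"
  then have "(unit_vec m (m - 1) :: complex vec) $ (m - 1) = 0\<^sub>v m $ (m - 1)" by simp
  then show False using lt by simp
 qed
 ultimately show False
  using det_0_iff_vec_prod_zero[of "transpose_mat B" m] B by (metis transpose_carrier_mat unit_vec_carrier)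
qed

lemma inj_cols_snoc:
 assumes ws: "inj_cols d ws" and w: "w \<in> carrier_vec d"
  and nw: "\<And>v. v \<in> carrier_vec (length ws) \<Longrightarrow> mat_of_cols d ws *\<^sub>v v \<noteq> w"
 shows "inj_cols d (ws @ [w])"
 unfolding inj_cols_def
proof (intro conjI ballI impI)
 let ?n = "length ws"
 show "set (ws @ [w]) \<subseteq> carrier_vec d" using ws w by (simp add: inj_cols_def)
 fix v assume v: "v \<in> carrier_vec (length (ws @ [w]))" "mat_of_cols d (ws @ [w]) *\<^sub>v v = 0\<^sub>v d"
 define u where "u = vec ?n (\<lambda>i. v $ i)"
 have u: "u \<in> carrier_vec ?n" by (simp add: u_def)
 have M: "mat_of_cols d ws \<in> carrier_mat d ?n" by simp
 have M': "mat_of_cols d (ws @ [w]) \<in> carrier_mat d (Suc ?n)" using mat_of_cols_carrier(1)[of d "ws @ [w]"] by simp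
 have v': "v \<in> carrier_vec (Suc ?n)" using v(1) by simp
 have e: "(mat_of_cols d ws *\<^sub>v u) $ i + v $ ?n * w $ i = 0" if i: "i < d" for i
 proof -
  have "0 = (mat_of_cols d (ws @ [w]) *\<^sub>v v) $ i" using v(2) i by simp
  also have "\<dots> = (\<Sum>k<Suc ?n. mat_of_cols d (ws @ [w]) $$ (i, k) * v $ k)" using mat_vec_entry[OF M' v' i] .
  also have "\<dots> = (\<Sum>k<?n. mat_of_cols d ws $$ (i, k) * u $ k) + w $ i * v $ ?n"
   using i by (simp add: mat_of_cols_index nth_append u_def)
  also have "(\<Sum>k<?n. mat_of_cols d ws $$ (i, k) * u $ k) = (mat_of_cols d ws *\<^sub>v u) $ i"
   using mat_vec_entry[OF M u i] by simp
  finally show ?thesis by (simp add: mult.commute)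
 qed
 have v0: "v $ ?n = 0"
 proof (rule ccontr)
  assume nz: "v $ ?n \<noteq> 0"
  have "mat_of_cols d ws *\<^sub>v ((- 1 / v $ ?n) \<cdot>\<^sub>v u) = w"
  proof (rule eq_vecI)
   fix i assume "i < dim_vec w"
   then have i: "i < d" using w by simp
   have "(mat_of_cols d ws *\<^sub>v ((- 1 / v $ ?n) \<cdot>\<^sub>v u)) $ i = (- 1 / v $ ?n) * (mat_of_cols d ws *\<^sub>v u) $ i"
    using mult_mat_vec[OF M u] i by simp
   also have "(mat_of_cols d ws *\<^sub>v u) $ i = - (v $ ?n * w $ i)" using e[OF i] by (simp add: eq_neg_iff_add_eq_0)
   finally show "(mat_of_cols d ws *\<^sub>v ((- 1 / v $ ?n) \<cdot>\<^sub>v u)) $ i = w $ i" using nz by simp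
  qed (use w in simp)
  moreover have "(- 1 / v $ ?n) \<cdot>\<^sub>v u \<in> carrier_vec ?n" using u by simp
  ultimately show False using nw by blast
 qed
 have "mat_of_cols d ws *\<^sub>v u = 0\<^sub>v d" by (rule eq_vecI) (use e v0 in auto)
 then have u0: "u = 0\<^sub>v ?n" using ws u by (auto simp: inj_cols_def)
 show "v = 0\<^sub>v (length (ws @ [w]))"
 proof (rule eq_vecI)
  fix i assume "i < dim_vec (0\<^sub>v (length (ws @ [w])) :: complex vec)"
  then have "i < ?n \<or> i = ?n" by auto
  moreover have "v $ i = 0" if "i < ?n" using arg_cong[OF u0, of "\<lambda>x. x $ i"] that by (simp add: u_def)
  ultimately show "v $ i = 0\<^sub>v (length (ws @ [w])) $ i" using v0 by auto
 qed (use v in simp)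
qed

text \<open>Vectors outside the current span are appended one at a time;
  \<open>inj_matrix_dim\<close> bounds the length by \<open>d\<close>, so this stops.\<close>

lemma inj_cols_extend:
 assumes ws: "inj_cols d ws" "set ws \<subseteq> U" and U: "U \<subseteq> carrier_vec d"
 shows "\<exists>us. inj_cols d (ws @ us) \<and> set us \<subseteq> U \<and>
  (\<forall>w\<in>U. \<exists>v\<in>carrier_vec (length (ws @ us)). mat_of_cols d (ws @ us) *\<^sub>v v = w)"
 using ws
proof (induction "d - length ws" arbitrary: ws rule: less_induct)
 case (less ws)
 show ?case
 proof (cases "\<forall>w\<in>U. \<exists>v\<in>carrier_vec (length ws). mat_of_cols d ws *\<^sub>v v = w")
  case True
  then show ?thesis using less.prems by (intro exI[of _ "[]"]) simp
 next
  case False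
  then obtain w where w: "w \<in> U" "\<And>v. v \<in> carrier_vec (length ws) \<Longrightarrow> mat_of_cols d ws *\<^sub>v v \<noteq> w" by blast
  have i: "inj_cols d (ws @ [w])" using inj_cols_snoc[OF less.prems(1)] w U by blast
  have "length (ws @ [w]) \<le> d"
   by (rule inj_matrix_dim[of "mat_of_cols d (ws @ [w])"]) (use i in \<open>auto simp: inj_cols_def\<close>)
  then have lt: "d - length (ws @ [w]) < d - length ws" by simp
  have "set (ws @ [w]) \<subseteq> U" using less.prems(2) w(1) by simp
  from less.hyps[OF lt i this] obtain us where
   us: "inj_cols d ((ws @ [w]) @ us)" "set us \<subseteq> U"
    "\<forall>x\<in>U. \<exists>v\<in>carrier_vec (length ((ws @ [w]) @ us)). mat_of_cols d ((ws @ [w]) @ us) *\<^sub>v v = x" by blast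
  show ?thesis
   by (rule exI[of _ "w # us"]) (use us w(1) in simp)
 qed
qed

text \<open>A basis of \<open>W\<close>, extended to one of the whole space, gives the columns of
  \<open>A\<close>, so that \<open>A\<close> carries the vectors supported on the first
  \<open>m\<close> coordinates onto \<open>W\<close>.\<close>

lemma subspace_basis:
 assumes W: "subsp d W"
 obtains m A B where "m \<le> d" "A \<in> carrier_mat d d" "B \<in> carrier_mat d d" "A * B = 1\<^sub>m d" "B * A = 1\<^sub>m d"
  "W = {A *\<^sub>v v | v. v \<in> carrier_vec d \<and> (\<forall>i. m \<le> i \<and> i < d \<longrightarrow> v $ i = 0)}"
proof -
 have WV: "W \<subseteq> carrier_vec d" using W by (simp add: subsp_def)
 have nil: "inj_cols d []" by (auto simp: inj_cols_def)
 obtain bs where bs: "inj_cols d bs" "set bs \<subseteq> W"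
  "\<forall>w\<in>W. \<exists>v\<in>carrier_vec (length bs). mat_of_cols d bs *\<^sub>v v = w"
  using inj_cols_extend[OF nil _ WV] by auto
 have bsV: "set bs \<subseteq> carrier_vec d" using bs(2) WV by blast
 obtain us where us: "inj_cols d (bs @ us)"
  "\<forall>w\<in>carrier_vec d. \<exists>v\<in>carrier_vec (length (bs @ us)). mat_of_cols d (bs @ us) *\<^sub>v v = w"
  using inj_cols_extend[OF bs(1) bsV order_refl] by auto
 define n where "n = length (bs @ us)"
 define A where "A = mat_of_cols d (bs @ us)"
 define m where "m = length bs"
 have A: "A \<in> carrier_mat d n" by (simp add: A_def n_def del: length_append)
 have injA: "v = 0\<^sub>v n" if "v \<in> carrier_vec n" "A *\<^sub>v v = 0\<^sub>v d" for v
  using us(1) that by (auto simp: inj_cols_def A_def n_def)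
 have surjA: "\<exists>v\<in>carrier_vec n. A *\<^sub>v v = w" if "w \<in> carrier_vec d" for w using us(2) that by (simp add: A_def n_def)
 have "\<forall>i<d. \<exists>v\<in>carrier_vec n. A *\<^sub>v v = unit_vec d i" using surjA by simp
 then obtain y where y: "\<And>i. i < d \<Longrightarrow> y i \<in> carrier_vec n \<and> A *\<^sub>v y i = unit_vec d i" by metis
 define B where "B = mat n d (\<lambda>(k, i). y i $ k)"
 have B: "B \<in> carrier_mat n d" by (simp add: B_def)
 have AB: "A * B = 1\<^sub>m d"
 proof (rule eq_matI)
  fix i j assume "i < dim_row (1\<^sub>m d :: complex mat)" "j < dim_col (1\<^sub>m d :: complex mat)"
  then have ij: "i < d" "j < d" by auto
  have "(A * B) $$ (i, j) = (\<Sum>k<n. A $$ (i, k) * y j $ k)" using mat_mult_entry[OF A B ij] ij by (simp add: B_def)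
  also have "\<dots> = (A *\<^sub>v y j) $ i" by (rule mat_vec_entry[OF A conjunct1[OF y[OF ij(2)]] ij(1), symmetric])
  also have "\<dots> = 1\<^sub>m d $$ (i, j)" using y[OF ij(2)] ij by auto
  finally show "(A * B) $$ (i, j) = 1\<^sub>m d $$ (i, j)" .
 qed (use A B in auto)
 have "n \<le> d" using inj_matrix_dim[OF A] injA by blast
 moreover have "d \<le> n"
 proof (rule inj_matrix_dim[OF B])
  fix v assume v: "v \<in> carrier_vec d" "B *\<^sub>v v = 0\<^sub>v n"
  have "v = (A * B) *\<^sub>v v" using AB v by simp
  also have "\<dots> = A *\<^sub>v (B *\<^sub>v v)" using A B v by (simp add: assoc_mult_mat_vec)
  also have "\<dots> = 0\<^sub>v d" using v A by auto
  finally show "v = 0\<^sub>v d" .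
 qed
 ultimately have nd: "n = d" by simp
 have A': "A \<in> carrier_mat d d" and B': "B \<in> carrier_mat d d" using A B nd by auto
 have BA: "B * A = 1\<^sub>m d" using mat_mult_left_right_inverse[OF A' B' AB] .
 have md: "m \<le> d" using nd by (simp add: m_def n_def)
 have pad: "A *\<^sub>v v = mat_of_cols d bs *\<^sub>v vec m (\<lambda>i. v $ i)"
  if v: "v \<in> carrier_vec d" "\<forall>i. m \<le> i \<and> i < d \<longrightarrow> v $ i = 0" for v
 proof (rule eq_vecI)
  fix i assume "i < dim_vec (mat_of_cols d bs *\<^sub>v vec m (\<lambda>i. v $ i))"
  then have i: "i < d" by simp
  have M: "mat_of_cols d bs \<in> carrier_mat d m" by (simp add: m_def)
  have "(A *\<^sub>v v) $ i = (\<Sum>k<d. A $$ (i, k) * v $ k)" using mat_vec_entry[OF A' v(1) i] .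
  also have "\<dots> = (\<Sum>k<m. A $$ (i, k) * v $ k)"
   using md v(2) by (intro sum.mono_neutral_right) auto
  also have "\<dots> = (\<Sum>k<m. mat_of_cols d bs $$ (i, k) * vec m (\<lambda>i. v $ i) $ k)"
   using i md nd by (intro sum.cong) (auto simp: A_def mat_of_cols_index nth_append m_def n_def)
  also have "\<dots> = (mat_of_cols d bs *\<^sub>v vec m (\<lambda>i. v $ i)) $ i" using mat_vec_entry[OF M _ i] by simp
  finally show "(A *\<^sub>v v) $ i = (mat_of_cols d bs *\<^sub>v vec m (\<lambda>i. v $ i)) $ i" .
 qed (use A' in simp)
 have comb: "mat_of_cols d bs *\<^sub>v v \<in> W" if v: "v \<in> carrier_vec m" for v
 proof -
  have "(\<exists>w\<in>W. \<forall>i<d. w $ i = (\<Sum>k<j. (bs ! k) $ i * v $ k))" if "j \<le> m" for j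
   using that
  proof (induction j)
   case 0 then show ?case using W by (intro bexI[of _ "0\<^sub>v d"]) (auto simp: subsp_def)
  next
   case (Suc j)
   then obtain w where w: "w \<in> W" "\<forall>i<d. w $ i = (\<Sum>k<j. (bs ! k) $ i * v $ k)" by auto
   have bj: "bs ! j \<in> W" using Suc.prems bs(2) by (auto simp: m_def)
   have bjv: "bs ! j \<in> carrier_vec d" "w \<in> carrier_vec d" using bj w(1) WV by auto
   have "w + v $ j \<cdot>\<^sub>v (bs ! j) \<in> W" using W w(1) bj by (simp add: subsp_def)
   moreover have "\<forall>i<d. (w + v $ j \<cdot>\<^sub>v (bs ! j)) $ i = (\<Sum>k<Suc j. (bs ! k) $ i * v $ k)"
    using w(2) bjv by (simp add: mult.commute)
   ultimately show ?case by blast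
  qed
  then obtain w where w: "w \<in> W" "\<forall>i<d. w $ i = (\<Sum>k<m. (bs ! k) $ i * v $ k)" by blast
  have M: "mat_of_cols d bs \<in> carrier_mat d m" by (simp add: m_def)
  have "mat_of_cols d bs *\<^sub>v v = w"
  proof (rule eq_vecI)
   fix i assume "i < dim_vec w"
   then have i: "i < d" using w(1) WV by auto
   show "(mat_of_cols d bs *\<^sub>v v) $ i = w $ i"
    unfolding mat_vec_entry[OF M v i] using w(2) i by (auto simp: mat_of_cols_index m_def intro!: sum.cong)
  qed (use w(1) WV in auto)
  then show ?thesis using w(1) by simp
 qed
 have "W = {A *\<^sub>v v | v. v \<in> carrier_vec d \<and> (\<forall>i. m \<le> i \<and> i < d \<longrightarrow> v $ i = 0)}"
 proof (intro equalityI subsetI)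
  fix w assume w: "w \<in> W"
  then obtain u where u: "u \<in> carrier_vec m" "mat_of_cols d bs *\<^sub>v u = w" using bs(3) by (auto simp: m_def)
  define v where "v = vec d (\<lambda>i. if i < m then u $ i else 0)"
  have v: "v \<in> carrier_vec d" "\<forall>i. m \<le> i \<and> i < d \<longrightarrow> v $ i = 0" by (auto simp: v_def)
  have "vec m (\<lambda>i. v $ i) = u" using u(1) md by (auto simp: v_def)
  then have "A *\<^sub>v v = w" using pad[OF v] u(2) by simp
  then show "w \<in> {A *\<^sub>v v | v. v \<in> carrier_vec d \<and> (\<forall>i. m \<le> i \<and> i < d \<longrightarrow> v $ i = 0)}" using v by blast
 next
  fix w assume "w \<in> {A *\<^sub>v v | v. v \<in> carrier_vec d \<and> (\<forall>i. m \<le> i \<and> i < d \<longrightarrow> v $ i = 0)}"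
  then obtain v where "v \<in> carrier_vec d" "\<forall>i. m \<le> i \<and> i < d \<longrightarrow> v $ i = 0" "w = A *\<^sub>v v" by blast
  then show "w \<in> W" using pad comb by simp
 qed
 then show ?thesis using that md A' B' AB BA by blast
qed

subsection \<open>Schur's lemma\<close>

abbreviation rp :: "'g::grp set \<Rightarrow> nat \<Rightarrow> ('g \<Rightarrow> complex mat) \<Rightarrow> bool" where
 "rp H \<equiv> is_rep (mon H)"

abbreviation irp :: "'g::grp set \<Rightarrow> nat \<Rightarrow> ('g \<Rightarrow> complex mat) \<Rightarrow> bool" where
 "irp H \<equiv> is_irred_rep (mon H)"

lemma rpD:
 assumes "rp H d \<rho>"
 shows "g \<in> H \<Longrightarrow> \<rho> g \<in> carrier_mat d d" "\<rho> 1 = 1\<^sub>m d" "g \<in> H \<Longrightarrow> h \<in> H \<Longrightarrow> \<rho> (g * h) = \<rho> g * \<rho> h"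
 using assms by (auto simp: is_rep_def)

lemma rpI:
 "(\<And>g. g \<in> H \<Longrightarrow> \<rho> g \<in> carrier_mat d d) \<Longrightarrow> \<rho> 1 = 1\<^sub>m d \<Longrightarrow>
 (\<And>g h. g \<in> H \<Longrightarrow> h \<in> H \<Longrightarrow> \<rho> (g * h) = \<rho> g * \<rho> h) \<Longrightarrow> rp H d \<rho>"
 by (auto simp: is_rep_def)

lemma irpD:
 assumes "irp H d \<rho>"
 shows "rp H d \<rho>" "d > 0"
  "subsp d W \<Longrightarrow> (\<And>g w. g \<in> H \<Longrightarrow> w \<in> W \<Longrightarrow> \<rho> g *\<^sub>v w \<in> W) \<Longrightarrow> W = {0\<^sub>v d} \<or> W = carrier_vec d"
 using assms by (auto simp: is_irred_rep_def is_invariant_subspace_def subsp_def)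

lemma irpI:
 assumes "rp H d \<rho>" "d > 0"
  "\<And>W. subsp d W \<Longrightarrow> (\<And>g w. g \<in> H \<Longrightarrow> w \<in> W \<Longrightarrow> \<rho> g *\<^sub>v w \<in> W) \<Longrightarrow> W = {0\<^sub>v d} \<or> W = carrier_vec d"
 shows "irp H d \<rho>"
 using assms by (auto simp: is_irred_rep_def is_invariant_subspace_def subsp_def)

text \<open>The kernel of \<open>X\<close> is invariant under \<open>\<tau>\<close> and its image
  under \<open>\<rho>\<close>; since \<open>X\<close> is non-zero, irreducibility makes the kernel
  trivial and the image the whole space.\<close>

lemma schur_intertwiner:
 assumes \<rho>: "irp H d \<rho>" and \<tau>: "irp H e \<tau>" and X: "X \<in> carrier_mat d e"
  and comm: "\<And>h. h \<in> H \<Longrightarrow> \<rho> h * X = X * \<tau> h" and nz: "X \<noteq> 0\<^sub>m d e"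
 shows "\<exists>Y\<in>carrier_mat e d. X * Y = 1\<^sub>m d \<and> Y * X = 1\<^sub>m e"
proof -
 note r = rpD[OF irpD(1)[OF \<rho>]] and t = rpD[OF irpD(1)[OF \<tau>]]
 obtain i j where ij: "i < d" "j < e" "X $$ (i, j) \<noteq> 0"
 proof -
  have "\<not> (\<forall>i<d. \<forall>j<e. X $$ (i, j) = 0)" using nz X by (auto intro!: eq_matI)
  then show ?thesis using that by blast
 qed
 have Xu: "(X *\<^sub>v unit_vec e j) $ i \<noteq> 0" using ij X by simp
 let ?K = "{v \<in> carrier_vec e. X *\<^sub>v v = 0\<^sub>v d}"
 have sK: "subsp e ?K" unfolding subsp_def using X by (auto simp: mult_add_distrib_mat_vec mult_mat_vec)
 have "\<tau> g *\<^sub>v w \<in> ?K" if g: "g \<in> H" and w: "w \<in> ?K" for g w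
 proof -
  have "X *\<^sub>v (\<tau> g *\<^sub>v w) = (X * \<tau> g) *\<^sub>v w" using X t(1)[OF g] w by (simp add: assoc_mult_mat_vec)
  also have "\<dots> = \<rho> g *\<^sub>v (X *\<^sub>v w)" using comm[OF g] X r(1)[OF g] w by (simp add: assoc_mult_mat_vec flip: comm[OF g])
  also have "\<dots> = 0\<^sub>v d" using w r(1)[OF g] by auto
  finally show ?thesis using w t(1)[OF g] by auto
 qed
 from irpD(3)[OF \<tau> sK this] have "?K = {0\<^sub>v e} \<or> ?K = carrier_vec e" by blast
 moreover have "?K \<noteq> carrier_vec e"
 proof
  assume "?K = carrier_vec e"
  moreover have "unit_vec e j \<in> carrier_vec e" by simp
  ultimately have "X *\<^sub>v unit_vec e j = 0\<^sub>v d" by blast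
  then show False using Xu ij by simp
 qed
 ultimately have K0: "v = 0\<^sub>v e" if "v \<in> carrier_vec e" "X *\<^sub>v v = 0\<^sub>v d" for v using that by blast
 let ?I = "{X *\<^sub>v v | v. v \<in> carrier_vec e}"
 have sI: "subsp d ?I" unfolding subsp_def
 proof (intro conjI ballI allI)
  show "?I \<subseteq> carrier_vec d" using X by auto
  show "0\<^sub>v d \<in> ?I" using X by (auto intro!: exI[of _ "0\<^sub>v e"])
  fix v w assume "v \<in> ?I" "w \<in> ?I"
  then obtain v' w' where "v' \<in> carrier_vec e" "w' \<in> carrier_vec e" "v = X *\<^sub>v v'" "w = X *\<^sub>v w'" by blast
  then show "v + w \<in> ?I" using X by (auto intro!: exI[of _ "v' + w'"] simp: mult_add_distrib_mat_vec)
 next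
  fix c v assume "v \<in> ?I"
  then obtain v' where "v' \<in> carrier_vec e" "v = X *\<^sub>v v'" by blast
  then show "c \<cdot>\<^sub>v v \<in> ?I" using X by (auto intro!: exI[of _ "c \<cdot>\<^sub>v v'"] simp: mult_mat_vec)
 qed
 have "\<rho> g *\<^sub>v w \<in> ?I" if g: "g \<in> H" and w: "w \<in> ?I" for g w
 proof -
  obtain v where v: "v \<in> carrier_vec e" "w = X *\<^sub>v v" using w by blast
  have "\<rho> g *\<^sub>v w = (\<rho> g * X) *\<^sub>v v" unfolding v(2) using X r(1)[OF g] v(1) by (simp add: assoc_mult_mat_vec)
  also have "\<dots> = X *\<^sub>v (\<tau> g *\<^sub>v v)" unfolding comm[OF g] using X t(1)[OF g] v(1) by (simp add: assoc_mult_mat_vec)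
  finally show ?thesis using t(1)[OF g] v(1) by auto
 qed
 from irpD(3)[OF \<rho> sI this] have "?I = {0\<^sub>v d} \<or> ?I = carrier_vec d" by blast
 moreover have "?I \<noteq> {0\<^sub>v d}"
 proof
  assume "?I = {0\<^sub>v d}"
  moreover have "X *\<^sub>v unit_vec e j \<in> ?I" by auto
  ultimately have "X *\<^sub>v unit_vec e j = 0\<^sub>v d" by blast
  then show False using Xu ij by simp
 qed
 ultimately have I: "?I = carrier_vec d" by blast
 have "\<forall>i<d. \<exists>v\<in>carrier_vec e. X *\<^sub>v v = unit_vec d i"
 proof (intro allI impI)
  fix i assume "i < d"
  have "unit_vec d i \<in> ?I" unfolding I by simp
  then show "\<exists>v\<in>carrier_vec e. X *\<^sub>v v = unit_vec d i" by auto
 qed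
 then obtain y where y: "\<And>i. i < d \<Longrightarrow> y i \<in> carrier_vec e \<and> X *\<^sub>v y i = unit_vec d i" by metis
 define Y where "Y = mat e d (\<lambda>(k, i). y i $ k)"
 have Y: "Y \<in> carrier_mat e d" by (simp add: Y_def)
 have XY: "X * Y = 1\<^sub>m d"
 proof (rule eq_matI)
  fix i j assume "i < dim_row (1\<^sub>m d :: complex mat)" "j < dim_col (1\<^sub>m d :: complex mat)"
  then have ij: "i < d" "j < d" by auto
  have "(X * Y) $$ (i, j) = (\<Sum>k<e. X $$ (i, k) * y j $ k)" using mat_mult_entry[OF X Y ij] ij by (simp add: Y_def)
  also have "\<dots> = (X *\<^sub>v y j) $ i" by (rule mat_vec_entry[OF X conjunct1[OF y[OF ij(2)]] ij(1), symmetric])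
  also have "\<dots> = 1\<^sub>m d $$ (i, j)" using y[OF ij(2)] ij by auto
  finally show "(X * Y) $$ (i, j) = 1\<^sub>m d $$ (i, j)" .
 qed (use X Y in auto)
 have YX: "Y * X = 1\<^sub>m e"
 proof (rule eq_matI)
  fix i j assume "i < dim_row (1\<^sub>m e :: complex mat)" "j < dim_col (1\<^sub>m e :: complex mat)"
  then have ij: "i < e" "j < e" by auto
  let ?u = "unit_vec e j :: complex vec"
  have YXc: "Y * X \<in> carrier_mat e e" using X Y by simp
  have "X *\<^sub>v ((Y * X) *\<^sub>v ?u) = X *\<^sub>v (Y *\<^sub>v (X *\<^sub>v ?u))" using X Y by (simp add: assoc_mult_mat_vec)
  also have "\<dots> = (X * Y) *\<^sub>v (X *\<^sub>v ?u)" using X Y by (subst assoc_mult_mat_vec) auto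
  also have "\<dots> = X *\<^sub>v ?u" using XY X by auto
  finally have e1: "X *\<^sub>v ((Y * X) *\<^sub>v ?u) = X *\<^sub>v ?u" .
  have "X *\<^sub>v ((Y * X) *\<^sub>v ?u - ?u) = X *\<^sub>v ((Y * X) *\<^sub>v ?u) - X *\<^sub>v ?u"
   using X YXc by (intro mult_minus_distrib_mat_vec) auto
  also have "\<dots> = 0\<^sub>v d" unfolding e1 using X by auto
  finally have "(Y * X) *\<^sub>v ?u - ?u = 0\<^sub>v e" using K0 YXc by auto
  then have "((Y * X) *\<^sub>v ?u - ?u) $ i = 0" using ij by simp
  then have "((Y * X) *\<^sub>v ?u) $ i = ?u $ i" using YXc ij by simp
  moreover have "((Y * X) *\<^sub>v ?u) $ i = (Y * X) $$ (i, j)" by (rule mat_vec_unit[OF YXc ij])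
  ultimately show "(Y * X) $$ (i, j) = 1\<^sub>m e $$ (i, j)" using ij by auto
 qed (use X Y in auto)
 show ?thesis using Y XY YX by blast
qed

text \<open>For an eigenvalue \<open>c\<close> the matrix \<open>Z\<close>, which is
  \<open>X\<close> minus the scalar matrix \<open>c\<close>, still intertwines but kills an
  eigenvector, so it is not invertible and must be zero.\<close>

lemma schur_scalar:
 assumes \<rho>: "irp H d \<rho>" and X: "X \<in> carrier_mat d d"
  and comm: "\<And>h. h \<in> H \<Longrightarrow> \<rho> h * X = X * \<rho> h"
 shows "\<exists>c. X = c \<cdot>\<^sub>m 1\<^sub>m d"
proof -
 note r = rpD[OF irpD(1)[OF \<rho>]]
 obtain c where "c \<in> spectrum X" using spectrum_non_empty[OF X irpD(2)[OF \<rho>]] by blast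
 then obtain v where v: "v \<in> carrier_vec d" "v \<noteq> 0\<^sub>v d" "X *\<^sub>v v = c \<cdot>\<^sub>v v"
  using X by (auto simp: spectrum_def eigenvalue_def eigenvector_def)
 define Z where "Z = X - c \<cdot>\<^sub>m 1\<^sub>m d"
 have Z: "Z \<in> carrier_mat d d" unfolding Z_def by (intro minus_carrier_mat) simp
 have Zv: "Z *\<^sub>v v = 0\<^sub>v d"
 proof -
  have "(c \<cdot>\<^sub>m 1\<^sub>m d) *\<^sub>v v = c \<cdot>\<^sub>v v"
  proof (rule eq_vecI)
   fix i assume "i < dim_vec (c \<cdot>\<^sub>v v)"
   then have i: "i < d" using v(1) by simp
   have C: "c \<cdot>\<^sub>m 1\<^sub>m d \<in> carrier_mat d d" by simp
   have "((c \<cdot>\<^sub>m 1\<^sub>m d) *\<^sub>v v) $ i = (\<Sum>k<d. if k = i then c * v $ k else 0)"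
    unfolding mat_vec_entry[OF C v(1) i] by (rule sum.cong) (use i in auto)
   then show "((c \<cdot>\<^sub>m 1\<^sub>m d) *\<^sub>v v) $ i = (c \<cdot>\<^sub>v v) $ i" using i v(1) by simp
  qed (use v(1) in simp)
  then show ?thesis unfolding Z_def using X v by (simp add: minus_mult_distrib_mat_vec)
 qed
 have "\<rho> h * Z = Z * \<rho> h" if h: "h \<in> H" for h
 proof -
  have R: "\<rho> h \<in> carrier_mat d d" using r(1)[OF h] .
  have "\<rho> h * (c \<cdot>\<^sub>m 1\<^sub>m d) = c \<cdot>\<^sub>m \<rho> h" using mult_smult_distrib[OF R one_carrier_mat] R by simp
  moreover have "(c \<cdot>\<^sub>m 1\<^sub>m d) * \<rho> h = c \<cdot>\<^sub>m \<rho> h" using mult_smult_assoc_mat[OF one_carrier_mat R] R by simp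
  ultimately show ?thesis unfolding Z_def using R X comm[OF h]
   by (simp add: mult_minus_distrib_mat minus_mult_distrib_mat)
 qed
 then have "Z = 0\<^sub>m d d"
 proof (rule_tac ccontr)
  assume "\<And>h. h \<in> H \<Longrightarrow> \<rho> h * Z = Z * \<rho> h" "Z \<noteq> 0\<^sub>m d d"
  then obtain Y where Y: "Y \<in> carrier_mat d d" "Y * Z = 1\<^sub>m d" using schur_intertwiner[OF \<rho> \<rho> Z] by blast
  have "v = 1\<^sub>m d *\<^sub>v v" using v(1) by simp
  also have "\<dots> = (Y * Z) *\<^sub>v v" by (simp only: Y(2))
  also have "\<dots> = Y *\<^sub>v (Z *\<^sub>v v)" by (rule assoc_mult_mat_vec[OF Y(1) Z v(1)])
  also have "\<dots> = 0\<^sub>v d" unfolding Zv using Y by auto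
  finally show False using v(2) by simp
 qed
 then have "X = c \<cdot>\<^sub>m 1\<^sub>m d"
  unfolding Z_def using X by (auto simp: mat_eq_iff)
 then show ?thesis by blast
qed

subsection \<open>Decomposition into irreducible representations\<close>

text \<open>In a basis adapted to an invariant subspace all matrices are block upper triangular. The
  two diagonal blocks are representations, and they determine trace and determinant.\<close>

lemma rep_split:
 assumes \<rho>: "rp H d \<rho>" "d > 0" "\<not> irp H d \<rho>"
 shows "\<exists>m \<sigma> \<tau>. 0 < m \<and> m < d \<and> rp H m \<sigma> \<and> rp H (d - m) \<tau> \<and>
  (\<forall>h\<in>H. mat_trace (\<rho> h) = mat_trace (\<sigma> h) + mat_trace (\<tau> h) \<and> det (\<rho> h) = det (\<sigma> h) * det (\<tau> h))"
proof -
 note r = rpD[OF \<rho>(1)]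
 obtain W where W: "subsp d W" "\<And>g w. g \<in> H \<Longrightarrow> w \<in> W \<Longrightarrow> \<rho> g *\<^sub>v w \<in> W" "W \<noteq> {0\<^sub>v d}" "W \<noteq> carrier_vec d"
  using irpI[OF \<rho>(1,2)] \<rho>(3) by blast
 obtain m A B where m: "m \<le> d" and A: "A \<in> carrier_mat d d" and B: "B \<in> carrier_mat d d"
  and AB: "A * B = 1\<^sub>m d" and BA: "B * A = 1\<^sub>m d"
  and WA: "W = {A *\<^sub>v v | v. v \<in> carrier_vec d \<and> (\<forall>i. m \<le> i \<and> i < d \<longrightarrow> v $ i = 0)}"
  using subspace_basis[OF W(1)] by blast
 have m0: "m \<noteq> 0"
 proof
  assume "m = 0"
  then have "v = 0\<^sub>v d" if "v \<in> carrier_vec d" "\<forall>i. m \<le> i \<and> i < d \<longrightarrow> v $ i = 0" for v using that by (auto intro!: eq_vecI)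
  moreover have "A *\<^sub>v 0\<^sub>v d = 0\<^sub>v d" using A by auto
  ultimately have "W \<subseteq> {0\<^sub>v d}" unfolding WA by (smt (verit, best) mem_Collect_eq singletonI subsetI)
  then show False using W(1,3) by (auto simp: subsp_def)
 qed
 have md: "m \<noteq> d"
 proof
  assume "m = d"
  have "w \<in> W" if w: "w \<in> carrier_vec d" for w
  proof -
   have "A *\<^sub>v (B *\<^sub>v w) = (A * B) *\<^sub>v w" using assoc_mult_mat_vec[OF A B w] by simp
   then have "w = A *\<^sub>v (B *\<^sub>v w)" unfolding AB using w by simp
   then show ?thesis unfolding WA using \<open>m = d\<close> B w by (auto intro!: exI[of _ "B *\<^sub>v w"])
  qed
  then show False using W(1,4) by (auto simp: subsp_def)
 qed
 define T where "T h = B * \<rho> h * A" for h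
 have Tc: "T h \<in> carrier_mat d d" if "h \<in> H" for h using A B r(1)[OF that] by (simp add: T_def)
 have T1: "T 1 = 1\<^sub>m d" using A B BA r(2) by (simp add: T_def)
 have Tm: "T (g * h) = T g * T h" if g: "g \<in> H" and h: "h \<in> H" for g h
 proof -
  note G = r(1)[OF g] and Hh = r(1)[OF h]
  have "T g * T h = (B * \<rho> g) * (A * (B * \<rho> h * A))"
   unfolding T_def using A B G Hh by (intro assoc_mult_mat) auto
  also have "A * (B * \<rho> h * A) = A * (B * (\<rho> h * A))" using assoc_mult_mat[OF B Hh A] by simp
  also have "\<dots> = (A * B) * (\<rho> h * A)" using assoc_mult_mat[OF A B mult_carrier_mat[OF Hh A]] by simp
  also have "\<dots> = \<rho> h * A" unfolding AB using Hh A by simp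
  also have "(B * \<rho> g) * (\<rho> h * A) = (B * \<rho> g) * \<rho> h * A" using assoc_mult_mat[OF mult_carrier_mat[OF B G] Hh A] by simp
  also have "(B * \<rho> g) * \<rho> h = B * (\<rho> g * \<rho> h)" using assoc_mult_mat[OF B G Hh] .
  finally show ?thesis by (simp add: T_def r(3)[OF g h])
 qed
 \<comment> \<open>The lower left block vanishes because the unit vectors with index below
   \<open>m\<close> correspond to vectors of the invariant subspace \<open>W\<close>.\<close>
 have Tz: "T h $$ (i, j) = 0" if h: "h \<in> H" and ij: "m \<le> i" "i < d" "j < m" for h i j
 proof -
  have jd: "j < d" using ij by simp
  have u: "unit_vec d j \<in> (carrier_vec d :: complex vec set)" by simp
  have "A *\<^sub>v unit_vec d j \<in> W" unfolding WA using ij by (auto intro!: exI[of _ "unit_vec d j"])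
  then have "\<rho> h *\<^sub>v (A *\<^sub>v unit_vec d j) \<in> W" using W(2)[OF h] by blast
  then obtain v where v: "\<rho> h *\<^sub>v (A *\<^sub>v unit_vec d j) = A *\<^sub>v v" "v \<in> carrier_vec d" "\<forall>i. m \<le> i \<and> i < d \<longrightarrow> v $ i = 0"
   unfolding WA by blast
  have "T h *\<^sub>v unit_vec d j = (B * \<rho> h) *\<^sub>v (A *\<^sub>v unit_vec d j)"
   unfolding T_def by (rule assoc_mult_mat_vec[OF mult_carrier_mat[OF B r(1)[OF h]] A u])
  also have "\<dots> = B *\<^sub>v (\<rho> h *\<^sub>v (A *\<^sub>v unit_vec d j))"
   by (rule assoc_mult_mat_vec[OF B r(1)[OF h] mult_mat_vec_carrier[OF A u]])
  also have "\<dots> = (B * A) *\<^sub>v v" unfolding v(1) using assoc_mult_mat_vec[OF B A v(2)] by simp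
  also have "\<dots> = v" unfolding BA using v(2) by simp
  finally have "(T h *\<^sub>v unit_vec d j) $ i = v $ i" by simp
  then show ?thesis using mat_vec_unit[OF Tc[OF h] ij(2) jd] v(3) ij by simp
 qed
 define \<sigma> where "\<sigma> h = mat m m (\<lambda>(i, j). T h $$ (i, j))" for h
 define \<tau> where "\<tau> h = mat (d - m) (d - m) (\<lambda>(i, j). T h $$ (i + m, j + m))" for h
 have split: "(\<Sum>k<d. f k) = (\<Sum>k<m. f k) + (\<Sum>k<d - m. f (k + m))" for f :: "nat \<Rightarrow> complex"
 proof -
  have "(\<Sum>k<d. f k) = (\<Sum>k<m. f k) + (\<Sum>k=m..<d. f k)"
   using m by (metis atLeast0LessThan sum.atLeastLessThan_concat zero_le)
  also have "(\<Sum>k=m..<d. f k) = (\<Sum>k=0+m..<(d-m)+m. f k)" using m by simp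
  also have "\<dots> = (\<Sum>k=0..<d-m. f (k + m))" by (rule sum.shift_bounds_nat_ivl)
  finally show ?thesis by (simp add: atLeast0LessThan)
 qed
 \<comment> \<open>Treats both diagonal blocks at once: the offset \<open>s\<close> is 0 or
   \<open>m\<close>, and the hypothesis on the sums says that entries outside the block do not
   contribute to products inside it.\<close>
 have blk: "rp H n (\<lambda>h. mat n n (\<lambda>(i, j). T h $$ (i + s, j + s)))"
  if s: "s + n \<le> d" and z: "\<And>g h i j. g \<in> H \<Longrightarrow> h \<in> H \<Longrightarrow> i < n \<Longrightarrow> j < n \<Longrightarrow>
    (\<Sum>k<d. T g $$ (i + s, k) * T h $$ (k, j + s)) = (\<Sum>k<n. T g $$ (i + s, k + s) * T h $$ (k + s, j + s))" for s n
 proof (rule rpI)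
  let ?b = "\<lambda>h. mat n n (\<lambda>(i, j). T h $$ (i + s, j + s))"
  have bc: "?b h \<in> carrier_mat n n" for h by simp
  then show "?b h \<in> carrier_mat n n" for h .
  show "?b 1 = 1\<^sub>m n" using T1 s by auto
  fix g h assume g: "g \<in> H" and h: "h \<in> H"
  show "?b (g * h) = ?b g * ?b h"
  proof (rule eq_matI)
   fix i j assume "i < dim_row (?b g * ?b h)" "j < dim_col (?b g * ?b h)"
   then have ij: "i < n" "j < n" "i + s < d" "j + s < d" using s by auto
   have "?b (g * h) $$ (i, j) = (T g * T h) $$ (i + s, j + s)" using Tm[OF g h] ij by simp
   also have "\<dots> = (\<Sum>k<n. T g $$ (i + s, k + s) * T h $$ (k + s, j + s))"
    unfolding mat_mult_entry[OF Tc[OF g] Tc[OF h] ij(3,4)] by (rule z[OF g h ij(1,2)])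
   also have "\<dots> = (?b g * ?b h) $$ (i, j)" unfolding mat_mult_entry[OF bc bc ij(1,2)] using ij by simp
   finally show "?b (g * h) $$ (i, j) = (?b g * ?b h) $$ (i, j)" .
  qed auto
 qed
 have "rp H m (\<lambda>h. mat m m (\<lambda>(i, j). T h $$ (i + 0, j + 0)))"
  by (rule blk) (use m Tz in \<open>simp_all add: split\<close>)
 then have "rp H m \<sigma>" by (simp add: \<sigma>_def[abs_def])
 moreover have "rp H (d - m) \<tau>"
  unfolding \<tau>_def by (rule blk) (use m Tz in \<open>simp_all add: split\<close>)
 moreover have "mat_trace (\<rho> h) = mat_trace (\<sigma> h) + mat_trace (\<tau> h) \<and> det (\<rho> h) = det (\<sigma> h) * det (\<tau> h)" if h: "h \<in> H" for h
 proof
  have "mat_trace (T h) = mat_trace (A * (B * \<rho> h))"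
   unfolding T_def by (rule mat_trace_mult_comm[OF mult_carrier_mat[OF B r(1)[OF h]] A])
  also have "A * (B * \<rho> h) = (A * B) * \<rho> h" using assoc_mult_mat[OF A B r(1)[OF h]] by simp
  also have "\<dots> = \<rho> h" unfolding AB using r(1)[OF h] by simp
  finally have t: "mat_trace (\<rho> h) = mat_trace (T h)" by simp
  show "mat_trace (\<rho> h) = mat_trace (\<sigma> h) + mat_trace (\<tau> h)"
   unfolding t using Tc[OF h] m by (simp add: mat_trace_def split \<sigma>_def \<tau>_def)
  have "det (T h) = det B * det (\<rho> h) * det A"
   unfolding T_def using det_mult[OF mult_carrier_mat[OF B r(1)[OF h]] A] det_mult[OF B r(1)[OF h]] by simp
  also have "\<dots> = det (\<rho> h) * det (A * B)" using det_mult[OF A B] by (simp add: mult_ac)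
  finally have e: "det (\<rho> h) = det (T h)" unfolding AB by simp
  have "T h = four_block_mat (\<sigma> h) (mat m (d - m) (\<lambda>(i, j). T h $$ (i, j + m))) (0\<^sub>m (d - m) m) (\<tau> h)"
  proof (rule eq_matI)
   fix i j assume "i < dim_row (four_block_mat (\<sigma> h) (mat m (d - m) (\<lambda>(i, j). T h $$ (i, j + m))) (0\<^sub>m (d - m) m) (\<tau> h))"
    "j < dim_col (four_block_mat (\<sigma> h) (mat m (d - m) (\<lambda>(i, j). T h $$ (i, j + m))) (0\<^sub>m (d - m) m) (\<tau> h))"
   then have ij: "i < d" "j < d" using m by (auto simp: \<sigma>_def \<tau>_def)
   show "T h $$ (i, j) = four_block_mat (\<sigma> h) (mat m (d - m) (\<lambda>(i, j). T h $$ (i, j + m))) (0\<^sub>m (d - m) m) (\<tau> h) $$ (i, j)"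
    using ij m Tz[OF h, of i j] by (auto simp: \<sigma>_def \<tau>_def)
  qed (use Tc[OF h] m in \<open>auto simp: \<sigma>_def \<tau>_def\<close>)
  moreover have "det (four_block_mat (\<sigma> h) (mat m (d - m) (\<lambda>(i, j). T h $$ (i, j + m))) (0\<^sub>m (d - m) m) (\<tau> h))
    = det (\<sigma> h) * det (\<tau> h)"
   by (rule det_four_block_mat_lower_left_zero[of _ m _ "d - m"]) (auto simp: \<sigma>_def \<tau>_def)
  ultimately have "det (T h) = det (\<sigma> h) * det (\<tau> h)" by (simp only:)
  then show "det (\<rho> h) = det (\<sigma> h) * det (\<tau> h)" using e by simp
 qed
 ultimately show ?thesis using m0 md m by (intro exI[of _ m] exI[of _ \<sigma>] exI[of _ \<tau>]) auto
qed

text \<open>Determinants are recorded along with traces because \<open>gcs_degree_dvd\<close>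
  compares the determinants of representations that have equal characters.\<close>

lemma rep_decomp:
 assumes "rp H d \<rho>"
 shows "\<exists>L. (\<forall>(e, \<sigma>)\<in>set L. irp H e \<sigma>) \<and>
  (\<forall>h\<in>H. mat_trace (\<rho> h) = (\<Sum>(e, \<sigma>)\<leftarrow>L. mat_trace (\<sigma> h)) \<and> det (\<rho> h) = (\<Prod>(e, \<sigma>)\<leftarrow>L. det (\<sigma> h)))"
 using assms
proof (induction d arbitrary: \<rho> rule: less_induct)
 case (less d)
 consider "d = 0" | "irp H d \<rho>" | "d > 0" "\<not> irp H d \<rho>" by blast
 then show ?case
 proof cases
  case 1
  have "mat_trace (\<rho> h) = 0 \<and> det (\<rho> h) = 1" if "h \<in> H" for h
   using rpD(1)[OF less.prems that] 1 by (auto simp: mat_trace_def det_dim_zero)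
  then show ?thesis by (intro exI[of _ "[]"]) auto
 next
  case 2
  then show ?thesis by (intro exI[of _ "[(d, \<rho>)]"]) auto
 next
  case 3
  obtain m \<sigma> \<tau> where s: "0 < m" "m < d" "rp H m \<sigma>" "rp H (d - m) \<tau>"
   "\<forall>h\<in>H. mat_trace (\<rho> h) = mat_trace (\<sigma> h) + mat_trace (\<tau> h) \<and> det (\<rho> h) = det (\<sigma> h) * det (\<tau> h)"
   using rep_split[OF less.prems 3] by blast
  have "d - m < d" using s by simp
  obtain L1 where L1: "\<forall>(e, \<sigma>)\<in>set L1. irp H e \<sigma>"
   "\<forall>h\<in>H. mat_trace (\<sigma> h) = (\<Sum>(e, \<sigma>)\<leftarrow>L1. mat_trace (\<sigma> h)) \<and> det (\<sigma> h) = (\<Prod>(e, \<sigma>)\<leftarrow>L1. det (\<sigma> h))"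
   using less.IH[OF s(2,3)] by blast
  obtain L2 where L2: "\<forall>(e, \<sigma>)\<in>set L2. irp H e \<sigma>"
   "\<forall>h\<in>H. mat_trace (\<tau> h) = (\<Sum>(e, \<sigma>)\<leftarrow>L2. mat_trace (\<sigma> h)) \<and> det (\<tau> h) = (\<Prod>(e, \<sigma>)\<leftarrow>L2. det (\<sigma> h))"
   using less.IH[OF \<open>d - m < d\<close> s(4)] by blast
  show ?thesis
   using L1 L2 s(5) by (intro exI[of _ "L1 @ L2"]) auto
 qed
qed

subsection \<open>Irreducible characters\<close>

text \<open>Characters vanish outside \<open>H\<close>, so their equality as functions is equality
  on \<open>H\<close>.\<close>

definition Irr :: "'g::grp set \<Rightarrow> ('g \<Rightarrow> complex) set" where
 "Irr H = {\<chi>. irr_char (mon H) \<chi>}"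

lemma IrrE:
 assumes "\<chi> \<in> Irr H"
 obtains d \<rho> where "irp H d \<rho>" "\<And>g. g \<in> H \<Longrightarrow> \<chi> g = mat_trace (\<rho> g)" "\<And>g. g \<notin> H \<Longrightarrow> \<chi> g = 0" "\<chi> = character (mon H) \<rho>"
 using assms by (auto simp: Irr_def irr_char_def character_def)

lemma IrrI: "irp H d \<rho> \<Longrightarrow> character (mon H) \<rho> \<in> Irr H"
 by (auto simp: Irr_def irr_char_def)

lemma character_mon: "character (mon H) \<rho> g = (if g \<in> H then mat_trace (\<rho> g) else 0)"
 by (simp add: character_def)

lemma Irr_eqI: "\<chi> \<in> Irr H \<Longrightarrow> \<psi> \<in> Irr H \<Longrightarrow> (\<And>h. h \<in> H \<Longrightarrow> \<chi> h = \<psi> h) \<Longrightarrow> \<chi> = \<psi>"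
proof (rule HOL.ext)
 fix h assume a: "\<chi> \<in> Irr H" "\<psi> \<in> Irr H" "\<And>h. h \<in> H \<Longrightarrow> \<chi> h = \<psi> h"
 have "\<chi> h = 0" "\<psi> h = 0" if "h \<notin> H" using that a(1,2) by (auto elim: IrrE)
 then show "\<chi> h = \<psi> h" using a(3) by (cases "h \<in> H") auto
qed

lemma trace_one_rep: "rp H d \<rho> \<Longrightarrow> mat_trace (\<rho> 1) = of_nat d"
 using rpD(2) mat_trace_one by metis

lemma Irr_degree:
 assumes "\<chi> \<in> Irr H" "subgrp H" obtains d where "d > 0" "\<chi> 1 = of_nat d"
 using assms by (elim IrrE) (metis irpD(1,2) subgrp_one trace_one_rep)

lemma trace_class:
 assumes "rp H d \<rho>" "subgrp H" "g \<in> H" "h \<in> H" shows "mat_trace (\<rho> (g * h)) = mat_trace (\<rho> (h * g))"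
 using rpD[OF assms(1)] assms(3,4) mat_trace_mult_comm by metis

lemma Irr_comm:
 assumes "\<chi> \<in> Irr H" "subgrp H" "g \<in> H" "h \<in> H" shows "\<chi> (g * h) = \<chi> (h * g)"
 using assms by (elim IrrE) (metis irpD(1) subgrp_mult trace_class)

lemma Irr_cj:
 assumes "\<chi> \<in> Irr H" "subgrp H" "g \<in> H" "h \<in> H" shows "\<chi> (cj g h) = \<chi> h"
proof -
 have "\<chi> (cj g h) = \<chi> (inverse g * (g * h))"
  unfolding cj_def using Irr_comm[OF assms(1,2), of "g * h" "inverse g"] assms by (simp add: subgrp_closed)
 then show ?thesis by simp
qed

lemma sum_reindex_left:
 assumes "subgrp H" "g \<in> H" shows "(\<Sum>h\<in>H. f (g * h)) = (\<Sum>h\<in>H. f h)"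
proof -
 have "bij_betw ((*) g) H H"
  by (rule bij_betw_byWitness[where f' = "(*) (inverse g)"]) (use assms in \<open>auto simp: subgrp_closed\<close>)
 then show ?thesis by (rule sum.reindex_bij_betw)
qed

lemma sum_reindex_right:
 assumes "subgrp H" "g \<in> H" shows "(\<Sum>h\<in>H. f (h * g)) = (\<Sum>h\<in>H. f h)"
proof -
 have "bij_betw (\<lambda>h. h * g) H H"
  by (rule bij_betw_byWitness[where f' = "\<lambda>h. h * inverse g"]) (use assms in \<open>auto simp: subgrp_closed mult.assoc\<close>)
 then show ?thesis by (rule sum.reindex_bij_betw)
qed

lemma sum_reindex_inverse:
 assumes "subgrp H" shows "(\<Sum>h\<in>H. f (inverse h)) = (\<Sum>h\<in>H. f h)"
proof -
 have "bij_betw inverse H H"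
  by (rule bij_betw_byWitness[where f' = inverse]) (use assms in \<open>auto simp: subgrp_closed\<close>)
 then show ?thesis by (rule sum.reindex_bij_betw)
qed

text \<open>\<open>M\<close> is the sum of \<open>\<rho> h * E * \<tau> (inverse h)\<close> over
  \<open>H\<close> for the matrix unit \<open>E\<close> at position \<open>(j, k)\<close>;
  translating the summation variable by \<open>g\<close> moves \<open>\<rho> g\<close> across
  it.\<close>

lemma coeff_intertwine:
 assumes H: "subgrp H" and \<rho>: "rp H d \<rho>" and \<tau>: "rp H e \<tau>" and jk: "j < d" "k < e" and g: "g \<in> H"
 defines "M \<equiv> mat d e (\<lambda>(i, l). \<Sum>h\<in>H. \<rho> h $$ (i, j) * \<tau> (inverse h) $$ (k, l))"
 shows "\<rho> g * M = M * \<tau> g"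
proof (rule eq_matI)
 note r = rpD[OF \<rho>] and t = rpD[OF \<tau>]
 have M: "M \<in> carrier_mat d e" by (simp add: M_def)
 fix i l assume "i < dim_row (M * \<tau> g)" "l < dim_col (M * \<tau> g)"
 then have il: "i < d" "l < e" using M t(1)[OF g] by auto
 have "(\<rho> g * M) $$ (i, l) = (\<Sum>m<d. \<rho> g $$ (i, m) * (\<Sum>h\<in>H. \<rho> h $$ (m, j) * \<tau> (inverse h) $$ (k, l)))"
  unfolding mat_mult_entry[OF r(1)[OF g] M il] using il by (simp add: M_def)
 also have "\<dots> = (\<Sum>h\<in>H. (\<Sum>m<d. \<rho> g $$ (i, m) * \<rho> h $$ (m, j)) * \<tau> (inverse h) $$ (k, l))"
  by (simp add: sum_distrib_left sum_distrib_right mult.assoc) (rule sum.swap)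
 also have "\<dots> = (\<Sum>h\<in>H. \<rho> (g * h) $$ (i, j) * \<tau> (inverse h) $$ (k, l))"
  by (rule sum.cong[OF refl]) (use mat_mult_entry[OF r(1)[OF g] r(1) il(1) jk(1)] r(3)[OF g] in simp)
 also have "\<dots> = (\<Sum>h\<in>H. \<rho> (g * h) $$ (i, j) * \<tau> (inverse (g * h) * g) $$ (k, l))"
  by (simp add: mult.assoc)
 also have "\<dots> = (\<Sum>h\<in>H. \<rho> h $$ (i, j) * \<tau> (inverse h * g) $$ (k, l))"
  by (rule sum_reindex_left[OF H g, of "\<lambda>h. \<rho> h $$ (i, j) * \<tau> (inverse h * g) $$ (k, l)"])
 also have "\<dots> = (\<Sum>h\<in>H. \<rho> h $$ (i, j) * (\<Sum>m<e. \<tau> (inverse h) $$ (k, m) * \<tau> g $$ (m, l)))"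
  by (rule sum.cong[OF refl])
   (use mat_mult_entry[OF t(1) t(1)[OF g] jk(2) il(2)] t(3)[OF _ g] subgrp_inverse[OF H] in simp)
 also have "\<dots> = (\<Sum>m<e. (\<Sum>h\<in>H. \<rho> h $$ (i, j) * \<tau> (inverse h) $$ (k, m)) * \<tau> g $$ (m, l))"
  by (simp add: sum_distrib_left sum_distrib_right mult.assoc) (rule sum.swap)
 also have "\<dots> = (M * \<tau> g) $$ (i, l)"
  unfolding mat_mult_entry[OF M t(1)[OF g] il] using il by (simp add: M_def)
 finally show "(\<rho> g * M) $$ (i, l) = (M * \<tau> g) $$ (i, l)" .
qed (use rpD(1)[OF \<rho> g] rpD(1)[OF \<tau> g] in \<open>auto simp: M_def\<close>)

text \<open>By Schur's lemma the matrices of \<open>coeff_intertwine\<close> vanish for different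
  characters, since an invertible intertwiner would force equal traces; for equal characters they
  are scalar, and the scalar is found from the trace.\<close>

lemma Irr_orth:
 assumes H: "subgrp H" and "\<chi> \<in> Irr H" "\<psi> \<in> Irr H"
 shows "(\<Sum>h\<in>H. \<chi> h * \<psi> (inverse h)) = (if \<chi> = \<psi> then of_nat (card H) else 0)"
proof -
 obtain d \<rho> where \<rho>: "irp H d \<rho>" "\<And>g. g \<in> H \<Longrightarrow> \<chi> g = mat_trace (\<rho> g)" by (rule IrrE[OF assms(2)]) blast
 obtain e \<tau> where \<tau>: "irp H e \<tau>" "\<And>g. g \<in> H \<Longrightarrow> \<psi> g = mat_trace (\<tau> g)" by (rule IrrE[OF assms(3)]) blast
 note r = rpD[OF irpD(1)[OF \<rho>(1)]] and t = rpD[OF irpD(1)[OF \<tau>(1)]]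
 show ?thesis
 proof (cases "\<chi> = \<psi>")
  case False
  have zero: "(\<Sum>h\<in>H. \<rho> h $$ (i, j) * \<tau> (inverse h) $$ (k, l)) = 0" if ij: "i < d" "j < d" "k < e" "l < e" for i j k l
  proof -
   let ?M = "mat d e (\<lambda>(i, l). \<Sum>h\<in>H. \<rho> h $$ (i, j) * \<tau> (inverse h) $$ (k, l))"
   have M: "?M \<in> carrier_mat d e" by simp
   have comm: "\<rho> g * ?M = ?M * \<tau> g" if "g \<in> H" for g
    using coeff_intertwine[OF H irpD(1)[OF \<rho>(1)] irpD(1)[OF \<tau>(1)] ij(2,3) that] .
   have "?M = 0\<^sub>m d e"
   proof (rule ccontr)
    assume "?M \<noteq> 0\<^sub>m d e"
    then obtain Y where Y: "Y \<in> carrier_mat e d" "?M * Y = 1\<^sub>m d" "Y * ?M = 1\<^sub>m e"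
     using schur_intertwiner[OF \<rho>(1) \<tau>(1) M comm] by blast
    have "\<chi> g = \<psi> g" if g: "g \<in> H" for g
    proof -
     have "\<rho> g = \<rho> g * (?M * Y)" unfolding Y(2) using r(1)[OF g] by simp
     also have "\<dots> = (\<rho> g * ?M) * Y" using assoc_mult_mat[OF r(1)[OF g] M Y(1)] by simp
     also have "\<dots> = ?M * \<tau> g * Y" unfolding comm[OF g] ..
     also have "\<dots> = ?M * (\<tau> g * Y)" by (rule assoc_mult_mat[OF M t(1)[OF g] Y(1)])
     finally have "mat_trace (\<rho> g) = mat_trace (?M * (\<tau> g * Y))" by simp
     also have "\<dots> = mat_trace (\<tau> g * Y * ?M)" by (rule mat_trace_mult_comm[OF M mult_carrier_mat[OF t(1)[OF g] Y(1)]])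
     also have "\<tau> g * Y * ?M = \<tau> g * (Y * ?M)" by (rule assoc_mult_mat[OF t(1)[OF g] Y(1) M])
     also have "\<dots> = \<tau> g" unfolding Y(3) using t(1)[OF g] by simp
     finally show ?thesis using \<rho>(2)[OF g] \<tau>(2)[OF g] by simp
    qed
    then show False using False Irr_eqI[OF assms(2,3)] by blast
   qed
   then have "?M $$ (i, l) = 0\<^sub>m d e $$ (i, l)" by simp
   then show ?thesis using ij by simp
  qed
  have "(\<Sum>h\<in>H. \<chi> h * \<psi> (inverse h)) = (\<Sum>h\<in>H. (\<Sum>i<d. \<rho> h $$ (i, i)) * (\<Sum>k<e. \<tau> (inverse h) $$ (k, k)))"
   by (rule sum.cong[OF refl])
    (simp add: \<rho>(2) \<tau>(2) mat_trace_def subgrp_inverse[OF H] carrier_matD(1)[OF r(1)] carrier_matD(1)[OF t(1)])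
  also have "\<dots> = (\<Sum>h\<in>H. \<Sum>i<d. \<Sum>k<e. \<rho> h $$ (i, i) * \<tau> (inverse h) $$ (k, k))" by (simp add: sum_product)
  also have "\<dots> = (\<Sum>i<d. \<Sum>h\<in>H. \<Sum>k<e. \<rho> h $$ (i, i) * \<tau> (inverse h) $$ (k, k))" by (rule sum.swap)
  also have "\<dots> = (\<Sum>i<d. \<Sum>k<e. \<Sum>h\<in>H. \<rho> h $$ (i, i) * \<tau> (inverse h) $$ (k, k))" by (rule sum.cong[OF refl sum.swap])
  also have "\<dots> = 0" using zero by simp
  finally show ?thesis using False by simp
 next
  case True
  have ent: "(\<Sum>h\<in>H. \<rho> h $$ (i, j) * \<rho> (inverse h) $$ (k, l)) = (if i = l \<and> j = k then of_nat (card H) / of_nat d else 0)"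
   if ij: "i < d" "j < d" "k < d" "l < d" for i j k l
  proof -
   let ?M = "mat d d (\<lambda>(i, l). \<Sum>h\<in>H. \<rho> h $$ (i, j) * \<rho> (inverse h) $$ (k, l))"
   have M: "?M \<in> carrier_mat d d" by simp
   obtain c where c: "?M = c \<cdot>\<^sub>m 1\<^sub>m d"
    using schur_scalar[OF \<rho>(1) M coeff_intertwine[OF H irpD(1)[OF \<rho>(1)] irpD(1)[OF \<rho>(1)] ij(2,3)]] by blast
   have "mat_trace ?M = c * of_nat d" unfolding c using mat_trace_smult[of "1\<^sub>m d" d c] mat_trace_one[of d] by simp
   moreover have "mat_trace ?M = (\<Sum>i<d. \<Sum>h\<in>H. \<rho> (inverse h) $$ (k, i) * \<rho> h $$ (i, j))" by (simp add: mat_trace_def mult.commute)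
   moreover have "\<dots> = (\<Sum>h\<in>H. \<Sum>i<d. \<rho> (inverse h) $$ (k, i) * \<rho> h $$ (i, j))" by (rule sum.swap)
   moreover have "\<dots> = (\<Sum>h\<in>H. (1\<^sub>m d :: complex mat) $$ (k, j))"
   proof (rule sum.cong[OF refl])
    fix h assume h: "h \<in> H"
    have "(\<Sum>i<d. \<rho> (inverse h) $$ (k, i) * \<rho> h $$ (i, j)) = (\<rho> (inverse h) * \<rho> h) $$ (k, j)"
     using mat_mult_entry[OF r(1)[OF subgrp_inverse[OF H h]] r(1)[OF h] ij(3,2)] by simp
    also have "\<rho> (inverse h) * \<rho> h = 1\<^sub>m d" using r(3)[OF subgrp_inverse[OF H h] h] r(2) by simp
    finally show "(\<Sum>i<d. \<rho> (inverse h) $$ (k, i) * \<rho> h $$ (i, j)) = (1\<^sub>m d :: complex mat) $$ (k, j)" .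
   qed
   ultimately have cd: "c * of_nat d = (if j = k then of_nat (card H) else 0)" using ij by auto
   have "?M $$ (i, l) = (c \<cdot>\<^sub>m 1\<^sub>m d) $$ (i, l)" using c by simp
   then have "(\<Sum>h\<in>H. \<rho> h $$ (i, j) * \<rho> (inverse h) $$ (k, l)) = (if i = l then c else 0)" using ij by simp
   then show ?thesis using cd irpD(2)[OF \<rho>(1)] by (auto simp: field_simps)
  qed
  have "(\<Sum>h\<in>H. \<chi> h * \<psi> (inverse h)) = (\<Sum>h\<in>H. (\<Sum>i<d. \<rho> h $$ (i, i)) * (\<Sum>k<d. \<rho> (inverse h) $$ (k, k)))"
   unfolding True[symmetric] by (rule sum.cong[OF refl])
    (simp add: \<rho>(2) mat_trace_def subgrp_inverse[OF H] carrier_matD(1)[OF r(1)])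
  also have "\<dots> = (\<Sum>h\<in>H. \<Sum>i<d. \<Sum>k<d. \<rho> h $$ (i, i) * \<rho> (inverse h) $$ (k, k))" by (simp add: sum_product)
  also have "\<dots> = (\<Sum>i<d. \<Sum>h\<in>H. \<Sum>k<d. \<rho> h $$ (i, i) * \<rho> (inverse h) $$ (k, k))" by (rule sum.swap)
  also have "\<dots> = (\<Sum>i<d. \<Sum>k<d. \<Sum>h\<in>H. \<rho> h $$ (i, i) * \<rho> (inverse h) $$ (k, k))" by (rule sum.cong[OF refl sum.swap])
  also have "\<dots> = (\<Sum>i<d. \<Sum>k<d. if i = k then of_nat (card H) / of_nat d else 0)"
   using ent by (intro sum.cong refl) auto
  also have "\<dots> = of_nat (card H)" using irpD(2)[OF \<rho>(1)] by simp
  finally show ?thesis using True by simp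
 qed
qed

text \<open>On characters \<open>g (inverse h)\<close> is the complex conjugate of
  \<open>g h\<close>, so this is the usual inner product; in this algebraic form it is linear in
  both arguments.\<close>

definition ip :: "'g::grp set \<Rightarrow> ('g \<Rightarrow> complex) \<Rightarrow> ('g \<Rightarrow> complex) \<Rightarrow> complex" where
 "ip H f g = (\<Sum>h\<in>H. f h * g (inverse h)) / of_nat (card H)"

lemma ip_Irr: "subgrp H \<Longrightarrow> \<chi> \<in> Irr H \<Longrightarrow> \<psi> \<in> Irr H \<Longrightarrow> ip H \<chi> \<psi> = (if \<chi> = \<psi> then 1 else 0)"
 unfolding ip_def by (simp add: Irr_orth)

lemma rep_char_list:
 assumes "rp H d \<rho>"
 shows "\<exists>cs. set cs \<subseteq> Irr H \<and> (\<forall>h\<in>H. mat_trace (\<rho> h) = (\<Sum>c\<leftarrow>cs. c h))"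
proof -
 obtain L where L: "\<forall>(e, \<sigma>)\<in>set L. irp H e \<sigma>" "\<forall>h\<in>H. mat_trace (\<rho> h) = (\<Sum>(e, \<sigma>)\<leftarrow>L. mat_trace (\<sigma> h))"
  using rep_decomp[OF assms] by blast
 let ?cs = "map (\<lambda>(e, \<sigma>). character (mon H) \<sigma>) L"
 have "set ?cs \<subseteq> Irr H" using L(1) IrrI by fastforce
 moreover have "mat_trace (\<rho> h) = (\<Sum>c\<leftarrow>?cs. c h)" if "h \<in> H" for h
 proof -
  have "map (\<lambda>c. c h) ?cs = map (\<lambda>(e, \<sigma>). mat_trace (\<sigma> h)) L" using that by (auto simp: character_mon)
  then show ?thesis using L(2) that by metis
 qed
 ultimately show ?thesis by blast
qed

lemma ip_list:
 assumes H: "subgrp H" and cs: "set cs \<subseteq> Irr H" and f: "\<And>h. h \<in> H \<Longrightarrow> f h = (\<Sum>c\<leftarrow>cs. c h)" and \<chi>: "\<chi> \<in> Irr H"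
 shows "ip H f \<chi> = of_nat (count_list cs \<chi>)"
proof -
 have "(\<Sum>h\<in>H. (\<Sum>c\<leftarrow>cs. c h) * \<chi> (inverse h)) = of_nat (card H) * of_nat (count_list cs \<chi>)"
  using cs
 proof (induction cs)
  case (Cons c cs)
  have "(\<Sum>h\<in>H. (\<Sum>c\<leftarrow>c # cs. c h) * \<chi> (inverse h)) = (\<Sum>h\<in>H. c h * \<chi> (inverse h)) + (\<Sum>h\<in>H. (\<Sum>c\<leftarrow>cs. c h) * \<chi> (inverse h))"
   by (simp add: sum.distrib distrib_right)
  also have "\<dots> = (if c = \<chi> then of_nat (card H) else 0) + of_nat (card H) * of_nat (count_list cs \<chi>)"
   using Cons Irr_orth[OF H _ \<chi>] by simp
  finally show ?case by (simp add: algebra_simps)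
 qed simp
 moreover have "(\<Sum>h\<in>H. f h * \<chi> (inverse h)) = (\<Sum>h\<in>H. (\<Sum>c\<leftarrow>cs. c h) * \<chi> (inverse h))" using f by simp
 ultimately show ?thesis unfolding ip_def using H by simp
qed

lemma regular_rep:
 assumes H: "subgrp H"
 shows "\<exists>\<rho>. rp H (card H) \<rho> \<and> (\<forall>h\<in>H. mat_trace (\<rho> h) = (if h = 1 then of_nat (card H) else 0))"
proof -
 let ?n = "card H"
 obtain e where e: "bij_betw e {..<?n} H" using H by (metis ex_bij_betw_nat_finite subgrp_finite atLeast0LessThan)
 have eH: "e i \<in> H" if "i < ?n" for i using e that by (auto simp: bij_betw_def)
 have einj: "e i = e j \<longleftrightarrow> i = j" if "i < ?n" "j < ?n" for i j using e that by (auto simp: bij_betw_def inj_on_def)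
 define \<rho> :: "'a \<Rightarrow> complex mat" where "\<rho> h = mat ?n ?n (\<lambda>(i, j). if e i = h * e j then 1 else 0)" for h
 have c: "\<rho> h \<in> carrier_mat ?n ?n" for h by (simp add: \<rho>_def)
 have "rp H ?n \<rho>"
  unfolding is_rep_def
 proof (intro conjI ballI)
  show "\<rho> \<one>\<^bsub>mon H\<^esub> = 1\<^sub>m ?n" using einj by (auto simp: \<rho>_def)
  fix g h assume "g \<in> carrier (mon H)" "h \<in> carrier (mon H)"
  then have gh: "g \<in> H" "h \<in> H" by auto
  have "\<rho> (g * h) = \<rho> g * \<rho> h"
  proof (rule eq_matI)
   fix i j assume "i < dim_row (\<rho> g * \<rho> h)" "j < dim_col (\<rho> g * \<rho> h)"
   then have ij: "i < ?n" "j < ?n" by (auto simp: \<rho>_def)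
   have "h * e j \<in> H" using gh eH[OF ij(2)] H by (simp add: subgrp_mult)
   then have "h * e j \<in> e ` {..<?n}" using e by (simp add: bij_betw_def)
   then obtain k0 where k0: "k0 < ?n" "e k0 = h * e j" by (metis imageE lessThan_iff)
   have "(\<rho> g * \<rho> h) $$ (i, j) = (\<Sum>k<?n. \<rho> g $$ (i, k) * \<rho> h $$ (k, j))" by (rule mat_mult_entry[OF c c ij])
   also have "\<dots> = (\<Sum>k<?n. if k = k0 then (if e i = g * (h * e j) then 1 else 0) else 0)"
   proof (rule sum.cong[OF refl])
    fix k assume "k \<in> {..<?n}"
    then have k: "k < ?n" by simp
    have "e k = h * e j \<longleftrightarrow> k = k0" using einj[OF k k0(1)] k0(2) by simp
    then show "\<rho> g $$ (i, k) * \<rho> h $$ (k, j) = (if k = k0 then (if e i = g * (h * e j) then 1 else 0) else 0)"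
     using ij k by (cases "k = k0") (simp_all add: \<rho>_def)
   qed
   also have "\<dots> = \<rho> (g * h) $$ (i, j)" using k0 ij by (simp add: \<rho>_def mult.assoc)
   finally show "\<rho> (g * h) $$ (i, j) = (\<rho> g * \<rho> h) $$ (i, j)" by simp
  qed (auto simp: \<rho>_def)
  then show "\<rho> (g \<otimes>\<^bsub>mon H\<^esub> h) = \<rho> g * \<rho> h" by simp
 qed (simp add: c)
 moreover have "mat_trace (\<rho> h) = (if h = 1 then of_nat ?n else 0)" for h
 proof -
  have "e i = h * e i \<longleftrightarrow> h = 1" for i by (metis grp_mult_eq_right)
  then show ?thesis by (simp add: mat_trace_def \<rho>_def)
 qed
 ultimately show ?thesis by blast
qed

lemma sum_list_count:
 fixes f :: "'a \<Rightarrow> complex"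
 assumes "finite S" "set xs \<subseteq> S"
 shows "(\<Sum>x\<leftarrow>xs. f x) = (\<Sum>x\<in>S. of_nat (count_list xs x) * f x)"
 using assms(2)
proof (induction xs)
 case (Cons c xs)
 have "(\<Sum>x\<in>S. of_nat (count_list (c # xs) x) * f x) = (\<Sum>x\<in>S. (if x = c then f x else 0) + of_nat (count_list xs x) * f x)"
  by (rule sum.cong) (auto simp: algebra_simps)
 also have "\<dots> = f c + (\<Sum>x\<in>S. of_nat (count_list xs x) * f x)" using Cons.prems assms(1) by (simp add: sum.distrib)
 finally show ?case using Cons by simp
qed simp

text \<open>The multiplicity of \<open>\<chi>\<close> in the regular representation is its degree,
  hence positive, so the finite list of constituents contains every irreducible character.\<close>

lemma Irr_regular:
 assumes H: "subgrp H"
 shows "finite (Irr H)" "h \<in> H \<Longrightarrow> (\<Sum>\<chi>\<in>Irr H. \<chi> 1 * \<chi> h) = (if h = 1 then of_nat (card H) else 0)"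
proof -
 obtain \<rho> where \<rho>: "rp H (card H) \<rho>" "\<forall>h\<in>H. mat_trace (\<rho> h) = (if h = 1 then of_nat (card H) else 0)"
  using regular_rep[OF H] by blast
 obtain cs where cs: "set cs \<subseteq> Irr H" "\<forall>h\<in>H. mat_trace (\<rho> h) = (\<Sum>c\<leftarrow>cs. c h)" using rep_char_list[OF \<rho>(1)] by blast
 have cnt: "of_nat (count_list cs \<chi>) = \<chi> 1" if \<chi>: "\<chi> \<in> Irr H" for \<chi>
 proof -
  have "ip H (\<lambda>h. mat_trace (\<rho> h)) \<chi> = of_nat (count_list cs \<chi>)" by (rule ip_list[OF H cs(1) _ \<chi>]) (use cs(2) in blast)
  moreover have "(\<Sum>h\<in>H. mat_trace (\<rho> h) * \<chi> (inverse h)) = (\<Sum>h\<in>H. if h = 1 then of_nat (card H) * \<chi> 1 else 0)"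
   by (rule sum.cong) (use \<rho>(2) in auto)
  ultimately show ?thesis using H by (simp add: ip_def)
 qed
 have eq: "Irr H = set cs"
 proof
  show "Irr H \<subseteq> set cs"
  proof
   fix \<chi> assume \<chi>: "\<chi> \<in> Irr H"
   then have "\<chi> 1 \<noteq> 0" using Irr_degree[OF \<chi> H] by (metis of_nat_eq_0_iff not_gr_zero)
   then have "count_list cs \<chi> \<noteq> 0" using cnt[OF \<chi>] by (metis of_nat_0)
   then show "\<chi> \<in> set cs" by (simp add: count_list_0_iff)
  qed
 qed (rule cs(1))
 then show "finite (Irr H)" by simp
 show "(\<Sum>\<chi>\<in>Irr H. \<chi> 1 * \<chi> h) = (if h = 1 then of_nat (card H) else 0)" if h: "h \<in> H"
 proof -
  have "(\<Sum>\<chi>\<in>Irr H. \<chi> 1 * \<chi> h) = (\<Sum>\<chi>\<in>set cs. of_nat (count_list cs \<chi>) * \<chi> h)"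
   unfolding eq by (rule sum.cong) (use cnt cs(1) in auto)
  also have "\<dots> = (\<Sum>c\<leftarrow>cs. c h)"
   by (rule sum_list_count[OF finite_set order_refl, symmetric])
  finally show ?thesis using cs(2) \<rho>(2) h by simp
 qed
qed

lemma char_decomp:
 assumes H: "subgrp H" and \<rho>: "rp H d \<rho>" and f: "\<And>h. h \<in> H \<Longrightarrow> f h = mat_trace (\<rho> h)"
 shows "\<exists>n. (\<forall>h\<in>H. f h = (\<Sum>\<chi>\<in>Irr H. of_nat (n \<chi>) * \<chi> h)) \<and> (\<forall>\<chi>\<in>Irr H. ip H f \<chi> = of_nat (n \<chi> :: nat))"
proof -
 obtain cs where cs: "set cs \<subseteq> Irr H" "\<forall>h\<in>H. mat_trace (\<rho> h) = (\<Sum>c\<leftarrow>cs. c h)" using rep_char_list[OF \<rho>] by blast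
 have fin: "finite (Irr H)" using Irr_regular(1)[OF H] .
 have fcs: "f h = (\<Sum>c\<leftarrow>cs. c h)" if "h \<in> H" for h using f cs(2) that by simp
 have "(\<Sum>c\<leftarrow>cs. c h) = (\<Sum>\<chi>\<in>Irr H. of_nat (count_list cs \<chi>) * \<chi> h)" for h
  by (rule sum_list_count[OF fin cs(1)])
 then show ?thesis using fcs ip_list[OF H cs(1) fcs] by (intro exI[of _ "count_list cs"]) auto
qed

text \<open>For a class function \<open>f\<close> the sum of the matrices
  \<open>f h \<cdot>\<^sub>m \<rho> h\<close> commutes with the representation, so it is a scalar
  \<open>c\<close>. The three conclusions read this off from its trace, from the entries after
  multiplication by \<open>\<rho> y\<close>, and from the trace of that product.\<close>

lemma class_sum:
 assumes H: "subgrp H" and \<rho>: "irp H d \<rho>" and f: "\<And>g h. g \<in> H \<Longrightarrow> h \<in> H \<Longrightarrow> f (cj g h) = f h"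
 shows "\<exists>c. c * of_nat d = (\<Sum>h\<in>H. f h * mat_trace (\<rho> h)) \<and>
  (\<forall>y\<in>H. \<forall>i<d. \<forall>j<d. (\<Sum>h\<in>H. f h * \<rho> (h * y) $$ (i, j)) = c * \<rho> y $$ (i, j)) \<and>
  (\<forall>y\<in>H. (\<Sum>h\<in>H. f h * mat_trace (\<rho> (h * y))) = c * mat_trace (\<rho> y))"
proof -
 note r = rpD[OF irpD(1)[OF \<rho>]]
 define M where "M = mat d d (\<lambda>(i, j). \<Sum>h\<in>H. f h * \<rho> h $$ (i, j))"
 have M: "M \<in> carrier_mat d d" by (simp add: M_def)
 have right: "(M * \<rho> y) $$ (i, j) = (\<Sum>h\<in>H. f h * \<rho> (h * y) $$ (i, j))" if y: "y \<in> H" and ij: "i < d" "j < d" for y i j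
 proof -
  have "(M * \<rho> y) $$ (i, j) = (\<Sum>k<d. (\<Sum>h\<in>H. f h * \<rho> h $$ (i, k)) * \<rho> y $$ (k, j))"
   unfolding mat_mult_entry[OF M r(1)[OF y] ij] using ij by (simp add: M_def)
  also have "\<dots> = (\<Sum>h\<in>H. \<Sum>k<d. f h * (\<rho> h $$ (i, k) * \<rho> y $$ (k, j)))"
   by (simp add: sum_distrib_right mult.assoc) (rule sum.swap)
  also have "\<dots> = (\<Sum>h\<in>H. f h * \<rho> (h * y) $$ (i, j))"
   by (rule sum.cong[OF refl])
    (simp only: r(3)[OF _ y] mat_mult_entry[OF r(1) r(1)[OF y] ij] sum_distrib_left)
  finally show ?thesis .
 qed
 have left: "(\<rho> y * M) $$ (i, j) = (\<Sum>h\<in>H. f h * \<rho> (y * h) $$ (i, j))" if y: "y \<in> H" and ij: "i < d" "j < d" for y i j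
 proof -
  have "(\<rho> y * M) $$ (i, j) = (\<Sum>k<d. \<rho> y $$ (i, k) * (\<Sum>h\<in>H. f h * \<rho> h $$ (k, j)))"
   unfolding mat_mult_entry[OF r(1)[OF y] M ij] using ij by (simp add: M_def)
  also have "\<dots> = (\<Sum>h\<in>H. \<Sum>k<d. f h * (\<rho> y $$ (i, k) * \<rho> h $$ (k, j)))"
   by (simp add: sum_distrib_left mult.left_commute) (rule sum.swap)
  also have "\<dots> = (\<Sum>h\<in>H. f h * \<rho> (y * h) $$ (i, j))"
   by (rule sum.cong[OF refl])
    (simp only: r(3)[OF y] mat_mult_entry[OF r(1)[OF y] r(1) ij] sum_distrib_left)
  finally show ?thesis .
 qed
 have "\<rho> y * M = M * \<rho> y" if y: "y \<in> H" for y
 proof (rule eq_matI)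
  fix i j assume "i < dim_row (M * \<rho> y)" "j < dim_col (M * \<rho> y)"
  then have ij: "i < d" "j < d" using M r(1)[OF y] by auto
  have "bij_betw (cj y) H H"
   by (rule bij_betw_byWitness[where f' = "cj (inverse y)"])
    (use y H in \<open>auto simp: subgrp_cj subgrp_inverse\<close>)
  from sum.reindex_bij_betw[OF this, of "\<lambda>h. f h * \<rho> (h * y) $$ (i, j)"]
  have "(\<Sum>h\<in>H. f h * \<rho> (h * y) $$ (i, j)) = (\<Sum>h\<in>H. f (cj y h) * \<rho> (cj y h * y) $$ (i, j))" by simp
  also have "\<dots> = (\<Sum>h\<in>H. f h * \<rho> (y * h) $$ (i, j))"
   by (rule sum.cong[OF refl]) (use f[OF y] in \<open>simp add: cj_def mult.assoc\<close>)
  finally show "(\<rho> y * M) $$ (i, j) = (M * \<rho> y) $$ (i, j)" using left[OF y ij] right[OF y ij] by simp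
 qed (use M r(1)[OF y] in auto)
 then obtain c where c: "M = c \<cdot>\<^sub>m 1\<^sub>m d" using schur_scalar[OF \<rho> M] by blast
 have "c * of_nat d = mat_trace M" unfolding c using mat_trace_smult[of "1\<^sub>m d" d c] mat_trace_one[of d] by simp
 also have "\<dots> = (\<Sum>i<d. \<Sum>h\<in>H. f h * \<rho> h $$ (i, i))" by (simp add: mat_trace_def M_def)
 also have "\<dots> = (\<Sum>h\<in>H. \<Sum>i<d. f h * \<rho> h $$ (i, i))" by (rule sum.swap)
 also have "\<dots> = (\<Sum>h\<in>H. f h * mat_trace (\<rho> h))"
  by (rule sum.cong[OF refl]) (simp add: mat_trace_def sum_distrib_left carrier_matD(1)[OF r(1)])
 finally have "c * of_nat d = (\<Sum>h\<in>H. f h * mat_trace (\<rho> h))" .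
 moreover have ent: "(\<Sum>h\<in>H. f h * \<rho> (h * y) $$ (i, j)) = c * \<rho> y $$ (i, j)" if y: "y \<in> H" and ij: "i < d" "j < d" for y i j
 proof -
  have "M * \<rho> y = c \<cdot>\<^sub>m \<rho> y" unfolding c using mult_smult_assoc_mat[OF one_carrier_mat r(1)[OF y]] r(1)[OF y] by simp
  then have "(M * \<rho> y) $$ (i, j) = c * \<rho> y $$ (i, j)" using r(1)[OF y] ij by simp
  then show ?thesis using right[OF y ij] by simp
 qed
 moreover have "(\<Sum>h\<in>H. f h * mat_trace (\<rho> (h * y))) = c * mat_trace (\<rho> y)" if y: "y \<in> H" for y
 proof -
  have "(\<Sum>h\<in>H. f h * mat_trace (\<rho> (h * y))) = (\<Sum>h\<in>H. \<Sum>i<d. f h * \<rho> (h * y) $$ (i, i))"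
   by (rule sum.cong[OF refl])
    (simp add: mat_trace_def sum_distrib_left carrier_matD(1)[OF r(1)[OF subgrp_mult[OF H _ y]]])
  also have "\<dots> = (\<Sum>i<d. \<Sum>h\<in>H. f h * \<rho> (h * y) $$ (i, i))" by (rule sum.swap)
  also have "\<dots> = (\<Sum>i<d. c * \<rho> y $$ (i, i))" by (rule sum.cong[OF refl]) (use ent[OF y] in simp)
  finally show ?thesis using r(1)[OF y] by (simp add: mat_trace_def sum_distrib_left)
 qed
 ultimately show ?thesis by blast
qed

text \<open>An instance of \<open>class_sum\<close>, with \<open>f h\<close> counting the elements
  that conjugate \<open>x\<close> to \<open>h\<close>: the sum of \<open>\<rho>\<close> over the
  conjugates of \<open>x\<close>, taken with multiplicity, is a scalar matrix.\<close>

lemma scalar_class_sum: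
 assumes H: "subgrp H" and \<rho>: "irp H d \<rho>" and x: "x \<in> H" "y \<in> H"
 shows "(\<Sum>g\<in>H. mat_trace (\<rho> (cj g x * y))) * of_nat d = of_nat (card H) * mat_trace (\<rho> x) * mat_trace (\<rho> y)"
proof -
 let ?f = "\<lambda>h. of_nat (card {g\<in>H. cj g x = h}) :: complex"
 have cl: "?f (cj k h) = ?f h" if k: "k \<in> H" "h \<in> H" for k h
 proof -
  have "bij_betw ((*) k) {g\<in>H. cj g x = h} {g\<in>H. cj g x = cj k h}"
   by (rule bij_betw_byWitness[where f' = "(*) (inverse k)"]) (use k H in \<open>auto simp: cj_comp subgrp_closed\<close>)
  then show ?thesis by (simp add: bij_betw_same_card)
 qed
 have push: "(\<Sum>h\<in>H. ?f h * F h) = (\<Sum>g\<in>H. F (cj g x))" for F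
 proof -
  have "(\<Sum>g\<in>H. F (cj g x)) = (\<Sum>g\<in>H. \<Sum>h\<in>H. if cj g x = h then F h else 0)"
   using subgrp_cj[OF H _ x(1)] H by simp
  also have "\<dots> = (\<Sum>h\<in>H. \<Sum>g\<in>H. if cj g x = h then F h else 0)" by (rule sum.swap)
  also have "\<dots> = (\<Sum>h\<in>H. ?f h * F h)" using H by (simp add: sum.If_cases Int_def)
  finally show ?thesis by simp
 qed
 obtain c where c: "c * of_nat d = (\<Sum>h\<in>H. ?f h * mat_trace (\<rho> h))"
  "\<forall>y\<in>H. (\<Sum>h\<in>H. ?f h * mat_trace (\<rho> (h * y))) = c * mat_trace (\<rho> y)"
  using class_sum[OF H \<rho>, of ?f] cl by blast
 have "mat_trace (\<rho> (cj g x)) = mat_trace (\<rho> x)" if "g \<in> H" for g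
  using Irr_cj[OF IrrI[OF \<rho>] H that x(1)] subgrp_cj[OF H that x(1)] x(1) by (simp add: character_mon)
 then have "c * of_nat d = of_nat (card H) * mat_trace (\<rho> x)" unfolding c(1) push by simp
 moreover have "(\<Sum>g\<in>H. mat_trace (\<rho> (cj g x * y))) = c * mat_trace (\<rho> y)"
  using bspec[OF c(2) x(2)] unfolding push .
 ultimately show ?thesis by (simp add: mult_ac)
qed

text \<open>By \<open>scalar_class_sum\<close> the product of two values becomes a sum of
  \<open>\<chi> 1 * \<chi> (cj g x * inverse y)\<close> over \<open>g\<close>; summing over
  \<open>\<chi>\<close> first, the regular character picks out those \<open>g\<close> with
  \<open>cj g x = y\<close>.\<close>

lemma Irr_second_orth:
 assumes H: "subgrp H" and x: "x \<in> H" "y \<in> H"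
 shows "(\<Sum>\<chi>\<in>Irr H. \<chi> x * \<chi> (inverse y)) = of_nat (card {g\<in>H. cj g x = y})"
proof -
 have iy: "inverse y \<in> H" using x H by (simp add: subgrp_inverse)
 have "of_nat (card H) * (\<chi> x * \<chi> (inverse y)) = (\<Sum>g\<in>H. \<chi> 1 * \<chi> (cj g x * inverse y))" if \<chi>: "\<chi> \<in> Irr H" for \<chi>
 proof -
  obtain d \<rho> where \<rho>: "irp H d \<rho>" "\<And>g. g \<in> H \<Longrightarrow> \<chi> g = mat_trace (\<rho> g)" by (rule IrrE[OF \<chi>]) blast
  have "(\<Sum>g\<in>H. \<chi> 1 * \<chi> (cj g x * inverse y)) = (\<Sum>g\<in>H. mat_trace (\<rho> (cj g x * inverse y))) * of_nat d"
   using \<rho>(2) trace_one_rep[OF irpD(1)[OF \<rho>(1)]] subgrp_cj[OF H _ x(1)] iy H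
   by (simp add: subgrp_closed sum_distrib_left mult.commute)
  then show ?thesis using scalar_class_sum[OF H \<rho>(1) x(1) iy] \<rho>(2) x iy by (simp add: mult.assoc)
 qed
 then have "of_nat (card H) * (\<Sum>\<chi>\<in>Irr H. \<chi> x * \<chi> (inverse y)) = (\<Sum>\<chi>\<in>Irr H. \<Sum>g\<in>H. \<chi> 1 * \<chi> (cj g x * inverse y))"
  by (simp add: sum_distrib_left)
 also have "\<dots> = (\<Sum>g\<in>H. \<Sum>\<chi>\<in>Irr H. \<chi> 1 * \<chi> (cj g x * inverse y))" by (rule sum.swap)
 also have "\<dots> = (\<Sum>g\<in>H. if cj g x = y then of_nat (card H) else 0)"
 proof (rule sum.cong[OF refl])
  fix g assume g: "g \<in> H"
  have "cj g x * inverse y \<in> H" using subgrp_cj[OF H g x(1)] iy H by (simp add: subgrp_mult)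
  moreover have "cj g x * inverse y = 1 \<longleftrightarrow> cj g x = y" by (metis grp_inverse_inverse grp_inverse_unique grp_right_inverse)
  ultimately show "(\<Sum>\<chi>\<in>Irr H. \<chi> 1 * \<chi> (cj g x * inverse y)) = (if cj g x = y then of_nat (card H) else 0)"
   using Irr_regular(2)[OF H] by simp
 qed
 also have "\<dots> = of_nat (card H) * of_nat (card {g\<in>H. cj g x = y})"
  using H by (simp add: sum.If_cases Int_def)
 finally show ?thesis using H by simp
qed

subsection \<open>Constructions with representations\<close>

lemma rp_subset: "rp H d \<rho> \<Longrightarrow> K \<subseteq> H \<Longrightarrow> rp K d \<rho>"
 by (auto simp: is_rep_def)

lemma irp_if_restrict:
 assumes "rp H d \<rho>" "irp K d \<rho>" "K \<subseteq> H" shows "irp H d \<rho>"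
 by (rule irpI[OF assms(1) irpD(2)[OF assms(2)]]) (use irpD(3)[OF assms(2)] assms(3) in blast)

text \<open>Stated for arbitrary carriers so that it serves conjugation of characters as well as the
  passage between the given group and its Cayley image.\<close>

lemma irr_pullback:
 assumes \<rho>: "is_irred_rep B d \<rho>" and f: "f ` carrier A = carrier B" "f \<one>\<^bsub>A\<^esub> = \<one>\<^bsub>B\<^esub>"
  and hom: "\<And>x y. x \<in> carrier A \<Longrightarrow> y \<in> carrier A \<Longrightarrow> f (x \<otimes>\<^bsub>A\<^esub> y) = f x \<otimes>\<^bsub>B\<^esub> f y"
 shows "is_irred_rep A d (\<lambda>x. \<rho> (f x))"
proof -
 have "is_invariant_subspace A d (\<lambda>x. \<rho> (f x)) W \<longleftrightarrow> is_invariant_subspace B d \<rho> W" for W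
  by (simp add: is_invariant_subspace_def flip: f(1))
 moreover have "is_rep A d (\<lambda>x. \<rho> (f x))"
 proof -
  have fc: "f x \<in> carrier B" if "x \<in> carrier A" for x using f(1) that by blast
  show ?thesis using \<rho> unfolding is_irred_rep_def is_rep_def by (simp add: fc f(2) hom)
 qed
 ultimately show ?thesis using \<rho> by (simp add: is_irred_rep_def)
qed

lemma smult_mat_vec:
 fixes A :: "complex mat"
 assumes "A \<in> carrier_mat d e" "v \<in> carrier_vec e" shows "(c \<cdot>\<^sub>m A) *\<^sub>v v = c \<cdot>\<^sub>v (A *\<^sub>v v)"
 using assms by (auto intro!: eq_vecI simp: scalar_prod_def sum_distrib_left mult.assoc)

lemma smult_smult_mat: "a \<cdot>\<^sub>m (b \<cdot>\<^sub>m A) = (a * b) \<cdot>\<^sub>m (A :: complex mat)"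
 by (auto intro!: eq_matI)

lemma smult_mult_smult:
 fixes A B :: "complex mat"
 assumes "A \<in> carrier_mat d d" "B \<in> carrier_mat d d"
 shows "(a \<cdot>\<^sub>m A) * (b \<cdot>\<^sub>m B) = (a * b) \<cdot>\<^sub>m (A * B)"
proof -
 have "(a \<cdot>\<^sub>m A) * (b \<cdot>\<^sub>m B) = b \<cdot>\<^sub>m ((a \<cdot>\<^sub>m A) * B)"
  by (rule mult_smult_distrib[OF _ assms(2), of _ d]) (use assms in simp)
 also have "(a \<cdot>\<^sub>m A) * B = a \<cdot>\<^sub>m (A * B)" by (rule mult_smult_assoc_mat[OF assms])
 finally show ?thesis by (simp add: smult_smult_mat mult.commute)
qed

lemma twist_rp:
 assumes "rp H d \<rho>" "lin H \<mu>" shows "rp H d (\<lambda>h. \<mu> h \<cdot>\<^sub>m \<rho> h)"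
proof (rule rpI)
 note r = rpD[OF assms(1)]
 show "\<mu> 1 \<cdot>\<^sub>m \<rho> 1 = 1\<^sub>m d" using lin_one[OF assms(2)] r(2) by auto
 show "\<mu> (g * h) \<cdot>\<^sub>m \<rho> (g * h) = (\<mu> g \<cdot>\<^sub>m \<rho> g) * (\<mu> h \<cdot>\<^sub>m \<rho> h)" if "g \<in> H" "h \<in> H" for g h
  unfolding smult_mult_smult[OF r(1)[OF that(1)] r(1)[OF that(2)]] lin_mult[OF assms(2) that] r(3)[OF that] ..
qed (use rpD(1)[OF assms(1)] in simp)

lemma twist_irp:
 assumes \<rho>: "irp H d \<rho>" and \<mu>: "lin H \<mu>" and H: "subgrp H" shows "irp H d (\<lambda>h. \<mu> h \<cdot>\<^sub>m \<rho> h)"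
proof (rule irpI[OF twist_rp[OF irpD(1)[OF \<rho>] \<mu>] irpD(2)[OF \<rho>]])
 fix W assume W: "subsp d W" and inv: "\<And>g w. g \<in> H \<Longrightarrow> w \<in> W \<Longrightarrow> (\<mu> g \<cdot>\<^sub>m \<rho> g) *\<^sub>v w \<in> W"
 have "\<rho> g *\<^sub>v w \<in> W" if g: "g \<in> H" and w: "w \<in> W" for g w
 proof -
  have wc: "w \<in> carrier_vec d" using W w by (auto simp: subsp_def)
  have c: "\<rho> g \<in> carrier_mat d d" using rpD(1)[OF irpD(1)[OF \<rho>] g] .
  have "(1 / \<mu> g) \<cdot>\<^sub>v ((\<mu> g \<cdot>\<^sub>m \<rho> g) *\<^sub>v w) \<in> W" using W inv[OF g w] by (simp add: subsp_def)
  also have "(1 / \<mu> g) \<cdot>\<^sub>v ((\<mu> g \<cdot>\<^sub>m \<rho> g) *\<^sub>v w) = \<rho> g *\<^sub>v w"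
   unfolding smult_mat_vec[OF c wc] using lin_nz[OF \<mu> H g] by (simp add: smult_smult_assoc)
  finally show ?thesis .
 qed
 from irpD(3)[OF \<rho> W this] show "W = {0\<^sub>v d} \<or> W = carrier_vec d" by blast
qed

lemma Irr_twist:
 assumes "\<chi> \<in> Irr H" "lin H \<mu>" "subgrp H" shows "(\<lambda>h. \<mu> h * \<chi> h) \<in> Irr H"
proof -
 obtain d \<rho> where \<rho>: "irp H d \<rho>" "\<chi> = character (mon H) \<rho>" by (rule IrrE[OF assms(1)]) blast
 have "(\<lambda>h. \<mu> h * \<chi> h) = character (mon H) (\<lambda>h. \<mu> h \<cdot>\<^sub>m \<rho> h)"
  using mat_trace_smult[OF rpD(1)[OF irpD(1)[OF \<rho>(1)]]] unfolding \<rho>(2) by (auto simp: character_mon)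
 then show ?thesis using IrrI[OF twist_irp[OF \<rho>(1) assms(2,3)]] by simp
qed

lemma irp_dim1:
 assumes "rp H 1 \<rho>" shows "irp H 1 \<rho>"
proof (rule irpI[OF assms])
 fix W :: "complex vec set" assume W: "subsp 1 W"
 show "W = {0\<^sub>v 1} \<or> W = carrier_vec 1"
 proof (cases "W = {0\<^sub>v 1}")
  case False
  then obtain w where w: "w \<in> W" "w \<noteq> 0\<^sub>v 1" "w \<in> carrier_vec 1" using W unfolding subsp_def by blast
  have w0: "w $ 0 \<noteq> 0"
  proof
   assume "w $ 0 = 0"
   then have "w = 0\<^sub>v 1" using w(3) by (intro eq_vecI) auto
   then show False using w(2) by simp
  qed
  have "v \<in> W" if v: "v \<in> carrier_vec 1" for v
  proof -
   have "v = (v $ 0 / w $ 0) \<cdot>\<^sub>v w" using v w(3) w0 by (intro eq_vecI) auto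
   moreover have "(v $ 0 / w $ 0) \<cdot>\<^sub>v w \<in> W" using W w(1) by (simp add: subsp_def)
   ultimately show ?thesis by metis
  qed
  then show ?thesis using W by (auto simp: subsp_def)
 qed simp
qed simp

lemma lin_Irr:
 assumes "lin H \<mu>" "subgrp H" shows "(\<lambda>h. if h \<in> H then \<mu> h else 0) \<in> Irr H"
proof -
 have "rp H 1 (\<lambda>h. 1\<^sub>m 1)" by (rule rpI) auto
 then have "irp H 1 (\<lambda>h. 1\<^sub>m 1)" by (rule irp_dim1)
 from IrrI[OF this] have "character (mon H) (\<lambda>h. 1\<^sub>m 1) \<in> Irr H" .
 from Irr_twist[OF this assms] have "(\<lambda>h. \<mu> h * character (mon H) (\<lambda>h. 1\<^sub>m 1) h) \<in> Irr H" .
 moreover have "(\<lambda>h. \<mu> h * character (mon H) (\<lambda>h. 1\<^sub>m 1) h) = (\<lambda>h. if h \<in> H then \<mu> h else 0)"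
  by (auto simp: character_mon mat_trace_one)
 ultimately show ?thesis by simp
qed

lemma Irr_lin:
 assumes \<chi>: "\<chi> \<in> Irr H" "\<chi> 1 = 1" and H: "subgrp H" shows "lin H \<chi>"
proof -
 obtain d \<rho> where \<rho>: "irp H d \<rho>" "\<And>g. g \<in> H \<Longrightarrow> \<chi> g = mat_trace (\<rho> g)" by (rule IrrE[OF \<chi>(1)]) blast
 note r = rpD[OF irpD(1)[OF \<rho>(1)]]
 have "complex_of_nat d = of_nat 1" using trace_one_rep[OF irpD(1)[OF \<rho>(1)]] \<rho>(2)[of 1] \<chi>(2) H by simp
 then have d: "d = 1" by (simp only: of_nat_eq_iff)
 have tr: "mat_trace A = A $$ (0, 0)" if "A \<in> carrier_mat 1 1" for A using that by (simp add: mat_trace_def)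
 show ?thesis
  unfolding lin_def
 proof (intro conjI ballI)
  fix x y assume xy: "x \<in> H" "y \<in> H"
  have c: "\<rho> x \<in> carrier_mat 1 1" "\<rho> y \<in> carrier_mat 1 1" using r(1) xy d by auto
  have "\<chi> (x * y) = (\<rho> x * \<rho> y) $$ (0, 0)"
   using \<rho>(2)[OF subgrp_mult[OF H xy]] r(3)[OF xy] tr[OF mult_carrier_mat[OF c]] by simp
  also have "\<dots> = \<rho> x $$ (0, 0) * \<rho> y $$ (0, 0)" using mat_mult_entry[OF c, of 0 0] by simp
  finally show "\<chi> (x * y) = \<chi> x * \<chi> y" using \<rho>(2) xy tr c by simp
 qed (rule \<chi>(2))
qed

lemma det_lin: "lin H (\<lambda>h. det (\<rho> h))" if "rp H d \<rho>"
 unfolding lin_def by (simp add: rpD(2,3)[OF that] det_mult[OF rpD(1)[OF that] rpD(1)[OF that]])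

lemma abelian_degree:
 assumes \<rho>: "irp H d \<rho>" and comm: "\<And>x y. x \<in> H \<Longrightarrow> y \<in> H \<Longrightarrow> x * y = y * x"
 shows "d = 1"
proof -
 note r = rpD[OF irpD(1)[OF \<rho>]]
 \<comment> \<open>The line spanned by the first unit vector. All operators are scalar by Schur's
   lemma, so it is invariant, and irreducibility makes it the whole space.\<close>
 let ?W = "{v \<in> carrier_vec d. \<forall>i. 1 \<le> i \<and> i < d \<longrightarrow> v $ i = (0 :: complex)}"
 have W: "subsp d ?W" unfolding subsp_def by auto
 have "\<rho> g *\<^sub>v w \<in> ?W" if g: "g \<in> H" and w: "w \<in> ?W" for g w
 proof -
  have "\<rho> h * \<rho> g = \<rho> g * \<rho> h" if "h \<in> H" for h using r(3)[OF g that] r(3)[OF that g] comm[OF g that] by metis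
  then obtain c where c: "\<rho> g = c \<cdot>\<^sub>m 1\<^sub>m d" using schur_scalar[OF \<rho> r(1)[OF g]] by blast
  have "\<rho> g *\<^sub>v w = c \<cdot>\<^sub>v w" unfolding c using smult_mat_vec[of "1\<^sub>m d" d d w c] w by simp
  then show ?thesis using w by auto
 qed
 from irpD(3)[OF \<rho> W this] have cs: "?W = {0\<^sub>v d} \<or> ?W = carrier_vec d" by blast
 have d0: "d > 0" by (rule irpD(2)[OF \<rho>])
 have u0: "(unit_vec d 0 :: complex vec) \<in> ?W" using d0 by auto
 have "(unit_vec d 0 :: complex vec) \<noteq> 0\<^sub>v d"
 proof
  assume "(unit_vec d 0 :: complex vec) = 0\<^sub>v d"
  then have "(unit_vec d 0 :: complex vec) $ 0 = 0\<^sub>v d $ 0" by simp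
  then show False using d0 by simp
 qed
 then have full: "?W = carrier_vec d" using cs u0 by blast
 show "d = 1"
 proof (rule ccontr)
  assume "d \<noteq> 1"
  then have d1: "1 < d" using d0 by simp
  have "(unit_vec d 1 :: complex vec) \<in> ?W" unfolding full by simp
  then have "(unit_vec d 1 :: complex vec) $ 1 = 0" using d1 by blast
  then show False using d1 by simp
 qed
qed

lemma abelian_char_list:
 assumes H: "subgrp H" and comm: "\<And>x y. x \<in> H \<Longrightarrow> y \<in> H \<Longrightarrow> x * y = y * x" and \<rho>: "rp H d \<rho>"
 shows "\<exists>cs. set cs \<subseteq> Irr H \<and> (\<forall>c\<in>set cs. lin H c) \<and>
  (\<forall>h\<in>H. mat_trace (\<rho> h) = (\<Sum>c\<leftarrow>cs. c h) \<and> det (\<rho> h) = (\<Prod>c\<leftarrow>cs. c h))"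
proof -
 obtain L where L: "\<forall>(e, \<sigma>)\<in>set L. irp H e \<sigma>" "\<forall>h\<in>H. mat_trace (\<rho> h) = (\<Sum>(e, \<sigma>)\<leftarrow>L. mat_trace (\<sigma> h))
  \<and> det (\<rho> h) = (\<Prod>(e, \<sigma>)\<leftarrow>L. det (\<sigma> h))"
  using rep_decomp[OF \<rho>] by blast
 let ?cs = "map (\<lambda>(e, \<sigma>). character (mon H) \<sigma>) L"
 have 1: "irp H 1 \<sigma>" if "(e, \<sigma>) \<in> set L" for e \<sigma> using L(1) that abelian_degree[OF _ comm] by fastforce
 have "set ?cs \<subseteq> Irr H" using L(1) IrrI by fastforce
 moreover have "lin H c" if c: "c \<in> set ?cs" for c
 proof -
  obtain e \<sigma> where e: "(e, \<sigma>) \<in> set L" "c = character (mon H) \<sigma>" using c by auto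
  have "c 1 = 1" unfolding e(2) using trace_one_rep[OF irpD(1)[OF 1[OF e(1)]]] H by (simp add: character_mon)
  moreover have "c \<in> Irr H" unfolding e(2) by (rule IrrI[OF 1[OF e(1)]])
  ultimately show ?thesis using Irr_lin H by blast
 qed
 moreover have "mat_trace (\<rho> h) = (\<Sum>c\<leftarrow>?cs. c h) \<and> det (\<rho> h) = (\<Prod>c\<leftarrow>?cs. c h)" if h: "h \<in> H" for h
 proof -
  have e1: "map (\<lambda>c. c h) ?cs = map (\<lambda>(e, \<sigma>). mat_trace (\<sigma> h)) L" using h by (auto simp: character_mon)
  have e2: "map (\<lambda>(e, \<sigma>). mat_trace (\<sigma> h)) L = map (\<lambda>(e, \<sigma>). det (\<sigma> h)) L"
  proof (rule map_cong[OF refl], clarify)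
   fix e \<sigma> assume "(e, \<sigma>) \<in> set L"
   from rpD(1)[OF irpD(1)[OF 1[OF this]] h] have c: "\<sigma> h \<in> carrier_mat 1 1" .
   show "mat_trace (\<sigma> h) = det (\<sigma> h)" using det_single[OF c] c by (simp add: mat_trace_def)
  qed
  show ?thesis using L(2) h e1 e2 by metis
 qed
 ultimately show ?thesis by blast
qed

text \<open>On an abelian group both representations have lists of linear constituents; equal traces
  give equal multiplicities, and the determinant is the product over the list.\<close>

lemma abelian_det_eq:
 assumes H: "subgrp H" and comm: "\<And>x y. x \<in> H \<Longrightarrow> y \<in> H \<Longrightarrow> x * y = y * x"
  and \<rho>: "rp H d \<rho>" and \<tau>: "rp H e \<tau>" and tr: "\<And>h. h \<in> H \<Longrightarrow> mat_trace (\<rho> h) = mat_trace (\<tau> h)" and h: "h \<in> H"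
 shows "det (\<rho> h) = det (\<tau> h)"
proof -
 obtain cs where cs: "set cs \<subseteq> Irr H" "\<forall>h\<in>H. mat_trace (\<rho> h) = (\<Sum>c\<leftarrow>cs. c h) \<and> det (\<rho> h) = (\<Prod>c\<leftarrow>cs. c h)"
  using abelian_char_list[OF H comm \<rho>] by blast
 obtain ds where ds: "set ds \<subseteq> Irr H" "\<forall>h\<in>H. mat_trace (\<tau> h) = (\<Sum>c\<leftarrow>ds. c h) \<and> det (\<tau> h) = (\<Prod>c\<leftarrow>ds. c h)"
  using abelian_char_list[OF H comm \<tau>] by blast
 have "count_list cs c = count_list ds c" for c
 proof (cases "c \<in> Irr H")
  case True
  have "ip H (\<lambda>h. mat_trace (\<rho> h)) c = of_nat (count_list cs c)"
   by (rule ip_list[OF H cs(1) _ True]) (use cs(2) in blast)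
  moreover have "ip H (\<lambda>h. mat_trace (\<rho> h)) c = of_nat (count_list ds c)"
   by (rule ip_list[OF H ds(1) _ True]) (use ds(2) tr in simp)
  ultimately show ?thesis by simp
 next
  case False
  then have "c \<notin> set cs" "c \<notin> set ds" using cs(1) ds(1) by auto
  then show ?thesis by (simp add: count_list_0_iff)
 qed
 then have "mset cs = mset ds" by (simp add: multiset_eq_iff count_mset)
 then have "prod_mset (image_mset (\<lambda>c. c h) (mset cs)) = prod_mset (image_mset (\<lambda>c. c h) (mset ds))" by simp
 then have "(\<Prod>c\<leftarrow>cs. c h) = (\<Prod>c\<leftarrow>ds. c h)" by (simp flip: mset_map add: prod_mset_prod_list)
 then show ?thesis using cs(2) ds(2) h by simp
qed

section \<open>Characters on cyclic subgroups\<close>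

lemma cyc_commute: "x \<in> cyc g n \<Longrightarrow> y \<in> cyc g n \<Longrightarrow> x * y = y * x"
 by (auto simp: cyc_def power_add[symmetric] add.commute)

lemma cyc_card:
 assumes "subgrp H" "g \<in> H"
 shows "subgrp (cyc g (card H))" "cyc g (card H) \<subseteq> H" "g ^ i \<in> cyc g (card H)"
 using cyc_subgrp[of g "card H"] subgrp_power_card[OF assms] assms by (auto simp: cyc_def subgrp_power)

text \<open>Restriction to the cyclic group generated by \<open>g\<close>: \<open>zs\<close> lists
  the eigenvalues of \<open>g\<close>, and the same list serves all exponents \<open>k\<close>. This
  links Galois automorphisms, which act on roots of unity, to power maps.\<close>

lemma char_root_sum:
 assumes H: "subgrp H" and \<chi>: "\<chi> \<in> Irr H" and g: "g \<in> H"
 shows "\<exists>zs. (\<forall>z\<in>set zs. z ^ card H = 1) \<and> (\<forall>k. \<chi> (g ^ k) = (\<Sum>z\<leftarrow>zs. z ^ k))"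
proof -
 let ?C = "cyc g (card H)"
 note C = cyc_card[OF H g]
 obtain d \<rho> where \<rho>: "irp H d \<rho>" "\<And>g. g \<in> H \<Longrightarrow> \<chi> g = mat_trace (\<rho> g)" by (rule IrrE[OF \<chi>]) blast
 have cc: "x * y = y * x" if "x \<in> ?C" "y \<in> ?C" for x y using that by (rule cyc_commute)
 obtain cs where cs: "\<forall>c\<in>set cs. lin ?C c"
  "\<forall>h\<in>?C. mat_trace (\<rho> h) = (\<Sum>c\<leftarrow>cs. c h) \<and> det (\<rho> h) = (\<Prod>c\<leftarrow>cs. c h)"
  using abelian_char_list[OF C(1) cc rp_subset[OF irpD(1)[OF \<rho>(1)] C(2)]] by blast
 have gC: "g \<in> ?C" using C(3)[of 1] by simp
 have pw: "c (g ^ k) = c g ^ k" if "c \<in> set cs" for c k using lin_power[OF _ C(1) gC] cs(1) that by blast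
 have "z ^ card H = 1" if z: "z \<in> set (map (\<lambda>c. c g) cs)" for z
 proof -
  obtain c where c: "c \<in> set cs" "z = c g" using z by auto
  have "z ^ card H = c (g ^ card H)" using pw[OF c(1)] c(2) by simp
  then show ?thesis using subgrp_power_card[OF H g] lin_one cs(1) c(1) by metis
 qed
 moreover have "\<chi> (g ^ k) = (\<Sum>z\<leftarrow>map (\<lambda>c. c g) cs. z ^ k)" for k
 proof -
  have "\<chi> (g ^ k) = (\<Sum>c\<leftarrow>cs. c (g ^ k))" using cs(2) C(3) \<rho>(2)[OF subgrp_power[OF H g]] by simp
  also have "map (\<lambda>c. c (g ^ k)) cs = map (\<lambda>c. c g ^ k) cs" using pw by simp
  finally show ?thesis by (simp add: comp_def)
 qed
 ultimately show ?thesis by blast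
qed

subsection \<open>Class sums and character degrees\<close>

text \<open>A non-zero sum means that the trivial character of \<open>N\<close> occurs in
  \<open>\<chi>\<close>. The sum of \<open>\<rho>\<close> over \<open>N\<close> is then a non-zero
  scalar that absorbs factors from \<open>N\<close>, so \<open>\<rho>\<close> is trivial on
  \<open>N\<close>.\<close>

lemma Irr_normal_sum:
 assumes H: "subgrp H" and N: "nsub N H" and \<chi>: "\<chi> \<in> Irr H" and nz: "(\<Sum>y\<in>N. \<chi> y) \<noteq> 0" and x: "x \<in> H" and y: "y \<in> N"
 shows "\<chi> (x * y) = \<chi> x"
proof -
 obtain d \<rho> where \<rho>: "irp H d \<rho>" "\<And>g. g \<in> H \<Longrightarrow> \<chi> g = mat_trace (\<rho> g)" by (rule IrrE[OF \<chi>]) blast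
 note r = rpD[OF irpD(1)[OF \<rho>(1)]]
 note NH = nsubD(2)[OF N] and sN = nsubD(1)[OF N]
 let ?f = "\<lambda>h. if h \<in> N then 1 else 0 :: complex"
 have nn: "cj g h \<in> N \<longleftrightarrow> h \<in> N" if "g \<in> H" for g h
  using nsubD(3)[OF N that] nsubD(3)[OF N subgrp_inverse[OF H that], of "cj g h"] by auto
 obtain c where c: "c * of_nat d = (\<Sum>h\<in>H. ?f h * mat_trace (\<rho> h))"
  "\<And>y i j. y \<in> H \<Longrightarrow> i < d \<Longrightarrow> j < d \<Longrightarrow> (\<Sum>h\<in>H. ?f h * \<rho> (h * y) $$ (i, j)) = c * \<rho> y $$ (i, j)"
  using class_sum[OF H \<rho>(1), of ?f] nn by (auto cong: if_cong)
 have restr: "(\<Sum>h\<in>H. ?f h * F h) = (\<Sum>h\<in>N. F h)" for F :: "_ \<Rightarrow> complex"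
 proof -
  have "(\<Sum>h\<in>H. ?f h * F h) = (\<Sum>h\<in>N. ?f h * F h)"
   by (rule sum.mono_neutral_right) (use NH H in auto)
  then show ?thesis by simp
 qed
 have "(\<Sum>h\<in>N. mat_trace (\<rho> h)) = (\<Sum>y\<in>N. \<chi> y)" by (rule sum.cong[OF refl]) (use \<rho>(2) NH in auto)
 then have c0: "c \<noteq> 0" using c(1) nz restr by auto
 have yH: "y \<in> H" using y NH by blast
 have "\<rho> y = 1\<^sub>m d"
 proof (rule eq_matI)
  fix i j assume "i < dim_row (1\<^sub>m d :: complex mat)" "j < dim_col (1\<^sub>m d :: complex mat)"
  then have ij: "i < d" "j < d" by auto
  have "c * \<rho> y $$ (i, j) = (\<Sum>h\<in>N. \<rho> (h * y) $$ (i, j))" using c(2)[OF yH ij] restr by simp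
  also have "\<dots> = (\<Sum>h\<in>N. \<rho> h $$ (i, j))" by (rule sum_reindex_right[OF sN y, of "\<lambda>h. \<rho> h $$ (i, j)"])
  also have "\<dots> = c * \<rho> 1 $$ (i, j)" using c(2)[OF subgrp_one[OF H] ij] restr by simp
  finally show "\<rho> y $$ (i, j) = 1\<^sub>m d $$ (i, j)" using c0 r(2) by simp
 qed (use r(1)[OF yH] in auto)
 then have "\<rho> (x * y) = \<rho> x" using r(3)[OF x yH] r(1)[OF x] by simp
 then show ?thesis using \<rho>(2) x yH H by (simp add: subgrp_mult)
qed

text \<open>\<open>q\<close> is an eigenvalue of an integer matrix, hence a root of its monic
  characteristic polynomial.\<close>

lemma int_matrix_eigenvalue:
 fixes v :: "'i \<Rightarrow> complex" and A :: "'i \<Rightarrow> 'i \<Rightarrow> int"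
 assumes I: "finite I" and ev: "\<And>i. i \<in> I \<Longrightarrow> q * v i = (\<Sum>j\<in>I. of_int (A i j) * v j)" and i0: "i0 \<in> I" "v i0 \<noteq> 0"
 shows "algebraic_int q"
proof -
 define n where "n = card I"
 obtain e where e: "bij_betw e {..<n} I" using I unfolding n_def by (metis ex_bij_betw_nat_finite atLeast0LessThan)
 define M where "M = mat n n (\<lambda>(i, j). A (e i) (e j))"
 define u where "u = vec n (\<lambda>i. v (e i))"
 let ?M = "map_mat of_int M :: complex mat"
 have M: "M \<in> carrier_mat n n" "?M \<in> carrier_mat n n" and u: "u \<in> carrier_vec n" by (simp_all add: M_def u_def)
 have "?M *\<^sub>v u = q \<cdot>\<^sub>v u"
 proof (rule eq_vecI)
  fix i assume "i < dim_vec (q \<cdot>\<^sub>v u)"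
  then have i: "i < n" by (simp add: u_def)
  then have ei: "e i \<in> I" using e by (auto simp: bij_betw_def)
  have "(?M *\<^sub>v u) $ i = (\<Sum>k<n. of_int (A (e i) (e k)) * v (e k))"
   unfolding mat_vec_entry[OF M(2) u i] by (rule sum.cong[OF refl]) (use i in \<open>simp add: M_def u_def\<close>)
  also have "\<dots> = (\<Sum>j\<in>I. of_int (A (e i) j) * v j)"
   by (rule sum.reindex_bij_betw[OF e, of "\<lambda>j. of_int (A (e i) j) * v j"])
  finally show "(?M *\<^sub>v u) $ i = (q \<cdot>\<^sub>v u) $ i" using ev[OF ei] i by (simp add: u_def)
 qed (simp add: M_def u_def)
 moreover have "u \<noteq> 0\<^sub>v n"
 proof
  assume 0: "u = 0\<^sub>v n"
  have "i0 \<in> e ` {..<n}" using i0(1) e by (simp add: bij_betw_def)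
  then obtain k where k: "k < n" "e k = i0" by auto
  have "u $ k = v i0" using k by (simp add: u_def)
  then show False using i0(2) 0 k by simp
 qed
 ultimately have "eigenvalue ?M q" unfolding eigenvalue_def eigenvector_def using u by (intro exI[of _ u]) (simp add: M_def)
 then have "poly (char_poly ?M) q = 0" using eigenvalue_root_char_poly[OF M(2)] by blast
 then have "poly (map_poly of_int (char_poly M)) q = 0" using of_int_hom.char_poly_hom[OF M(1)] by metis
 moreover have "lead_coeff (char_poly M) = 1" using degree_monic_char_poly[OF M(1)] by simp
 ultimately show ?thesis unfolding algebraic_int_altdef_ipoly by blast
qed

lemma Irr_convolution:
 assumes H: "subgrp H" and \<chi>: "\<chi> \<in> Irr H" and x: "x \<in> H"
 shows "(\<Sum>h\<in>H. \<chi> (inverse h) * \<chi> (h * x)) * \<chi> 1 = of_nat (card H) * \<chi> x"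
proof -
 obtain d \<rho> where \<rho>: "irp H d \<rho>" "\<And>g. g \<in> H \<Longrightarrow> \<chi> g = mat_trace (\<rho> g)" by (rule IrrE[OF \<chi>]) blast
 have cl: "\<chi> (inverse (cj g h)) = \<chi> (inverse h)" if "g \<in> H" "h \<in> H" for g h
  using Irr_cj[OF \<chi> H that(1) subgrp_inverse[OF H that(2)]] by (simp add: cj_inverse)
 obtain c where c: "c * of_nat d = (\<Sum>h\<in>H. \<chi> (inverse h) * mat_trace (\<rho> h))"
  "\<forall>y\<in>H. (\<Sum>h\<in>H. \<chi> (inverse h) * mat_trace (\<rho> (h * y))) = c * mat_trace (\<rho> y)"
  using class_sum[OF H \<rho>(1), of "\<lambda>h. \<chi> (inverse h)"] cl by blast
 have "(\<Sum>h\<in>H. \<chi> (inverse h) * mat_trace (\<rho> h)) = (\<Sum>h\<in>H. \<chi> h * \<chi> (inverse h))"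
  by (rule sum.cong[OF refl]) (use \<rho>(2) in \<open>simp add: mult.commute\<close>)
 then have cd: "c * of_nat d = of_nat (card H)" using c(1) Irr_orth[OF H \<chi> \<chi>] by simp
 have "(\<Sum>h\<in>H. \<chi> (inverse h) * \<chi> (h * x)) = (\<Sum>h\<in>H. \<chi> (inverse h) * mat_trace (\<rho> (h * x)))"
  by (rule sum.cong[OF refl]) (use \<rho>(2) subgrp_mult[OF H _ x] in simp)
 also have "\<dots> = c * \<chi> x" using c(2) x \<rho>(2) by simp
 finally show ?thesis using cd trace_one_rep[OF irpD(1)[OF \<rho>(1)]] \<rho>(2)[OF subgrp_one[OF H]] by (simp add: mult_ac)
qed

text \<open>Convolving \<open>\<chi>\<close> with the function \<open>\<chi> (inverse h)\<close>
  multiplies it by the quotient \<open>q\<close> of the group order by \<open>d\<close>. The values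
  \<open>\<chi> (inverse h)\<close> are sums of roots of unity; enlarging the index set from
  \<open>H\<close> to pairs of a root of unity and a group element absorbs the roots and leaves
  their multiplicities as integer matrix entries. So the rational number \<open>q\<close> is an
  algebraic integer.\<close>

lemma Irr_degree_dvd:
 assumes H: "subgrp H" and \<chi>: "\<chi> \<in> Irr H" and d: "\<chi> 1 = of_nat d"
 shows "d dvd card H"
proof -
 define n where "n = card H"
 have n0: "n > 0" using H by (simp add: n_def)
 define R where "R = {z::complex. z ^ n = 1}"
 have R: "finite R" unfolding R_def using n0 by (intro finite_roots_unity) simp
 have "\<forall>h\<in>H. \<exists>zs. set zs \<subseteq> R \<and> \<chi> (inverse h) = (\<Sum>z\<leftarrow>zs. z)"
 proof
  fix h assume h: "h \<in> H"
  obtain zs where "\<forall>z\<in>set zs. z ^ card H = 1" "\<forall>k. \<chi> (inverse h ^ k) = (\<Sum>z\<leftarrow>zs. z ^ k)"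
   using char_root_sum[OF H \<chi> subgrp_inverse[OF H h]] by blast
  then show "\<exists>zs. set zs \<subseteq> R \<and> \<chi> (inverse h) = (\<Sum>z\<leftarrow>zs. z)"
   by (intro exI[of _ zs]) (auto simp: R_def n_def dest: spec[of _ 1])
 qed
 then obtain zs where zs: "\<And>h. h \<in> H \<Longrightarrow> set (zs h) \<subseteq> R" "\<And>h. h \<in> H \<Longrightarrow> \<chi> (inverse h) = (\<Sum>z\<leftarrow>zs h. z)" by metis
 have zc: "\<chi> (inverse h) = (\<Sum>w\<in>R. of_nat (count_list (zs h) w) * w)" if "h \<in> H" for h
  using sum_list_count[OF R zs(1)[OF that], of "\<lambda>z. z"] zs(2)[OF that] by simp
 define q :: complex where "q = of_nat n / of_nat d"
 have d0: "d > 0" using Irr_degree[OF \<chi> H] d by (metis of_nat_eq_iff)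
 have conv: "q * \<chi> x = (\<Sum>h\<in>H. \<chi> (inverse h) * \<chi> (h * x))" if "x \<in> H" for x
  using Irr_convolution[OF H \<chi> that] d d0 by (simp add: q_def n_def field_simps)
 have Rnz: "z \<noteq> 0" if "z \<in> R" for z using that n0 by (auto simp: R_def zero_power)
 have Rbij: "bij_betw (\<lambda>w. w * z) R R" if z: "z \<in> R" for z
  by (rule bij_betw_byWitness[where f' = "\<lambda>w. w / z"])
   (use z Rnz[OF z] in \<open>auto simp: R_def power_mult_distrib power_divide\<close>)
 have Hbij: "bij_betw (\<lambda>h. h * x) H H" if "x \<in> H" for x
  by (rule bij_betw_byWitness[where f' = "\<lambda>h. h * inverse x"]) (use that H in \<open>auto simp: subgrp_closed mult.assoc\<close>)
 have "algebraic_int q"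
 proof (rule int_matrix_eigenvalue[where I = "R \<times> H" and v = "\<lambda>(z, x). z * \<chi> x"
    and A = "\<lambda>(z, x) (w, y). int (count_list (zs (y * inverse x)) (w / z))" and ?i0.0 = "(1, 1)"])
  show "finite (R \<times> H)" using R H by simp
  show "(1, 1) \<in> R \<times> H" using H by (simp add: R_def)
  show "(case (1, 1) of (z, x) \<Rightarrow> z * \<chi> x) \<noteq> 0" using d d0 by simp
  fix i assume "i \<in> R \<times> H"
  then obtain z x where zx: "i = (z, x)" "z \<in> R" "x \<in> H" by auto
  have "q * (z * \<chi> x) = (\<Sum>h\<in>H. (\<Sum>w\<in>R. of_nat (count_list (zs h) w) * w) * (z * \<chi> (h * x)))"
  proof -
   have "q * (z * \<chi> x) = z * (\<Sum>h\<in>H. \<chi> (inverse h) * \<chi> (h * x))" using conv[OF zx(3)] by (simp add: mult.left_commute)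
   also have "\<dots> = (\<Sum>h\<in>H. \<chi> (inverse h) * (z * \<chi> (h * x)))" by (simp add: sum_distrib_left mult.left_commute)
   finally show ?thesis using zc by simp
  qed
  also have "\<dots> = (\<Sum>h\<in>H. \<Sum>w\<in>R. of_nat (count_list (zs h) w) * ((w * z) * \<chi> (h * x)))"
   by (simp add: sum_distrib_right mult.assoc)
  \<comment> \<open>Everything is written in terms of \<open>w * z\<close> and \<open>h * x\<close>,
    so that both summation variables can be shifted to the index pair \<open>(w, y)\<close>.\<close>
  also have "\<dots> = (\<Sum>w\<in>R. \<Sum>h\<in>H. of_nat (count_list (zs (h * x * inverse x)) (w * z / z)) * ((w * z) * \<chi> (h * x)))"
   using Rnz[OF zx(2)] by (subst sum.swap) (simp add: mult.assoc)
  also have "\<dots> = (\<Sum>w\<in>R. \<Sum>y\<in>H. of_nat (count_list (zs (y * inverse x)) (w * z / z)) * ((w * z) * \<chi> y))"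
   by (rule sum.cong[OF refl], rule sum.reindex_bij_betw[OF Hbij[OF zx(3)]])
  also have "\<dots> = (\<Sum>w\<in>R. \<Sum>y\<in>H. of_nat (count_list (zs (y * inverse x)) (w / z)) * (w * \<chi> y))"
   by (rule sum.reindex_bij_betw[OF Rbij[OF zx(2)], of "\<lambda>w. \<Sum>y\<in>H. of_nat (count_list (zs (y * inverse x)) (w / z)) * (w * \<chi> y)"])
  finally show "q * (case i of (z, x) \<Rightarrow> z * \<chi> x) = (\<Sum>j\<in>R \<times> H. of_int ((case i of (z, x) \<Rightarrow> \<lambda>(w, y). int (count_list (zs (y * inverse x)) (w / z))) j) * (case j of (z, x) \<Rightarrow> z * \<chi> x))"
   using R H by (simp add: zx(1) sum.cartesian_product split_def)
 qed
 moreover have "q \<in> \<rat>" by (simp add: q_def)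
 ultimately have "q \<in> \<int>" by (rule rational_algebraic_int_is_int)
 then obtain k where k: "q = of_int k" by (auto elim: Ints_cases)
 then have "of_int (int n) = (of_int (k * int d) :: complex)" using d0 by (simp add: q_def field_simps)
 then have "int n = k * int d" by (simp only: of_int_eq_iff)
 then have "int d dvd int n" by simp
 then show ?thesis by (simp add: n_def)
qed

text \<open>A natural number for every function; it agrees with \<open>\<chi> 1\<close> as soon as
  that value is a natural number.\<close>

definition deg :: "('g::grp \<Rightarrow> complex) \<Rightarrow> nat" where
 "deg \<chi> = nat \<lfloor>Re (\<chi> 1)\<rfloor>"

lemma deg_Irr:
 assumes "\<chi> \<in> Irr H" "subgrp H" shows "\<chi> 1 = of_nat (deg \<chi>)" "deg \<chi> > 0"
proof -
 obtain d where "d > 0" "\<chi> 1 = of_nat d" by (rule Irr_degree[OF assms])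
 then show "\<chi> 1 = of_nat (deg \<chi>)" "deg \<chi> > 0" by (simp_all add: deg_def)
qed

lemma deg_eqI: "\<chi> 1 = of_nat d \<Longrightarrow> deg \<chi> = d"
 by (simp add: deg_def)

lemma Irr_zero: "\<chi> \<in> Irr H \<Longrightarrow> h \<notin> H \<Longrightarrow> \<chi> h = 0"
 by (auto elim: IrrE)

lemma sum_deg_squares:
 assumes "subgrp H" shows "(\<Sum>\<chi>\<in>Irr H. deg \<chi> ^ 2) = card H"
proof -
 have "(\<Sum>\<chi>\<in>Irr H. \<chi> 1 * \<chi> 1) = (of_nat (card H) :: complex)"
  using Irr_regular(2)[OF assms subgrp_one[OF assms]] by simp
 moreover have "(\<Sum>\<chi>\<in>Irr H. \<chi> 1 * \<chi> 1) = (\<Sum>\<chi>\<in>Irr H. of_nat (deg \<chi> ^ 2))"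
  by (rule sum.cong[OF refl]) (simp add: deg_Irr(1)[OF _ assms] power2_eq_square)
 ultimately have "of_nat (\<Sum>\<chi>\<in>Irr H. deg \<chi> ^ 2) = (of_nat (card H) :: complex)" by simp
 then show ?thesis by (simp only: of_nat_eq_iff)
qed

section \<open>Linear characters of p-groups\<close>

lemma pgrp_degree_dvd:
 assumes p: "prime p" "pgrp p Q" and \<mu>: "\<mu> \<in> Irr Q" "deg \<mu> \<noteq> 1" shows "p dvd deg \<mu>"
proof -
 have sQ: "subgrp Q" by (rule pgrp_subgrp[OF p(2)])
 obtain b where b: "card Q = p ^ b" using p(2) unfolding pgrp_def by blast
 have "deg \<mu> dvd p ^ b" using Irr_degree_dvd[OF sQ \<mu>(1) deg_Irr(1)[OF \<mu>(1) sQ]] b by simp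
 then obtain i where i: "deg \<mu> = p ^ i" using divides_primepow_nat[OF p(1)] by metis
 then have "i \<noteq> 0" using \<mu>(2) by auto
 then show ?thesis unfolding i by (simp add: dvd_power)
qed

text \<open>The order of \<open>Q\<close> is the sum of the squared degrees; both the order and
  every square of a degree other than 1 are divisible by \<open>p\<close>.\<close>

lemma pgrp_linear_count:
 assumes p: "prime p" "pgrp p Q" "Q \<noteq> {1}" shows "p dvd card {\<mu>\<in>Irr Q. deg \<mu> = 1}"
proof -
 define L where "L = {\<mu>\<in>Irr Q. deg \<mu> = 1}"
 have sQ: "subgrp Q" by (rule pgrp_subgrp[OF p(2)])
 obtain b where b: "card Q = p ^ b" using p(2) unfolding pgrp_def by blast
 have "b \<noteq> 0"
 proof
  assume "b = 0"
  then have "card Q = 1" using b by simp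
  then obtain z where "Q = {z}" by (auto simp: card_1_singleton_iff)
  then show False using p(3) subgrp_one[OF sQ] by simp
 qed
 then have "p dvd card Q" unfolding b by (simp add: dvd_power)
 moreover have "(\<Sum>\<mu>\<in>Irr Q. deg \<mu> ^ 2) = (\<Sum>\<mu>\<in>Irr Q - L. deg \<mu> ^ 2) + (\<Sum>\<mu>\<in>L. deg \<mu> ^ 2)"
  by (rule sum.subset_diff[OF _ Irr_regular(1)[OF sQ]]) (auto simp: L_def)
 moreover have "(\<Sum>\<mu>\<in>L. deg \<mu> ^ 2) = card L" by (simp add: L_def)
 moreover have "p dvd (\<Sum>\<mu>\<in>Irr Q - L. deg \<mu> ^ 2)"
  by (rule dvd_sum) (use pgrp_degree_dvd[OF p(1,2)] in \<open>simp add: L_def power2_eq_square\<close>)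
 ultimately have "p dvd card L" using sum_deg_squares[OF sQ] by (metis dvd_add_right_iff)
 then show ?thesis by (simp add: L_def)
qed

text \<open>The number of linear characters is positive and divisible by \<open>q\<close>, so there
  is one besides the trivial one. Kernels of characters obtained from it supply the proper subgroups
  on which later inductions run.\<close>

lemma pgrp_lin_ex:
 assumes q: "prime q" and Q: "pgrp q Q" "Q \<noteq> {1}"
 shows "\<exists>\<mu>. lin Q \<mu> \<and> (\<exists>x\<in>Q. \<mu> x \<noteq> 1)"
proof -
 let ?L = "{\<mu>\<in>Irr Q. deg \<mu> = 1}" and ?one = "\<lambda>h. if h \<in> Q then 1 else 0 :: complex"
 have sQ: "subgrp Q" by (rule pgrp_subgrp[OF Q(1)])
 have fin: "finite ?L" using Irr_regular(1)[OF sQ] by simp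
 have one: "?one \<in> Irr Q" by (rule lin_Irr[OF _ sQ]) (simp add: lin_def)
 then have "?one \<in> ?L" using sQ by (simp add: deg_def)
 then have "card ?L \<noteq> 0" using fin by (metis (no_types, lifting) card_0_eq empty_iff)
 then have "q \<le> card ?L" using pgrp_linear_count[OF q Q] by (metis dvd_imp_le gr0I)
 then have "1 < card ?L" using prime_gt_1_nat[OF q] by simp
 then have "\<not> ?L \<subseteq> {?one}" using card_mono[of "{?one}" ?L] by auto
 then obtain \<mu> where \<mu>: "\<mu> \<in> Irr Q" "deg \<mu> = 1" "\<mu> \<noteq> ?one" by blast
 have "lin Q \<mu>" using Irr_lin[OF \<mu>(1) _ sQ] deg_Irr(1)[OF \<mu>(1) sQ] \<mu>(2) by simp
 moreover have "\<exists>x\<in>Q. \<mu> x \<noteq> 1" using Irr_eqI[OF \<mu>(1) one] \<mu>(3) by auto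
 ultimately show ?thesis by blast
qed

section \<open>Normal complements and fixed-point-free automorphisms\<close>

subsection \<open>Transfer\<close>

text \<open>\<open>L\<close> is \<open>\<mu>\<close> composed with the transfer from
  \<open>H\<close> to \<open>P\<close>. For \<open>z\<close> in \<open>P\<close>, each cycle of
  length \<open>n\<close> of \<open>z\<close> on the cosets contributes \<open>\<mu>\<close> of a
  conjugate of \<open>z ^ n\<close>, which by stability is \<open>\<mu> z ^ n\<close>; the lengths
  add up to the index.\<close>

lemma transfer_ex:
 fixes \<mu> :: "'g::grp \<Rightarrow> complex"
 assumes H: "subgrp H" and P: "subgrp P" "P \<subseteq> H" and \<mu>: "lin P \<mu>"
  and stable: "\<And>x h. x \<in> P \<Longrightarrow> h \<in> H \<Longrightarrow> cj h x \<in> P \<Longrightarrow> \<mu> (cj h x) = \<mu> x"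
 shows "\<exists>L. lin H L \<and> (\<forall>z\<in>P. L z = \<mu> z ^ card (lcosets H P)) \<and> (\<forall>h\<in>H. L h ^ card P = 1)"
proof -
 let ?\<Omega> = "lcosets H P"
 define r where "r C = (SOME x. x \<in> C)" for C :: "'g set"
 have rC: "r C \<in> C" "r C \<in> H" "C = (*) (r C) ` P" if C: "C \<in> ?\<Omega>" for C
 proof -
  obtain h where h: "h \<in> H" "C = (*) h ` P" using C by (auto simp: lcosets_def)
  then have "h \<in> C" using P(1) by (metis image_eqI mult_1_right subgrp_one)
  then show 1: "r C \<in> C" unfolding r_def by (rule someI)
  then obtain p where p: "p \<in> P" "r C = h * p" using h by auto
  then show "r C \<in> H" using h P H by (auto intro: subgrp_mult)
  show "C = (*) (r C) ` P" using coset_eq_iff[OF P(1), of h "r C"] p h(2) by simp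
 qed
 have im: "(*) g ` C \<in> ?\<Omega>" if "g \<in> H" "C \<in> ?\<Omega>" for g C
  using acts_lcosets[OF H P(1) order_refl] that by (simp add: acts_def)
 \<comment> \<open>The element of \<open>P\<close> by which \<open>g\<close> times the
   representative of \<open>C\<close> differs from the representative of the translated coset; it
   obeys the cocycle rule \<open>um\<close>.\<close>
 define u where "u g C = inverse (r ((*) g ` C)) * (g * r C)" for g C
 have uP: "u g C \<in> P" if "g \<in> H" "C \<in> ?\<Omega>" for g C
 proof -
  have "(*) (r ((*) g ` C)) ` P = (*) (g * r C) ` P"
   using rC(3)[OF im[OF that]] rC(3)[OF that(2)] coset_image[of g "r C" P] by simp
  then show ?thesis unfolding u_def using coset_eq_iff[OF P(1)] by blast
 qed
 have um: "u (g * h) C = u g ((*) h ` C) * u h C" for g h C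
  unfolding u_def coset_image[symmetric] by (simp add: mult.assoc image_image)
 define L where "L g = (\<Prod>C\<in>?\<Omega>. \<mu> (u g C))" for g
 have bij: "bij_betw ((`) ((*) h)) ?\<Omega> ?\<Omega>" if h: "h \<in> H" for h
  unfolding bij_betw_def
 proof
  have inj: "inj_on ((`) ((*) h)) ?\<Omega>" by (rule inj_onI) (simp add: inj_image_eq_iff inj_def)
  then show "inj_on ((`) ((*) h)) ?\<Omega>" .
  have "(`) ((*) h) ` ?\<Omega> \<subseteq> ?\<Omega>" using im[OF h] by blast
  then show "(`) ((*) h) ` ?\<Omega> = ?\<Omega>" using H inj by (intro endo_inj_surj) simp_all
 qed
 have hom: "L (g * h) = L g * L h" if "g \<in> H" "h \<in> H" for g h
 proof -
  have "L (g * h) = (\<Prod>C\<in>?\<Omega>. \<mu> (u g ((*) h ` C)) * \<mu> (u h C))"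
   unfolding L_def um using that by (intro prod.cong refl lin_mult[OF \<mu>] uP im)
  also have "\<dots> = (\<Prod>C\<in>?\<Omega>. \<mu> (u g ((*) h ` C))) * L h" by (simp add: prod.distrib L_def)
  also have "(\<Prod>C\<in>?\<Omega>. \<mu> (u g ((*) h ` C))) = L g"
   unfolding L_def by (rule prod.reindex_bij_betw[OF bij[OF that(2)]])
  finally show ?thesis .
 qed
 have card1: "L h ^ card P = 1" if "h \<in> H" for h
  unfolding L_def prod_power_distrib
  by (rule prod.neutral) (use uP[OF that] lin_power_card[OF \<mu> P(1)] in blast)
 have L1: "L 1 = 1"
  unfolding L_def u_def by (rule prod.neutral) (use lin_one[OF \<mu>] in simp)
 \<comment> \<open>Stated for every finite set \<open>T\<close> of cosets stable under
   \<open>z\<close>, so that cycles can be split off one at a time.\<close>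
 have orb: "(\<Prod>C\<in>T. \<mu> (u z C)) = \<mu> z ^ card T"
  if "z \<in> P" "finite T" "T \<subseteq> ?\<Omega>" "\<And>C. C \<in> T \<Longrightarrow> (*) z ` C \<in> T" for z T
  using that
 proof (induction "card T" arbitrary: T rule: less_induct)
  case (less T)
  show ?case
  proof (cases "T = {}")
   case False
   then obtain C where C: "C \<in> T" by blast
   have C\<Omega>: "C \<in> ?\<Omega>" using C less.prems by blast
   have zH: "z \<in> H" using less.prems(1) P by blast
   define s where "s i = (*) (z ^ i) ` C" for i
   have sS: "s (Suc i) = (*) z ` s i" for i by (simp add: s_def coset_image)
   have sT: "s i \<in> T" for i
   proof (induction i)
    case 0 then show ?case using C by (simp add: s_def)
   next
    case (Suc i) then show ?case unfolding sS by (rule less.prems(4))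
   qed
   have s\<Omega>: "s i \<in> ?\<Omega>" for i using sT less.prems(3) by blast
   define n where "n = (LEAST n. n > 0 \<and> s n = C)"
   have "card H > 0 \<and> s (card H) = C" using H subgrp_power_card[OF H zH] by (simp add: s_def)
   then have n: "n > 0" "s n = C" unfolding n_def by (metis (mono_tags, lifting) LeastI)+
   have nmin: "s m \<noteq> C" if "0 < m" "m < n" for m
    using not_less_Least[of m "\<lambda>n. n > 0 \<and> s n = C"] that unfolding n_def by blast
   have sadd: "s (a + b) = (*) (z ^ a) ` s b" for a b
    by (simp add: s_def coset_image power_add)
   have injs: "inj_on s {..<n}"
   proof -
    have "False" if "a < b" "b < n" "s a = s b" for a b
    proof -
     have "s (n - b + a) = s (n - b + b)" using that by (simp only: sadd)
     then have "s (n - b + a) = C" using that n by simp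
     moreover have "s (n - b + a) \<noteq> C" using that by (intro nmin) arith+
     ultimately show False by simp
    qed
    then show ?thesis by (auto intro!: inj_onI) (metis linorder_neqE_nat)
   qed
   define Or where "Or = s ` {..<n}"
   have OT: "Or \<subseteq> T" using sT by (auto simp: Or_def)
   have inv: "(*) z ` D \<in> Or" if D: "D \<in> Or" for D
   proof -
    obtain i where i: "i < n" "D = s i" using D by (auto simp: Or_def)
    have "(*) z ` D = s (Suc i)" by (simp add: i sS)
    moreover have "s 0 = C" by (simp add: s_def)
    ultimately show ?thesis unfolding Or_def using i n
     by (metis Suc_lessI imageI lessThan_iff)
   qed
   have inv': "(*) z ` D \<in> T - Or" if D: "D \<in> T - Or" for D
   proof -
    have "(*) z ` D \<notin> Or"
    proof
     assume "(*) z ` D \<in> Or"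
     moreover have "(`) ((*) z) ` Or = Or"
      using inv by (intro endo_inj_surj) (auto simp: Or_def intro!: inj_onI simp: inj_image_eq_iff inj_def)
     ultimately obtain D' where "D' \<in> Or" "(*) z ` D = (*) z ` D'" by blast
     then have "D = D'" by (simp add: inj_image_eq_iff inj_def)
     then show False using D \<open>D' \<in> Or\<close> by simp
    qed
    then show ?thesis using less.prems(4) D by blast
   qed
   \<comment> \<open>Along a cycle the representatives cancel and the factors telescope; at
     \<open>m = n\<close> the cycle closes, and what remains is a conjugate of \<open>z ^ n\<close>
     by a coset representative.\<close>
   have tele: "\<mu> (inverse (r (s m)) * (z ^ m * r C)) = (\<Prod>i<m. \<mu> (u z (s i))) \<and> inverse (r (s m)) * (z ^ m * r C) \<in> P" for m
   proof (induction m)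
    case 0
    then show ?case using P lin_one[OF \<mu>] by (simp add: s_def)
   next
    case (Suc m)
    have e: "inverse (r (s (Suc m))) * (z ^ Suc m * r C) = u z (s m) * (inverse (r (s m)) * (z ^ m * r C))"
     unfolding u_def sS by (simp add: mult.assoc)
    have "u z (s m) \<in> P" using uP[OF zH s\<Omega>] .
    then show ?case unfolding e using Suc lin_mult[OF \<mu>] subgrp_mult[OF P(1)] by (simp add: mult.commute)
   qed
   have "(\<Prod>C\<in>Or. \<mu> (u z C)) = (\<Prod>i<n. \<mu> (u z (s i)))"
    unfolding Or_def by (simp add: prod.reindex[OF injs])
   also have "\<dots> = \<mu> (cj (inverse (r C)) (z ^ n))"
    using tele[of n] n(2) by (simp add: cj_def mult.assoc)
   also have "\<dots> = \<mu> (z ^ n)"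
    using stable[of "z ^ n" "inverse (r C)"] tele[of n] n(2) less.prems(1) P H rC(2)[OF C\<Omega>]
    by (simp add: cj_def mult.assoc subgrp_power subgrp_inverse)
   also have "\<dots> = \<mu> z ^ card Or" using lin_power[OF \<mu> P(1) less.prems(1)] card_image[OF injs] by (simp add: Or_def)
   finally have 1: "(\<Prod>C\<in>Or. \<mu> (u z C)) = \<mu> z ^ card Or" .
   have "Or \<noteq> {}" using n by (auto simp: Or_def)
   then have "card (T - Or) < card T" using OT less.prems(2) by (intro psubset_card_mono) auto
   then have 2: "(\<Prod>C\<in>T - Or. \<mu> (u z C)) = \<mu> z ^ card (T - Or)"
    using less.prems inv' by (intro less.hyps) auto
   have "(\<Prod>C\<in>T. \<mu> (u z C)) = (\<Prod>C\<in>T - Or. \<mu> (u z C)) * (\<Prod>C\<in>Or. \<mu> (u z C))"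
    using prod.subset_diff[OF OT less.prems(2)] by simp
   also have "\<dots> = \<mu> z ^ card T" unfolding 1 2 power_add[symmetric]
    using OT less.prems(2) by (simp add: card_Diff_subset finite_subset card_mono)
   finally show ?thesis .
  qed simp
 qed
 have "L z = \<mu> z ^ card ?\<Omega>" if "z \<in> P" for z
 proof -
  have zH: "z \<in> H" using that P by blast
  show ?thesis unfolding L_def by (rule orb[OF that]) (use H im[OF zH] in simp_all)
 qed
 then show ?thesis using hom L1 card1 unfolding lin_def by blast
qed

subsection \<open>Frobenius' normal complement theorem\<close>

text \<open>The index of the product in \<open>N\<close> divides a power of \<open>q\<close> because
  of \<open>C\<close> and is prime to \<open>q\<close> because of \<open>S\<close>.\<close>

lemma setmul_syl_eq:
 assumes N: "subgrp N" and q: "prime q" and C: "nsub C N" "card N = card C * q ^ k" and S: "syl q N S"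
 shows "setmul C S = N"
proof -
 have sub: "setmul C S \<subseteq> N" using setmul_subset[OF N nsubD(2)[OF C(1)] sylD(2)[OF S]] .
 have sg: "subgrp (setmul C S)"
  using subgrp_setmul[OF nsubD(1)[OF C(1)] sylD(1)[OF S]] nsubD(3)[OF C(1)] sylD(2)[OF S] by blast
 obtain t where t: "card N = card (setmul C S) * t" using subgrp_card_dvd[OF N sg sub] by (elim dvdE)
 have "card S dvd card (setmul C S)"
  using subgrp_card_dvd[OF sg sylD(1)[OF S] setmul_right[OF nsubD(1)[OF C(1)]]] .
 then obtain a where a: "card (setmul C S) = card S * a" by (elim dvdE)
 have "card (lcosets N S) * card S = card N" using card_lcosets[OF N sylD(1,2)[OF S]] .
 then have "card (lcosets N S) * card S = (a * t) * card S" using t a by (simp add: mult_ac)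
 then have "card (lcosets N S) = a * t" using sylD(1)[OF S] by simp
 then have nq: "\<not> q dvd t" using not_dvd_card_lcosets_syl[OF N q S] by auto
 have "card C dvd card (setmul C S)"
  using subgrp_card_dvd[OF sg nsubD(1)[OF C(1)] setmul_left[OF sylD(1)[OF S]]] .
 then obtain b where b: "card (setmul C S) = card C * b" by (elim dvdE)
 have "card C * q ^ k = card C * (b * t)" using C(2) t b by (metis mult.assoc)
 then have "q ^ k = b * t" using nsubD(1)[OF C(1)] by simp
 then have "t dvd q ^ k" by simp
 then have "t = 1" using nq q by (metis divides_primepow_nat dvd_power gr0I power_0)
 then show ?thesis using t sub N by (metis card_subset_eq mult_1_right subgrp_finite)
qed

text \<open>Frobenius' condition: for every non-trivial \<open>q\<close>-subgroup \<open>Y\<close>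
  the quotient of its normalizer in \<open>H\<close> by its centralizer is a
  \<open>q\<close>-group.\<close>

definition frob :: "nat \<Rightarrow> 'g::grp set \<Rightarrow> bool" where
 "frob q H \<longleftrightarrow> (\<forall>Y. pgrp q Y \<and> Y \<subseteq> H \<and> Y \<noteq> {1} \<longrightarrow> (\<forall>g\<in>H. p'el q g \<and> g \<in> nrm Y \<longrightarrow> g \<in> cent Y))"

lemma frob_normalizer:
 assumes H: "subgrp H" and q: "prime q" and f: "frob q H" and D: "pgrp q D" "D \<subseteq> H" "D \<noteq> {1}"
  and S: "syl q (H \<inter> nrm D) S" and n: "n \<in> H \<inter> nrm D"
 shows "\<exists>c\<in>H \<inter> cent D. \<exists>s\<in>S. n = c * s"
proof -
 let ?N = "H \<inter> nrm D" let ?C = "?N \<inter> cent D"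
 have sN: "subgrp ?N" using subgrp_Int_nrm[OF H] .
 have nC: "nsub ?C ?N" using nsub_Int_cent[OF sN, of D] by blast
 have "R \<subseteq> ?C" if R: "prime r" "r \<noteq> q" "syl r ?N R" for r R
 proof
  fix x assume x: "x \<in> R"
  then have "p'el q x" using syl_p'el[OF q R] by blast
  moreover have "x \<in> ?N" using x sylD(2)[OF R(3)] by blast
  ultimately show "x \<in> ?C" using f D unfolding frob_def by blast
 qed
 then obtain k where k: "card ?N = card ?C * q ^ k"
  using prime_power_index[OF sN q nsubD(1,2)[OF nC]] by blast
 have "n \<in> setmul ?C S" using setmul_syl_eq[OF sN q nC k S] n by simp
 then show ?thesis by (elim setmulE) blast
qed

text \<open>Let \<open>D\<close> be the intersection. Both \<open>P\<close> and \<open>R\<close>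
  meet the normalizer of \<open>D\<close> in more than \<open>D\<close>, and Sylow subgroups of that
  normalizer above these parts are conjugate under the centralizer of \<open>D\<close>, by
  \<open>frob_normalizer\<close>. Extending one of them to a Sylow subgroup \<open>T\<close> of
  \<open>H\<close> links \<open>P\<close> to \<open>T\<close>, and a conjugate of \<open>T\<close>
  to \<open>R\<close>, with intersections larger than \<open>D\<close>, where induction
  applies.\<close>

lemma frob_sylow_conj:
 assumes H: "subgrp H" and q: "prime q" and f: "frob q H" and "syl q H P" "syl q H R"
 shows "\<exists>c\<in>H \<inter> cent (P \<inter> R). R = cj c ` P"
 using assms(4,5)
proof (induction "card P - card (P \<inter> R)" arbitrary: P R rule: less_induct)
 case (less P R)
 note P = sylD[OF less.prems(1)] and R = sylD[OF less.prems(2)]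
 let ?D = "P \<inter> R"
 have cardR: "card R = card P" using P(4) R(4) by simp
 have sD: "subgrp ?D" using subgrp_Int[OF P(1) R(1)] .
 consider "?D = {1}" | "?D = P" | "?D \<noteq> {1}" "?D \<noteq> P" by blast
 then show ?case
 proof cases
  case 1
  obtain h where "h \<in> H" "R = cj h ` P" using sylow_conj_eq[OF H q less.prems] by blast
  moreover have "h \<in> cent ?D" using 1 by (simp add: cent_def)
  ultimately show ?thesis by blast
 next
  case 2
  then have "P = R" using cardR R(1) by (metis card_subset_eq inf.absorb_iff2 inf_commute subgrp_finite)
  then show ?thesis using H by (intro bexI[of _ 1]) auto
 next
  case 3
  have DP: "?D \<subset> P" using 3 by blast
  have DR: "?D \<subset> R" using 3 cardR P(1) by (metis card_subset_eq inf.cobounded1 inf.cobounded2 psubsetI subgrp_finite)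
  have pD: "pgrp q ?D" using pgrp_subset[OF q P(3) sD] by blast
  have DH: "?D \<subseteq> H" using P(2) by blast
  let ?N = "H \<inter> nrm ?D"
  have sN: "subgrp ?N" using subgrp_Int_nrm[OF H] .
  have P1: "pgrp q (P \<inter> nrm ?D)" "P \<inter> nrm ?D \<subseteq> ?N" "?D \<subset> P \<inter> nrm ?D"
   using pgrp_subset[OF q P(3) subgrp_Int_nrm[OF P(1)]] P(2) normalizer_grows[OF q P(3) sD DP] by blast+
  have R1: "pgrp q (R \<inter> nrm ?D)" "R \<inter> nrm ?D \<subseteq> ?N" "?D \<subset> R \<inter> nrm ?D"
   using pgrp_subset[OF q R(3) subgrp_Int_nrm[OF R(1)]] R(2) normalizer_grows[OF q R(3) sD DR] by blast+
  obtain S1 where S1: "syl q ?N S1" "P \<inter> nrm ?D \<subseteq> S1" using sylow_above[OF sN q P1(1,2)] by blast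
  obtain S2 where S2: "syl q ?N S2" "R \<inter> nrm ?D \<subseteq> S2" using sylow_above[OF sN q R1(1,2)] by blast
  obtain n where n: "n \<in> ?N" "S2 = cj n ` S1" using sylow_conj_eq[OF sN q S1(1) S2(1)] by blast
  obtain c s where cs: "c \<in> H \<inter> cent ?D" "s \<in> S1" "n = c * s"
   using frob_normalizer[OF H q f pD DH 3(1) S1(1) n(1)] by blast
  have "cj s ` S1 = S1" using subgrp_le_nrm[OF sylD(1)[OF S1(1)]] cs(2) by (auto simp: nrm_def)
  then have S2c: "S2 = cj c ` S1" using n(2) cs(3) by (simp add: cj_image_comp)
  have S1H: "S1 \<subseteq> H" using sylD(2)[OF S1(1)] by blast
  obtain T where T: "syl q H T" "S1 \<subseteq> T" using sylow_above[OF H q sylD(3)[OF S1(1)] S1H] by blast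
  have PT: "?D \<subset> P \<inter> T" using P1(3) S1(2) T(2) by blast
  have less1: "card P - card (P \<inter> T) < card P - card ?D"
   using psubset_card_mono[OF _ PT] P(1) card_mono[of P "P \<inter> T"] by (simp add: diff_less_mono2) 
  obtain c1 where c1: "c1 \<in> H \<inter> cent (P \<inter> T)" "T = cj c1 ` P" using less.hyps[OF less1 less.prems(1) T(1)] by blast
  have cH: "c \<in> nrm H" using cs(1) subgrp_le_nrm[OF H] by blast
  have T': "syl q H (cj c ` T)" using syl_cj_image[OF H T(1) cH] .
  have "R \<inter> nrm ?D \<subseteq> cj c ` T" using S2(2) S2c T(2) by blast
  then have TR: "?D \<subset> cj c ` T \<inter> R" using R1(3) by blast
  have "card (cj c ` T) = card P" using sylD(4)[OF T'] P(4) by simp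
  then have less2: "card (cj c ` T) - card (cj c ` T \<inter> R) < card P - card ?D"
   using psubset_card_mono[OF _ TR] R(1) card_mono[of "cj c ` T" "cj c ` T \<inter> R"] sylD(1)[OF T'] by (simp add: diff_less_mono2)
  obtain c2 where c2: "c2 \<in> H \<inter> cent (cj c ` T \<inter> R)" "R = cj c2 ` cj c ` T"
   using less.hyps[OF less2 T' less.prems(2)] by blast
  have "c1 \<in> cent ?D" "c2 \<in> cent ?D"
   using c1(1) c2(1) PT TR cent_antimono by blast+
  then have "c2 * (c * c1) \<in> H \<inter> cent ?D" using cs(1) c1(1) c2(1) H by (simp add: cent_mult subgrp_mult)
  moreover have "R = cj (c2 * (c * c1)) ` P" using c2(2) c1(2) by (simp only: cj_image_comp)
  ultimately show ?thesis by blast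
 qed
qed

text \<open>Correcting \<open>h\<close> by an element \<open>c\<close> that centralizes
  \<open>x\<close>, from \<open>frob_sylow_conj\<close>, makes it normalize \<open>P\<close>;
  \<open>frob_normalizer\<close> then writes \<open>h * c\<close> as an element centralizing
  \<open>P\<close> times an element of \<open>P\<close>, and only the latter moves
  \<open>x\<close>.\<close>

lemma frob_fusion:
 assumes H: "subgrp H" and q: "prime q" and f: "frob q H" and P: "syl q H P"
  and x: "x \<in> P" "h \<in> H" "cj h x \<in> P"
 shows "\<exists>u\<in>P. cj h x = cj u x"
proof (cases "P = {1}")
 case True then show ?thesis using x by auto
next
 case False
 note PD = sylD[OF P]
 have ih: "inverse h \<in> nrm H" using x(2) subgrp_inverse[OF H] subgrp_le_nrm[OF H] by blast
 obtain c where c: "c \<in> H \<inter> cent (P \<inter> cj (inverse h) ` P)" "cj (inverse h) ` P = cj c ` P"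
  using frob_sylow_conj[OF H q f P syl_cj_image[OF H P ih]] by blast
 have "x \<in> cj (inverse h) ` P" using x(3) by (metis cj_cancel(2) imageI)
 then have "c * x = x * c" using c(1) x(1) by (auto simp: cent_def)
 then have cx: "cj c x = x" by (simp add: cj_eq_iff)
 have "cj (h * c) ` P = cj h ` cj (inverse h) ` P" using c(2) by (simp only: cj_image_comp)
 also have "\<dots> = cj (h * inverse h) ` P" by (simp only: cj_image_comp)
 finally have "cj (h * c) ` P = P" by simp
 then have hc: "h * c \<in> H \<inter> nrm P" using x(2) c(1) H by (simp add: nrm_def subgrp_mult)
 have PN: "P \<subseteq> H \<inter> nrm P" using PD(2) subgrp_le_nrm[OF PD(1)] by blast
 have sN: "subgrp (H \<inter> nrm P)" using subgrp_Int_nrm[OF H] .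
 have "syl q (H \<inter> nrm P) P"
 proof -
  obtain S where S: "syl q (H \<inter> nrm P) S" "P \<subseteq> S" using sylow_above[OF sN q PD(3) PN] by blast
  have "S \<subseteq> H" using sylD(2)[OF S(1)] by blast
  then obtain h' where "S \<subseteq> cj h' ` P" using sylow_conj[OF H q P sylD(3)[OF S(1)]] by blast
  then have "card S \<le> card P" using card_mono[of "cj h' ` P" S] PD(1) by simp
  then have "P = S" using S(2) sylD(1)[OF S(1)] by (metis card_seteq subgrp_finite)
  then show ?thesis using S(1) by simp
 qed
 then obtain a u where au: "a \<in> H \<inter> cent P" "u \<in> P" "h * c = a * u"
  using frob_normalizer[OF H q f PD(3,2) False _ hc] by blast
 have "cj u x \<in> P" using au(2) x(1) PD(1) by (simp add: subgrp_cj)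
 then have "cj a (cj u x) = cj u x" using au(1) by (simp add: cent_iff_cj)
 then have "cj (h * c) x = cj u x" unfolding au(3) cj_comp .
 then have "cj h x = cj u x" by (simp add: cj_comp cx)
 then show ?thesis using au(2) by blast
qed

text \<open>By \<open>frob_fusion\<close> every linear character of the Sylow subgroup
  \<open>P\<close> is stable under conjugation in \<open>H\<close>, so a non-trivial one transfers
  to a non-trivial \<open>L\<close>. Its kernel is a proper normal subgroup that inherits the
  condition and contains all elements of order prime to \<open>q\<close>.\<close>

theorem frobenius_qnil:
 assumes "subgrp H" "prime q" "frob q H" shows "qnil q H"
 using assms(1,3)
proof (induction "card H" arbitrary: H rule: less_induct)
 case (less H)
 note q = assms(2)
 obtain P where P: "syl q H P" using syl_ex[OF less.prems(1) q] by blast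
 note PD = sylD[OF P]
 show ?case
 proof (cases "P = {1}")
  case True
  then have "card P = 1" by simp
  then have "multiplicity q (card H) = 0" using PD(4) prime_gt_1_nat[OF q] by (metis less_irrefl nat_power_eq_Suc_0_iff One_nat_def)
  then have "\<not> q dvd card H" using multiplicity_pos_iff_dvd[OF q, of "card H"] less.prems(1) by simp
  then have "coprime (card H) q" using coprime_prime_iff[OF q] by simp
  then show ?thesis unfolding qnil_def using coprime_card_p'el[OF less.prems(1)] subgrp_mult[OF less.prems(1)] by blast
 next
  case False
  obtain \<mu> x where \<mu>: "lin P \<mu>" "x \<in> P" "\<mu> x \<noteq> 1" using pgrp_lin_ex[OF q PD(3) False] by blast
  have stable: "\<mu> (cj h y) = \<mu> y" if y: "y \<in> P" "h \<in> H" "cj h y \<in> P" for y h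
  proof -
   obtain u where "u \<in> P" "cj h y = cj u y" using frob_fusion[OF less.prems(1) q less.prems(2) P y] by blast
   then show ?thesis using lin_cj[OF \<mu>(1) PD(1)] y(1) by simp
  qed
  obtain L where L: "lin H L" "\<And>z. z \<in> P \<Longrightarrow> L z = \<mu> z ^ card (lcosets H P)" "\<And>h. h \<in> H \<Longrightarrow> L h ^ card P = 1"
   using transfer_ex[OF less.prems(1) PD(1,2) \<mu>(1) stable] by blast
  define M where "M = {h\<in>H. L h = 1}"
  have M: "nsub M H" unfolding M_def using lin_ker_nsub[OF L(1) less.prems(1)] .
  have "L x \<noteq> 1"
  proof
   assume "L x = 1"
   then have "\<mu> x ^ card (lcosets H P) = 1" using L(2)[OF \<mu>(2)] by simp
   moreover have "coprime (card (lcosets H P)) (card P)"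
    using not_dvd_card_lcosets_syl[OF less.prems(1) q P] PD(4) coprime_prime_iff[OF q] by simp
   ultimately show False using coprime_powers_1 lin_power_card[OF \<mu>(1) PD(1) \<mu>(2)] \<mu>(3) by blast
  qed
  then have "M \<subset> H" using \<mu>(2) PD(2) by (auto simp: M_def)
  then have lt: "card M < card H" using less.prems(1) by (intro psubset_card_mono) auto
  have fM: "frob q M" unfolding frob_def
  proof (intro allI impI ballI)
   fix Y g assume Y: "pgrp q Y \<and> Y \<subseteq> M \<and> Y \<noteq> {1}" and g: "g \<in> M" "p'el q g \<and> g \<in> nrm Y"
   have "Y \<subseteq> H" "g \<in> H" using Y g(1) nsubD(2)[OF M] by blast+
   then show "g \<in> cent Y" using less.prems(2) Y g unfolding frob_def by blast
  qed
  have qM: "qnil q M" using less.hyps[OF lt nsubD(1)[OF M] fM] .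
  have inM: "g \<in> M" if g: "g \<in> H" "p'el q g" for g
  proof -
   obtain m where m: "coprime m q" "g ^ m = 1" using g(2) by (auto simp: p'el_def)
   then have "L g ^ m = 1" using lin_power[OF L(1) less.prems(1) g(1)] lin_one[OF L(1)] by metis
   moreover have "coprime m (card P)" using m(1) PD(4) by simp
   ultimately have "L g = 1" using L(3)[OF g(1)] coprime_powers_1 by blast
   then show ?thesis using g by (simp add: M_def)
  qed
  show ?thesis unfolding qnil_def
  proof (intro ballI impI)
   fix a b assume "a \<in> H" "b \<in> H" "p'el q a" "p'el q b"
   then show "p'el q (a * b)" using inM qM unfolding qnil_def by blast
  qed
 qed
qed

subsection \<open>The Thompson subgroup and the replacement theorem\<close>

text \<open>For \<open>S\<close> inside the finite group \<open>H\<close> this is the subgroup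
  generated by \<open>S\<close>.\<close>

definition genin :: "'g::grp set \<Rightarrow> 'g set \<Rightarrow> 'g set" where
 "genin H S = \<Inter>{K. subgrp K \<and> K \<subseteq> H \<and> S \<subseteq> K}"

lemma genin_subgrp:
 assumes "subgrp H" "S \<subseteq> H" shows "subgrp (genin H S)" "genin H S \<subseteq> H" "S \<subseteq> genin H S"
proof -
 show sub: "genin H S \<subseteq> H" unfolding genin_def using assms by blast
 show "S \<subseteq> genin H S" unfolding genin_def by blast
 show "subgrp (genin H S)"
 proof (rule subgrpI)
  show "finite (genin H S)" using finite_subset[OF sub] assms(1) by simp
  show "1 \<in> genin H S" unfolding genin_def by simp
  fix x y assume "x \<in> genin H S" "y \<in> genin H S"
  then show "x * y \<in> genin H S" unfolding genin_def using subgrp_mult by blast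
 qed
qed

lemma genin_least: "subgrp K \<Longrightarrow> K \<subseteq> H \<Longrightarrow> S \<subseteq> K \<Longrightarrow> genin H S \<subseteq> K"
 unfolding genin_def by blast

text \<open>\<open>JJ Q\<close> is the Thompson subgroup, generated by the abelian subgroups of maximal order; \<open>ZZ Q\<close> is the centre.\<close>

definition absub :: "'g::grp set \<Rightarrow> 'g set \<Rightarrow> bool" where
 "absub Q A \<longleftrightarrow> subgrp A \<and> A \<subseteq> Q \<and> (\<forall>x\<in>A. \<forall>y\<in>A. x * y = y * x)"

definition AA :: "'g::grp set \<Rightarrow> 'g set set" where
 "AA Q = {A. absub Q A \<and> (\<forall>B. absub Q B \<longrightarrow> card B \<le> card A)}"

definition JJ :: "'g::grp set \<Rightarrow> 'g set" where "JJ Q = genin Q (\<Union>(AA Q))"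

definition ZZ :: "'g::grp set \<Rightarrow> 'g set" where "ZZ Q = Q \<inter> cent Q"

lemma AA_subset: "\<Union>(AA Q) \<subseteq> Q" by (auto simp: AA_def absub_def)

lemma JJ_subgrp: assumes "subgrp Q" shows "subgrp (JJ Q)" "JJ Q \<subseteq> Q"
 using genin_subgrp[OF assms AA_subset] unfolding JJ_def by blast+

lemma AA_le_JJ: "subgrp Q \<Longrightarrow> A \<in> AA Q \<Longrightarrow> A \<subseteq> JJ Q"
 using genin_subgrp(3)[OF _ AA_subset] unfolding JJ_def by blast

lemma ZZ_subgrp: "subgrp Q \<Longrightarrow> subgrp (ZZ Q)"
 unfolding ZZ_def by (rule subgrp_Int_cent)

lemma ZZ_le: "ZZ Q \<subseteq> Q"
 by (simp add: ZZ_def)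

lemma absub_ZZ: "subgrp Q \<Longrightarrow> absub Q (ZZ Q)"
 unfolding absub_def by (intro conjI ballI ZZ_subgrp ZZ_le) (unfold ZZ_def cent_def, blast+)

lemma commute_products:
 fixes a b c d :: "'g::grp"
 assumes "a * c = c * a" "b * d = d * b" "c * b = b * c" "a * d = d * a"
 shows "(a * b) * (c * d) = (c * d) * (a * b)"
proof -
 have "(a * b) * (c * d) = a * (b * c) * d" by (simp only: mult.assoc)
 also have "\<dots> = a * (c * b) * d" by (simp only: assms(3))
 also have "\<dots> = (a * c) * (b * d)" by (simp only: mult.assoc)
 also have "\<dots> = (c * a) * (d * b)" by (simp only: assms(1,2))
 also have "\<dots> = c * (a * d) * b" by (simp only: mult.assoc)
 also have "\<dots> = c * (d * a) * b" by (simp only: assms(4))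
 also have "\<dots> = (c * d) * (a * b)" by (simp only: mult.assoc)
 finally show ?thesis .
qed

lemma absub_setmul:
 assumes "subgrp Q" "absub Q A" "absub Q B" "\<And>x y. x \<in> A \<Longrightarrow> y \<in> B \<Longrightarrow> x * y = y * x"
 shows "absub Q (setmul A B)"
 unfolding absub_def
proof (intro conjI ballI)
 have A: "subgrp A" "A \<subseteq> Q" "\<And>x y. x \<in> A \<Longrightarrow> y \<in> A \<Longrightarrow> x * y = y * x" using assms(2) by (auto simp: absub_def)
 have B: "subgrp B" "B \<subseteq> Q" "\<And>x y. x \<in> B \<Longrightarrow> y \<in> B \<Longrightarrow> x * y = y * x" using assms(3) by (auto simp: absub_def)
 have "cj b a = a" if "b \<in> B" "a \<in> A" for a b using assms(4)[OF that(2,1)] by (simp add: cj_eq_iff)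
 then show "subgrp (setmul A B)" by (intro subgrp_setmul A(1) B(1)) simp
 show "setmul A B \<subseteq> Q" using setmul_subset[OF assms(1) A(2) B(2)] .
 fix x y assume "x \<in> setmul A B" "y \<in> setmul A B"
 then obtain a b c d where *: "a \<in> A" "b \<in> B" "x = a * b" "c \<in> A" "d \<in> B" "y = c * d" by (elim setmulE) blast
 show "x * y = y * x" unfolding *(3,6) using * A(3) B(3) assms(4) by (intro commute_products) auto
qed

lemma AA_ex: assumes "subgrp Q" shows "\<exists>A. A \<in> AA Q"
proof -
 let ?S = "{A. absub Q A}"
 have "finite ?S" using assms by (auto intro!: finite_subset[of _ "Pow Q"] simp: absub_def)
 moreover have "ZZ Q \<in> ?S" using absub_ZZ[OF assms] by simp
 ultimately have "Max (card ` ?S) \<in> card ` ?S" by (intro Max_in) auto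
 then obtain A where "absub Q A" "card A = Max (card ` ?S)" by auto
 then show ?thesis unfolding AA_def using \<open>finite ?S\<close> by auto
qed

lemma ZZ_nontrivial:
 assumes "prime q" "pgrp q Q" "Q \<noteq> {1}" shows "ZZ Q \<noteq> {1}"
 using fixed_element[OF assms(1,2,2) subgrp_le_nrm[OF pgrp_subgrp[OF assms(2)]] assms(3)]
 unfolding ZZ_def by blast

lemma JJ_nontrivial:
 assumes "prime q" "pgrp q Q" "Q \<noteq> {1}" shows "JJ Q \<noteq> {1}"
proof
 note s = pgrp_subgrp[OF assms(2)]
 assume J: "JJ Q = {1}"
 obtain A where A: "A \<in> AA Q" using AA_ex[OF s] by blast
 then have "card (ZZ Q) \<le> card A" using absub_ZZ[OF s] by (auto simp: AA_def)
 moreover have "card A \<le> card {1::'a}" using AA_le_JJ[OF s A] J by (metis card_mono finite.emptyI finite.insertI)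
 ultimately have "card (ZZ Q) \<le> 1" by simp
 then have "ZZ Q = {1}" using ZZ_subgrp[OF s] by (metis One_nat_def card_le_Suc0_iff_eq subgrp_finite subgrp_one subsetI singletonI equalityI singleton_iff)
 then show False using ZZ_nontrivial[OF assms] by simp
qed

section \<open>Invariance of the Thompson subgroup and of the centre\<close>

lemma absub_image:
 assumes "homo Q \<phi>" "absub Q A" shows "absub (\<phi> ` Q) (\<phi> ` A)"
proof -
 have A: "subgrp A" "A \<subseteq> Q" "\<And>x y. x \<in> A \<Longrightarrow> y \<in> A \<Longrightarrow> x * y = y * x" using assms(2) by (auto simp: absub_def)
 have "\<phi> x * \<phi> y = \<phi> y * \<phi> x" if "x \<in> A" "y \<in> A" for x y
  using A(3)[OF that] homo_mult[OF assms(1)] that A(2) by (metis subsetD)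
 then show ?thesis unfolding absub_def using homo_image_subgrp[OF assms(1) A(1,2)] A(2) by blast
qed

lemma homo_inv_into:
 assumes "homo Q \<phi>" "inj_on \<phi> Q" shows "homo (\<phi> ` Q) (inv_into Q \<phi>)"
 unfolding homo_def
proof (intro conjI ballI)
 show "subgrp (\<phi> ` Q)" using homo_image_subgrp[OF assms(1) homo_subgrp[OF assms(1)]] by blast
 fix x y assume "x \<in> \<phi> ` Q" "y \<in> \<phi> ` Q"
 then obtain a b where ab: "a \<in> Q" "b \<in> Q" "x = \<phi> a" "y = \<phi> b" by blast
 have "a * b \<in> Q" using ab homo_subgrp[OF assms(1)] by (simp add: subgrp_mult)
 moreover have "x * y = \<phi> (a * b)" using ab homo_mult[OF assms(1)] by simp
 ultimately show "inv_into Q \<phi> (x * y) = inv_into Q \<phi> x * inv_into Q \<phi> y"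
  using ab assms(2) by (simp add: inv_into_f_f)
qed

lemma AA_image:
 assumes "homo Q \<phi>" "inj_on \<phi> Q" shows "AA (\<phi> ` Q) = (`) \<phi> ` AA Q"
proof -
 let ?\<psi> = "inv_into Q \<phi>"
 have inv: "?\<psi> ` \<phi> ` B = B" if "B \<subseteq> Q" for B
  using that assms(2) by (auto simp: image_image inv_into_f_f subset_iff) 
 have inv': "\<phi> ` ?\<psi> ` B = B" if "B \<subseteq> \<phi> ` Q" for B
  using that by (auto simp: image_image f_inv_into_f subset_iff image_iff)
 have bk: "absub Q (?\<psi> ` B) \<and> card (?\<psi> ` B) = card B \<and> \<phi> ` ?\<psi> ` B = B" if B: "absub (\<phi> ` Q) B" for B
 proof -
  have sub: "B \<subseteq> \<phi> ` Q" using B by (simp add: absub_def)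
  have "absub (?\<psi> ` \<phi> ` Q) (?\<psi> ` B)" by (rule absub_image[OF homo_inv_into[OF assms] B])
  then have "absub Q (?\<psi> ` B)" using inv by simp
  moreover have "card (?\<psi> ` B) = card B" using sub by (intro card_image inj_on_inv_into)
  ultimately show ?thesis using inv'[OF sub] by simp
 qed
 have fwd: "absub (\<phi> ` Q) (\<phi> ` A) \<and> card (\<phi> ` A) = card A" if A: "absub Q A" for A
  using absub_image[OF assms(1) A] assms(2) A by (auto simp: absub_def card_image inj_on_subset)
 show ?thesis
 proof (intro equalityI subsetI)
  fix B assume B: "B \<in> AA (\<phi> ` Q)"
  then have b: "absub Q (?\<psi> ` B)" "card (?\<psi> ` B) = card B" "\<phi> ` ?\<psi> ` B = B" using bk by (auto simp: AA_def)
  have "card A \<le> card (?\<psi> ` B)" if "absub Q A" for A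
   using fwd[OF that] B b(2) by (auto simp: AA_def)
  then have "?\<psi> ` B \<in> AA Q" using b(1) by (simp add: AA_def)
  then show "B \<in> (`) \<phi> ` AA Q" using b(3) by (metis imageI)
 next
  fix B assume "B \<in> (`) \<phi> ` AA Q"
  then obtain A where A: "A \<in> AA Q" "B = \<phi> ` A" by blast
  have "card D \<le> card B" if "absub (\<phi> ` Q) D" for D
   using bk[OF that] A fwd[of A] by (auto simp: AA_def)
  then show "B \<in> AA (\<phi> ` Q)" using A fwd[of A] by (auto simp: AA_def)
 qed
qed

text \<open>Injective homomorphisms cover two uses: conjugation, and reduction modulo a normal
  \<open>q'\<close>-subgroup, which is injective on a Sylow \<open>q\<close>-subgroup.\<close>

lemma JJ_image:
 assumes "homo Q \<phi>" "inj_on \<phi> Q" shows "JJ (\<phi> ` Q) = \<phi> ` JJ Q"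
proof -
 note s = homo_subgrp[OF assms(1)]
 have sI: "subgrp (\<phi> ` Q)" using homo_image_subgrp[OF assms(1) s] by blast
 have "\<phi> ` JJ Q \<subseteq> JJ (\<phi> ` Q)"
 proof -
  let ?K = "{x\<in>Q. \<phi> x \<in> JJ (\<phi> ` Q)}"
  have "A \<subseteq> ?K" if A: "A \<in> AA Q" for A
  proof -
   have "\<phi> ` A \<subseteq> JJ (\<phi> ` Q)" using AA_le_JJ[OF sI] AA_image[OF assms] A by blast
   then show ?thesis using A by (auto simp: AA_def absub_def)
  qed
  then have "JJ Q \<subseteq> ?K" unfolding JJ_def[of Q]
   by (intro genin_least homo_preimage_subgrp[OF assms(1)] JJ_subgrp(1)[OF sI]) auto
  then show ?thesis by blast
 qed
 moreover have "JJ (\<phi> ` Q) \<subseteq> \<phi> ` JJ Q"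
  unfolding JJ_def[of "\<phi> ` Q"]
 proof (rule genin_least)
  show "subgrp (\<phi> ` JJ Q)" using homo_image_subgrp[OF assms(1) JJ_subgrp[OF s]] .
  show "\<phi> ` JJ Q \<subseteq> \<phi> ` Q" using JJ_subgrp(2)[OF s] by blast
  show "\<Union> (AA (\<phi> ` Q)) \<subseteq> \<phi> ` JJ Q" unfolding AA_image[OF assms] using AA_le_JJ[OF s] by blast
 qed
 ultimately show ?thesis by blast
qed

lemma ZZ_image:
 assumes "homo Q \<phi>" "inj_on \<phi> Q" shows "ZZ (\<phi> ` Q) = \<phi> ` ZZ Q"
proof -
 have "(\<phi> x * \<phi> y = \<phi> y * \<phi> x) = (x * y = y * x)" if "x \<in> Q" "y \<in> Q" for x y
  using homo_mult[OF assms(1)] that assms(2) homo_subgrp[OF assms(1)] by (metis inj_on_eq_iff subgrp_mult)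
 then show ?thesis unfolding ZZ_def cent_def by auto
qed

lemma homo_cj_fun: "subgrp Q \<Longrightarrow> homo Q (cj g)"
 by (simp add: homo_def cj_mult)

lemma JJ_cj: "subgrp Q \<Longrightarrow> JJ (cj g ` Q) = cj g ` JJ Q"
 by (intro JJ_image homo_cj_fun inj_cj)

lemma ZZ_cj: "subgrp Q \<Longrightarrow> ZZ (cj g ` Q) = cj g ` ZZ Q"
 by (intro ZZ_image homo_cj_fun inj_cj)

lemma nrm_JJ: "subgrp Q \<Longrightarrow> nrm Q \<subseteq> nrm (JJ Q)"
 using JJ_cj[of Q] by (auto simp: nrm_def) (metis imageI, metis imageE)

lemma nrm_ZZ: "subgrp Q \<Longrightarrow> nrm Q \<subseteq> nrm (ZZ Q)"
 using ZZ_cj[of Q] by (auto simp: nrm_def) (metis imageI, metis imageE)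

text \<open>The abelian subgroups of maximal order of \<open>Q\<close> all lie in \<open>X\<close>,
  so \<open>X\<close> and \<open>Q\<close> have the same ones.\<close>

lemma JJ_eq_if_le:
 assumes "subgrp Q" "subgrp X" "X \<subseteq> Q" "JJ Q \<subseteq> X" shows "JJ X = JJ Q"
proof -
 have AAX: "A \<in> AA X" if A: "A \<in> AA Q" for A
 proof -
  have "A \<subseteq> X" using AA_le_JJ[OF assms(1) A] assms(4) by blast
  then show ?thesis using A assms(3) unfolding AA_def absub_def by auto
 qed
 have AAQ: "A \<in> AA Q" if A: "A \<in> AA X" for A
 proof -
  obtain B where B: "B \<in> AA Q" using AA_ex[OF assms(1)] by blast
  have "card B \<le> card A" using AAX[OF B] A by (auto simp: AA_def)
  moreover have "absub Q A" using A assms(3) by (auto simp: AA_def absub_def)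
  moreover have "card C \<le> card B" if "absub Q C" for C using B that by (auto simp: AA_def)
  ultimately show ?thesis unfolding AA_def using le_trans by blast
 qed
 have eq: "AA X = AA Q" using AAX AAQ by blast
 have "JJ X \<subseteq> JJ Q"
  unfolding JJ_def[of X] eq by (rule genin_least) (use JJ_subgrp[OF assms(1)] assms(4) AA_le_JJ[OF assms(1)] in auto)
 moreover have "JJ Q \<subseteq> JJ X"
  unfolding JJ_def[of Q] eq[symmetric] 
  by (rule genin_least) (use JJ_subgrp[OF assms(2)] assms(3) AA_le_JJ[OF assms(2)] in auto)
 ultimately show ?thesis by blast
qed

text \<open>Replacing \<open>A\<close> by \<open>[v, A] C\<^sub>A([v, A])\<close> for a suitable
 \<open>v \<in> V\<close> keeps the order maximal and enlarges the intersection with \<open>V\<close>.\<close>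

lemma thompson_replacement:
 assumes q: "prime q" and Q: "pgrp q Q" and A: "A \<in> AA Q" and V: "absub Q V" and AV: "A \<subseteq> nrm V"
  and nV: "\<not> V \<subseteq> nrm A"
 shows "\<exists>B\<in>AA Q. A \<inter> V \<subset> B \<inter> V \<and> B \<subseteq> nrm A"
proof -
 have sA: "subgrp A" "A \<subseteq> Q" and cA: "\<And>x y. x \<in> A \<Longrightarrow> y \<in> A \<Longrightarrow> x * y = y * x"
  and maxA: "\<And>B. absub Q B \<Longrightarrow> card B \<le> card A" using A by (auto simp: AA_def absub_def)
 have sV: "subgrp V" "V \<subseteq> Q" and cV: "\<And>x y. x \<in> V \<Longrightarrow> y \<in> V \<Longrightarrow> x * y = y * x" using V by (auto simp: absub_def)
 define N where "N = V \<inter> nrm A"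
 have sN: "subgrp N" unfolding N_def using subgrp_Int_nrm[OF sV(1)] .
 have NV: "N \<subset> V" unfolding N_def using nV by blast
 have AN: "A \<subseteq> nrm N"
 proof
  fix a assume a: "a \<in> A"
  have aA: "a \<in> nrm A" using a subgrp_le_nrm[OF sA(1)] by blast
  show "a \<in> nrm N"
  proof (rule nrmI)
   fix x assume x: "x \<in> N"
   have "cj a x \<in> V" using nrm_cj[of a V x] AV a x by (auto simp: N_def)
   moreover have "cj a x \<in> nrm A" using aA x unfolding cj_def N_def by (auto intro!: nrm_mult nrm_inverse)
   ultimately show "cj a x \<in> N" by (simp add: N_def)
  qed (use sN in simp)
 qed
 have pA: "pgrp q A" using pgrp_subset[OF q Q sA] .
 have pV: "pgrp q V" using pgrp_subset[OF q Q sV] .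
 \<comment> \<open>\<open>v\<close> does not normalize \<open>A\<close>, but its commutators with
   the elements of \<open>A\<close> do.\<close>
 obtain v where v: "v \<in> V - N" "\<forall>a\<in>A. inverse v * cj a v \<in> N"
  using fixed_coset[OF q pA pV AV sN NV AN] by blast
 have vV: "v \<in> V" using v by blast
 define m where "m a = inverse v * cj a v" for a
 have mN: "m a \<in> N" if "a \<in> A" for a using v(2) that by (simp add: m_def)
 have cjV: "cj a x \<in> V" if "a \<in> A" "x \<in> V" for a x using nrm_cj AV that by blast
 \<comment> \<open>The elements \<open>m a\<close> are the commutators of \<open>v\<close> with
   \<open>A\<close>, so \<open>M\<close> is the group \<open>[v, A]\<close>.\<close>
 define M where "M = genin N (m ` A)"
 have mA: "m ` A \<subseteq> N" using mN by blast
 have sM: "subgrp M" "M \<subseteq> N" "m ` A \<subseteq> M" using genin_subgrp[OF sN mA] unfolding M_def by blast+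
 have MV: "M \<subseteq> V" using sM(2) NV by blast
 define C where "C = A \<inter> cent M"
 have sC: "subgrp C" "C \<subseteq> A" unfolding C_def using subgrp_Int_cent[OF sA(1)] by blast+
 define B where "B = setmul M C"
 have MC: "x * y = y * x" if "x \<in> M" "y \<in> C" for x y using that by (simp add: C_def cent_def)
 have abM: "absub Q M" unfolding absub_def using sM(1) MV sV(2) cV by blast
 have abC: "absub Q C" unfolding absub_def using sC sA(2) cA by blast
 have abB: "absub Q B" unfolding B_def by (rule absub_setmul[OF pgrp_subgrp[OF Q] abM abC MC])
 define K where "K = M \<inter> A"
 have sK: "subgrp K" "K \<subseteq> M" unfolding K_def using subgrp_Int[OF sM(1) sA(1)] by blast+
 \<comment> \<open>Since \<open>A\<close> is abelian, an element \<open>m c\<close> of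
   \<open>A\<close> is fixed by every \<open>d\<close>; as \<open>V\<close> is abelian too, this
   turns into \<open>c\<close> fixing every \<open>m d\<close>, hence all of
   \<open>M\<close>.\<close>
 have key: "c \<in> C" if c: "c \<in> A" "m c \<in> A" for c
 proof -
  have "cj c (m d) = m d" if d: "d \<in> A" for d
  proof -
   have "cj d (m c) = m c" using cA[OF d c(2)] by (simp add: cj_eq_iff)
   then have "inverse (cj d v) * cj (d * c) v = inverse v * cj c v"
    unfolding m_def by (simp add: cj_mult cj_inverse cj_comp)
   then have e: "cj (d * c) v = cj d v * (inverse v * cj c v)" by (metis grp_mult_inverse_cancel)
   have "cj c (m d) = inverse (cj c v) * cj (c * d) v" unfolding m_def by (simp add: cj_mult cj_inverse cj_comp)
   also have "c * d = d * c" using cA c d by blast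
   also have "inverse (cj c v) * cj (d * c) v = inverse (cj c v) * ((cj d v * inverse v) * cj c v)" using e by (simp add: mult.assoc)
   also have "(cj d v * inverse v) * cj c v = cj c v * (cj d v * inverse v)"
    using cV[of "cj d v * inverse v" "cj c v"] cjV d c vV sV(1) by (simp add: subgrp_closed)
   also have "inverse (cj c v) * (cj c v * (cj d v * inverse v)) = cj d v * inverse v" by simp
   also have "\<dots> = m d" unfolding m_def using cV[of "cj d v" "inverse v"] cjV d vV sV(1) by (simp add: subgrp_closed)
   finally show ?thesis .
  qed
  then have "m ` A \<subseteq> N \<inter> cent {c}" using mN by (auto simp: cent_def cj_eq_iff)
  then have "M \<subseteq> N \<inter> cent {c}" unfolding M_def by (intro genin_least subgrp_Int_cent sN) auto
  then show ?thesis using c(1) by (auto simp: C_def cent_def)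
 qed
 \<comment> \<open>By \<open>key\<close>, two elements of \<open>A\<close> with the same value of
   \<open>f\<close> differ by an element of \<open>C\<close>, so the index of \<open>C\<close> in
   \<open>A\<close> is at most the index of \<open>K\<close> in \<open>M\<close>. This is what makes
   \<open>B\<close> as large as \<open>A\<close>.\<close>
 define f where "f a = (*) (m a) ` K" for a
 have fib: "inverse a * b \<in> C" if ab: "a \<in> A" "b \<in> A" "f a = f b" for a b
 proof -
  have "inverse (m a) * m b \<in> A" using coset_eq_iff[OF sK(1)] ab(3) unfolding f_def K_def by blast
  moreover have "inverse (m a) * m b = cj a (m (inverse a * b))"
   unfolding m_def by (simp add: cj_mult cj_inverse mult.assoc flip: cj_comp)
  ultimately have "cj a (m (inverse a * b)) \<in> A" by simp
  then have "m (inverse a * b) \<in> A"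
   using subgrp_cj[OF sA(1) subgrp_inverse[OF sA(1) ab(1)], of "cj a (m (inverse a * b))"] by simp
  then show ?thesis using key ab(1,2) sA(1) by (simp add: subgrp_closed)
 qed
 have "card A \<le> card (f ` A) * card C"
 proof -
  have "card A = (\<Sum>y\<in>f ` A. card {a\<in>A. f a = y})"
   using sum.image_gen[of A "\<lambda>_. 1::nat" f] sA(1) by simp
  also have "\<dots> \<le> (\<Sum>y\<in>f ` A. card C)"
  proof (rule sum_mono)
   fix y assume "y \<in> f ` A"
   then obtain a0 where a0: "a0 \<in> A" "y = f a0" by blast
   have "{a\<in>A. f a = y} \<subseteq> (*) a0 ` C"
   proof
    fix a assume "a \<in> {a\<in>A. f a = y}"
    then have "inverse a0 * a \<in> C" using fib[of a0 a] a0 by auto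
    then have "a0 * (inverse a0 * a) \<in> (*) a0 ` C" by blast
    then show "a \<in> (*) a0 ` C" by simp
   qed
   then have "card {a\<in>A. f a = y} \<le> card ((*) a0 ` C)" using sC(1) by (intro card_mono) auto
   also have "\<dots> \<le> card C" using sC(1) by (intro card_image_le) simp
   finally show "card {a\<in>A. f a = y} \<le> card C" .
  qed
  finally show ?thesis by simp
 qed
 moreover have "f ` A \<subseteq> lcosets M K" unfolding f_def lcosets_def using sM(3) by blast
 then have "card (f ` A) \<le> card (lcosets M K)" using sM(1) by (intro card_mono) auto
 ultimately have cA': "card A \<le> card (lcosets M K) * card C" by (meson le_trans mult_le_mono1)
 have "card A \<le> card B"
 proof -
  have "card A * card K \<le> card (lcosets M K) * card C * card K" using cA' by simp
  also have "\<dots> = card M * card C" using card_lcosets[OF sM(1) sK] by (simp add: mult_ac)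
  also have "\<dots> = card B * card (M \<inter> C)" unfolding B_def using card_setmul[OF sM(1) sC(1)] by simp
  also have "\<dots> \<le> card B * card K" using sK(1) sC(2) unfolding K_def by (intro mult_le_mono2 card_mono) auto
  finally show ?thesis using sK(1) by simp
 qed
 then have BA: "B \<in> AA Q" unfolding AA_def using abB maxA le_trans by blast
 have "A \<inter> V \<subseteq> C" unfolding C_def cent_def using cV MV by blast
 then have "A \<inter> V \<subseteq> B" unfolding B_def using setmul_right[OF sM(1)] by blast
 moreover have "M \<subseteq> B" unfolding B_def using setmul_left[OF sC(1)] .
 moreover have "\<not> M \<subseteq> A"
 proof
  assume "M \<subseteq> A"
  have "inverse v \<in> nrm A"
  proof (rule nrmI)
   fix a assume a: "a \<in> A"
   have "m a \<in> A" using \<open>M \<subseteq> A\<close> sM(3) a by blast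
   then have "m a * a \<in> A" using a sA(1) by (simp add: subgrp_mult)
   moreover have "m a * a = cj (inverse v) a" by (simp add: m_def cj_def mult.assoc)
   ultimately show "cj (inverse v) a \<in> A" by simp
  qed (use sA in simp)
  then have "v \<in> nrm A" using nrm_inverse[of "inverse v"] by simp
  then show False using v(1) by (simp add: N_def)
 qed
 ultimately have "A \<inter> V \<subset> B \<inter> V" using MV by blast
 moreover have "B \<subseteq> nrm A"
 proof
  fix x assume "x \<in> B"
  then obtain a b where "a \<in> M" "b \<in> C" "x = a * b" unfolding B_def by (elim setmulE)
  then show "x \<in> nrm A" using sM(2) sC(2) subgrp_le_nrm[OF sA(1)] by (auto simp: N_def intro!: nrm_mult)
 qed
 ultimately show ?thesis using BA by blast
qed

text \<open>In additive notation for \<open>V\<close>: if \<open>a\<close> acts quadratically then \<open>a\<^sup>-\<^sup>1 = 2 - a\<close>, hence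
 \<open>a\<^sup>-\<^sup>1 u a - a u a\<^sup>-\<^sup>1 = 2 (u a - a u)\<close>; so \<open>u\<close> commutes with \<open>c = u a - a u\<close> and
 \<open>u\<^sup>m a - a u\<^sup>m = m u\<^sup>m\<^sup>-\<^sup>1 c\<close>.\<close>

lemma quadratic_commute:
 fixes a b u :: "'g::grp \<Rightarrow> 'g"
 assumes V: "subgrp V" and cV: "\<And>x y. x \<in> V \<Longrightarrow> y \<in> V \<Longrightarrow> x * y = y * x"
  and t2: "\<And>x. x \<in> V \<Longrightarrow> x ^ 2 = 1 \<Longrightarrow> x = 1" and tm: "\<And>x. x \<in> V \<Longrightarrow> x ^ m = 1 \<Longrightarrow> x = 1"
  and a: "\<And>x. x \<in> V \<Longrightarrow> a x \<in> V" "\<And>x y. x \<in> V \<Longrightarrow> y \<in> V \<Longrightarrow> a (x * y) = a x * a y"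
  and b: "\<And>x. x \<in> V \<Longrightarrow> b x \<in> V" "\<And>x y. x \<in> V \<Longrightarrow> y \<in> V \<Longrightarrow> b (x * y) = b x * b y"
  and u: "\<And>x. x \<in> V \<Longrightarrow> u x \<in> V" "\<And>x y. x \<in> V \<Longrightarrow> y \<in> V \<Longrightarrow> u (x * y) = u x * u y"
  and ab: "\<And>x. x \<in> V \<Longrightarrow> a (b x) = x" "\<And>x. x \<in> V \<Longrightarrow> b (a x) = x"
  and um: "m > 0" "\<And>x. x \<in> V \<Longrightarrow> (u ^^ m) x = x"
  and quad: "\<And>x. x \<in> V \<Longrightarrow> a (a x) * x = a x * a x"
  and c1: "\<And>x. x \<in> V \<Longrightarrow> u (b (u (a x))) = b (u (a (u x)))"
  and c2: "\<And>x. x \<in> V \<Longrightarrow> u (a (u (b x))) = a (u (b (u x)))"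
  and x: "x \<in> V"
 shows "u (a x) = a (u x)"
proof -
 have ac: "x * (y * z) = y * (x * z)" if "x \<in> V" "y \<in> V" "z \<in> V" for x y z
  using cV[of x y] that by (simp flip: mult.assoc)
 have inv: "h (inverse x) = inverse (h x)" if h: "\<And>x y. x \<in> V \<Longrightarrow> y \<in> V \<Longrightarrow> h (x * y) = h x * h y" and "x \<in> V" for h :: "'g \<Rightarrow> 'g" and x
 proof -
  have "h (x * inverse x) = h x * h (inverse x)" by (rule h[OF that(2) subgrp_inverse[OF V that(2)]])
  moreover have "h 1 * h 1 = h 1" using h[of 1 1] V by simp
  then have "h 1 = 1" by (simp only: grp_mult_eq_left)
  ultimately have "h x * h (inverse x) = 1" by simp
  then show ?thesis by (simp add: grp_inverse_unique)
 qed
 define c where "c y = u (a y) * inverse (a (u y))" for y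
 have cVV: "c y \<in> V" if "y \<in> V" for y using that a u V by (simp add: c_def subgrp_closed)
 have bx: "b y = y * y * inverse (a y)" if y: "y \<in> V" for y
 proof -
  have "a (a (b y)) * b y = a (b y) * a (b y)" using quad b y by blast
  then have "a y * b y = y * y" using ab y by simp
  then have "b y * a y = y * y" using cV[of "b y" "a y"] a b y by simp
  then show ?thesis by (metis grp_right_inverse mult.assoc mult_1_right)
 qed
 have r: "b (u (a y)) * inverse (a (u (b y))) = c y ^ 2" if y: "y \<in> V" for y
 proof -
  define s t w where "s = u (a y)" and "t = a (u y)" and "w = a (u (a y))"
  have V': "s \<in> V" "t \<in> V" "w \<in> V" using a u y by (auto simp: s_def t_def w_def)
  have 1: "b (u (a y)) = s * s * inverse w" using bx[of "u (a y)"] a u y by (simp add: s_def w_def)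
  have "a (u (b y)) = a (u (y * y * inverse (a y)))" using bx[OF y] by simp
  also have "\<dots> = t * t * inverse w"
   using a u y V inv[OF u(2)] inv[OF a(2)] by (simp add: subgrp_closed t_def w_def)
  finally have 2: "a (u (b y)) = t * t * inverse w" .
  have "b (u (a y)) * inverse (a (u (b y))) = s * (s * (inverse w * (w * (inverse t * inverse t))))"
   unfolding 1 2 by (simp add: mult.assoc)
  also have "\<dots> = s * (s * (inverse t * inverse t))" by simp
  also have "\<dots> = s * (inverse t * (s * inverse t))" using ac[of s "inverse t" "inverse t"] V' V by (simp add: subgrp_closed)
  also have "\<dots> = c y ^ 2" by (simp add: c_def s_def t_def power2_eq_square mult.assoc)
  finally show ?thesis .
 qed
 \<comment> \<open>\<open>c1\<close> and \<open>c2\<close> say that \<open>u\<close> commutes with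
   \<open>b u a\<close> and \<open>a u b\<close>, hence, by \<open>r\<close>, with the square of
   \<open>c\<close>; \<open>t2\<close> removes the square.\<close>
 have cu: "u (c y) = c (u y)" if y: "y \<in> V" for y
 proof -
  have p: "b (u (a y)) \<in> V" "a (u (b y)) \<in> V" using a b u y by auto
  have "u (c y) * u (c y) = u (c y ^ 2)" using u(2)[OF cVV[OF y] cVV[OF y]] by (simp add: power2_eq_square)
  also have "\<dots> = u (b (u (a y))) * inverse (u (a (u (b y))))"
   unfolding r[OF y, symmetric] using p V u(2) inv[OF u(2)] by (simp add: subgrp_closed)
  also have "\<dots> = b (u (a (u y))) * inverse (a (u (b (u y))))" using c1 c2 y by simp
  also have "\<dots> = c (u y) ^ 2" using r u(1) y by simp
  finally have e: "u (c y) * u (c y) = c (u y) * c (u y)" by (simp add: power2_eq_square)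
  define s t where "s = u (c y)" and "t = c (u y)"
  have V': "s \<in> V" "t \<in> V" using cVV u(1) y by (auto simp: s_def t_def)
  have "(s * inverse t) ^ 2 = s * (inverse t * (s * inverse t))" by (simp add: power2_eq_square mult.assoc)
  also have "\<dots> = s * s * inverse t * inverse t" using ac[of "inverse t" s "inverse t"] V' V by (simp add: subgrp_closed mult.assoc)
  also have "\<dots> = 1" using e unfolding s_def[symmetric] t_def[symmetric] by (simp add: mult.assoc)
  finally have "s * inverse t = 1" using t2 V' V by (simp add: subgrp_closed)
  then have "s = t" by (metis grp_inverse_inverse grp_inverse_unique grp_left_inverse grp_right_cancel grp_right_inverse)
  then show ?thesis by (simp add: s_def t_def)
 qed
 have uV: "(u ^^ j) y \<in> V" if "y \<in> V" for j y using that u(1) by (induction j) auto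
 have step: "(u ^^ Suc j) (a y) = a ((u ^^ Suc j) y) * c ((u ^^ j) y) ^ Suc j" if y: "y \<in> V" for j y
 proof (induction j)
  case 0
  have "u (a y) = c y * a (u y)" by (simp add: c_def mult.assoc)
  then show ?case using cV[of "c y" "a (u y)"] cVV y a u by simp
 next
  case (Suc j)
  let ?y = "(u ^^ Suc j) y"
  have pw: "u (z ^ n) = u z ^ n" if "z \<in> V" for z n
  proof (induction n)
   case 0
   have "u 1 * u 1 = u 1" using u(2)[of 1 1] V by simp
   then have "u 1 = 1" by (simp only: grp_mult_eq_left)
   then show ?case by simp
  next
   case (Suc n) then show ?case using u(2)[OF that subgrp_power[OF V that]] by simp
  qed
  have y': "?y \<in> V" "(u ^^ j) y \<in> V" using uV[OF y, of "Suc j"] uV[OF y, of j] by auto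
  have "(u ^^ Suc (Suc j)) (a y) = u (a ?y * c ((u ^^ j) y) ^ Suc j)" using Suc.IH by simp
  also have "\<dots> = u (a ?y) * u (c ((u ^^ j) y) ^ Suc j)" using u(2) a(1) y' cVV V by (simp add: subgrp_closed del: funpow.simps)
  also have "u (c ((u ^^ j) y) ^ Suc j) = c ?y ^ Suc j" using pw[OF cVV[OF y'(2)], of "Suc j"] cu[OF y'(2)] by (simp del: power_Suc)
  also have "u (a ?y) = c ?y * a (u ?y)" by (simp add: c_def mult.assoc)
  also have "\<dots> = a (u ?y) * c ?y" by (rule cV[OF cVV[OF y'(1)] a(1)[OF u(1)[OF y'(1)]]])
  finally show ?case by (simp add: mult.assoc)
 qed
 \<comment> \<open>At \<open>j = m - 1\<close> the iterate of \<open>u\<close> is the identity, so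
   the error term in \<open>step\<close> must be trivial; \<open>tm\<close> then removes the
   exponent.\<close>
 have cm: "c ((u ^^ (m - 1)) y) ^ m = 1" if y: "y \<in> V" for y
 proof -
  have "(u ^^ m) (a y) = a ((u ^^ m) y) * c ((u ^^ (m - 1)) y) ^ m" using step[OF y, of "m - 1"] um(1) by simp
  then show ?thesis using um(2) a(1) y by (metis grp_mult_eq_left)
 qed
 have "c ((u ^^ (m - 1)) (u x)) = 1" by (rule tm[OF cVV[OF uV[OF u(1)[OF x]]] cm[OF u(1)[OF x]]])
 moreover have "(u ^^ (m - 1)) (u x) = x"
  using um x by (metis Suc_diff_1 comp_apply funpow_Suc_right)
 ultimately have "c x = 1" by simp
 then show ?thesis unfolding c_def by (metis grp_inverse_inverse grp_inverse_unique grp_right_cancel grp_right_inverse)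
qed

subsection \<open>Thompson's normal complement theorem\<close>

lemma syl_subgroup:
 assumes "subgrp H" "prime q" "syl q H Q" "subgrp K" "Q \<subseteq> K" "K \<subseteq> H" shows "syl q K Q"
proof -
 obtain S where S: "syl q K S" "Q \<subseteq> S" using sylow_above[OF assms(4,2) sylD(3)[OF assms(3)] assms(5)] by blast
 have "S \<subseteq> H" using sylD(2)[OF S(1)] assms(6) by blast
 then obtain h where "S \<subseteq> cj h ` Q" using sylow_conj[OF assms(1,2,3) sylD(3)[OF S(1)]] by blast
 then have "card S \<le> card Q" using card_mono[of "cj h ` Q" S] sylD(1)[OF assms(3)] by simp
 then have "Q = S" using S(2) sylD(1)[OF S(1)] by (metis card_seteq subgrp_finite)
 then show ?thesis using S(1) by simp
qed

lemma normal_pgrp_le_syl: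
 assumes "subgrp H" "prime q" "syl q H Q" "nsub X H" "pgrp q X" shows "X \<subseteq> Q"
proof
 obtain h where h: "h \<in> H" "X \<subseteq> cj h ` Q"
  using sylow_conj[OF assms(1-3,5) nsubD(2)[OF assms(4)]] by blast
 fix x assume "x \<in> X"
 then have "cj h x \<in> cj h ` Q" using nsubD(3)[OF assms(4) h(1)] h(2) by blast
 then show "x \<in> Q" by auto
qed

lemma pgrp_homo_kernel:
 assumes "prime q" "homo H \<phi>" "x \<in> H" "pel q x" "p'el q (\<phi> x)" shows "\<phi> x = 1"
 using pel_p'el_trivial[OF assms(1) homo_pel[OF assms(2-4)] assms(5)] .

text \<open>The hypotheses describe a minimal counterexample: \<open>X\<close> is the largest normal
  \<open>q\<close>-subgroup, no non-trivial normal subgroup has order prime to \<open>q\<close>, the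
  quotient by \<open>X\<close> is \<open>q\<close>-nilpotent, and so are the proper subgroups
  containing \<open>Q\<close>. The contradiction comes from an element \<open>a\<close> outside
  \<open>X\<close> of an abelian subgroup of maximal order: it acts quadratically on the centre
  \<open>V\<close> of \<open>X\<close> and therefore centralizes the \<open>q'\<close>-group
  \<open>R\<close>, the core of the quotient.\<close>

lemma thompson_core:
 fixes \<phi> :: "'g::grp \<Rightarrow> 'h::grp"
 assumes q: "prime q" "odd q" and H: "subgrp H" and Q: "syl q H Q" and nq: "\<not> qnil q H"
  and hJ: "qnil q (H \<inter> nrm (JJ Q))" and hZ: "qnil q (H \<inter> nrm (ZZ Q))"
  and X: "nsub X H" "pgrp q X" and maxX: "\<And>Y. nsub Y H \<Longrightarrow> pgrp q Y \<Longrightarrow> Y \<subseteq> X"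
  and core1: "\<And>N. nsub N H \<Longrightarrow> coprime (card N) q \<Longrightarrow> N = {1}"
  and \<phi>: "homo H \<phi>" "ker H \<phi> = X" "qnil q (\<phi> ` H)"
  and sub: "\<And>K. subgrp K \<Longrightarrow> Q \<subseteq> K \<Longrightarrow> K \<subset> H \<Longrightarrow> qnil q K"
 shows False
proof -
 note QD = sylD[OF Q]
 have sX: "subgrp X" "X \<subseteq> H" using nsubD(1,2)[OF X(1)] .
 have ph: "\<phi> x = 1 \<longleftrightarrow> x \<in> X" if "x \<in> H" for x using \<phi>(2) that by (auto simp: ker_def)
 have XQ: "X \<subseteq> Q" using normal_pgrp_le_syl[OF H q(1) Q X] .
 define R where "R = core q (\<phi> ` H)"
 have sG: "subgrp (\<phi> ` H)" using homo_image_subgrp[OF \<phi>(1) H] by blast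
 have R: "nsub R (\<phi> ` H)" unfolding R_def using core_nsub[OF sG \<phi>(3)] .
 have copR: "coprime (card R) q" unfolding R_def using core_coprime[OF sG \<phi>(3) q(1)] .
 have Rp: "p'el q y" if "y \<in> R" for y using that by (simp add: R_def core_def)
 \<comment> \<open>The preimage of \<open>R\<close>: an extension of the \<open>q\<close>-group
   \<open>X\<close> by a \<open>q'\<close>-group, with \<open>H\<close> the product of
   \<open>E\<close> and \<open>Q\<close>.\<close>
 define E where "E = {x\<in>H. \<phi> x \<in> R}"
 have EH: "E \<subseteq> H" by (auto simp: E_def)
 have sE: "subgrp E" unfolding E_def using homo_preimage_subgrp[OF \<phi>(1) nsubD(1)[OF R]] .
 have nE: "nsub E H"
 proof (rule nsubI[OF sE EH])
  fix g x assume gx: "g \<in> H" "x \<in> E"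
  then have "\<phi> (cj g x) = cj (\<phi> g) (\<phi> x)" using homo_cj[OF \<phi>(1)] by (auto simp: E_def)
  then show "cj g x \<in> E" using nsubD(3)[OF R] gx subgrp_cj[OF H gx(1)] by (auto simp: E_def)
 qed
 have XE: "X \<subseteq> E" using sX(2) ph nsubD(1)[OF R] unfolding E_def by force
 have EX: "x \<in> X" if "x \<in> E" "pel q x" for x
  using pgrp_homo_kernel[OF q(1) \<phi>(1)] that Rp ph unfolding E_def by blast
 have p'E: "x \<in> E" if "x \<in> H" "p'el q x" for x
  using homo_p'el[OF \<phi>(1) that] that by (auto simp: E_def R_def core_def)
 have HEQ: "\<exists>e\<in>E. \<exists>s\<in>Q. h = e * s" if h: "h \<in> H" for h
 proof -
  have "\<phi> h \<in> setmul R (\<phi> ` Q)"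
   using core_decomp[OF sG \<phi>(3) q(1) homo_image_syl[OF \<phi>(1) q(1) Q]] h unfolding R_def by blast
  then obtain w s where ws: "w \<in> R" "s \<in> Q" "\<phi> h = w * \<phi> s" by (auto elim!: setmulE)
  have sH: "s \<in> H" using ws QD(2) by blast
  have "\<phi> (h * inverse s) = w"
   using homo_mult[OF \<phi>(1)] homo_inverse[OF \<phi>(1)] h sH H ws by (simp add: subgrp_closed mult.assoc)
  then have "h * inverse s \<in> E" using ws h sH H by (simp add: E_def subgrp_closed)
  moreover have "h = (h * inverse s) * s" by (simp add: mult.assoc)
  ultimately show ?thesis using ws by blast
 qed
 \<comment> \<open>The core of \<open>D\<close> is normal in \<open>H\<close>, so trivial by
   \<open>core1\<close>, and \<open>D\<close> is a normal \<open>q\<close>-subgroup.\<close>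
 have norm_pgrp: "D \<subseteq> X" if D: "nsub D H" "qnil q D" for D
 proof -
  note sD = nsubD(1,2)[OF D(1)]
  have "nsub (core q D) H"
  proof (rule nsubI)
   show "subgrp (core q D)" using core_nsub[OF sD(1) D(2)] nsubD(1) by blast
   show "core q D \<subseteq> H" using sD(2) by (auto simp: core_def)
   fix g x assume "g \<in> H" "x \<in> core q D"
   then show "cj g x \<in> core q D" using nsubD(3)[OF D(1)] by (simp add: core_def)
  qed
  then have c: "core q D = {1}" using core1 core_coprime[OF sD(1) D(2) q(1)] by blast
  have "pgrp q D"
  proof (rule no_p'el_imp_pgrp[OF sD(1) q(1)])
   fix x assume "x \<in> D" "p'el q x"
   then have "x \<in> core q D" by (simp add: core_def)
   then show "x = 1" using c by simp
  qed
  then show ?thesis using maxX D(1) by blast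
 qed
 have HnX: "H \<subseteq> nrm X" using nsub_le_nrm[OF X(1)] .
 \<comment> \<open>The \<open>q\<close>-subgroups of \<open>?D\<close> lie in \<open>X\<close> and
   are centralized by \<open>?D\<close>, so Frobenius' condition holds and \<open>?D\<close> lies in
   \<open>X\<close>. As all elements of \<open>H\<close> of order prime to \<open>q\<close> lie in
   \<open>E\<close>, the centralizer of \<open>X\<close> has none but 1.\<close>
 have CX: "H \<inter> cent X \<subseteq> X"
 proof -
  let ?D = "H \<inter> cent X \<inter> E"
  have nC: "nsub (H \<inter> cent X) H" using nsub_Int_cent[OF H] HnX by blast
  have nD: "nsub ?D H"       by (rule nsubI[OF subgrp_Int[OF nsubD(1)[OF nC] sE]]) (use nsubD(3)[OF nC] nsubD(3)[OF nE] in auto)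
  have "frob q ?D" unfolding frob_def
  proof (intro allI impI ballI)
   fix Y g assume Y: "pgrp q Y \<and> Y \<subseteq> ?D \<and> Y \<noteq> {1}" and g: "g \<in> ?D" "p'el q g \<and> g \<in> nrm Y"
   have "Y \<subseteq> X" using Y EX pgrp_pel by blast
   then show "g \<in> cent Y" using g(1) cent_antimono by blast
  qed
  then have qD: "qnil q ?D" using frobenius_qnil[OF nsubD(1)[OF nD] q(1)] by blast
  have DX: "?D \<subseteq> X" using norm_pgrp[OF nD qD] .
  have "x = 1" if x: "x \<in> H \<inter> cent X" "p'el q x" for x
  proof -
   have "x \<in> X" using p'E x DX by blast
   then show ?thesis using pel_p'el_trivial[OF q(1)] pgrp_pel[OF X(2)] x(2) by blast
  qed
  then have "pgrp q (H \<inter> cent X)" using no_p'el_imp_pgrp[OF nsubD(1)[OF nC] q(1)] by blast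
  then show ?thesis using maxX nC by blast
 qed
 define V where "V = ZZ X"
 have VX: "V \<subseteq> X" unfolding V_def by (rule ZZ_le)
 have sV: "subgrp V" unfolding V_def using ZZ_subgrp[OF sX(1)] .
 have cVX: "v * x = x * v" if "v \<in> V" "x \<in> X" for v x using that unfolding V_def ZZ_def cent_def by blast
 have HnV: "H \<subseteq> nrm V" unfolding V_def using HnX nrm_ZZ[OF sX(1)] by blast
 have ZQV: "ZZ Q \<subseteq> V"
 proof
  fix z assume z: "z \<in> ZZ Q"
  then have "z \<in> cent X" using XQ cent_antimono unfolding ZZ_def by blast
  moreover have "z \<in> H" using z QD(2) ZZ_le by blast
  ultimately show "z \<in> V" using CX by (auto simp: V_def ZZ_def)
 qed
 \<comment> \<open>\<open>V\<close> contains the centre of \<open>Q\<close>, so its centralizer lies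
   in the \<open>q\<close>-nilpotent normalizer of \<open>ZZ Q\<close>.\<close>
 have CV: "H \<inter> cent V \<subseteq> X"
 proof -
  have nW: "nsub (H \<inter> cent V) H" using nsub_Int_cent[OF H] HnV by blast
  have "H \<inter> cent V \<subseteq> H \<inter> nrm (ZZ Q)" using cent_antimono[OF ZQV] cent_le_nrm by blast
  then have "qnil q (H \<inter> cent V)" using qnil_subset[OF hZ] by blast
  then show ?thesis using norm_pgrp nW by blast
 qed
 have ex: "\<exists>A\<in>AA Q. \<not> A \<subseteq> X"
 proof (rule ccontr)
  assume "\<not> ?thesis"
  then have "JJ Q \<subseteq> X" unfolding JJ_def using sX(1) XQ by (intro genin_least) auto
  then have "JJ X = JJ Q" using JJ_eq_if_le[OF QD(1) sX(1) XQ] by blast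
  then have "H \<subseteq> nrm (JJ Q)" using HnX nrm_JJ[OF sX(1)] by auto
  then have "H \<inter> nrm (JJ Q) = H" by blast
  then show False using hJ nq by simp
 qed
 have VQ: "V \<subseteq> Q" using VX XQ by blast
 have abV: "absub Q V" unfolding absub_def using sV VQ cVX VX by blast
 \<comment> \<open>Take \<open>A\<close> outside \<open>X\<close> with \<open>A \<inter> V\<close>
   as large as possible. If \<open>V\<close> did not normalize \<open>A\<close>, the replacement
   \<open>B\<close> would meet \<open>V\<close> in more and hence lie in \<open>X\<close>; then
   \<open>B\<close> commutes with \<open>V\<close>, so it contains \<open>V\<close> by maximality of
   its order, although \<open>B\<close> normalizes \<open>A\<close>.\<close>
 have "\<exists>A\<in>AA Q. \<not> A \<subseteq> X \<and> V \<subseteq> nrm A"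
 proof -
  let ?S = "{A\<in>AA Q. \<not> A \<subseteq> X}"
  have fin: "finite ?S" using QD(1) by (auto intro!: finite_subset[of _ "Pow Q"] simp: AA_def absub_def)
  have "?S \<noteq> {}" using ex by blast
  then have "Max ((\<lambda>A. card (A \<inter> V)) ` ?S) \<in> (\<lambda>A. card (A \<inter> V)) ` ?S" using fin by (intro Max_in) auto
  then obtain A where A2: "Max ((\<lambda>A. card (A \<inter> V)) ` ?S) = card (A \<inter> V)" and A1: "A \<in> ?S" by (rule imageE)
  note A = A1 A2[symmetric]
  have Amax: "card (B \<inter> V) \<le> card (A \<inter> V)" if "B \<in> ?S" for B using A(2) fin that by simp
  have AQ: "A \<in> AA Q" "subgrp A" "A \<subseteq> Q" using A(1) by (auto simp: AA_def absub_def)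
  have "V \<subseteq> nrm A"
  proof (rule ccontr)
   assume nV: "\<not> V \<subseteq> nrm A"
   have AV: "A \<subseteq> nrm V" using AQ(3) QD(2) HnV by blast
   obtain B where B: "B \<in> AA Q" "A \<inter> V \<subset> B \<inter> V" "B \<subseteq> nrm A"
    using thompson_replacement[OF q(1) QD(3) AQ(1) abV AV nV] by blast
   have sB: "subgrp B" "B \<subseteq> Q" "\<And>x y. x \<in> B \<Longrightarrow> y \<in> B \<Longrightarrow> x * y = y * x"
    and mB: "\<And>C. absub Q C \<Longrightarrow> card C \<le> card B" using B(1) by (auto simp: AA_def absub_def)
   have "card (A \<inter> V) < card (B \<inter> V)" using B(2) sV by (intro psubset_card_mono) auto
   then have "B \<notin> ?S" using Amax by fastforce
   then have BX: "B \<subseteq> X" using B(1) by blast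
   have vb: "v * b = b * v" if "v \<in> V" "b \<in> B" for v b using cVX that BX by blast
   let ?C = "setmul B V"
   have abB: "absub Q B" using B(1) by (simp add: AA_def)
   have abC: "absub Q ?C" by (rule absub_setmul[OF QD(1) abB abV]) (use vb in simp)
   then have sC: "subgrp ?C" by (simp add: absub_def)
   have "card ?C \<le> card B" using mB[OF abC] .
   moreover have "B \<subseteq> ?C" using setmul_left[OF sV] .
   ultimately have "?C = B" using sC by (metis card_seteq subgrp_finite)
   then have "V \<subseteq> B" using setmul_right[OF sB(1), of V] by simp
   then show False using nV B(3) by blast
  qed
  then show ?thesis using A(1) by blast
 qed
 then obtain A a where A: "A \<in> AA Q" "V \<subseteq> nrm A" "a \<in> A" "a \<notin> X" by blast
 have sA: "subgrp A" "A \<subseteq> Q" "\<And>x y. x \<in> A \<Longrightarrow> y \<in> A \<Longrightarrow> x * y = y * x" using A(1) by (auto simp: AA_def absub_def)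
 have aH: "a \<in> H" using A(3) sA(2) QD(2) by blast
 \<comment> \<open>The product of \<open>E1\<close> and \<open>Q\<close> is a proper subgroup, hence
   \<open>q\<close>-nilpotent, so the elements of \<open>E1\<close> of order prime to
   \<open>q\<close> centralize the normal \<open>q\<close>-subgroup \<open>X\<close>; by
   \<open>CX\<close> they are trivial.\<close>
 have minE: "E1 = X" if E1: "subgrp E1" "X \<subseteq> E1" "E1 \<subset> E" "Q \<subseteq> nrm E1" for E1
 proof -
  let ?K = "setmul E1 Q"
  have E1H: "E1 \<subseteq> H" using E1(3) EH by blast
  have sK: "subgrp ?K" using E1(4) nrm_cj by (intro subgrp_setmul E1(1) QD(1)) blast
  have KH: "?K \<subseteq> H" using setmul_subset[OF H E1H QD(2)] .
  have QK: "Q \<subseteq> ?K" using setmul_right[OF E1(1)] .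
  have "?K \<noteq> H"
  proof
   assume KeH: "?K = H"
   have "e \<in> E1" if e: "e \<in> E" for e
   proof -
    have "e \<in> ?K" using e EH KeH by blast
    then obtain e1 s where es: "e1 \<in> E1" "s \<in> Q" "e = e1 * s" by (elim setmulE)
    have "s = inverse e1 * e" using es by simp
    moreover have "e1 \<in> E" using es(1) E1(3) by blast
    then have "inverse e1 * e \<in> E" using e sE by (intro subgrp_mult subgrp_inverse)
    ultimately have "s \<in> E" by simp
    then have "s \<in> E1" using EX pgrp_pel[OF QD(3) es(2)] E1(2) by blast
    then show ?thesis using es E1(1) by (simp add: subgrp_mult)
   qed
   then show False using E1(3) by blast
  qed
  then have qK: "qnil q ?K" using sub[OF sK QK] KH by blast
  have nX: "nsub X ?K" using X(1) KH XQ QK by (auto intro!: nsubI dest: nsubD)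
  have "pgrp q E1"
  proof (rule no_p'el_imp_pgrp[OF E1(1) q(1)])
   fix x assume x: "x \<in> E1" "p'el q x"
   have "x \<in> core q ?K" using x setmul_left[OF QD(1)] by (auto simp: core_def)
   then have "x \<in> cent X" using qnil_commute[OF sK qK q(1) nX X(2)] by (simp add: cent_def)
   then have "x \<in> X" using CX x(1) E1H by blast
   then show "x = 1" using pel_p'el_trivial[OF q(1)] pgrp_pel[OF X(2)] x(2) by blast
  qed
  then have "E1 \<subseteq> X" using EX pgrp_pel E1(3) by blast
  then show ?thesis using E1(2) by blast
 qed
 have QnR: "\<phi> ` Q \<subseteq> nrm R" using nsub_le_nrm[OF R] QD(2) by blast
 have minR: "R1 = R" if R1: "subgrp R1" "R1 \<subseteq> R" "R1 \<noteq> {1}" "\<phi> ` Q \<subseteq> nrm R1" for R1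
 proof (rule ccontr)
  assume "R1 \<noteq> R"
  let ?E1 = "{x\<in>H. \<phi> x \<in> R1}"
  have Rim: "\<exists>x\<in>H. \<phi> x = y" if "y \<in> R" for y using that nsubD(2)[OF R] by blast
  have s1: "subgrp ?E1" using homo_preimage_subgrp[OF \<phi>(1) R1(1)] .
  have "X \<subseteq> ?E1" using sX(2) ph R1(1) by force
  moreover have "?E1 \<subset> E" using R1(2) \<open>R1 \<noteq> R\<close> Rim unfolding E_def by blast
  moreover have "Q \<subseteq> nrm ?E1"
  proof
   fix s assume s: "s \<in> Q"
   show "s \<in> nrm ?E1"
   proof (rule nrmI)
    fix x assume x: "x \<in> ?E1"
    have sH: "s \<in> H" using s QD(2) by blast
    have "\<phi> (cj s x) = cj (\<phi> s) (\<phi> x)" using homo_cj[OF \<phi>(1) sH] x by blast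
    moreover have "cj (\<phi> s) (\<phi> x) \<in> R1" using nrm_cj R1(4) s x by blast
    ultimately show "cj s x \<in> ?E1" using subgrp_cj[OF H sH] x by simp
   qed (use H in simp)
  qed
  ultimately have "?E1 = X" using minE[OF s1] by blast
  moreover obtain y where y: "y \<in> R1" "y \<noteq> 1" using R1(1,3) subgrp_one[OF R1(1)] by blast
  moreover obtain x where "x \<in> H" "\<phi> x = y" using Rim R1(2) y(1) by blast
  ultimately show False using ph by blast
 qed
 have "R \<noteq> {1}"
 proof
  assume R1: "R = {1}"
  have "H \<subseteq> Q"
  proof
   fix h assume "h \<in> H"
   then obtain e s where es: "e \<in> E" "s \<in> Q" "h = e * s" using HEQ by blast
   have "e \<in> X" using es(1) R1 ph by (auto simp: E_def)
   then show "h \<in> Q" using es XQ QD(1) by (auto intro: subgrp_mult)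
  qed
  then have "H = Q" using QD(2) by blast
  then show False using nq pgrp_qnil[OF q(1) QD(3)] by simp
 qed
 have sR: "subgrp R" using nsubD(1)[OF R] .
 have "card R \<noteq> 1" using \<open>R \<noteq> {1}\<close> subgrp_one[OF sR] by (metis card_1_singletonE singletonD)
 then obtain r where r: "prime r" "r dvd card R" using prime_factor_nat by blast
 have pQ: "pgrp q (\<phi> ` Q)" using homo_image_pgrp[OF \<phi>(1) q(1) QD(3,2)] .
 have nqR: "\<not> q dvd card R" using copR coprime_prime_iff[OF q(1)] by blast
 \<comment> \<open>A Sylow subgroup of \<open>R\<close> invariant under \<open>Q\<close> is all of
   \<open>R\<close> by \<open>minR\<close>, and so is the centre of \<open>R\<close>; thus
   \<open>R\<close> is an abelian \<open>r\<close>-group.\<close>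
 obtain R1 where R1: "syl r R R1" "\<phi> ` Q \<subseteq> nrm R1" using invariant_sylow[OF sR r(1) q(1) pQ QnR nqR] by blast
 have "R1 \<noteq> {1}"
 proof
  assume "R1 = {1}"
  then have "card R1 = 1" by simp
  then have "multiplicity r (card R) = 0"
   using sylD(4)[OF R1(1)] prime_gt_1_nat[OF r(1)] by (metis less_irrefl nat_power_eq_Suc_0_iff One_nat_def)
  then show False using multiplicity_pos_iff_dvd[OF r(1), of "card R"] r(2) sR by simp
 qed
 then have "R1 = R" using minR sylD(1,2)[OF R1(1)] R1(2) by blast
 then have pR: "pgrp r R" using sylD(3)[OF R1(1)] by simp
 have "ZZ R = R"
 proof (rule minR)
  show "subgrp (ZZ R)" using ZZ_subgrp[OF sR] .
  show "ZZ R \<subseteq> R" by (rule ZZ_le)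
  show "ZZ R \<noteq> {1}" using ZZ_nontrivial[OF r(1) pR \<open>R \<noteq> {1}\<close>] .
  show "\<phi> ` Q \<subseteq> nrm (ZZ R)" using QnR nrm_ZZ[OF sR] by blast
 qed
 then have cR: "y * z = z * y" if "y \<in> R" "z \<in> R" for y z using that unfolding ZZ_def cent_def by blast
 define m where "m = card R"
 have m: "m > 0" "coprime m q" using sR copR by (auto simp: m_def)
 \<comment> \<open>\<open>X\<close> centralizes \<open>V\<close>, so the action of \<open>H\<close>
   on \<open>V\<close> depends only on images under \<open>\<phi>\<close>.\<close>
 have act: "cj x v = cj y v" if xy: "x \<in> H" "y \<in> H" "\<phi> x = \<phi> y" and v: "v \<in> V" for x y v
 proof -
  have "inverse x * y \<in> X" using homo_eq_iff[OF \<phi>(1) xy(1,2)] xy(3) \<phi>(2) by blast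
  then have "cj (inverse x * y) v = v" using cVX[OF v] by (simp add: cj_eq_iff)
  then have "cj x (cj (inverse x * y) v) = cj x v" by simp
  then show ?thesis by (simp flip: cj_comp)
 qed
 have pV: "pgrp q V" using pgrp_subset[OF q(1) X(2) sV VX] .
 have tors: "v = 1" if "v \<in> V" "v ^ n = 1" "coprime n q" for v n
  using pel_p'el_trivial[OF q(1)] pgrp_pel[OF pV that(1)] that unfolding p'el_def by blast
 have acomm: "\<phi> a * \<phi> u = \<phi> u * \<phi> a" if u: "u \<in> E" for u
 proof -
  have uH: "u \<in> H" using u EH by blast
  have iaH: "inverse a \<in> H" using aH H by (simp add: subgrp_inverse)
  have nV: "cj h v \<in> V" if "h \<in> H" "v \<in> V" for h v using nrm_cj HnV that by blast
  have cjE: "\<phi> (cj h u) \<in> R" if "h \<in> H" for h using nsubD(3)[OF nE that u] by (simp add: E_def)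
  have comm: "cj u (cj (cj h u) v) = cj (cj h u) (cj u v)" if h: "h \<in> H" and v: "v \<in> V" for h v
  proof -
   have hu: "cj h u \<in> H" using subgrp_cj[OF H h uH] .
   have "\<phi> (u * cj h u) = \<phi> (cj h u * u)"
    using homo_mult[OF \<phi>(1)] uH hu cR[of "\<phi> u" "\<phi> (cj h u)"] cjE[OF h] u by (simp add: E_def)
   then have "cj (u * cj h u) v = cj (cj h u * u) v" using act[OF _ _ _ v] uH hu H by (simp add: subgrp_mult)
   then show ?thesis by (simp add: cj_comp)
  qed
  have "cj u (cj a v) = cj a (cj u v)" if v: "v \<in> V" for v
  \<comment> \<open>Conjugation by \<open>a\<close> is quadratic on \<open>V\<close> because
    \<open>V\<close> normalizes the abelian group \<open>A\<close>. The two conditions on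
    \<open>u\<close> say that on \<open>V\<close> it commutes with its conjugates by
    \<open>a\<close> and \<open>inverse a\<close>, which holds since \<open>R\<close> is abelian.
    Oddness of \<open>q\<close> excludes elements of order two in \<open>V\<close>.\<close>
  proof (rule quadratic_commute[where V = V and b = "cj (inverse a)" and m = m])
   show "subgrp V" by (rule sV)
   show "x * y = y * x" if "x \<in> V" "y \<in> V" for x y using cVX that VX by blast
   show "x = 1" if "x \<in> V" "x ^ 2 = 1" for x using tors[OF that] q(2) by simp
   show "x = 1" if "x \<in> V" "x ^ m = 1" for x using tors[OF that] m(2) by simp
   show "(cj u ^^ m) x = x" if x: "x \<in> V" for x
   proof -
    have "(cj u ^^ n) x = cj (u ^ n) x" for n by (induction n) (simp_all add: cj_comp)
    moreover have "\<phi> (u ^ m) = 1"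
     using homo_power[OF \<phi>(1) uH] subgrp_power_card[OF sR, of "\<phi> u"] u by (simp add: m_def E_def)
    then have "\<phi> (u ^ m) = \<phi> 1" using homo_one[OF \<phi>(1)] by simp
    then have "cj (u ^ m) x = cj 1 x" by (rule act[OF subgrp_power[OF H uH] subgrp_one[OF H] _ x])
    ultimately show ?thesis by simp
   qed
   show "cj a (cj a x) * x = cj a x * cj a x" if x: "x \<in> V" for x
   proof -
    have xA: "inverse x \<in> nrm A" using A(2) x nrm_inverse by blast
    have "cj (inverse x) a * inverse a \<in> A" using nrm_cj[OF xA A(3)] A(3) sA(1) by (simp add: subgrp_closed)
    moreover have e: "cj (inverse x) a * inverse a = inverse x * cj a x" by (simp add: cj_def mult.assoc)
    ultimately have "a * (inverse x * cj a x) = (inverse x * cj a x) * a" using sA(3)[OF A(3)] by simp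
    then have "cj a (inverse x * cj a x) = inverse x * cj a x" by (simp add: cj_eq_iff)
    then have 1: "inverse (cj a x) * cj a (cj a x) = inverse x * cj a x" by (simp add: cj_mult cj_inverse)
    define y z where "y = cj a x" and "z = cj a (cj a x)"
    have yz: "y \<in> V" "z \<in> V" using nV aH x by (auto simp: y_def z_def)
    have "inverse y * z = inverse x * y" using 1 by (simp add: y_def z_def)
    then have "z = y * (inverse x * y)" by (metis grp_mult_inverse_cancel)
    also have "\<dots> = y * (y * inverse x)" using cVX[of "inverse x" y] x yz VX sV by (metis subgrp_inverse subsetD)
    finally have "z * x = y * y" by (simp add: mult.assoc)
    then show ?thesis by (simp add: y_def z_def)
   qed
   show "cj u (cj (inverse a) (cj u (cj a x))) = cj (inverse a) (cj u (cj a (cj u x)))" if "x \<in> V" for x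
    using comm[OF iaH that] by (simp add: cj_def[of "inverse a" u] cj_comp)
   show "cj u (cj a (cj u (cj (inverse a) x))) = cj a (cj u (cj (inverse a) (cj u x)))" if "x \<in> V" for x
    using comm[OF aH that] by (simp add: cj_def[of a u] cj_comp)
  qed (use nV aH uH iaH v m(1) in \<open>auto simp: cj_mult\<close>)
  \<comment> \<open>The products \<open>u * a\<close> and \<open>a * u\<close> act alike on
    \<open>V\<close>, and by \<open>CV\<close> the centralizer of \<open>V\<close> lies in the
    kernel of \<open>\<phi>\<close>.\<close>
  then have "inverse (u * a) * (a * u) \<in> cent V"
   unfolding cent_iff_cj by (simp add: cj_comp) (metis cj_cancel(2))
  then have "inverse (u * a) * (a * u) \<in> ker H \<phi>" using CV \<phi>(2) uH aH H by (auto simp: subgrp_closed simp del: grp_inverse_mult)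
  then have "\<phi> (u * a) = \<phi> (a * u)" using homo_eq_iff[OF \<phi>(1)] uH aH H by (simp add: subgrp_mult)
  then show ?thesis using homo_mult[OF \<phi>(1)] uH aH by simp
 qed
 \<comment> \<open>The elements of \<open>Q\<close> that centralize \<open>E\<close> modulo
   \<open>X\<close>. Conjugation by \<open>E\<close> moves them only within cosets of
   \<open>X\<close>, which lies in \<open>Y\<close>, and \<open>Q\<close> preserves the condition;
   so \<open>Y\<close> is a normal \<open>q\<close>-subgroup of \<open>H\<close> and lies in
   \<open>X\<close>, although it contains \<open>a\<close>.\<close>
 define Y where "Y = {y\<in>Q. \<forall>e\<in>E. \<phi> y * \<phi> e = \<phi> e * \<phi> y}"
 have Rim': "\<exists>e\<in>E. \<phi> e = z" if "z \<in> R" for z using that nsubD(2)[OF R] unfolding E_def by blast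
 have sY: "subgrp Y"
 proof (rule subgrpI)
  show "finite Y" unfolding Y_def using QD(1) by simp
  show "1 \<in> Y" unfolding Y_def using QD(1) homo_one[OF \<phi>(1)] by simp
  fix x y assume xy: "x \<in> Y" "y \<in> Y"
  then have "x \<in> H" "y \<in> H" using QD(2) by (auto simp: Y_def)
  then have "\<phi> (x * y) = \<phi> x * \<phi> y" using homo_mult[OF \<phi>(1)] by blast
  moreover have "\<phi> x * \<phi> y * \<phi> e = \<phi> e * (\<phi> x * \<phi> y)" if "e \<in> E" for e
   using xy that unfolding Y_def by (auto simp: mult.assoc) (metis mult.assoc)
  ultimately show "x * y \<in> Y" using xy QD(1) by (simp add: Y_def subgrp_mult)
 qed
 have XY: "X \<subseteq> Y"
 proof
  fix x assume x: "x \<in> X"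
  then have "\<phi> x = 1" using ph sX(2) by blast
  then show "x \<in> Y" unfolding Y_def using x XQ by auto
 qed
 have YE: "cj e y \<in> Y" if "e \<in> E" "y \<in> Y" for e y
 proof -
  have H': "e \<in> H" "y \<in> H" using that EH QD(2) by (auto simp: Y_def)
  have "\<phi> (cj e y) = cj (\<phi> e) (\<phi> y)" using homo_cj[OF \<phi>(1) H'] .
  also have "\<dots> = \<phi> y" using that by (simp add: cj_eq_iff Y_def)
  finally have "inverse y * cj e y \<in> X" using homo_eq_iff[OF \<phi>(1) H'(2) subgrp_cj[OF H H']] \<phi>(2) by simp
  then have "inverse y * cj e y \<in> Y" using XY by blast
  then have "y * (inverse y * cj e y) \<in> Y" by (rule subgrp_mult[OF sY that(2)])
  then show ?thesis by simp
 qed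
 have YQ: "cj s y \<in> Y" if "s \<in> Q" "y \<in> Y" for s y
 proof -
  have H': "s \<in> H" "y \<in> H" "inverse s \<in> H" using that QD H by (auto simp: Y_def subgrp_closed)
  have "cj s y \<in> Q" using that QD(1) by (simp add: Y_def subgrp_cj)
  moreover have "\<phi> (cj s y) * \<phi> e = \<phi> e * \<phi> (cj s y)" if e: "e \<in> E" for e
  proof -
   have e': "cj (inverse s) e \<in> E" using nsubD(3)[OF nE H'(3) e] .
   then have "cj (\<phi> y) (\<phi> (cj (inverse s) e)) = \<phi> (cj (inverse s) e)" using \<open>y \<in> Y\<close> by (simp add: cj_eq_iff Y_def)
   then have "cj (\<phi> s) (cj (\<phi> y) (cj (inverse (\<phi> s)) (\<phi> e))) = cj (\<phi> s) (cj (inverse (\<phi> s)) (\<phi> e))"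
    using homo_cj[OF \<phi>(1) H'(3), of e] homo_inverse[OF \<phi>(1) H'(1)] e EH by auto
   then have "cj (cj (\<phi> s) (\<phi> y)) (\<phi> e) = \<phi> e" by (simp add: cj_def[of "\<phi> s" "\<phi> y"] cj_comp)
   then show ?thesis using homo_cj[OF \<phi>(1) H'(1,2)] by (simp add: cj_eq_iff)
  qed
  ultimately show ?thesis by (simp add: Y_def)
 qed
 have "nsub Y H"
 proof (rule nsubI[OF sY])
  show "Y \<subseteq> H" using QD(2) by (auto simp: Y_def)
  fix g x assume "g \<in> H" "x \<in> Y"
  moreover obtain e s where "e \<in> E" "s \<in> Q" "g = e * s" using HEQ[OF \<open>g \<in> H\<close>] by blast
  ultimately show "cj g x \<in> Y" using YE YQ by (simp add: cj_comp)
 qed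
 moreover have "pgrp q Y" using pgrp_subset[OF q(1) QD(3) sY] by (auto simp: Y_def)
 ultimately have "Y \<subseteq> X" using maxX by blast
 moreover have "a \<in> Y" unfolding Y_def using A(3) sA(2) acomm by blast
 ultimately show False using A(4) by blast
qed

text \<open>A Frattini argument: \<open>X\<close> is a Sylow subgroup of the product of
  \<open>N\<close> and \<open>X\<close>, so a conjugate of \<open>X\<close> with the same image is
  already conjugate to it under \<open>N\<close>.\<close>

lemma frattini_coprime:
 assumes q: "prime q" and H: "subgrp H" and N: "nsub N H" "coprime (card N) q"
  and \<phi>: "homo H \<phi>" "ker H \<phi> = N" and X: "pgrp q X" "X \<subseteq> H"
 shows "\<phi> ` H \<inter> nrm (\<phi> ` X) \<subseteq> \<phi> ` (H \<inter> nrm X)"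
proof
 fix y assume "y \<in> \<phi> ` H \<inter> nrm (\<phi> ` X)"
 then obtain h where h: "h \<in> H" "y = \<phi> h" "\<phi> h \<in> nrm (\<phi> ` X)" by blast
 note sN = nsubD(1,2)[OF N(1)]
 let ?K = "setmul N X"
 have sK: "subgrp ?K" using nsubD(3)[OF N(1)] X by (intro subgrp_setmul sN(1)) auto
 have KH: "?K \<subseteq> H" using setmul_subset[OF H sN(2) X(2)] .
 have "N \<inter> X = {1}"
  using pel_p'el_trivial[OF q] coprime_card_p'el[OF sN(1) N(2)] pgrp_pel[OF X(1)] sN(1) X(1) subgrp_one pgrp_subgrp by blast
 then have cK: "card ?K = card N * card X" using card_setmul[OF sN(1) pgrp_subgrp[OF X(1)]] by simp
 obtain k where k: "card X = q ^ k" using X(1) unfolding pgrp_def by blast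
 have "multiplicity q (card ?K) = k"
 proof -
  have "\<not> q dvd card N" using N(2) coprime_prime_iff[OF q] by blast
  then have "multiplicity q (q ^ k * card N) = k"
   using prime_gt_0_nat[OF q] by (intro multiplicity_eqI) (auto simp: mult.commute[of q])
  then show ?thesis using cK k by (simp add: mult.commute)
 qed
 then have X1: "syl q ?K X" unfolding syl_def using setmul_right[OF sN(1)] X(1) k pgrp_subgrp by blast
 have "cj h ` X \<subseteq> ?K"
 proof
  fix z assume "z \<in> cj h ` X"
  then obtain x where x: "x \<in> X" "z = cj h x" by blast
  have "\<phi> z = cj (\<phi> h) (\<phi> x)" using homo_cj[OF \<phi>(1) h(1)] x X(2) by auto
  then have "\<phi> z \<in> \<phi> ` X" using nrm_cj[OF h(3)] x(1) by auto
  then obtain x' where x': "x' \<in> X" "\<phi> z = \<phi> x'" by blast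
  have zH: "z \<in> H" "x' \<in> H" using x x' X(2) subgrp_cj[OF H h(1)] by auto
  have "inverse z * x' \<in> N" using homo_eq_iff[OF \<phi>(1) zH] x'(2) \<phi>(2) by simp
  then have "cj z (inverse (inverse z * x')) \<in> N" using nsubD(3)[OF N(1) zH(1)] sN(1) by (simp add: subgrp_inverse del: grp_inverse_mult)
  moreover have "z = cj z (inverse (inverse z * x')) * x'" by (simp add: cj_def mult.assoc)
  ultimately show "z \<in> ?K" using setmulI[OF _ x'(1), of "cj z (inverse (inverse z * x'))" N] by simp
 qed
 then have X2: "syl q ?K (cj h ` X)"
  using X1 subgrp_cj_image[OF pgrp_subgrp[OF X(1)]] unfolding syl_def by simp
 obtain c where c: "c \<in> ?K" "cj h ` X = cj c ` X" using sylow_conj_eq[OF sK q X1 X2] by blast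
 then obtain n x where nx: "n \<in> N" "x \<in> X" "c = n * x" by (elim setmulE)
 have "cj x ` X = X" using subgrp_le_nrm[OF pgrp_subgrp[OF X(1)]] nx(2) by (auto simp: nrm_def)
 then have "cj h ` X = cj n ` X" using c(2) nx(3) by (simp add: cj_image_comp)
 then have "cj (inverse n * h) ` X = cj (inverse n * n) ` X" by (simp only: cj_image_comp)
 then have 1: "inverse n * h \<in> H \<inter> nrm X" using h(1) nx(1) sN(2) H by (auto simp: nrm_def subgrp_closed)
 have nH: "n \<in> H" "\<phi> n = 1" using nx(1) sN(2) \<phi>(2) by (auto simp: ker_def)
 have "\<phi> (inverse n * h) = y"
  using homo_mult[OF \<phi>(1)] homo_inverse[OF \<phi>(1)] nH h H by (simp add: subgrp_inverse)
 then show "y \<in> \<phi> ` (H \<inter> nrm X)" using 1 by blast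
qed

lemma qnil_lift_coprime:
 assumes q: "prime q" and \<phi>: "homo H \<phi>" "coprime (card (ker H \<phi>)) q" "qnil q (\<phi> ` H)"
 shows "qnil q H"
 unfolding qnil_def
proof (intro ballI impI)
 fix x y assume xy: "x \<in> H" "y \<in> H" "p'el q x" "p'el q y"
 note s = homo_subgrp[OF \<phi>(1)]
 have xyH: "x * y \<in> H" using xy s by (simp add: subgrp_mult)
 have "p'el q (\<phi> x * \<phi> y)" using \<phi>(3) xy homo_p'el[OF \<phi>(1)] unfolding qnil_def by blast
 then obtain m where m: "coprime m q" "\<phi> (x * y) ^ m = 1" using homo_mult[OF \<phi>(1)] xy by (auto simp: p'el_def)
 then have "(x * y) ^ m \<in> ker H \<phi>" using homo_power[OF \<phi>(1) xyH] subgrp_power[OF s xyH] by (simp add: ker_def)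
 then have "((x * y) ^ m) ^ card (ker H \<phi>) = 1" using subgrp_power_card[OF nsubD(1)[OF ker_nsub[OF \<phi>(1)]]] by blast
 then show "p'el q (x * y)" unfolding p'el_def using m(1) \<phi>(2)
  by (intro exI[of _ "m * card (ker H \<phi>)"]) (simp add: power_mult)
qed

text \<open>A counterexample of least order violates Frobenius' condition. Among its
  \<open>q\<close>-subgroups with a normalizer that is not \<open>q\<close>-nilpotent, a suitably
  extremal one turns out to be the largest normal \<open>q\<close>-subgroup, which is the situation
  of \<open>thompson_core\<close>. The type is fixed to \<open>nat perm\<close> because the
  induction passes to quotients.\<close>

theorem thompson_qnil:
 fixes H :: "nat perm set"
 assumes q: "prime q" "odd q"
 shows "subgrp H \<Longrightarrow> syl q H Q \<Longrightarrow> qnil q (H \<inter> nrm (JJ Q)) \<Longrightarrow> qnil q (H \<inter> nrm (ZZ Q)) \<Longrightarrow> qnil q H"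
proof (induction "card H" arbitrary: H Q rule: less_induct)
 case (less H Q)
 note H = less.prems(1) and Q = less.prems(2) and hJ = less.prems(3) and hZ = less.prems(4)
 note QD = sylD[OF Q]
 show ?case
 proof (rule ccontr)
  assume nq: "\<not> qnil q H"
  \<comment> \<open>The hypotheses persist modulo \<open>N\<close>, because normalizers of the
    images of \<open>JJ Q\<close> and \<open>ZZ Q\<close> lift by \<open>frattini_coprime\<close>;
    induction and \<open>qnil_lift_coprime\<close> would then make \<open>H\<close> itself
    \<open>q\<close>-nilpotent.\<close>
  have core1: "N = {1}" if N: "nsub N H" "coprime (card N) q" for N
  proof (rule ccontr)
   assume N1: "N \<noteq> {1}"
   obtain \<phi> :: "nat perm \<Rightarrow> nat perm" where \<phi>: "homo H \<phi>" "ker H \<phi> = N" using quotient_ex[OF H N(1)] by blast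
   have sG: "subgrp (\<phi> ` H)" using homo_image_subgrp[OF \<phi>(1) H] by blast
   have "card N > 1" using N1 nsubD(1)[OF N(1)] subgrp_one[OF nsubD(1)[OF N(1)]]
    by (metis One_nat_def card_1_singletonE less_one linorder_neqE_nat singletonD subgrp_card_pos less_irrefl)
   moreover have "card (\<phi> ` H) * card N = card H"
    using card_homo_image[OF \<phi>(1) H order_refl] \<phi>(2) nsubD(2)[OF N(1)] by (simp add: Int_absorb1)
   moreover have "card (\<phi> ` H) > 0" using sG by simp
   ultimately have lt: "card (\<phi> ` H) < card H" by (metis mult.right_neutral mult_less_cancel1)
   have hQ: "homo Q \<phi>" using \<phi>(1) QD(1,2) unfolding homo_def by blast
   have injQ: "inj_on \<phi> Q"
   proof (rule inj_onI)
    fix x y assume xy: "x \<in> Q" "y \<in> Q" "\<phi> x = \<phi> y"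
    have "inverse x * y \<in> N" using homo_eq_iff[OF \<phi>(1)] xy QD(2) \<phi>(2) by (metis subsetD)
    moreover have "inverse x * y \<in> Q" using xy QD(1) by (simp add: subgrp_closed)
    ultimately have "inverse x * y = 1"
     using pel_p'el_trivial[OF q(1)] pgrp_pel[OF QD(3)] coprime_card_p'el[OF nsubD(1)[OF N(1)] N(2)] by blast
    then show "x = y" by (metis grp_mult_inverse_cancel mult_1_right)
   qed
   have JQ: "pgrp q (JJ Q)" "JJ Q \<subseteq> H" using pgrp_subset[OF q(1) QD(3) JJ_subgrp[OF QD(1)]] JJ_subgrp(2)[OF QD(1)] QD(2) by blast+
   have ZQ: "pgrp q (ZZ Q)" "ZZ Q \<subseteq> H" using pgrp_subset[OF q(1) QD(3) ZZ_subgrp[OF QD(1)] ZZ_le] ZZ_le QD(2) by blast+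
   have 1: "qnil q (\<phi> ` H \<inter> nrm (JJ (\<phi> ` Q)))"
    unfolding JJ_image[OF hQ injQ]
    by (rule qnil_subset[OF _ frattini_coprime[OF q(1) H N \<phi> JQ]])
     (rule qnil_image[OF \<phi>(1) hJ q(1) _ subgrp_Int_nrm[OF H]], blast)
   have 2: "qnil q (\<phi> ` H \<inter> nrm (ZZ (\<phi> ` Q)))"
    unfolding ZZ_image[OF hQ injQ]
    by (rule qnil_subset[OF _ frattini_coprime[OF q(1) H N \<phi> ZQ]])
     (rule qnil_image[OF \<phi>(1) hZ q(1) _ subgrp_Int_nrm[OF H]], blast)
   have "qnil q (\<phi> ` H)" using less.hyps[OF lt sG homo_image_syl[OF \<phi>(1) q(1) Q] 1 2] .
   then have "qnil q H" using qnil_lift_coprime[OF q(1) \<phi>(1)] \<phi>(2) N(2) by simp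
   then show False using nq by simp
  qed
  define bad where "bad = {Y. pgrp q Y \<and> Y \<subseteq> H \<and> Y \<noteq> {1} \<and> \<not> qnil q (H \<inter> nrm Y)}"
  \<comment> \<open>Encodes a lexicographic order: first the \<open>q\<close>-part of the
    normalizer, then the order of \<open>Y\<close>, which is less than the factor
    \<open>card H + 1\<close>.\<close>
  define key where "key Y = multiplicity q (card (H \<inter> nrm Y)) * (card H + 1) + card Y" for Y
  have "\<not> frob q H" using frobenius_qnil[OF H q(1)] nq by blast
  then obtain Y g where Y: "pgrp q Y" "Y \<subseteq> H" "Y \<noteq> {1}" "g \<in> H" "p'el q g" "g \<in> nrm Y" "g \<notin> cent Y"
   unfolding frob_def by blast
  have "\<not> qnil q (H \<inter> nrm Y)"
  proof
   assume qn: "qnil q (H \<inter> nrm Y)"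
   have "g \<in> core q (H \<inter> nrm Y)" using Y by (simp add: core_def)
   then have "g \<in> cent Y"
    using qnil_commute[OF subgrp_Int_nrm[OF H] qn q(1) nsub_Int_nrm[OF pgrp_subgrp[OF Y(1)] Y(2) H] Y(1)]
    by (simp add: cent_def)
   then show False using Y(7) by simp
  qed
  then have "bad \<noteq> {}" using Y unfolding bad_def by blast
  moreover have finb: "finite bad" using H by (auto intro!: finite_subset[of _ "Pow H"] simp: bad_def)
  ultimately have "Max (key ` bad) \<in> key ` bad" by (intro Max_in) auto
  then obtain X where X: "X \<in> bad" "key X = Max (key ` bad)" by auto
  have keymax: "key Y \<le> key X" if "Y \<in> bad" for Y using X(2) finb that by simp
  have pX: "pgrp q X" "X \<subseteq> H" "X \<noteq> {1}" "\<not> qnil q (H \<inter> nrm X)" using X(1) by (auto simp: bad_def)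
  have cardle: "card Y \<le> card H" if "Y \<subseteq> H" for Y using that H by (intro card_mono) auto
  have key1: "Y \<notin> bad" if "multiplicity q (card (H \<inter> nrm X)) < multiplicity q (card (H \<inter> nrm Y))" for Y
  proof
   assume "Y \<in> bad"
   have "multiplicity q (card (H \<inter> nrm X)) * (card H + 1) + (card H + 1)
     \<le> multiplicity q (card (H \<inter> nrm Y)) * (card H + 1)" using that
    by (metis Suc_leI add.commute mult_Suc mult_le_mono1)
   then have "key X < key Y" unfolding key_def using cardle[OF pX(2)] by linarith
   then show False using keymax[OF \<open>Y \<in> bad\<close>] by simp
  qed
  have XnH: "H \<subseteq> nrm X"
  proof (rule ccontr)
   assume "\<not> H \<subseteq> nrm X"
   let ?L = "H \<inter> nrm X"
   have LH: "?L \<subset> H" using \<open>\<not> H \<subseteq> nrm X\<close> by blast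
   then have lt: "card ?L < card H" using H by (intro psubset_card_mono) auto
   have sL: "subgrp ?L" using subgrp_Int_nrm[OF H] .
   obtain S where S: "syl q ?L S" using syl_ex[OF sL q(1)] by blast
   note SD = sylD[OF S]
   have SH: "S \<subseteq> H" using SD(2) by blast
   obtain P where P: "syl q H P" "S \<subseteq> P" using sylow_above[OF H q(1) SD(3) SH] by blast
   note PD = sylD[OF P(1)]
   have S1: "S \<noteq> {1}"
    using normal_pgrp_le_syl[OF sL q(1) S nsub_Int_nrm[OF pgrp_subgrp[OF pX(1)] pX(2) H] pX(1)] pX(3) subgrp_one[OF pgrp_subgrp[OF pX(1)]] by blast
   \<comment> \<open>Used with \<open>JJ\<close> and \<open>ZZ\<close> as \<open>F\<close>. If
     \<open>S\<close> is a Sylow subgroup of \<open>H\<close>, the hypothesis for \<open>Q\<close>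
     is carried over by conjugation; otherwise the normalizer of \<open>F S\<close> contains a
     larger \<open>q\<close>-group than \<open>S\<close>, so the first component of
     \<open>key\<close> keeps \<open>F S\<close> out of \<open>bad\<close>.\<close>
   have good: "qnil q (H \<inter> nrm (F S))"
    if F: "F S \<subseteq> S" "subgrp (F S)" "F S \<noteq> {1}" "nrm S \<subseteq> nrm (F S)" "\<And>h. F (cj h ` Q) = cj h ` F Q" "qnil q (H \<inter> nrm (F Q))" for F
   proof (cases "S = P")
    case True
    obtain h where h: "h \<in> H" "P = cj h ` Q" using sylow_conj_eq[OF H q(1) Q P(1)] by blast
    have Hh: "cj h ` H = H" using subgrp_le_nrm[OF H] h(1) by (auto simp: nrm_def)
    have "H \<inter> nrm (F S) = cj h ` H \<inter> cj h ` nrm (F Q)" unfolding True h(2) F(5) nrm_cj_image Hh ..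
    also have "\<dots> = cj h ` (H \<inter> nrm (F Q))" by (rule image_Int[symmetric]) (auto intro: injI)
    finally show ?thesis using qnil_conj[OF F(6)] by simp
   next
    case False
    then have "S \<subset> P" using P(2) by blast
    then have g: "S \<subset> P \<inter> nrm S" using normalizer_grows[OF q(1) PD(3) SD(1)] by blast
    have T: "pgrp q (P \<inter> nrm S)" using pgrp_subset[OF q(1) PD(3) subgrp_Int_nrm[OF PD(1)]] by blast
    obtain k where k: "card (P \<inter> nrm S) = q ^ k" using T unfolding pgrp_def by blast
    have sub: "P \<inter> nrm S \<subseteq> H \<inter> nrm (F S)" using PD(2) F(4) by blast
    have sN: "subgrp (H \<inter> nrm (F S))" using subgrp_Int_nrm[OF H] .
    have "q ^ k dvd card (H \<inter> nrm (F S))" using subgrp_card_dvd[OF sN pgrp_subgrp[OF T] sub] k by simp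
    then have "k \<le> multiplicity q (card (H \<inter> nrm (F S)))"
     using power_dvd_iff_le_multiplicity[of "card (H \<inter> nrm (F S))" q k] sN prime_gt_1_nat[OF q(1)] by auto
    moreover have "card S < card (P \<inter> nrm S)" using g PD(1) by (intro psubset_card_mono) auto
    then have "multiplicity q (card ?L) < k" using SD(4) k prime_gt_1_nat[OF q(1)] by (metis power_less_imp_less_exp)
    ultimately have "F S \<notin> bad" by (intro key1) simp
    moreover have "pgrp q (F S)" using pgrp_subset[OF q(1) SD(3) F(2,1)] .
    moreover have "F S \<subseteq> H" using F(1) SH by blast
    ultimately show ?thesis using F(3) unfolding bad_def by blast
   qed
   have gJ: "qnil q (H \<inter> nrm (JJ S))"
    by (rule good) (use JJ_subgrp[OF SD(1)] JJ_nontrivial[OF q(1) SD(3) S1] nrm_JJ[OF SD(1)] JJ_cj[OF QD(1)] hJ in auto)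
   have gZ: "qnil q (H \<inter> nrm (ZZ S))"
    by (rule good) (use ZZ_le ZZ_subgrp[OF SD(1)] ZZ_nontrivial[OF q(1) SD(3) S1] nrm_ZZ[OF SD(1)] ZZ_cj[OF QD(1)] hZ in auto)
   have "qnil q ?L" by (rule less.hyps[OF lt sL S]) (rule qnil_subset[OF gJ], blast, rule qnil_subset[OF gZ], blast)
   then show False using pX(4) by simp
  qed
  then have HX: "H \<inter> nrm X = H" by blast
  have nX: "nsub X H" using nsub_Int_nrm[OF pgrp_subgrp[OF pX(1)] pX(2) H] HX by simp
  \<comment> \<open>\<open>Q\<close> normalizes \<open>Y\<close>, so the first component of
    \<open>key\<close> is the same for \<open>Y\<close> as for \<open>X\<close> and the second
    decides.\<close>
  have key2: "qnil q (H \<inter> nrm Y)" if Y: "pgrp q Y" "Y \<subseteq> H" "Q \<subseteq> nrm Y" "card X < card Y" for Y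
  proof (rule ccontr)
   assume "\<not> qnil q (H \<inter> nrm Y)"
   moreover have "Y \<noteq> {1}" using Y(4) pgrp_subgrp[OF pX(1)] by (metis card_1_singleton_iff less_one One_nat_def subgrp_card_pos less_irrefl)
   ultimately have "Y \<in> bad" using Y by (simp add: bad_def)
   have sN: "subgrp (H \<inter> nrm Y)" using subgrp_Int_nrm[OF H] .
   have "syl q (H \<inter> nrm Y) Q" using syl_subgroup[OF H q(1) Q sN] QD(2) Y(3) by blast
   then have "q ^ multiplicity q (card (H \<inter> nrm Y)) = q ^ multiplicity q (card H)" using sylD(4) QD(4) by metis
   then have "multiplicity q (card (H \<inter> nrm Y)) = multiplicity q (card H)" using prime_gt_1_nat[OF q(1)] by (metis power_inject_exp)
   then have "key X < key Y" unfolding key_def HX using Y(4) by simp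
   then show False using keymax[OF \<open>Y \<in> bad\<close>] by simp
  qed
  have maxX: "Y \<subseteq> X" if Y: "nsub Y H" "pgrp q Y" for Y
  proof -
   let ?T = "setmul X Y"
   have YH: "Y \<subseteq> H" using nsubD(2)[OF Y(1)] .
   have pT: "pgrp q ?T" using pgrp_setmul[OF q(1) pX(1) Y(2)] nsubD(3)[OF nX] YH by blast
   have TH: "?T \<subseteq> H" using setmul_subset[OF H pX(2) YH] .
   have "H \<subseteq> nrm ?T"
   proof
    fix h assume h: "h \<in> H"
    show "h \<in> nrm ?T"
    proof (rule nrmI)
     show "finite ?T" using pgrp_subgrp[OF pT] by simp
     fix x assume "x \<in> ?T"
     then obtain a b where "a \<in> X" "b \<in> Y" "x = a * b" by (elim setmulE)
     then show "cj h x \<in> ?T" using nsubD(3)[OF nX h] nsubD(3)[OF Y(1) h] by (simp add: cj_mult setmulI)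
    qed
   qed
   then have "H \<inter> nrm ?T = H" "Q \<subseteq> nrm ?T" using QD(2) by blast+
   then have "\<not> card X < card ?T" using key2[OF pT TH] nq by auto
   moreover have "X \<subseteq> ?T" using setmul_left[OF pgrp_subgrp[OF Y(2)]] .
   ultimately have "?T = X" using pgrp_subgrp[OF pT] by (metis card_seteq linorder_not_less subgrp_finite)
   then show ?thesis using setmul_right[OF pgrp_subgrp[OF pX(1)], of Y] by simp
  qed
  obtain \<phi> :: "nat perm \<Rightarrow> nat perm" where \<phi>: "homo H \<phi>" "ker H \<phi> = X" using quotient_ex[OF H nX] by blast
  have ph: "\<phi> x = 1 \<longleftrightarrow> x \<in> X" if "x \<in> H" for x using \<phi>(2) that by (auto simp: ker_def)
  have XQ: "X \<subseteq> Q" using normal_pgrp_le_syl[OF H q(1) Q nX pX(1)] .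
  have "X \<noteq> Q"
  proof
   assume "X = Q"
   then have "H \<subseteq> nrm (ZZ Q)" using XnH nrm_ZZ[OF QD(1)] by blast
   then have "H \<inter> nrm (ZZ Q) = H" by blast
   then show False using hZ nq by simp
  qed
  have sG: "subgrp (\<phi> ` H)" using homo_image_subgrp[OF \<phi>(1) H] by blast
  have sQ': "syl q (\<phi> ` H) (\<phi> ` Q)" using homo_image_syl[OF \<phi>(1) q(1) Q] .
  note QD' = sylD[OF sQ']
  have Q1: "\<phi> ` Q \<noteq> {1}"
  proof
   assume "\<phi> ` Q = {1}"
   then have "Q \<subseteq> X" using ph QD(2) by blast
   then show False using XQ \<open>X \<noteq> Q\<close> by blast
  qed
  \<comment> \<open>The preimage of \<open>Z\<close> is a \<open>q\<close>-group properly containing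
    \<open>X\<close>, so \<open>key2\<close> applies to it.\<close>
  have lift: "qnil q (\<phi> ` H \<inter> nrm Z)" if Z: "subgrp Z" "Z \<subseteq> \<phi> ` Q" "Z \<noteq> {1}" "\<phi> ` Q \<subseteq> nrm Z" for Z
  proof -
   let ?Y = "{x\<in>H. \<phi> x \<in> Z}"
   have sY: "subgrp ?Y" using homo_preimage_subgrp[OF \<phi>(1) Z(1)] .
   have YQ: "?Y \<subseteq> Q"
   proof
    fix x assume x: "x \<in> ?Y"
    then obtain y where y: "y \<in> Q" "\<phi> y = \<phi> x" using Z(2) by force
    have "inverse y * x \<in> X" using homo_eq_iff[OF \<phi>(1)] y x QD(2) \<phi>(2) by (metis (mono_tags, lifting) mem_Collect_eq subsetD)
    then have "inverse y * x \<in> Q" using XQ by blast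
    then have "y * (inverse y * x) \<in> Q" by (rule subgrp_mult[OF QD(1) y(1)])
    then show "x \<in> Q" by simp
   qed
   have nYI: "h \<in> nrm ?Y" if h: "h \<in> H" "\<phi> h \<in> nrm Z" for h
   proof (rule nrmI)
    show "finite ?Y" using H by simp
    fix x assume x: "x \<in> ?Y"
    then have "\<phi> (cj h x) = cj (\<phi> h) (\<phi> x)" using homo_cj[OF \<phi>(1) h(1)] by blast
    then show "cj h x \<in> ?Y" using nrm_cj[OF h(2)] x subgrp_cj[OF H h(1)] by auto
   qed
   have pY: "pgrp q ?Y" using pgrp_subset[OF q(1) QD(3) sY YQ] .
   have "X \<subseteq> ?Y" using pX(2) ph Z(1) by force
   moreover have "X \<noteq> ?Y"
   proof
    assume XY: "X = ?Y"
    obtain z where z: "z \<in> Z" "z \<noteq> 1" using Z(1,3) subgrp_one[OF Z(1)] by blast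
    then obtain x where "x \<in> H" "\<phi> x = z" using Z(2) QD(2) by blast
    then show False using XY ph z by blast
   qed
   ultimately have "X \<subset> ?Y" by blast
   then have "card X < card ?Y" using H by (intro psubset_card_mono) auto
   moreover have "Q \<subseteq> nrm ?Y" using nYI Z(4) QD(2) by blast
   ultimately have "qnil q (H \<inter> nrm ?Y)" using key2[OF pY] by blast
   then have "qnil q (\<phi> ` (H \<inter> nrm ?Y))" using qnil_image[OF \<phi>(1) _ q(1) _ subgrp_Int_nrm[OF H]] by blast
   moreover have "\<phi> ` H \<inter> nrm Z \<subseteq> \<phi> ` (H \<inter> nrm ?Y)" using nYI by blast
   ultimately show ?thesis by (rule qnil_subset)
  qed
  have "card X > 1" using pX(3) pgrp_subgrp[OF pX(1)] subgrp_one[OF pgrp_subgrp[OF pX(1)]]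
   by (metis One_nat_def card_1_singletonE less_one linorder_neqE_nat singletonD subgrp_card_pos less_irrefl)
  moreover have "card (\<phi> ` H) * card X = card H"
   using card_homo_image[OF \<phi>(1) H order_refl] \<phi>(2) pX(2) by (simp add: Int_absorb1)
  moreover have "card (\<phi> ` H) > 0" using sG by simp
  ultimately have lt: "card (\<phi> ` H) < card H" by (metis mult.right_neutral mult_less_cancel1)
  have leN: "\<phi> ` Q \<subseteq> nrm (\<phi> ` Q)" using subgrp_le_nrm[OF QD'(1)] .
  have qG: "qnil q (\<phi> ` H)"
  proof (rule less.hyps[OF lt sG sQ'])
   show "qnil q (\<phi> ` H \<inter> nrm (JJ (\<phi> ` Q)))"
    using lift[OF JJ_subgrp[OF QD'(1)] JJ_nontrivial[OF q(1) QD'(3) Q1]] nrm_JJ[OF QD'(1)] leN by blast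
   show "qnil q (\<phi> ` H \<inter> nrm (ZZ (\<phi> ` Q)))"
    using lift[OF ZZ_subgrp[OF QD'(1)] ZZ_le ZZ_nontrivial[OF q(1) QD'(3) Q1]] nrm_ZZ[OF QD'(1)] leN by blast
  qed
  have sub: "qnil q K" if K: "subgrp K" "Q \<subseteq> K" "K \<subset> H" for K
  proof (rule less.hyps[OF _ K(1)])
   show "card K < card H" using K(3) H by (intro psubset_card_mono) auto
   show "syl q K Q" using syl_subgroup[OF H q(1) Q K(1,2)] K(3) by blast
   show "qnil q (K \<inter> nrm (JJ Q))" by (rule qnil_subset[OF hJ]) (use K(3) in blast)
   show "qnil q (K \<inter> nrm (ZZ Q))" by (rule qnil_subset[OF hZ]) (use K(3) in blast)
  qed
  show False by (rule thompson_core[OF q H Q nq hJ hZ nX pX(1) maxX core1 \<phi> qG sub])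
 qed
qed

subsection \<open>Fixed-point-free automorphisms of prime order\<close>

text \<open>Equal values at \<open>s\<close> and \<open>r\<close> mean that
  \<open>r * inverse s\<close> commutes with \<open>t\<close>, so the map is injective on the finite
  set \<open>S\<close>.\<close>

lemma fpf_bij:
 assumes "subgrp S" "t \<in> nrm S" "S \<inter> cent {t} = {1}"
 shows "bij_betw (\<lambda>s. inverse s * cj t s) S S"
 unfolding bij_betw_def
proof
 show inj: "inj_on (\<lambda>s. inverse s * cj t s) S"
 proof (rule inj_onI)
  fix s r assume sr: "s \<in> S" "r \<in> S" "inverse s * cj t s = inverse r * cj t r"
  have "cj t (r * inverse s) = r * (inverse r * cj t r) * inverse (cj t s)" by (simp add: cj_mult cj_inverse)
  also have "\<dots> = r * (inverse s * cj t s) * inverse (cj t s)" using sr(3) by simp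
  also have "\<dots> = r * inverse s" by (simp add: mult.assoc)
  finally have "(r * inverse s) * t = t * (r * inverse s)" by (simp add: cj_eq_iff)
  then have "r * inverse s \<in> S \<inter> cent {t}" using sr assms(1) by (simp add: cent_def subgrp_closed)
  then have "r * inverse s = 1" using assms(3) by blast
  then show "s = r" by (metis grp_inverse_inverse grp_inverse_unique)
 qed
 have "(\<lambda>s. inverse s * cj t s) ` S \<subseteq> S"
  using assms nrm_cj[OF assms(2)] by (auto simp: subgrp_closed)
 then show "(\<lambda>s. inverse s * cj t s) ` S = S" using inj assms(1) by (intro endo_inj_surj) simp_all
qed

text \<open>Writing \<open>v\<close> as \<open>inverse s * cj t s\<close> shows that
  \<open>v * t\<close> is a conjugate of \<open>t\<close>, so its \<open>p\<close>-th power is 1;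
  expanding that power produces the product of the conjugates of \<open>v\<close>.\<close>

lemma fpf_lin:
 assumes "subgrp Y" "t \<in> nrm Y" "Y \<inter> cent {t} = {1}" "t ^ p = 1" "v \<in> Y" "lin Y \<mu>"
 shows "(\<Prod>i<p. \<mu> (cj (t ^ i) v)) = 1"
proof -
 obtain s where s: "s \<in> Y" "v = inverse s * cj t s"
  using fpf_bij[OF assms(1-3)] assms(5) unfolding bij_betw_def by blast
 have "v * t = cj (inverse s) t" by (simp add: s(2) cj_def mult.assoc)
 then have vt: "(v * t) ^ p = 1" using assms(4) by (simp flip: cj_power)
 have nt: "t ^ n \<in> nrm Y" for n by (induction n) (auto intro: nrm_mult assms(2))
 have step: "\<exists>w\<in>Y. (v * t) ^ n = w * t ^ n \<and> \<mu> w = (\<Prod>i<n. \<mu> (cj (t ^ i) v))" for n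
 proof (induction n)
  case 0 then show ?case using lin_one[OF assms(6)] assms(1) by (intro bexI[of _ 1]) auto
 next
  case (Suc n)
  then obtain w where w: "w \<in> Y" "(v * t) ^ n = w * t ^ n" "\<mu> w = (\<Prod>i<n. \<mu> (cj (t ^ i) v))" by blast
  have c: "cj (t ^ n) v \<in> Y" using nrm_cj[OF nt assms(5)] .
  have "(v * t) ^ Suc n = (v * t) ^ n * (v * t)" by (rule power_Suc2)
  also have "\<dots> = w * cj (t ^ n) v * t ^ Suc n" unfolding w(2) cj_def power_Suc2 by (simp add: mult.assoc)
  finally have "(v * t) ^ Suc n = w * cj (t ^ n) v * t ^ Suc n" .
  moreover have "w * cj (t ^ n) v \<in> Y" using w c assms(1) by (simp add: subgrp_mult)
  moreover have "\<mu> (w * cj (t ^ n) v) = (\<Prod>i<Suc n. \<mu> (cj (t ^ i) v))" using lin_mult[OF assms(6) w(1) c] w(3) by simp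
  ultimately show ?case by blast
 qed
 obtain w where "w \<in> Y" "(v * t) ^ p = w * t ^ p" "\<mu> w = (\<Prod>i<p. \<mu> (cj (t ^ i) v))" using step[of p] by blast
 moreover from this have "w = 1" using vt assms(4) by simp
 ultimately show ?thesis using lin_one[OF assms(6)] by simp
qed

lemma fpf_power:
 assumes "prime p" "t ^ p = 1" "S \<inter> cent {t} = {1}" "0 < i" "i < p"
 shows "S \<inter> cent {t ^ i} = {1}"
proof -
 have "coprime i p" using assms by (simp add: coprime_prime_iff nat_dvd_not_less)
 then obtain j where j: "[i * j = Suc 0] (mod p)" using cong_solve_coprime_nat by blast
 have t: "(t ^ i) ^ j = t" using power_cong_exp[OF assms(2) j] by (simp add: power_mult)
 have "y \<in> cent {t}" if y: "y \<in> cent {t ^ i}" for y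
 proof -
  have "cj y (t ^ i) = t ^ i" using y by (simp add: cent_def cj_eq_iff)
  then have "cj y ((t ^ i) ^ j) = (t ^ i) ^ j" by (simp add: cj_power)
  then show ?thesis unfolding t by (simp add: cent_def cj_eq_iff)
 qed
 then have "S \<inter> cent {t ^ i} \<subseteq> {1}" using assms(3) by blast
 moreover have "1 \<in> S" using assms(3) by blast
 ultimately show ?thesis by (auto simp: cent_def)
qed

text \<open>Multiplying the identities of \<open>fpf_lin\<close> over the conjugates of \<open>x\<close> by elements of \<open>R\<close>
 expresses \<open>v\<close> to the power \<open>|R|\<close> through traces over \<open>R\<close>, so it is fixed by \<open>R\<close>.\<close>

lemma fpf_centralize:
 assumes p: "prime p" and q: "prime q" and x: "x ^ p = 1"
  and R: "subgrp R" "coprime (card R) q" "x \<in> nrm R" "R \<inter> cent {x} = {1}"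
 shows "pgrp q Y \<Longrightarrow> R \<subseteq> nrm Y \<Longrightarrow> x \<in> nrm Y \<Longrightarrow> Y \<inter> cent {x} = {1} \<Longrightarrow> R \<subseteq> cent Y"
proof (induction "card Y" arbitrary: Y rule: less_induct)
 case (less Y)
 note Y = less.prems
 note sY = pgrp_subgrp[OF Y(1)]
 show ?case
 proof (cases "Y = {1}")
  case True then show ?thesis by (auto simp: cent_def)
 next
  case False
  \<comment> \<open>The common kernel of the linear characters of \<open>Y\<close>, that is, its
    derived subgroup. It is proper and invariant, so \<open>R\<close> centralizes it by induction,
    and it remains to see that \<open>R\<close> acts trivially on \<open>Y\<close> modulo
    \<open>D\<close>.\<close>
  define D where "D = {d\<in>Y. \<forall>\<mu>. lin Y \<mu> \<longrightarrow> \<mu> d = 1}"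
  have sD: "subgrp D" by (rule subgrpI) (use sY in \<open>auto simp: D_def lin_one lin_mult subgrp_mult\<close>)
  have linc: "lin Y (\<lambda>y. \<mu> (cj g y))" if "lin Y \<mu>" "g \<in> nrm Y" for \<mu> g
   using that nrm_cj[OF that(2)] by (auto simp: lin_def cj_mult)
  have nD: "g \<in> nrm D" if g: "g \<in> nrm Y" for g
  proof (rule nrmI)
   fix d assume d: "d \<in> D"
   have "\<mu> (cj g d) = 1" if "lin Y \<mu>" for \<mu> using linc[OF that g] d unfolding D_def by blast
   then show "cj g d \<in> D" using d nrm_cj[OF g] by (auto simp: D_def)
  qed (use sD in simp)
  obtain \<mu> y where "lin Y \<mu>" "y \<in> Y" "\<mu> y \<noteq> 1" using pgrp_lin_ex[OF q Y(1) False] by blast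
  then have DY: "D \<subset> Y" by (auto simp: D_def)
  have lt: "card D < card Y" using DY sY by (intro psubset_card_mono) auto
  have pD: "pgrp q D" using pgrp_subset[OF q Y(1) sD] DY by blast
  have "D \<inter> cent {x} = {1}" using Y(4) DY subgrp_one[OF sD] by (auto simp: cent_def)
  then have RD: "R \<subseteq> cent D" using less.hyps[OF lt pD] nD Y(2,3) by blast
  have xi: "x ^ i \<in> nrm R" "x ^ i \<in> nrm Y" for i
   by (induction i) (auto intro: nrm_mult R(3) Y(3))
  have inD: "inverse v * cj s0 v \<in> D" if v: "v \<in> Y" and s0: "s0 \<in> R" for v s0
  proof -
   have cv: "cj s0 v \<in> Y" using nrm_cj Y(2) s0 v by blast
   have "\<mu> (inverse v * cj s0 v) = 1" if \<mu>: "lin Y \<mu>" for \<mu>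
   proof -
    define F where "F i w = (\<Prod>s\<in>R. \<mu> (cj s (cj (x ^ i) w)))" for i w
    have main: "\<mu> w ^ card R * (\<Prod>i\<in>{1..<p}. F i w) = 1" if w: "w \<in> Y" for w
    proof -
     have 1: "(\<Prod>i<p. \<mu> (cj (inverse r * x ^ i * r) w)) = 1" if r: "r \<in> R" for r
     proof -
      let ?t = "cj (inverse r) x"
      have rY: "inverse r \<in> nrm Y" "r \<in> nrm Y" using Y(2) r subgrp_inverse[OF R(1)] by blast+
      have tY: "?t \<in> nrm Y" unfolding cj_def using rY Y(3) by (auto intro!: nrm_mult)
      have tp: "?t ^ i = inverse r * x ^ i * r" for i by (simp flip: cj_power) (simp add: cj_def)
      have "y = 1" if y: "y \<in> Y" "y \<in> cent {?t}" for y
      proof -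
       have "cj ?t y = y" using y(2) by (simp add: cent_def cj_eq_iff)
       then have "cj (inverse r) (cj x (cj r y)) = y" unfolding cj_def[of "inverse r" x] by (simp add: cj_comp)
       then have "cj x (cj r y) = cj r y" by (metis cj_cancel(1))
       then have "cj r y \<in> Y \<inter> cent {x}" using nrm_cj[OF rY(2) y(1)] by (simp add: cent_def cj_eq_iff)
       then have "cj r y = 1" using Y(4) by blast
       then show ?thesis by simp
      qed
      then have fp: "Y \<inter> cent {?t} = {1}" using sY by (auto simp: cent_def)
      have "?t ^ p = 1" unfolding tp using x by simp
      then show ?thesis using fpf_lin[OF sY tY fp _ w \<mu>] unfolding tp by blast
     qed
     have "1 = (\<Prod>r\<in>R. \<Prod>i<p. \<mu> (cj (inverse r * x ^ i * r) w))" using 1 by simp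
     also have "\<dots> = (\<Prod>i<p. \<Prod>r\<in>R. \<mu> (cj (inverse r * x ^ i * r) w))" by (rule prod.swap)
     also have "{..<p} = insert 0 {1..<p}" using prime_gt_0_nat[OF p] by auto
     also have "(\<Prod>i\<in>insert 0 {1..<p}. \<Prod>r\<in>R. \<mu> (cj (inverse r * x ^ i * r) w))
       = \<mu> w ^ card R * (\<Prod>i\<in>{1..<p}. \<Prod>r\<in>R. \<mu> (cj (inverse r * x ^ i * r) w))" by simp
     \<comment> \<open>The factor for \<open>i = 0\<close> has been split off as the power of
       \<open>\<mu> w\<close>. For the other \<open>i\<close> the power \<open>x ^ i\<close> has no
       fixed points on \<open>R\<close> except 1 either, so by \<open>fpf_bij\<close> the elements
       \<open>inverse r * cj (x ^ i) r\<close> run over \<open>R\<close>.\<close>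
     also have "(\<Prod>i\<in>{1..<p}. \<Prod>r\<in>R. \<mu> (cj (inverse r * x ^ i * r) w)) = (\<Prod>i\<in>{1..<p}. F i w)"
     proof (rule prod.cong[OF refl])
      fix i assume i: "i \<in> {1..<p}"
      have fp: "R \<inter> cent {x ^ i} = {1}" using fpf_power[OF p x R(4)] i by auto
      have e: "inverse r * x ^ i * r = inverse r * cj (x ^ i) r * x ^ i" for r by (simp add: cj_def mult.assoc)
      have "(\<Prod>r\<in>R. \<mu> (cj (inverse r * x ^ i * r) w)) = (\<Prod>r\<in>R. \<mu> (cj (inverse r * cj (x ^ i) r) (cj (x ^ i) w)))"
       unfolding e by (simp only: cj_comp)
      also have "\<dots> = F i w" unfolding F_def
       by (rule prod.reindex_bij_betw[OF fpf_bij[OF R(1) xi(1) fp], of "\<lambda>s. \<mu> (cj s (cj (x ^ i) w))"])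
      finally show "(\<Prod>r\<in>R. \<mu> (cj (inverse r * x ^ i * r) w)) = F i w" .
     qed
     finally show ?thesis by simp
    qed
    \<comment> \<open>Replacing \<open>v\<close> by its conjugate under \<open>s0\<close> translates
      the product over \<open>R\<close> by \<open>cj (x ^ i) s0\<close>.\<close>
    have Finv: "F i (cj s0 v) = F i v" for i
    proof -
     let ?s = "cj (x ^ i) s0"
     have sR: "?s \<in> R" using nrm_cj[OF xi(1) s0] .
     have c: "cj (x ^ i) (cj s0 v) = cj ?s (cj (x ^ i) v)" by (simp add: cj_def mult.assoc)
     have "bij_betw (\<lambda>s. s * ?s) R R"
      by (rule bij_betw_byWitness[where f' = "\<lambda>s. s * inverse ?s"])
       (use sR R(1) subgrp_inverse[OF R(1) sR] in \<open>auto simp: mult.assoc subgrp_mult\<close>)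
     from prod.reindex_bij_betw[OF this, of "\<lambda>s. \<mu> (cj s (cj (x ^ i) v))"]
     show ?thesis unfolding F_def c by (simp only: cj_comp)
    qed
    have e: "\<mu> (cj s0 v) ^ card R * (\<Prod>i\<in>{1..<p}. F i v) = \<mu> v ^ card R * (\<Prod>i\<in>{1..<p}. F i v)"
     using main[OF cv] main[OF v] unfolding Finv by simp
    have "(\<Prod>i\<in>{1..<p}. F i v) \<noteq> 0" using main[OF v] by (metis mult_zero_right zero_neq_one)
    then have eq: "\<mu> (cj s0 v) ^ card R = \<mu> v ^ card R" using e by simp
    have iv: "inverse v \<in> Y" using v sY by (simp add: subgrp_inverse)
    have "\<mu> (inverse v) * \<mu> v = 1" using lin_mult[OF \<mu> iv v] lin_one[OF \<mu>] by simp
    then have "(\<mu> (inverse v) * \<mu> (cj s0 v)) ^ card R = 1" by (metis eq power_mult_distrib power_one)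
    then have 1: "\<mu> (inverse v * cj s0 v) ^ card R = 1" using lin_mult[OF \<mu> iv cv] by simp
    have 2: "\<mu> (inverse v * cj s0 v) ^ card Y = 1"
     using lin_power_card[OF \<mu> sY] iv cv sY by (simp add: subgrp_mult)
    obtain k where k: "card Y = q ^ k" using Y(1) unfolding pgrp_def by blast
    have "coprime (card R) (card Y)" using R(2) k by simp
    then show ?thesis using coprime_powers_1 1 2 by blast
   qed
   then show ?thesis using v cv sY by (simp add: D_def subgrp_closed)
  qed
  show ?thesis
  proof
   fix s assume s: "s \<in> R"
   show "s \<in> cent Y" unfolding cent_iff_cj
   proof
    fix v assume v: "v \<in> Y"
    \<comment> \<open>\<open>s\<close> fixes \<open>d\<close>, so the powers of \<open>s\<close>
      move \<open>v\<close> by the powers of \<open>d\<close>. Hence the order of \<open>d\<close>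
      divides that of \<open>R\<close>, while \<open>d\<close> is a
      \<open>q\<close>-element.\<close>
    define d where "d = inverse v * cj s v"
    have dD: "d \<in> D" using inD[OF v s] by (simp add: d_def)
    have sd: "cj s d = d" using RD s dD by (auto simp: cent_iff_cj)
    have "cj (s ^ n) v = v * d ^ n" for n
    proof (induction n)
     case (Suc n)
     have "cj (s ^ Suc n) v = cj s (v * d ^ n)" using Suc by (simp add: cj_comp)
     also have "\<dots> = cj s v * d ^ n" using sd by (simp add: cj_mult cj_power)
     also have "cj s v = v * d" by (simp add: d_def)
     finally show ?case by (simp add: mult.assoc)
    qed simp
    from this[of "card R"] have "v * d ^ card R = v" using subgrp_power_card[OF R(1) s] by simp
    then have "d ^ card R = 1" by (simp only: grp_mult_eq_left)
    then have "p'el q d" using R(2) by (auto simp: p'el_def)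
    moreover have "pel q d" using pgrp_pel[OF pD dD] .
    ultimately have "d = 1" using pel_p'el_trivial[OF q] by blast
    then show "cj s v = v" unfolding d_def by (metis grp_mult_inverse_cancel mult_1_right)
   qed
  qed
 qed
qed

section \<open>Normal q-complements from an automorphism of prime order without fixed points\<close>

lemma cyc_pgrp:
 assumes "prime p" "x ^ p = 1" shows "pgrp p (cyc x p)"
proof (rule pel_imp_pgrp[OF cyc_subgrp(1)[OF assms(2)] assms(1)])
 fix y assume "y \<in> cyc x p"
 then obtain i where "y = x ^ i" by (auto simp: cyc_def)
 then have "y ^ p = 1" using assms(2) by (simp add: power_mult[symmetric] mult.commute[of i]) (simp add: power_mult)
 then show "pel p y" unfolding pel_def by (intro exI[of _ 1]) simp
qed (use assms prime_gt_0_nat in auto)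

lemma cyc_le_nrm: "x \<in> nrm S \<Longrightarrow> cyc x n \<subseteq> nrm S"
proof -
 assume x: "x \<in> nrm S"
 have "x ^ i \<in> nrm S" for i by (induction i) (auto intro: nrm_mult x)
 then show ?thesis by (auto simp: cyc_def)
qed

text \<open>The group generated by \<open>x\<close> has \<open>p\<close>-power order and exactly one
  fixed point on \<open>S\<close>, so the order of \<open>S\<close> is 1 modulo
  \<open>p\<close>.\<close>

lemma fpf_coprime:
 assumes "prime p" "x ^ p = 1" "subgrp S" "x \<in> nrm S" "S \<inter> cent {x} = {1}"
 shows "\<not> p dvd card S"
proof -
 let ?X = "cyc x p"
 have X: "pgrp p ?X" using cyc_pgrp[OF assms(1,2)] .
 obtain k where k: "card ?X = p ^ k" using X unfolding pgrp_def by blast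
 have ac: "acts ?X S cj" unfolding acts_def using cyc_le_nrm[OF assms(4), of p] nrm_cj by (auto simp: cj_comp)
 have "{w\<in>S. \<forall>g\<in>?X. cj g w = w} = {1}"
 proof -
  have "x \<in> ?X" using cyc_subgrp(2)[OF assms(2) prime_gt_0_nat[OF assms(1)], of 1] by simp
  then have "w \<in> S \<inter> cent {x}" if "w \<in> S" "\<forall>g\<in>?X. cj g w = w" for w using that by (auto simp: cent_def cj_eq_iff)
  then show ?thesis using assms(3,5) by auto
 qed
 then have "[card S = 1] (mod p)" using fixed_points_cong[OF pgrp_subgrp[OF X] k assms(1) subgrp_finite[OF assms(3)] ac] by simp
 then show ?thesis using assms(1) by (metis cong_dvd_iff not_prime_unit)
qed

text \<open>The case of \<open>fpf_qnil\<close> with an invariant normal \<open>q\<close>-subgroup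
  \<open>Y\<close>. The quotient by \<open>Y\<close> is \<open>q\<close>-nilpotent by induction.
  Either the preimage \<open>E\<close> of its core is proper and induction applies to
  \<open>E\<close>, or \<open>S\<close> is an extension of \<open>Y\<close> by a
  \<open>q'\<close>-group, and then invariant Sylow subgroups for the other primes centralize
  \<open>Y\<close> by \<open>fpf_centralize\<close>.\<close>

lemma fpf_qnil_normal:
 fixes S :: "nat perm set"
 assumes p: "prime p" and q: "prime q" and x: "x ^ p = 1" "x \<in> nrm S" and S: "subgrp S" "S \<inter> cent {x} = {1}"
  and IH: "\<And>(S'::nat perm set) x'. card S' < card S \<Longrightarrow> subgrp S' \<Longrightarrow> x' ^ p = 1 \<Longrightarrow> x' \<in> nrm S' \<Longrightarrow>
    S' \<inter> cent {x'} = {1} \<Longrightarrow> qnil q S'"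
  and Y: "nsub Y S" "pgrp q Y" "Y \<noteq> {1}" "x \<in> nrm Y"
 shows "qnil q S"
proof -
 note sY = nsubD(1,2)[OF Y(1)]
 \<comment> \<open>\<open>x\<close> may lie outside \<open>S\<close>, so the quotient is formed in
   the product of \<open>S\<close> with the group generated by \<open>x\<close>; this gives
   \<open>\<phi> x\<close> a meaning.\<close>
 let ?X = "cyc x p" let ?G = "setmul S ?X"
 have xX: "x \<in> ?X" using cyc_subgrp(2)[OF x(1) prime_gt_0_nat[OF p], of 1] by simp
 have sX: "subgrp ?X" using cyc_subgrp(1)[OF x(1) prime_gt_0_nat[OF p]] .
 have sG: "subgrp ?G" using cyc_le_nrm[OF x(2)] nrm_cj by (intro subgrp_setmul S(1) sX) blast
 have SG: "S \<subseteq> ?G" "x \<in> ?G" using setmul_left[OF sX] setmul_right[OF S(1)] xX by blast+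
 have nY: "nsub Y ?G"
 proof (rule nsubI)
  fix g y assume g: "g \<in> ?G" and y: "y \<in> Y"
  obtain s z where sz: "s \<in> S" "z \<in> ?X" "g = s * z" using g by (elim setmulE)
  have "cj z y \<in> Y" using nrm_cj cyc_le_nrm[OF Y(4)] sz(2) y by blast
  then show "cj g y \<in> Y" unfolding sz(3) cj_comp using nsubD(3)[OF Y(1) sz(1)] by blast
 qed (use sY SG in auto)
 obtain \<phi> :: "nat perm \<Rightarrow> nat perm" where \<phi>: "homo ?G \<phi>" "ker ?G \<phi> = Y" using quotient_ex[OF sG nY] by blast
 have ph: "\<phi> s = 1 \<longleftrightarrow> s \<in> Y" if "s \<in> S" for s using \<phi>(2) that SG(1) by (auto simp: ker_def)
 have hS: "homo S \<phi>" using \<phi>(1) S(1) SG(1) unfolding homo_def by blast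
 have fY: "Y \<inter> cent {x} = {1}" using S(2) sY subgrp_one[OF sY(1)] by (auto simp: cent_def)
 have fp: "\<phi> ` S \<inter> cent {\<phi> x} = {1}"
 proof -
  have "y = 1" if y: "y \<in> \<phi> ` S" "y \<in> cent {\<phi> x}" for y
  proof -
   obtain s where s: "s \<in> S" "y = \<phi> s" using y by blast
   have cs: "cj x s \<in> S" using nrm_cj[OF x(2) s(1)] .
   have "\<phi> (cj x s) = cj (\<phi> x) (\<phi> s)" using homo_cj[OF \<phi>(1) SG(2)] s(1) SG(1) by blast
   also have "\<dots> = \<phi> s" using y(2) s(2) by (simp add: cent_def cj_eq_iff)
   finally have "inverse s * cj x s \<in> Y"
    using homo_eq_iff[OF \<phi>(1), of s "cj x s"] s(1) cs SG(1) \<phi>(2) by auto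
   \<comment> \<open>\<open>fpf_bij\<close> holds for \<open>Y\<close> and for \<open>S\<close>:
     surjectivity on \<open>Y\<close> provides \<open>t\<close>, injectivity on \<open>S\<close>
     gives \<open>s = t\<close>, so a coset fixed by \<open>x\<close> is trivial.\<close>
   then obtain t where t: "t \<in> Y" "inverse s * cj x s = inverse t * cj x t"
    using fpf_bij[OF sY(1) Y(4) fY] unfolding bij_betw_def by (metis (no_types, lifting) imageE)
   have "s = t" using fpf_bij[OF S(1) x(2) S(2)] s(1) t sY(2) unfolding bij_betw_def by (meson inj_onD subsetD)
   then show ?thesis using ph[OF s(1)] s(2) t(1) by simp
  qed
  moreover have "1 \<in> \<phi> ` S" using homo_image_subgrp[OF hS S(1)] by simp
  ultimately show ?thesis by (auto simp: cent_def)
 qed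
 have sI: "subgrp (\<phi> ` S)" using homo_image_subgrp[OF hS S(1)] by blast
 have xS: "\<phi> x \<in> nrm (\<phi> ` S)"
 proof (rule nrmI)
  fix y assume "y \<in> \<phi> ` S"
  then obtain s where s: "s \<in> S" "y = \<phi> s" by blast
  have "cj (\<phi> x) y = \<phi> (cj x s)" using homo_cj[OF \<phi>(1) SG(2)] s SG(1) by auto
  then show "cj (\<phi> x) y \<in> \<phi> ` S" using nrm_cj[OF x(2) s(1)] by simp
 qed (use sI in simp)
 have "card Y > 1" using Y(3) subgrp_one[OF sY(1)] sY(1)
  by (metis One_nat_def card_1_singletonE less_one linorder_neqE_nat singletonD subgrp_card_pos less_irrefl)
 moreover have "ker S \<phi> = Y" using ph sY(2) by (auto simp: ker_def)
 then have "card (\<phi> ` S) * card Y = card S"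
  using card_homo_image[OF hS S(1) order_refl] sY(2) by (simp add: Int_absorb1)
 moreover have "card (\<phi> ` S) > 0" using sI by simp
 ultimately have lt: "card (\<phi> ` S) < card S" by (metis mult.right_neutral mult_less_cancel1)
 have "\<phi> x ^ p = 1" using homo_power[OF \<phi>(1) SG(2), of p] x(1) homo_one[OF \<phi>(1)] by simp
 then have qn: "qnil q (\<phi> ` S)" using IH[OF lt sI _ xS fp] by blast
 define E where "E = {s\<in>S. p'el q (\<phi> s)}"
 have Ecore: "E = {s\<in>S. \<phi> s \<in> core q (\<phi> ` S)}" by (auto simp: E_def core_def)
 have sE: "subgrp E" unfolding Ecore using homo_preimage_subgrp[OF hS nsubD(1)[OF core_nsub[OF sI qn]]] .
 have p'E: "s \<in> E" if "s \<in> S" "p'el q s" for s using that homo_p'el[OF hS] by (simp add: E_def)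
 show ?thesis
 proof (cases "E = S")
  case False
  then have "E \<subset> S" by (auto simp: E_def)
  then have lt: "card E < card S" using S(1) by (intro psubset_card_mono) auto
  have xE: "x \<in> nrm E"
  proof (rule nrmI)
   fix s assume s: "s \<in> E"
   then have "\<phi> (cj x s) = cj (\<phi> x) (\<phi> s)" using homo_cj[OF \<phi>(1) SG(2)] SG(1) by (auto simp: E_def)
   then show "cj x s \<in> E" using s nrm_cj[OF x(2)] by (simp add: E_def)
  qed (use sE in simp)
  have "E \<inter> cent {x} = {1}" using S(2) \<open>E \<subset> S\<close> subgrp_one[OF sE] by (auto simp: cent_def)
  then have "qnil q E" using IH[OF lt sE x(1) xE] by blast
  then show ?thesis unfolding qnil_def using p'E by blast
 next
  case True
  have YS: "s \<in> Y" if s: "s \<in> S" "pel q s" for s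
  proof -
   have "s \<in> E" using s(1) True by simp
   then have "p'el q (\<phi> s)" by (simp add: E_def)
   then have "\<phi> s = 1" using pgrp_homo_kernel[OF q hS s(1,2)] by blast
   then show ?thesis using ph[OF s(1)] by simp
  qed
  let ?C = "S \<inter> cent Y"
  have nC: "nsub ?C S" using nsub_Int_cent[OF S(1)] nsub_le_nrm[OF Y(1)] by blast
  have "R \<subseteq> ?C" if R: "prime r" "r \<noteq> q" "syl r S R" for r R
  proof -
   obtain R0 where R0: "syl r S R0" "?X \<subseteq> nrm R0"
    using invariant_sylow[OF S(1) R(1) p cyc_pgrp[OF p x(1)] cyc_le_nrm[OF x(2)] fpf_coprime[OF p x(1) S(1) x(2) S(2)]] by blast
   note RD = sylD[OF R0(1)]
   have cop: "coprime (card R0) q" unfolding RD(4) using R(1,2) q primes_coprime[of r q] by (simp add: coprime_power_left_iff)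
   have "R0 \<inter> cent {x} = {1}" using S(2) RD(2) subgrp_one[OF RD(1)] by (auto simp: cent_def)
   moreover have "R0 \<subseteq> nrm Y" using RD(2) nsub_le_nrm[OF Y(1)] by blast
   ultimately have "R0 \<subseteq> cent Y"
    using fpf_centralize[OF p q x(1) RD(1) cop _ _ Y(2) _ Y(4) fY] R0(2) xX by blast
   then have R0C: "R0 \<subseteq> ?C" using RD(2) by blast
   obtain h where h: "h \<in> S" "R = cj h ` R0" using sylow_conj_eq[OF S(1) R(1) R0(1) R(3)] by blast
   show ?thesis unfolding h(2) using R0C nsubD(3)[OF nC h(1)] by blast
  qed
  then obtain k where k: "card S = card ?C * q ^ k" using prime_power_index[OF S(1) q nsubD(1,2)[OF nC]] by blast
  obtain \<psi> :: "nat perm \<Rightarrow> nat perm" where \<psi>: "homo S \<psi>" "ker S \<psi> = ?C" using quotient_ex[OF S(1) nC] by blast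
  have "card (\<psi> ` S) * card ?C = card S"
   using card_homo_image[OF \<psi>(1) S(1) order_refl] \<psi>(2) by (simp add: Int_absorb1)
  then have "card (\<psi> ` S) * card ?C = q ^ k * card ?C" using k by (simp add: mult.commute)
  moreover have "card ?C \<noteq> 0" using nsubD(1)[OF nC] by simp
  ultimately have "card (\<psi> ` S) = q ^ k" by simp
  then have p\<psi>: "pgrp q (\<psi> ` S)" unfolding pgrp_def using homo_image_subgrp[OF \<psi>(1) S(1)] by blast
  have cenY: "g \<in> cent Y" if g: "g \<in> S" "p'el q g" for g
  proof -
   have "pel q (\<psi> g)" using pgrp_pel[OF p\<psi>] g(1) by blast
   then have "\<psi> g = 1" using pel_p'el_trivial[OF q] homo_p'el[OF \<psi>(1) g] by blast
   then have "g \<in> ker S \<psi>" using g(1) by (simp add: ker_def)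
   then show ?thesis using \<psi>(2) by blast
  qed
  \<comment> \<open>All \<open>q\<close>-subgroups lie in \<open>Y\<close>, which is centralized by
    the elements of order prime to \<open>q\<close>.\<close>
  have "frob q S" unfolding frob_def
  proof (intro allI impI ballI)
   fix W g assume W: "pgrp q W \<and> W \<subseteq> S \<and> W \<noteq> {1}" and g: "g \<in> S" "p'el q g \<and> g \<in> nrm W"
   have "W \<subseteq> Y" using W YS pgrp_pel by blast
   then show "g \<in> cent W" using cenY[OF g(1)] g(2) cent_antimono by blast
  qed
  then show ?thesis using frobenius_qnil[OF S(1) q] by blast
 qed
qed

text \<open>By Thompson's criterion it suffices to treat the normalizers of \<open>JJ Q\<close> and
  \<open>ZZ Q\<close> for an invariant Sylow subgroup \<open>Q\<close>. Such a normalizer is either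
  proper, and induction applies, or all of \<open>S\<close>, which is the case of
  \<open>fpf_qnil_normal\<close>.\<close>

theorem fpf_qnil:
 fixes S :: "nat perm set"
 assumes p: "prime p" and q: "prime q" "odd q"
 shows "subgrp S \<Longrightarrow> x ^ p = 1 \<Longrightarrow> x \<in> nrm S \<Longrightarrow> S \<inter> cent {x} = {1} \<Longrightarrow> qnil q S"
proof (induction "card S" arbitrary: S x rule: less_induct)
 case (less S x)
 note S = less.prems
 obtain Q where Q: "syl q S Q" "cyc x p \<subseteq> nrm Q"
  using invariant_sylow[OF S(1) q(1) p cyc_pgrp[OF p S(2)] cyc_le_nrm[OF S(3)] fpf_coprime[OF p S(2,1,3,4)]] by blast
 note QD = sylD[OF Q(1)]
 have xQ: "x \<in> nrm Q" using Q(2) cyc_subgrp(2)[OF S(2) prime_gt_0_nat[OF p], of 1] by auto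
 show ?case
 proof (cases "Q = {1}")
  case True
  then have "card Q = 1" by simp
  then have "multiplicity q (card S) = 0" using QD(4) prime_gt_1_nat[OF q(1)] by (metis less_irrefl nat_power_eq_Suc_0_iff One_nat_def)
  then have "\<not> q dvd card S" using multiplicity_pos_iff_dvd[OF q(1), of "card S"] S(1) by simp
  then have "coprime (card S) q" using coprime_prime_iff[OF q(1)] by simp
  then show ?thesis unfolding qnil_def using coprime_card_p'el[OF S(1)] subgrp_mult[OF S(1)] by blast
 next
  case False
  have cases: "qnil q S \<or> qnil q (S \<inter> nrm Y)" if Y: "subgrp Y" "Y \<subseteq> Q" "Y \<noteq> {1}" "nrm Q \<subseteq> nrm Y" for Y
  proof (cases "S \<inter> nrm Y = S")
   case True
   have YS: "Y \<subseteq> S" using Y(2) QD(2) by blast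
   have nY: "nsub Y S" using nsub_Int_nrm[OF Y(1) YS S(1)] True by simp
   have pY: "pgrp q Y" using pgrp_subset[OF q(1) QD(3) Y(1,2)] .
   have xY: "x \<in> nrm Y" using xQ Y(4) by blast
   have "qnil q S" by (rule fpf_qnil_normal[OF p q(1) S(2,3,1,4) less.hyps nY pY Y(3) xY])
   then show ?thesis by blast
  next
   case False
   let ?N = "S \<inter> nrm Y"
   have sN: "subgrp ?N" using subgrp_Int_nrm[OF S(1)] .
   have "?N \<subset> S" using False by blast
   then have lt: "card ?N < card S" using S(1) by (intro psubset_card_mono) auto
   have xY: "x \<in> nrm Y" using xQ Y(4) by blast
   have xN: "x \<in> nrm ?N"
   proof (rule nrmI)
    fix g assume g: "g \<in> ?N"
    have "cj x g \<in> nrm Y" unfolding cj_def using xY g by (auto intro!: nrm_mult nrm_inverse)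
    then show "cj x g \<in> ?N" using nrm_cj[OF S(3)] g by blast
   qed (use sN in simp)
   have "?N \<inter> cent {x} = {1}" using S(4) subgrp_one[OF sN] by (auto simp: cent_def)
   then show ?thesis using less.hyps[OF lt sN S(2) xN] by blast
  qed
  have "qnil q S \<or> qnil q (S \<inter> nrm (JJ Q))"
   by (rule cases[OF JJ_subgrp[OF QD(1)] JJ_nontrivial[OF q(1) QD(3) False] nrm_JJ[OF QD(1)]])
  moreover have "qnil q S \<or> qnil q (S \<inter> nrm (ZZ Q))"
   by (rule cases[OF ZZ_subgrp[OF QD(1)] ZZ_le ZZ_nontrivial[OF q(1) QD(3) False] nrm_ZZ[OF QD(1)]])
  ultimately show ?thesis using thompson_qnil[OF q S(1) Q(1)] by blast
 qed
qed

subsection \<open>Solvability\<close>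

inductive solv :: "'g::grp set \<Rightarrow> bool" where
 triv: "solv {1}"
| ext: "solv N \<Longrightarrow> nsub N H \<Longrightarrow> subgrp H \<Longrightarrow> (\<forall>x\<in>H. \<forall>y\<in>H. x * y * inverse x * inverse y \<in> N) \<Longrightarrow> solv H"

lemma lin_commutator:
 assumes "lin H \<mu>" "subgrp H" "x \<in> H" "y \<in> H" shows "\<mu> (x * y * inverse x * inverse y) = 1"
proof -
 have "x * y * inverse x * inverse y = cj x y * inverse y" by (simp add: cj_def)
 then have "\<mu> (x * y * inverse x * inverse y) = \<mu> (cj x y) * \<mu> (inverse y)"
  using lin_mult[OF assms(1) subgrp_cj[OF assms(2-4)] subgrp_inverse[OF assms(2,4)]] by simp
 also have "\<dots> = \<mu> y * \<mu> (inverse y)" using lin_cj[OF assms] by simp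
 also have "\<dots> = \<mu> (y * inverse y)" using lin_mult[OF assms(1,4) subgrp_inverse[OF assms(2,4)]] by simp
 finally show ?thesis using lin_one[OF assms(1)] by simp
qed

text \<open>The quotient is a \<open>q\<close>-group, so it has a non-trivial linear character; the
  kernel, pulled back to \<open>H\<close>, is smaller than \<open>H\<close>, contains
  \<open>N\<close> with \<open>q\<close>-power index and contains all commutators of
  \<open>H\<close>.\<close>

lemma solv_prime_power_index:
 assumes q: "prime q" and N: "solv N"
 shows "subgrp H \<Longrightarrow> nsub N H \<Longrightarrow> card H = card N * q ^ k \<Longrightarrow> solv H"
proof (induction "card H" arbitrary: H k rule: less_induct)
 case (less H)
 note H = less.prems
 note sN = nsubD(1,2)[OF H(2)]
 show ?case
 proof (cases "H = N")
  case True then show ?thesis using N by simp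
 next
  case False
  obtain \<phi> :: "'a \<Rightarrow> nat perm" where \<phi>: "homo H \<phi>" "ker H \<phi> = N" using quotient_ex[OF H(1,2)] by blast
  have "card (\<phi> ` H) * card N = card H"
   using card_homo_image[OF \<phi>(1) H(1) order_refl] \<phi>(2) sN(2) by (simp add: Int_absorb1)
  then have "card (\<phi> ` H) * card N = q ^ k * card N" using H(3) by (simp add: mult.commute)
  moreover have "card N \<noteq> 0" using sN(1) by simp
  ultimately have "card (\<phi> ` H) = q ^ k" by simp
  then have pI: "pgrp q (\<phi> ` H)" unfolding pgrp_def using homo_image_subgrp[OF \<phi>(1) H(1)] by blast
  have "\<phi> ` H \<noteq> {1}"
  proof
   assume "\<phi> ` H = {1}"
   then have "H \<subseteq> ker H \<phi>" by (auto simp: ker_def)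
   then show False using \<phi>(2) False sN(2) by blast
  qed
  then obtain \<mu> y where \<mu>: "lin (\<phi> ` H) \<mu>" "y \<in> \<phi> ` H" "\<mu> y \<noteq> 1" using pgrp_lin_ex[OF q pI] by blast
  let ?\<nu> = "\<lambda>h. \<mu> (\<phi> h)"
  have \<nu>: "lin H ?\<nu>" using \<mu>(1) homo_mult[OF \<phi>(1)] homo_one[OF \<phi>(1)] by (auto simp: lin_def)
  let ?M = "{h\<in>H. ?\<nu> h = 1}"
  have M: "nsub ?M H" using lin_ker_nsub[OF \<nu> H(1)] .
  have NM: "N \<subseteq> ?M" using \<phi>(2) lin_one[OF \<mu>(1)] by (auto simp: ker_def)
  have "?M \<noteq> H" using \<mu>(2,3) by blast
  then have "?M \<subset> H" by blast
  then have lt: "card ?M < card H" using H(1) by (intro psubset_card_mono) auto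
  have nN: "nsub N ?M" using H(2) NM by (auto intro!: nsubI dest: nsubD)
  obtain t where t: "card ?M = card N * t" using subgrp_card_dvd[OF nsubD(1)[OF M] sN(1) NM] by (elim dvdE)
  have "card ?M dvd card H" using subgrp_card_dvd[OF H(1) nsubD(1,2)[OF M]] .
  then have "card N * t dvd card N * q ^ k" using t H(3) by simp
  then have "t dvd q ^ k" using sN(1) by simp
  then obtain j where "t = q ^ j" using q by (meson divides_primepow_nat)
  then have sM: "solv ?M" using less.hyps[OF lt nsubD(1)[OF M] nN] t by blast
  have "\<forall>x\<in>H. \<forall>y\<in>H. x * y * inverse x * inverse y \<in> ?M"
   using lin_commutator[OF \<nu> H(1)] H(1) by (simp add: subgrp_closed)
  then show ?thesis using solv.ext[OF sM M H(1)] by blast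
 qed
qed

text \<open>An odd prime divisor \<open>q\<close> of the order yields the proper invariant subgroup
  \<open>core q S\<close> of \<open>q\<close>-power index, to which induction applies. Without such
  a prime \<open>S\<close> is a 2-group.\<close>

theorem fpf_solv:
 fixes S :: "nat perm set"
 assumes p: "prime p"
 shows "subgrp S \<Longrightarrow> x ^ p = 1 \<Longrightarrow> x \<in> nrm S \<Longrightarrow> S \<inter> cent {x} = {1} \<Longrightarrow> solv S"
proof (induction "card S" arbitrary: S rule: less_induct)
 case (less S)
 note S = less.prems
 show ?case
 proof (cases "\<exists>q. prime q \<and> odd q \<and> q dvd card S")
  case True
  then obtain q where q: "prime q" "odd q" "q dvd card S" by blast
  have qn: "qnil q S" using fpf_qnil[OF p q(1,2) S] .
  let ?C = "core q S"
  have C: "nsub ?C S" using core_nsub[OF S(1) qn] .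
  note sC = nsubD(1,2)[OF C]
  have cop: "\<not> q dvd card ?C" using core_coprime[OF S(1) qn q(1)] coprime_prime_iff[OF q(1)] by blast
  have "?C \<noteq> S" using cop q(3) by auto
  then have "?C \<subset> S" using sC(2) by blast
  then have lt: "card ?C < card S" using S(1) by (intro psubset_card_mono) auto
  have xC: "x \<in> nrm ?C" by (rule nrmI) (use sC(1) nrm_cj[OF S(3)] in \<open>auto simp: core_def\<close>)
  have "?C \<inter> cent {x} = {1}" using S(4) sC subgrp_one[OF sC(1)] by (auto simp: cent_def)
  then have sol: "solv ?C" using less.hyps[OF lt sC(1) S(2) xC] by blast
  have "R \<subseteq> ?C" if "prime r" "r \<noteq> q" "syl r S R" for r R
   using that syl_p'el[OF q(1)] sylD(2) unfolding core_def by blast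
  then obtain k where "card S = card ?C * q ^ k" using prime_power_index[OF S(1) q(1) sC] by blast
  then show ?thesis using solv_prime_power_index[OF q(1) sol S(1) C] by blast
 next
  case False
  have two: "prime (2::nat)" by simp
  have "R \<subseteq> {1}" if R: "prime r" "r \<noteq> 2" "syl r S R" for r R
  proof -
   have "\<not> r dvd card S" using False R(1,2) by (metis primes_dvd_imp_eq two)
   then have "multiplicity r (card S) = 0" by (rule not_dvd_imp_multiplicity_0)
   then have "card R = 1" using sylD(4)[OF R(3)] by simp
   then show ?thesis using subgrp_one[OF sylD(1)[OF R(3)]] by (metis card_1_singletonE singletonD subset_refl)
  qed
  then obtain k where "card S = card {1::nat perm} * 2 ^ k"
   using prime_power_index[OF S(1) two subgrp_trivial] S(1) by (metis empty_subsetI insert_subset subgrp_one)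
  moreover have "nsub {1} S" using S(1) by (intro nsubI) auto
  ultimately show ?thesis using solv_prime_power_index[OF two solv.triv S(1)] by blast
 qed
qed

section \<open>Characters of groups with a normal subgroup\<close>

subsection \<open>Conjugate characters and Clifford theory\<close>

lemma Irr_restrict:
 assumes H: "subgrp H" and K: "subgrp K" "K \<subseteq> H" and \<chi>: "\<chi> \<in> Irr H"
 obtains n :: "('g::grp \<Rightarrow> complex) \<Rightarrow> nat" where "\<And>k. k \<in> K \<Longrightarrow> \<chi> k = (\<Sum>\<theta>\<in>Irr K. of_nat (n \<theta>) * \<theta> k)"
  "\<And>\<theta>. \<theta> \<in> Irr K \<Longrightarrow> ip K \<chi> \<theta> = of_nat (n \<theta>)"
proof -
 obtain d \<rho> where \<rho>: "irp H d \<rho>" "\<And>g. g \<in> H \<Longrightarrow> \<chi> g = mat_trace (\<rho> g)" by (rule IrrE[OF \<chi>]) blast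
 obtain n where "\<forall>h\<in>K. \<chi> h = (\<Sum>\<theta>\<in>Irr K. of_nat (n \<theta>) * \<theta> h)" "\<forall>\<theta>\<in>Irr K. ip K \<chi> \<theta> = of_nat (n \<theta> :: nat)"
  using char_decomp[OF K(1) rp_subset[OF irpD(1)[OF \<rho>(1)] K(2)], of \<chi>] \<rho>(2) K(2) by blast
 then show ?thesis using that by blast
qed

text \<open>The inverse makes conjugation of characters a left action.\<close>

definition cnj :: "'g::grp \<Rightarrow> ('g \<Rightarrow> complex) \<Rightarrow> 'g \<Rightarrow> complex" where
 "cnj g \<theta> = (\<lambda>n. \<theta> (cj (inverse g) n))"

definition stab :: "'g::grp set \<Rightarrow> ('g \<Rightarrow> complex) \<Rightarrow> 'g set" where
 "stab G \<theta> = {g\<in>G. cnj g \<theta> = \<theta>}"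

lemma cnj_mult: "cnj (g * h) \<theta> = cnj g (cnj h \<theta>)"
 by (simp add: cnj_def cj_comp)

lemma cnj_one [simp]: "cnj 1 \<theta> = \<theta>"
 by (simp add: cnj_def)

lemma cnj_1 [simp]: "cnj g \<theta> 1 = \<theta> 1"
 by (simp add: cnj_def)

lemma deg_cnj [simp]: "deg (cnj g \<theta>) = deg \<theta>"
 by (simp add: deg_def)

lemma Irr_cnj:
 assumes "\<theta> \<in> Irr N" "g \<in> nrm N" shows "cnj g \<theta> \<in> Irr N"
proof -
 obtain d \<rho> where \<rho>: "irp N d \<rho>" "\<theta> = character (mon N) \<rho>" by (rule IrrE[OF assms(1)]) blast
 have im: "cj (inverse g) ` N = N" using nrm_inverse[OF assms(2)] by (simp add: nrm_def)
 have "irp N d (\<lambda>x. \<rho> (cj (inverse g) x))"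
  by (rule irr_pullback[OF \<rho>(1)]) (simp_all add: im cj_mult)
 moreover have "cj (inverse g) x \<in> N \<longleftrightarrow> x \<in> N" for x
  using im nrm_cj[OF assms(2), of "cj (inverse g) x"] nrm_cj[OF nrm_inverse[OF assms(2)], of x] by auto
 then have "cnj g \<theta> = character (mon N) (\<lambda>x. \<rho> (cj (inverse g) x))"
  unfolding \<rho>(2) by (simp add: cnj_def character_def)
 ultimately show ?thesis using IrrI by metis
qed

lemma acts_cnj:
 assumes "H \<subseteq> nrm N" shows "acts H (Irr N) cnj"
 unfolding acts_def using assms Irr_cnj by (auto simp: cnj_mult)

lemma cnj_inner:
 assumes "subgrp N" "\<theta> \<in> Irr N" "g \<in> N" shows "cnj g \<theta> = \<theta>"
proof (rule Irr_eqI[OF Irr_cnj[OF assms(2)] assms(2)])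
 show "g \<in> nrm N" using subgrp_le_nrm[OF assms(1)] assms(3) by blast
 show "cnj g \<theta> h = \<theta> h" if "h \<in> N" for h
  unfolding cnj_def using Irr_cj[OF assms(2,1) subgrp_inverse[OF assms(1,3)] that] .
qed

lemma stab_subgrp:
 assumes "subgrp G" shows "subgrp (stab G \<theta>)"
 by (rule subgrpI) (use assms in \<open>auto simp: stab_def cnj_mult subgrp_mult\<close>)

lemma stab_le: "stab G \<theta> \<subseteq> G"
 by (auto simp: stab_def)

lemma le_stab:
 assumes "nsub K G" "\<theta> \<in> Irr K" shows "K \<subseteq> stab G \<theta>"
 using cnj_inner[OF nsubD(1)[OF assms(1)] assms(2)] nsubD(2)[OF assms(1)] by (auto simp: stab_def)

lemma bij_cj: 
 assumes "g \<in> nrm K" shows "bij_betw (cj g) K K"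
 unfolding bij_betw_def using assms by (simp add: nrm_def)

section \<open>Multiplicities and induction from the stabilizer\<close>

lemma ip_cnj:
 assumes G: "subgrp G" and K: "nsub K G" and \<eta>: "\<eta> \<in> Irr G" and g: "g \<in> G"
 shows "ip K \<eta> (cnj g \<theta>) = ip K \<eta> \<theta>"
proof -
 have "(\<Sum>k\<in>K. \<eta> k * \<theta> (cj (inverse g) (inverse k))) = (\<Sum>k\<in>K. \<eta> (cj g k) * \<theta> (cj (inverse g) (inverse (cj g k))))"
  by (rule sum.reindex_bij_betw[OF bij_cj, symmetric]) (use nsub_le_nrm[OF K] g in blast)
 also have "\<dots> = (\<Sum>k\<in>K. \<eta> k * \<theta> (inverse k))"
  by (rule sum.cong[OF refl]) (use Irr_cj[OF \<eta> G g] nsubD(2)[OF K] in \<open>auto simp flip: cj_inverse\<close>)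
 finally show ?thesis by (simp add: ip_def cnj_def)
qed

lemma ip_cong: "(\<And>h. h \<in> H \<Longrightarrow> f h = f' h) \<Longrightarrow> ip H f g = ip H f' g"
 by (simp add: ip_def)

text \<open>Multiplicities are natural numbers, so constituents of constituents cannot
  cancel.\<close>

lemma ip_restrict_pos:
 assumes G: "subgrp G" and T: "subgrp T" "T \<subseteq> G" and K: "subgrp K" "K \<subseteq> T"
  and \<eta>: "\<eta> \<in> Irr G" and \<psi>: "\<psi> \<in> Irr T" and \<theta>: "\<theta> \<in> Irr K"
  and nz: "ip T \<eta> \<psi> \<noteq> 0" "ip K \<psi> \<theta> \<noteq> 0"
 shows "ip K \<eta> \<theta> \<noteq> 0"
proof -
 obtain n where n: "\<And>t. t \<in> T \<Longrightarrow> \<eta> t = (\<Sum>\<psi>\<in>Irr T. of_nat (n \<psi>) * \<psi> t)" "\<And>\<psi>. \<psi> \<in> Irr T \<Longrightarrow> ip T \<eta> \<psi> = of_nat (n \<psi>)"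
  using Irr_restrict[OF G T \<eta>] by blast
 have "\<forall>\<psi>\<in>Irr T. \<exists>l::nat. ip K \<psi> \<theta> = of_nat l"
  using Irr_restrict[OF T(1) K] \<theta> by metis
 then obtain l :: "_ \<Rightarrow> nat" where l: "\<And>\<psi>. \<psi> \<in> Irr T \<Longrightarrow> ip K \<psi> \<theta> = of_nat (l \<psi>)" by metis
 have "ip K \<eta> \<theta> = ip K (\<lambda>t. \<Sum>\<psi>\<in>Irr T. of_nat (n \<psi>) * \<psi> t) \<theta>"
  by (rule ip_cong) (use n(1) K(2) in blast)
 also have "\<dots> = (\<Sum>k\<in>K. \<Sum>\<psi>\<in>Irr T. of_nat (n \<psi>) * (\<psi> k * \<theta> (inverse k))) / of_nat (card K)"
  by (simp add: ip_def sum_distrib_right mult.assoc)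
 also have "\<dots> = (\<Sum>\<psi>\<in>Irr T. of_nat (n \<psi>) * ip K \<psi> \<theta>)"
  by (subst sum.swap) (simp add: ip_def sum_divide_distrib sum_distrib_left)
 also have "\<dots> = of_nat (\<Sum>\<psi>\<in>Irr T. n \<psi> * l \<psi>)" using l by simp
 finally have e: "ip K \<eta> \<theta> = of_nat (\<Sum>\<psi>\<in>Irr T. n \<psi> * l \<psi>)" .
 have "n \<psi> * l \<psi> \<le> (\<Sum>\<psi>\<in>Irr T. n \<psi> * l \<psi>)"
  by (rule member_le_sum[OF \<psi>]) (use Irr_regular(1)[OF T(1)] in auto)
 moreover have "n \<psi> * l \<psi> > 0" using nz n(2)[OF \<psi>] l[OF \<psi>] by simp
 ultimately show ?thesis unfolding e by (simp only: of_nat_eq_0_iff)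
qed

text \<open>\<open>\<eta>\<close> is invariant under conjugation by \<open>G\<close>, so its
  restriction to \<open>K\<close> contains every conjugate of \<open>\<theta>\<close>; their number
  is the index of the stabilizer.\<close>

lemma degree_bound:
 assumes G: "subgrp G" and K: "nsub K G" and \<eta>: "\<eta> \<in> Irr G" and \<theta>: "\<theta> \<in> Irr K" and nz: "ip K \<eta> \<theta> \<noteq> 0"
 shows "card G * deg \<theta> \<le> card (stab G \<theta>) * deg \<eta>"
proof -
 note sK = nsubD(1)[OF K] and KG = nsubD(2)[OF K]
 obtain m where m: "\<And>k. k \<in> K \<Longrightarrow> \<eta> k = (\<Sum>\<theta>\<in>Irr K. of_nat (m \<theta>) * \<theta> k)" "\<And>\<theta>. \<theta> \<in> Irr K \<Longrightarrow> ip K \<eta> \<theta> = of_nat (m \<theta>)"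
  using Irr_restrict[OF G sK KG \<eta>] by blast
 let ?O = "(\<lambda>g. cnj g \<theta>) ` G"
 have act: "acts G (Irr K) cnj" by (rule acts_cnj[OF nsub_le_nrm[OF K]])
 have O: "?O \<subseteq> Irr K" using act \<theta> by (auto simp: acts_def)
 have fin: "finite (Irr K)" by (rule Irr_regular(1)[OF sK])
 have "of_nat (deg \<eta>) = (\<Sum>\<theta>\<in>Irr K. of_nat (m \<theta>) * of_nat (deg \<theta>) :: complex)"
  using m(1)[OF subgrp_one[OF sK]] deg_Irr(1)[OF \<eta> G] deg_Irr(1)[OF _ sK] by simp
 then have "of_nat (deg \<eta>) = (of_nat (\<Sum>\<theta>\<in>Irr K. m \<theta> * deg \<theta>) :: complex)" by simp
 then have d: "deg \<eta> = (\<Sum>\<theta>\<in>Irr K. m \<theta> * deg \<theta>)" by (simp only: of_nat_eq_iff)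
 have "m \<theta>' \<ge> 1 \<and> deg \<theta>' = deg \<theta>" if "\<theta>' \<in> ?O" for \<theta>'
 proof -
  obtain g where g: "g \<in> G" "\<theta>' = cnj g \<theta>" using \<open>\<theta>' \<in> ?O\<close> by blast
  have "of_nat (m \<theta>') \<noteq> (0::complex)" using ip_cnj[OF G K \<eta> g(1), of \<theta>] nz m(2)[of \<theta>'] O that g(2) by auto
  then show ?thesis using g(2) by simp
 qed
 then have "(\<Sum>\<theta>'\<in>?O. deg \<theta>) \<le> (\<Sum>\<theta>'\<in>?O. m \<theta>' * deg \<theta>')" by (intro sum_mono) fastforce
 also have "\<dots> \<le> deg \<eta>" unfolding d by (rule sum_mono2[OF fin O]) simp
 finally have "card ?O * deg \<theta> \<le> deg \<eta>" by simp
 then have "card (stab G \<theta>) * (card ?O * deg \<theta>) \<le> card (stab G \<theta>) * deg \<eta>" by (rule mult_le_mono2)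
 moreover have "card ?O * card (stab G \<theta>) = card G" unfolding stab_def by (rule orbit_stabilizer[OF G act \<theta>])
 ultimately show ?thesis by (metis mult.assoc mult.commute)
qed

text \<open>For a character \<open>\<psi>\<close> of \<open>T\<close> the right side is
  \<open>card T\<close> times the induced character at \<open>g\<close>, and the coefficient of
  \<open>\<eta> g\<close> on the left is \<open>card T\<close> times the multiplicity predicted by
  Frobenius reciprocity. Second orthogonality, applied at \<open>inverse g\<close>, identifies the
  two.\<close>

lemma frobenius_induction:
 assumes G: "subgrp G" and T: "subgrp T" "T \<subseteq> G" and g: "g \<in> G"
 shows "(\<Sum>\<eta>\<in>Irr G. (\<Sum>t\<in>T. \<eta> t * \<psi> (inverse t)) * \<eta> g) = (\<Sum>h | h \<in> G \<and> cj h g \<in> T. \<psi> (cj h g))"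
proof -
 have fG: "finite G" using G by simp
 have ig: "inverse g \<in> G" using subgrp_inverse[OF G g] .
 have "(\<Sum>\<eta>\<in>Irr G. (\<Sum>t\<in>T. \<eta> t * \<psi> (inverse t)) * \<eta> g) = (\<Sum>\<eta>\<in>Irr G. \<Sum>t\<in>T. \<psi> (inverse t) * (\<eta> t * \<eta> (inverse (inverse g))))"
  by (simp add: sum_distrib_left mult_ac)
 also have "\<dots> = (\<Sum>t\<in>T. \<psi> (inverse t) * (\<Sum>\<eta>\<in>Irr G. \<eta> t * \<eta> (inverse (inverse g))))"
  by (subst sum.swap) (simp only: sum_distrib_left)
 also have "\<dots> = (\<Sum>t\<in>T. \<psi> (inverse t) * of_nat (card {h\<in>G. cj h t = inverse g}))"
  by (rule sum.cong[OF refl]) (use Irr_second_orth[OF G _ ig] T(2) in \<open>simp add: subset_iff\<close>)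
 also have "\<dots> = (\<Sum>t\<in>T. \<Sum>h\<in>G. if cj h t = inverse g then \<psi> (inverse t) else 0)"
  by (rule sum.cong[OF refl]) (use fG in \<open>simp add: sum.If_cases Int_def mult.commute\<close>)
 also have "\<dots> = (\<Sum>h\<in>G. \<Sum>t\<in>T. if cj h t = inverse g then \<psi> (inverse t) else 0)" by (rule sum.swap)
 also have "\<dots> = (\<Sum>h\<in>G. if cj (inverse h) g \<in> T then \<psi> (cj (inverse h) g) else 0)"
 proof (rule sum.cong[OF refl])
  fix h assume h: "h \<in> G"
  have iff: "cj h t = inverse g \<longleftrightarrow> t = inverse (cj (inverse h) g)" for t
   by (metis cj_cancel cj_inverse)
  show "(\<Sum>t\<in>T. if cj h t = inverse g then \<psi> (inverse t) else 0) = (if cj (inverse h) g \<in> T then \<psi> (cj (inverse h) g) else 0)"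
   unfolding iff using T(1) by (simp add: subgrp_inverse_iff)
 qed
 also have "\<dots> = (\<Sum>h\<in>G. if cj h g \<in> T then \<psi> (cj h g) else 0)"
  by (rule sum_reindex_inverse[OF G, of "\<lambda>h. if cj h g \<in> T then \<psi> (cj h g) else 0"])
 also have "\<dots> = (\<Sum>h | h \<in> G \<and> cj h g \<in> T. \<psi> (cj h g))"
  by (rule sum.inter_filter[OF fG, symmetric])
 finally show ?thesis .
qed

text \<open>A case of the Clifford correspondence. The degree of the induced character is the index
  of \<open>T\<close> times the degree of \<open>\<theta>\<close>, and by
  \<open>degree_bound\<close> any one constituent already has at least this degree, so there is a
  single constituent, of multiplicity one.\<close>

lemma clifford_induce:
 assumes G: "subgrp G" and K: "nsub K G" and \<theta>: "\<theta> \<in> Irr K" and T: "T = stab G \<theta>"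
  and \<psi>: "\<psi> \<in> Irr T" "\<And>k. k \<in> K \<Longrightarrow> \<psi> k = \<theta> k"
 shows "\<exists>\<chi>\<in>Irr G. card T * deg \<chi> = card G * deg \<theta> \<and>
  (\<forall>g\<in>G. of_nat (card T) * \<chi> g = (\<Sum>h | h \<in> G \<and> cj h g \<in> T. \<psi> (cj h g))) \<and>
  (\<forall>\<eta>\<in>Irr G. ip T \<eta> \<psi> \<noteq> 0 \<longrightarrow> \<eta> = \<chi>)"
proof -
 have sT: "subgrp T" "T \<subseteq> G" unfolding T using stab_subgrp[OF G] stab_le by auto
 have KT: "K \<subseteq> T" unfolding T by (rule le_stab[OF K \<theta>])
 note sK = nsubD(1)[OF K]
 have "\<forall>\<eta>\<in>Irr G. \<exists>n::nat. ip T \<eta> \<psi> = of_nat n" using Irr_restrict[OF G sT] \<psi>(1) by metis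
 then obtain n :: "_ \<Rightarrow> nat" where n: "\<And>\<eta>. \<eta> \<in> Irr G \<Longrightarrow> ip T \<eta> \<psi> = of_nat (n \<eta>)" by metis
 have fin: "finite (Irr G)" by (rule Irr_regular(1)[OF G])
 have ind: "of_nat (card T) * (\<Sum>\<eta>\<in>Irr G. of_nat (n \<eta>) * \<eta> g) = (\<Sum>h | h \<in> G \<and> cj h g \<in> T. \<psi> (cj h g))" if g: "g \<in> G" for g
 proof -
  have "of_nat (card T) * of_nat (n \<eta>) = (\<Sum>t\<in>T. \<eta> t * \<psi> (inverse t))" if "\<eta> \<in> Irr G" for \<eta>
   using n[OF that] sT(1) by (simp add: ip_def field_simps)
  then have "of_nat (card T) * (\<Sum>\<eta>\<in>Irr G. of_nat (n \<eta>) * \<eta> g) = (\<Sum>\<eta>\<in>Irr G. (\<Sum>t\<in>T. \<eta> t * \<psi> (inverse t)) * \<eta> g)"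
   unfolding sum_distrib_left by (intro sum.cong[OF refl]) (simp flip: mult.assoc)
  then show ?thesis using frobenius_induction[OF G sT g] by simp
 qed
 have "{h. h \<in> G \<and> cj h 1 \<in> T} = G" using sT(1) by auto
 then have "of_nat (card T) * (\<Sum>\<eta>\<in>Irr G. of_nat (n \<eta>) * of_nat (deg \<eta>)) = (of_nat (card G) * of_nat (deg \<theta>) :: complex)"
  using ind[OF subgrp_one[OF G]] deg_Irr(1)[OF _ G] \<psi>(2)[OF subgrp_one[OF sK]] deg_Irr(1)[OF \<theta> sK] by simp
 then have "of_nat (card T * (\<Sum>\<eta>\<in>Irr G. n \<eta> * deg \<eta>)) = (of_nat (card G * deg \<theta>) :: complex)" by simp
 then have tot: "card T * (\<Sum>\<eta>\<in>Irr G. n \<eta> * deg \<eta>) = card G * deg \<theta>" by (simp only: of_nat_eq_iff)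
 have "card G * deg \<theta> > 0" using deg_Irr(2)[OF \<theta> sK] G by simp
 then have "(\<Sum>\<eta>\<in>Irr G. n \<eta> * deg \<eta>) \<noteq> 0" using tot by (metis mult_0_right less_irrefl)
 then obtain \<chi> where \<chi>: "\<chi> \<in> Irr G" "n \<chi> \<noteq> 0" using fin by (metis (mono_tags, lifting) mult_eq_0_iff sum.neutral)
 have "ip K \<psi> \<theta> = ip K \<theta> \<theta>" by (rule ip_cong) (rule \<psi>(2))
 then have "ip K \<psi> \<theta> \<noteq> 0" using ip_Irr[OF sK \<theta> \<theta>] by simp
 then have "ip K \<chi> \<theta> \<noteq> 0" using ip_restrict_pos[OF G sT sK KT \<chi>(1) \<psi>(1) \<theta>] n[OF \<chi>(1)] \<chi>(2) by simp
 from degree_bound[OF G K \<chi>(1) \<theta> this] have "card T * (\<Sum>\<eta>\<in>Irr G. n \<eta> * deg \<eta>) \<le> card T * deg \<chi>"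
  by (simp only: tot T[symmetric])
 then have le: "(\<Sum>\<eta>\<in>Irr G. n \<eta> * deg \<eta>) \<le> deg \<chi>" using sT(1) by simp
 have split: "(\<Sum>\<eta>\<in>Irr G. n \<eta> * deg \<eta>) = n \<chi> * deg \<chi> + (\<Sum>\<eta>\<in>Irr G - {\<chi>}. n \<eta> * deg \<eta>)"
  by (rule sum.remove[OF fin \<chi>(1)])
 have dc: "deg \<chi> > 0" by (rule deg_Irr(2)[OF \<chi>(1) G])
 have n1: "n \<chi> = 1"
 proof (rule ccontr)
  assume "n \<chi> \<noteq> 1"
  then have "2 * deg \<chi> \<le> n \<chi> * deg \<chi>" using \<chi>(2) by (intro mult_le_mono1) simp
  then show False using le split dc by linarith
 qed
 then have "(\<Sum>\<eta>\<in>Irr G - {\<chi>}. n \<eta> * deg \<eta>) = 0" using le split by simp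
 then have n0: "n \<eta> = 0" if "\<eta> \<in> Irr G" "\<eta> \<noteq> \<chi>" for \<eta>
  using that fin deg_Irr(2)[OF that(1) G] by (auto simp: sum_eq_0_iff)
 have "(\<Sum>\<eta>\<in>Irr G. of_nat (n \<eta>) * \<eta> g) = \<chi> g" for g
 proof -
  have "(\<Sum>\<eta>\<in>Irr G. of_nat (n \<eta>) * \<eta> g) = of_nat (n \<chi>) * \<chi> g + (\<Sum>\<eta>\<in>Irr G - {\<chi>}. of_nat (n \<eta>) * \<eta> g)"
   by (rule sum.remove[OF fin \<chi>(1)])
  also have "(\<Sum>\<eta>\<in>Irr G - {\<chi>}. of_nat (n \<eta>) * \<eta> g) = 0" by (rule sum.neutral) (simp add: n0)
  finally show ?thesis using n1 by simp
 qed
 moreover have "card T * deg \<chi> = card G * deg \<theta>"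
  using tot split n1 \<open>(\<Sum>\<eta>\<in>Irr G - {\<chi>}. n \<eta> * deg \<eta>) = 0\<close> by simp
 moreover have "\<eta> = \<chi>" if "\<eta> \<in> Irr G" "ip T \<eta> \<psi> \<noteq> 0" for \<eta> using n0 n that by (metis of_nat_0)
 ultimately show ?thesis using \<chi>(1) ind by (intro bexI[of _ \<chi>]) auto
qed

text \<open>Mackey's formula for a single double coset: restricted to \<open>P\<close>, the induced
  character is induced from \<open>T \<inter> P\<close>. Only the sum over \<open>P\<close> is
  recorded; writing \<open>h\<close> as \<open>t * y\<close> removes \<open>h\<close> from the inner
  sums.\<close>

lemma mackey_sum:
 assumes G: "subgrp G" and T: "subgrp T" "T \<subseteq> G" and P: "subgrp P" "P \<subseteq> G" and TP: "setmul T P = G"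
  and \<psi>: "\<psi> \<in> Irr T" and \<chi>: "\<And>g. g \<in> G \<Longrightarrow> of_nat (card T) * \<chi> g = (\<Sum>h | h \<in> G \<and> cj h g \<in> T. \<psi> (cj h g))"
 shows "of_nat (card T) * (\<Sum>x\<in>P. \<chi> x) = of_nat (card G) * (\<Sum>x\<in>T \<inter> P. \<psi> x)"
proof -
 have fG: "finite G" and fP: "finite P" using G P by auto
 have "of_nat (card T) * (\<Sum>x\<in>P. \<chi> x) = (\<Sum>x\<in>P. \<Sum>h\<in>G. if cj h x \<in> T then \<psi> (cj h x) else 0)"
  unfolding sum_distrib_left
  by (rule sum.cong[OF refl]) (use \<chi> P(2) in \<open>auto simp: sum.inter_filter[OF fG, symmetric]\<close>)
 also have "\<dots> = (\<Sum>h\<in>G. \<Sum>x\<in>P. if cj h x \<in> T then \<psi> (cj h x) else 0)" by (rule sum.swap)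
 also have "\<dots> = (\<Sum>h\<in>G. \<Sum>x\<in>P. if x \<in> T then \<psi> x else 0)"
 proof (rule sum.cong[OF refl])
  fix h assume "h \<in> G"
  then obtain t y where ty: "t \<in> T" "y \<in> P" "h = t * y" unfolding TP[symmetric] by (elim setmulE)
  have tT: "cj t x \<in> T \<longleftrightarrow> x \<in> T" for x
   using subgrp_cj[OF T(1) ty(1), of x] subgrp_cj[OF T(1) subgrp_inverse[OF T(1) ty(1)], of "cj t x"] by auto
  have "(\<Sum>x\<in>P. if cj h x \<in> T then \<psi> (cj h x) else 0) = (\<Sum>x\<in>P. if cj t (cj y x) \<in> T then \<psi> (cj t (cj y x)) else 0)"
   by (simp only: ty(3) cj_comp)
  also have "\<dots> = (\<Sum>x\<in>P. if cj t x \<in> T then \<psi> (cj t x) else 0)"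
   by (rule sum.reindex_bij_betw[OF bij_cj, of y P "\<lambda>x. if cj t x \<in> T then \<psi> (cj t x) else 0"])
    (use subgrp_le_nrm[OF P(1)] ty(2) in blast)
  also have "\<dots> = (\<Sum>x\<in>P. if x \<in> T then \<psi> x else 0)"
   by (rule sum.cong[OF refl]) (use Irr_cj[OF \<psi> T(1) ty(1)] tT in auto)
  finally show "(\<Sum>x\<in>P. if cj h x \<in> T then \<psi> (cj h x) else 0) = (\<Sum>x\<in>P. if x \<in> T then \<psi> x else 0)" .
 qed
 also have "\<dots> = of_nat (card G) * (\<Sum>x\<in>T \<inter> P. \<psi> x)"
  using fP by (simp add: sum.inter_restrict[symmetric] Int_commute)
 finally show ?thesis .
qed

subsection \<open>Extension of invariant characters\<close>

lemma complex_power_cong: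
 fixes z :: complex
 assumes "z ^ n = 1" "[a = b] (mod n)" shows "z ^ a = z ^ b"
proof -
 have "z ^ c = z ^ (c mod n)" for c
 proof -
  have "z ^ c = z ^ (n * (c div n) + c mod n)" by simp
  also have "\<dots> = z ^ (c mod n)" by (simp only: power_add power_mult assms(1) power_one mult_1)
  finally show ?thesis .
 qed
 then show ?thesis using assms(2) unfolding cong_def by metis
qed

text \<open>Equal characters have inner product 1, so some matrix of \<open>coeff_intertwine\<close>
  is non-zero, hence invertible. Scaling by a \<open>d\<close>-th root makes its determinant 1,
  which later forces the cocycle values to be roots of unity.\<close>

lemma intertwiner_ex:
 assumes N: "subgrp N" and \<tau>: "irp N d \<tau>" and \<rho>: "irp N d \<rho>"
  and tr: "\<And>n. n \<in> N \<Longrightarrow> mat_trace (\<tau> n) = mat_trace (\<rho> n)"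
 shows "\<exists>A\<in>carrier_mat d d. det A = 1 \<and> (\<forall>n\<in>N. \<tau> n * A = A * \<rho> n)"
proof -
 note r = rpD[OF irpD(1)[OF \<rho>]] and t = rpD[OF irpD(1)[OF \<tau>]]
 have d0: "d > 0" by (rule irpD(2)[OF \<rho>])
 have "\<exists>i<d. \<exists>k<d. (\<Sum>h\<in>N. \<tau> h $$ (i, i) * \<rho> (inverse h) $$ (k, k)) \<noteq> 0"
 proof (rule ccontr)
  assume "\<not> ?thesis"
  then have zero: "(\<Sum>h\<in>N. \<tau> h $$ (i, i) * \<rho> (inverse h) $$ (k, k)) = 0" if "i < d" "k < d" for i k using that by blast
  let ?\<chi> = "character (mon N) \<rho>"
  have "(\<Sum>h\<in>N. ?\<chi> h * ?\<chi> (inverse h)) = (\<Sum>h\<in>N. (\<Sum>i<d. \<tau> h $$ (i, i)) * (\<Sum>k<d. \<rho> (inverse h) $$ (k, k)))"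
  proof (rule sum.cong[OF refl])
   fix h assume h: "h \<in> N"
   have "?\<chi> h = (\<Sum>i<d. \<tau> h $$ (i, i))" using h tr[OF h, symmetric] t(1)[OF h] by (simp add: character_mon mat_trace_def)
   moreover have "?\<chi> (inverse h) = (\<Sum>k<d. \<rho> (inverse h) $$ (k, k))"
    using subgrp_inverse[OF N h] r(1)[OF subgrp_inverse[OF N h]] by (simp add: character_mon mat_trace_def)
   ultimately show "?\<chi> h * ?\<chi> (inverse h) = (\<Sum>i<d. \<tau> h $$ (i, i)) * (\<Sum>k<d. \<rho> (inverse h) $$ (k, k))" by simp
  qed
  also have "\<dots> = (\<Sum>h\<in>N. \<Sum>i<d. \<Sum>k<d. \<tau> h $$ (i, i) * \<rho> (inverse h) $$ (k, k))" by (simp add: sum_product)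
  also have "\<dots> = (\<Sum>i<d. \<Sum>h\<in>N. \<Sum>k<d. \<tau> h $$ (i, i) * \<rho> (inverse h) $$ (k, k))" by (rule sum.swap)
  also have "\<dots> = (\<Sum>i<d. \<Sum>k<d. \<Sum>h\<in>N. \<tau> h $$ (i, i) * \<rho> (inverse h) $$ (k, k))" by (rule sum.cong[OF refl sum.swap])
  also have "\<dots> = 0" using zero by simp
  finally show False using Irr_orth[OF N IrrI[OF \<rho>] IrrI[OF \<rho>]] N by simp
 qed
 then obtain i k where ik: "i < d" "k < d" "(\<Sum>h\<in>N. \<tau> h $$ (i, i) * \<rho> (inverse h) $$ (k, k)) \<noteq> 0" by blast
 let ?M = "mat d d (\<lambda>(a, l). \<Sum>h\<in>N. \<tau> h $$ (a, i) * \<rho> (inverse h) $$ (k, l))"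
 have M: "?M \<in> carrier_mat d d" by simp
 have comm: "\<tau> g * ?M = ?M * \<rho> g" if "g \<in> N" for g
  using coeff_intertwine[OF N irpD(1)[OF \<tau>] irpD(1)[OF \<rho>] ik(1,2) that] .
 have "?M $$ (i, k) \<noteq> 0" using ik by simp
 then have "?M \<noteq> 0\<^sub>m d d" using ik(1,2) by (metis index_zero_mat(1))
 then obtain Y where Y: "Y \<in> carrier_mat d d" "?M * Y = 1\<^sub>m d" using schur_intertwiner[OF \<tau> \<rho> M comm] by blast
 have "det ?M * det Y = 1" using det_mult[OF M Y(1)] Y(2) by simp
 then have dM: "det ?M \<noteq> 0" by auto
 obtain c where c: "c ^ d = 1 / det ?M" using nth_root_exists[OF d0] by blast
 have "det (c \<cdot>\<^sub>m ?M) = c ^ d * det ?M" using det_smult[of c ?M] by simp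
 then have "det (c \<cdot>\<^sub>m ?M) = 1" using c dM by simp
 moreover have "\<tau> n * (c \<cdot>\<^sub>m ?M) = (c \<cdot>\<^sub>m ?M) * \<rho> n" if "n \<in> N" for n
  using mult_smult_distrib[OF t(1)[OF that] M] mult_smult_assoc_mat[OF M r(1)[OF that]] comm[OF that] by metis
 ultimately show ?thesis using M by (intro bexI[of _ "c \<cdot>\<^sub>m ?M"]) auto
qed

lemma smult_mat_cancel:
 fixes A :: "complex mat"
 assumes "a \<cdot>\<^sub>m A = b \<cdot>\<^sub>m A" "A \<in> carrier_mat d d" "A \<noteq> 0\<^sub>m d d" shows "a = b"
proof -
 have "\<not> (\<forall>i<d. \<forall>j<d. A $$ (i, j) = 0)" using assms(2,3) by (auto intro!: eq_matI)
 then obtain i j where ij: "i < d" "j < d" "A $$ (i, j) \<noteq> 0" by blast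
 have "(a \<cdot>\<^sub>m A) $$ (i, j) = (b \<cdot>\<^sub>m A) $$ (i, j)" using assms(1) by simp
 then show ?thesis using ij assms(2) by simp
qed

text \<open>Coset-compatible intertwiners of determinant a root of unity of order prime to \<open>p\<close> form a projective
 representation whose cocycle has order prime to \<open>p\<close>; multiplying the cocycle identity over a transversal of
 \<open>p\<close>-power size exhibits it as a coboundary.\<close>

lemma extension:
 fixes H :: "'g::grp set"
 assumes H: "subgrp H" and N: "nsub N H" and idx: "card H = card N * p ^ a" and p: "prime p"
  and \<rho>: "irp N d \<rho>" and inv: "\<And>h n. h \<in> H \<Longrightarrow> n \<in> N \<Longrightarrow> mat_trace (\<rho> (cj h n)) = mat_trace (\<rho> n)"
  and pd: "\<not> p dvd d" and m: "coprime m p" "\<And>n. n \<in> N \<Longrightarrow> det (\<rho> n) ^ m = 1"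
 shows "\<exists>\<tau>. rp H d \<tau> \<and> (\<forall>n\<in>N. \<tau> n = \<rho> n)"
proof -
 note r = rpD[OF irpD(1)[OF \<rho>]] and sN = nsubD(1)[OF N] and NH = nsubD(2)[OF N] and cjN = nsubD(3)[OF N]
 have d0: "d > 0" by (rule irpD(2)[OF \<rho>])
 have irr: "irp N d (\<lambda>n. \<rho> (cj h n))" if h: "h \<in> H" for h
 proof (rule irr_pullback[OF \<rho>])
  show "cj h ` carrier (mon N) = carrier (mon N)" using nsub_le_nrm[OF N] h by (auto simp: nrm_def)
 qed (simp_all add: cj_mult)
 have "\<forall>h\<in>H. \<exists>A. A \<in> carrier_mat d d \<and> det A = 1 \<and> (\<forall>n\<in>N. \<rho> (cj h n) * A = A * \<rho> n) \<and> (h = 1 \<longrightarrow> A = 1\<^sub>m d)"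
 proof
  fix h assume h: "h \<in> H"
  show "\<exists>A. A \<in> carrier_mat d d \<and> det A = 1 \<and> (\<forall>n\<in>N. \<rho> (cj h n) * A = A * \<rho> n) \<and> (h = 1 \<longrightarrow> A = 1\<^sub>m d)"
  proof (cases "h = 1")
   case True
   have "\<rho> n * 1\<^sub>m d = 1\<^sub>m d * \<rho> n" if "n \<in> N" for n using r(1)[OF that] by simp
   then show ?thesis using True by (intro exI[of _ "1\<^sub>m d"]) auto
  next
   case False
   then show ?thesis using intertwiner_ex[OF sN irr[OF h] \<rho> inv[OF h]] by blast
  qed
 qed
 then obtain B where "\<forall>h\<in>H. B h \<in> carrier_mat d d \<and> det (B h) = 1 \<and> (\<forall>n\<in>N. \<rho> (cj h n) * B h = B h * \<rho> n) \<and> (h = 1 \<longrightarrow> B h = 1\<^sub>m d)"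
  by metis
 then have B: "\<And>h. h \<in> H \<Longrightarrow> B h \<in> carrier_mat d d" "\<And>h. h \<in> H \<Longrightarrow> det (B h) = 1"
   "\<And>h n. h \<in> H \<Longrightarrow> n \<in> N \<Longrightarrow> \<rho> (cj h n) * B h = B h * \<rho> n" and B1: "B 1 = 1\<^sub>m d"
  using H by auto
 \<comment> \<open>Representative of the coset of \<open>h\<close>, with 1 representing
   \<open>N\<close> itself so that \<open>A\<close> below agrees with \<open>\<rho>\<close> on
   \<open>N\<close>.\<close>
 define f where "f h = (if h \<in> N then 1 else SOME t. \<exists>n\<in>N. t = n * h)" for h
 have fspec: "\<exists>n\<in>N. f h = n * h" for h
 proof (cases "h \<in> N")
  case True
  then show ?thesis using sN by (intro bexI[of _ "inverse h"]) (auto simp: f_def subgrp_inverse)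
 next
  case False
  have "\<exists>t. \<exists>n\<in>N. t = n * h" using sN subgrp_one by blast
  from someI_ex[OF this] show ?thesis using False by (simp add: f_def)
 qed
 have fH: "f h \<in> H" if "h \<in> H" for h using fspec[of h] that NH H by (auto simp: subgrp_mult subset_iff)
 have fN: "f (n * h) = f h" if n: "n \<in> N" for n h
 proof -
  have "(\<exists>k\<in>N. t = k * (n * h)) \<longleftrightarrow> (\<exists>k\<in>N. t = k * h)" for t
  proof
   assume "\<exists>k\<in>N. t = k * (n * h)"
   then obtain k where "k \<in> N" "t = k * (n * h)" by blast
   then show "\<exists>k\<in>N. t = k * h" using subgrp_mult[OF sN _ n] by (intro bexI[of _ "k * n"]) (auto simp: mult.assoc)
  next
   assume "\<exists>k\<in>N. t = k * h"
   then obtain k where "k \<in> N" "t = k * h" by blast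
   then show "\<exists>k\<in>N. t = k * (n * h)"
    using subgrp_mult[OF sN _ subgrp_inverse[OF sN n]] by (intro bexI[of _ "k * inverse n"]) (auto simp: mult.assoc)
  qed
  moreover have "n * h \<in> N \<longleftrightarrow> h \<in> N" using subgrp_mult_left_iff[OF sN n] .
  ultimately show ?thesis by (simp add: f_def)
 qed
 have ff: "f (f h) = f h" for h using fspec[of h] fN by auto
 define c where "c h = h * inverse (f h)" for h
 have cN: "c h \<in> N" for h
 proof -
  obtain n where "n \<in> N" "f h = n * h" using fspec by blast
  then have "c h = inverse n" by (simp add: c_def mult.assoc[symmetric])
  then show ?thesis using \<open>n \<in> N\<close> sN by (simp add: subgrp_inverse)
 qed
 have hcf: "h = c h * f h" for h by (simp add: c_def mult.assoc)
 \<comment> \<open>Splitting \<open>h\<close> as \<open>c h * f h\<close> makes \<open>A\<close>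
   compatible with left multiplication by \<open>N\<close>; the cocycle will then depend on cosets
   only.\<close>
 define A where "A h = \<rho> (c h) * B (f h)" for h
 have Ac: "A h \<in> carrier_mat d d" if "h \<in> H" for h
  unfolding A_def by (rule mult_carrier_mat[OF r(1)[OF cN] B(1)[OF fH[OF that]]])
 have An: "A (n * h) = \<rho> n * A h" if n: "n \<in> N" and h: "h \<in> H" for n h
 proof -
  have "c (n * h) = n * c h" by (simp add: c_def fN[OF n] mult.assoc)
  then have "A (n * h) = (\<rho> n * \<rho> (c h)) * B (f h)" unfolding A_def fN[OF n] using r(3)[OF n cN] by simp
  also have "\<dots> = \<rho> n * A h" unfolding A_def by (rule assoc_mult_mat[OF r(1)[OF n] r(1)[OF cN] B(1)[OF fH[OF h]]])
  finally show ?thesis .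
 qed
 have AN: "A n = \<rho> n" if n: "n \<in> N" for n
  unfolding A_def c_def f_def using n B1 r(1)[OF n] by simp
 have Ai: "\<rho> (cj h n) * A h = A h * \<rho> n" if h: "h \<in> H" and n: "n \<in> N" for h n
 proof -
  note Bf = B(1)[OF fH[OF h]] and ch = cN[of h]
  have e: "cj h n * c h = c h * cj (f h) n"
   unfolding cj_def c_def by (simp add: mult.assoc)
  have cf: "cj (f h) n \<in> N" using cjN[OF fH[OF h] n] .
  have "\<rho> (cj h n) * A h = (\<rho> (cj h n) * \<rho> (c h)) * B (f h)"
   unfolding A_def using assoc_mult_mat[OF r(1)[OF cjN[OF h n]] r(1)[OF ch] Bf] by simp
  also have "\<rho> (cj h n) * \<rho> (c h) = \<rho> (c h) * \<rho> (cj (f h) n)"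
   using r(3)[OF cjN[OF h n] ch] r(3)[OF ch cf] e by simp
  also have "\<rho> (c h) * \<rho> (cj (f h) n) * B (f h) = \<rho> (c h) * (\<rho> (cj (f h) n) * B (f h))"
   by (rule assoc_mult_mat[OF r(1)[OF ch] r(1)[OF cf] Bf])
  also have "\<rho> (cj (f h) n) * B (f h) = B (f h) * \<rho> n" by (rule B(3)[OF fH[OF h] n])
  also have "\<rho> (c h) * (B (f h) * \<rho> n) = A h * \<rho> n"
   unfolding A_def using assoc_mult_mat[OF r(1)[OF ch] Bf r(1)[OF n]] by simp
  finally show ?thesis .
 qed
 have detA: "det (A h) ^ m = 1" if h: "h \<in> H" for h
  unfolding A_def using det_mult[OF r(1)[OF cN] B(1)[OF fH[OF h]]] B(2)[OF fH[OF h]] m(2)[OF cN] by simp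
 have m0: "m > 0" using m(1) p by (auto intro: Nat.gr0I)
 have detA0: "det (A h) \<noteq> 0" if "h \<in> H" for h using detA[OF that] m0 by (metis zero_power zero_neq_one)
 have A0: "A h \<noteq> 0\<^sub>m d d" if "h \<in> H" for h
 proof
  assume e: "A h = 0\<^sub>m d d"
  have "0\<^sub>m d d = (0::complex) \<cdot>\<^sub>m 1\<^sub>m d" by (auto intro!: eq_matI)
  then have "det (0\<^sub>m d d :: complex mat) = 0 ^ d * det (1\<^sub>m d)" using det_smult[of 0 "1\<^sub>m d :: complex mat"] by simp
  then show False using detA0[OF that] e d0 by simp
 qed
 have "\<forall>g\<in>H. \<forall>h\<in>H. \<exists>\<alpha>. A g * A h = \<alpha> \<cdot>\<^sub>m A (g * h)"
 proof (intro ballI)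
  fix g h assume g: "g \<in> H" and h: "h \<in> H"
  have gh: "g * h \<in> H" using subgrp_mult[OF H g h] .
  let ?X = "A g * A h" and ?Y = "A (g * h)"
  have X: "?X \<in> carrier_mat d d" using Ac[OF g] Ac[OF h] by simp
  obtain Z where Z: "Z \<in> carrier_mat d d" "?Y * Z = 1\<^sub>m d" "Z * ?Y = 1\<^sub>m d"
   using schur_intertwiner[OF irr[OF gh] \<rho> Ac[OF gh] Ai[OF gh] A0[OF gh]] by blast
  have ZX: "Z * ?X \<in> carrier_mat d d" using Z X by simp
  have "\<rho> n * (Z * ?X) = Z * ?X * \<rho> n" if n: "n \<in> N" for n
  proof -
   note Rn = r(1)[OF n] and Rc = r(1)[OF cjN[OF gh n]]
   have x: "\<rho> (cj (g * h) n) * ?X = ?X * \<rho> n"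
   proof -
    have "\<rho> (cj (g * h) n) * ?X = \<rho> (cj g (cj h n)) * A g * A h"
     unfolding cj_comp using assoc_mult_mat[OF r(1)[OF cjN[OF g cjN[OF h n]]] Ac[OF g] Ac[OF h]] by simp
    also have "\<dots> = A g * \<rho> (cj h n) * A h" unfolding Ai[OF g cjN[OF h n]] ..
    also have "\<dots> = A g * (\<rho> (cj h n) * A h)" by (rule assoc_mult_mat[OF Ac[OF g] r(1)[OF cjN[OF h n]] Ac[OF h]])
    also have "\<dots> = A g * (A h * \<rho> n)" unfolding Ai[OF h n] ..
    also have "\<dots> = ?X * \<rho> n" using assoc_mult_mat[OF Ac[OF g] Ac[OF h] Rn] by simp
    finally show ?thesis .
   qed
   have "\<rho> n * (Z * ?X) = (Z * ?Y) * (\<rho> n * (Z * ?X))" unfolding Z(3) by (rule left_mult_one_mat[OF mult_carrier_mat[OF Rn ZX], symmetric])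
   also have "\<dots> = Z * (?Y * (\<rho> n * (Z * ?X)))" by (rule assoc_mult_mat[OF Z(1) Ac[OF gh] mult_carrier_mat[OF Rn ZX]])
   also have "?Y * (\<rho> n * (Z * ?X)) = (?Y * \<rho> n) * (Z * ?X)" using assoc_mult_mat[OF Ac[OF gh] Rn ZX] by simp
   also have "?Y * \<rho> n = \<rho> (cj (g * h) n) * ?Y" using Ai[OF gh n] by simp
   also have "\<dots> * (Z * ?X) = \<rho> (cj (g * h) n) * (?Y * (Z * ?X))" by (rule assoc_mult_mat[OF Rc Ac[OF gh] ZX])
   also have "?Y * (Z * ?X) = (?Y * Z) * ?X" using assoc_mult_mat[OF Ac[OF gh] Z(1) X] by simp
   also have "\<dots> = ?X" unfolding Z(2) by (rule left_mult_one_mat[OF X])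
   also have "Z * (\<rho> (cj (g * h) n) * ?X) = Z * (?X * \<rho> n)" unfolding x ..
   also have "\<dots> = Z * ?X * \<rho> n" using assoc_mult_mat[OF Z(1) X Rn] by simp
   finally show ?thesis .
  qed
  then obtain \<alpha> where \<alpha>: "Z * ?X = \<alpha> \<cdot>\<^sub>m 1\<^sub>m d" using schur_scalar[OF \<rho> ZX] by blast
  have "?X = (?Y * Z) * ?X" unfolding Z(2) by (rule left_mult_one_mat[OF X, symmetric])
  also have "\<dots> = ?Y * (Z * ?X)" by (rule assoc_mult_mat[OF Ac[OF gh] Z(1) X])
  also have "\<dots> = \<alpha> \<cdot>\<^sub>m (?Y * 1\<^sub>m d)" unfolding \<alpha> by (rule mult_smult_distrib[OF Ac[OF gh] one_carrier_mat])
  also have "?Y * 1\<^sub>m d = ?Y" using Ac[OF gh] by simp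
  finally show "\<exists>\<alpha>. ?X = \<alpha> \<cdot>\<^sub>m ?Y" by blast
 qed
 then obtain \<alpha> where \<alpha>: "\<And>g h. g \<in> H \<Longrightarrow> h \<in> H \<Longrightarrow> A g * A h = \<alpha> g h \<cdot>\<^sub>m A (g * h)" by metis
 have Hm: "g * h \<in> H" if "g \<in> H" "h \<in> H" for g h using subgrp_mult[OF H that] .
 have \<alpha>I: "\<alpha> g h = x" if "g \<in> H" "h \<in> H" "A g * A h = x \<cdot>\<^sub>m A (g * h)" for g h x
  using \<alpha>[OF that(1,2)] that(3) by (intro smult_mat_cancel[OF _ Ac[OF Hm[OF that(1,2)]] A0[OF Hm[OF that(1,2)]]]) simp
 \<comment> \<open>Comparison of determinants: those of \<open>A\<close> are \<open>m\<close>-th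
   roots of unity, and scaling by \<open>\<alpha> g h\<close> contributes its \<open>d\<close>-th
   power.\<close>
 have \<alpha>root: "\<alpha> g h ^ (d * m) = 1" if g: "g \<in> H" and h: "h \<in> H" for g h
 proof -
  have "det (A g) * det (A h) = \<alpha> g h ^ d * det (A (g * h))"
   using det_mult[OF Ac[OF g] Ac[OF h]] \<alpha>[OF g h] det_smult[of "\<alpha> g h" "A (g * h)"] Ac[OF Hm[OF g h]] by simp
  then have "(det (A g) * det (A h)) ^ m = (\<alpha> g h ^ d * det (A (g * h))) ^ m" by simp
  then show ?thesis using detA[OF g] detA[OF h] detA[OF Hm[OF g h]] by (simp add: power_mult_distrib power_mult)
 qed
 have dm0: "d * m > 0" using d0 m0 by simp
 have \<alpha>0: "\<alpha> g h \<noteq> 0" if "g \<in> H" "h \<in> H" for g h using \<alpha>root[OF that] dm0 by (metis zero_power zero_neq_one)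
 have \<alpha>1: "\<alpha> n h = 1" if n: "n \<in> N" and h: "h \<in> H" for n h
 proof (rule \<alpha>I[OF _ h])
  show "n \<in> H" using n NH by blast
  have "A n * A h = A (n * h)" using AN[OF n] An[OF n h] by simp
  then show "A n * A h = 1 \<cdot>\<^sub>m A (n * h)" by (auto intro!: eq_matI)
 qed
 have \<alpha>2: "\<alpha> g (n * h) = \<alpha> g h" if g: "g \<in> H" and n: "n \<in> N" and h: "h \<in> H" for g n h
 proof (rule \<alpha>I[OF g])
  show "n * h \<in> H" using n NH h Hm by blast
  have gn: "cj g n \<in> N" using cjN[OF g n] .
  have "A g * A (n * h) = A g * (\<rho> n * A h)" using An[OF n h] by simp
  also have "\<dots> = (A g * \<rho> n) * A h" using assoc_mult_mat[OF Ac[OF g] r(1)[OF n] Ac[OF h]] by simp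
  also have "\<dots> = (\<rho> (cj g n) * A g) * A h" using Ai[OF g n] by simp
  also have "\<dots> = \<rho> (cj g n) * (A g * A h)" by (rule assoc_mult_mat[OF r(1)[OF gn] Ac[OF g] Ac[OF h]])
  also have "\<dots> = \<alpha> g h \<cdot>\<^sub>m (\<rho> (cj g n) * A (g * h))"
   unfolding \<alpha>[OF g h] by (rule mult_smult_distrib[OF r(1)[OF gn] Ac[OF Hm[OF g h]]])
  also have "\<rho> (cj g n) * A (g * h) = A (cj g n * (g * h))" using An[OF gn Hm[OF g h]] by simp
  also have "cj g n * (g * h) = g * (n * h)" by (simp add: cj_def mult.assoc)
  finally show "A g * A (n * h) = \<alpha> g h \<cdot>\<^sub>m A (g * (n * h))" .
 qed
 have cocycle: "\<alpha> g h * \<alpha> (g * h) k = \<alpha> g (h * k) * \<alpha> h k" if g: "g \<in> H" and h: "h \<in> H" and k: "k \<in> H" for g h k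
 proof -
  note ghk = Hm[OF Hm[OF g h] k]
  have "(A g * A h) * A k = \<alpha> g h \<cdot>\<^sub>m (A (g * h) * A k)"
   unfolding \<alpha>[OF g h] by (rule mult_smult_assoc_mat[OF Ac[OF Hm[OF g h]] Ac[OF k]])
  also have "\<dots> = (\<alpha> g h * \<alpha> (g * h) k) \<cdot>\<^sub>m A (g * h * k)" unfolding \<alpha>[OF Hm[OF g h] k] smult_smult_mat ..
  finally have 1: "(A g * A h) * A k = (\<alpha> g h * \<alpha> (g * h) k) \<cdot>\<^sub>m A (g * h * k)" .
  have "A g * (A h * A k) = \<alpha> h k \<cdot>\<^sub>m (A g * A (h * k))"
   unfolding \<alpha>[OF h k] by (rule mult_smult_distrib[OF Ac[OF g] Ac[OF Hm[OF h k]]])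
  also have "\<dots> = (\<alpha> h k * \<alpha> g (h * k)) \<cdot>\<^sub>m A (g * (h * k))" unfolding \<alpha>[OF g Hm[OF h k]] smult_smult_mat ..
  finally have 2: "A g * (A h * A k) = (\<alpha> h k * \<alpha> g (h * k)) \<cdot>\<^sub>m A (g * h * k)" by (simp only: mult.assoc)
  have "(\<alpha> g h * \<alpha> (g * h) k) \<cdot>\<^sub>m A (g * h * k) = (\<alpha> h k * \<alpha> g (h * k)) \<cdot>\<^sub>m A (g * h * k)"
   using 1 2 assoc_mult_mat[OF Ac[OF g] Ac[OF h] Ac[OF k]] by simp
  from smult_mat_cancel[OF this Ac[OF ghk] A0[OF ghk]] show ?thesis by (simp add: mult.commute)
 qed
 define R where "R = f ` H"
 have fR: "finite R" and RH: "R \<subseteq> H" using H fH by (auto simp: R_def)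
 have Rf: "f k = k" if "k \<in> R" for k using that ff by (auto simp: R_def)
 have "bij_betw (\<lambda>(n, t). n * t) (N \<times> R) H"
  unfolding bij_betw_def
 proof
  show "inj_on (\<lambda>(n, t). n * t) (N \<times> R)"
  proof (rule inj_onI, clarify)
   fix n t n' t' assume a: "n \<in> N" "t \<in> R" "n' \<in> N" "t' \<in> R" "n * t = n' * t'"
   have "t = f (n * t)" using fN[OF a(1)] Rf[OF a(2)] by simp
   moreover have "t' = f (n' * t')" using fN[OF a(3)] Rf[OF a(4)] by simp
   ultimately have "t = t'" using a(5) by simp
   then show "n = n' \<and> t = t'" using a(5) by simp
  qed
  show "(\<lambda>(n, t). n * t) ` (N \<times> R) = H"
  proof (intro equalityI subsetI)
   fix x assume "x \<in> (\<lambda>(n, t). n * t) ` (N \<times> R)"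
   then show "x \<in> H" using NH RH Hm by auto
  next
   fix x assume "x \<in> H"
   then have "(c x, f x) \<in> N \<times> R" using cN by (simp add: R_def)
   then show "x \<in> (\<lambda>(n, t). n * t) ` (N \<times> R)" using hcf[of x] by (metis (no_types, lifting) case_prod_conv image_eqI)
  qed
 qed
 from bij_betw_same_card[OF this] have "card N * card R = card H" by (simp add: card_cartesian_product)
 then have cR: "card R = p ^ a" using idx sN by simp
 have cop: "coprime (card R) (d * m)"
 proof -
  have "coprime (d * m) p" using pd m(1) p by (simp add: coprime_prime_iff[symmetric])
  then show ?thesis unfolding cR by (simp add: coprime_commute coprime_power_right_iff)
 qed
 \<comment> \<open>An inverse of the index modulo \<open>d * m\<close>: raising to the power
   \<open>e\<close> undoes the exponent \<open>card R\<close> that the product over \<open>R\<close>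
   creates.\<close>
 obtain e where e: "[card R * e = Suc 0] (mod (d * m))" using cong_solve_coprime_nat[OF cop] by blast
 define \<beta> where "\<beta> h = (\<Prod>k\<in>R. \<alpha> h k)" for h
 have \<beta>: "\<alpha> g h ^ card R * \<beta> (g * h) = \<beta> g * \<beta> h" if g: "g \<in> H" and h: "h \<in> H" for g h
 proof -
  have "\<alpha> g h ^ card R * \<beta> (g * h) = (\<Prod>k\<in>R. \<alpha> g h * \<alpha> (g * h) k)" unfolding \<beta>_def by (simp add: prod.distrib)
  also have "\<dots> = (\<Prod>k\<in>R. \<alpha> g (h * k) * \<alpha> h k)" by (rule prod.cong[OF refl]) (use cocycle[OF g h] RH in blast)
  also have "\<dots> = (\<Prod>k\<in>R. \<alpha> g (h * k)) * \<beta> h" by (simp add: prod.distrib \<beta>_def)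
  \<comment> \<open>Multiplication by \<open>h\<close> permutes the cosets and
    \<open>\<alpha> g\<close> is constant on them, so passing to representatives only permutes the
    factors.\<close>
  also have "(\<Prod>k\<in>R. \<alpha> g (h * k)) = (\<Prod>k\<in>R. \<alpha> g (f (h * k)))"
  proof (rule prod.cong[OF refl])
   fix k assume "k \<in> R"
   then have k: "k \<in> H" using RH by blast
   obtain n where n: "n \<in> N" "f (h * k) = n * (h * k)" using fspec by blast
   show "\<alpha> g (h * k) = \<alpha> g (f (h * k))" unfolding n(2) using \<alpha>2[OF g n(1) Hm[OF h k]] by simp
  qed
  also have "\<dots> = \<beta> g"
  proof -
   have inj: "inj_on (\<lambda>k. f (h * k)) R"
   proof (rule inj_onI)
    fix k k' assume k: "k \<in> R" "k' \<in> R" "f (h * k) = f (h * k')"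
    obtain n n' where n: "n \<in> N" "f (h * k) = n * (h * k)" "n' \<in> N" "f (h * k') = n' * (h * k')" using fspec by metis
    have "h * k' = inverse n' * (n * (h * k))" using n k(3) by (metis grp_inverse_mult_cancel)
    then have "h * k' = (inverse n' * n) * h * k" by (simp add: mult.assoc)
    then have "k' = cj (inverse h) (inverse n' * n) * k" by (metis cj_def grp_inverse_inverse grp_inverse_mult_cancel mult.assoc)
    moreover have "cj (inverse h) (inverse n' * n) \<in> N"
     using n(1,3) h sN H by (intro cjN) (auto simp: subgrp_inverse subgrp_mult)
    ultimately have "f k' = f k" using fN by metis
    then show "k = k'" using Rf k by simp
   qed
   have "(\<lambda>k. f (h * k)) ` R \<subseteq> R" using RH Hm[OF h] by (auto simp: R_def)
   then have "bij_betw (\<lambda>k. f (h * k)) R R" using inj fR by (simp add: bij_betw_def endo_inj_surj)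
   from prod.reindex_bij_betw[OF this, of "\<alpha> g"] show ?thesis by (simp add: \<beta>_def)
  qed
  finally show ?thesis .
 qed
 have \<beta>0: "\<beta> h \<noteq> 0" if "h \<in> H" for h unfolding \<beta>_def using fR \<alpha>0[OF that] RH by (auto simp: prod_zero_iff)
 have \<beta>1: "\<beta> n = 1" if "n \<in> N" for n unfolding \<beta>_def by (rule prod.neutral) (use \<alpha>1[OF that] RH in blast)
 define \<gamma> where "\<gamma> h = \<beta> h ^ e" for h
 have \<gamma>: "\<alpha> g h * \<gamma> (g * h) = \<gamma> g * \<gamma> h" if g: "g \<in> H" and h: "h \<in> H" for g h
 proof -
  have "(\<alpha> g h ^ card R * \<beta> (g * h)) ^ e = (\<beta> g * \<beta> h) ^ e" using \<beta>[OF g h] by simp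
  then have "\<alpha> g h ^ (card R * e) * \<gamma> (g * h) = \<gamma> g * \<gamma> h" by (simp add: power_mult_distrib power_mult \<gamma>_def)
  moreover have "\<alpha> g h ^ (card R * e) = \<alpha> g h ^ Suc 0" by (rule complex_power_cong[OF \<alpha>root[OF g h] e])
  ultimately show ?thesis by simp
 qed
 have \<gamma>0: "\<gamma> h \<noteq> 0" if "h \<in> H" for h using \<beta>0[OF that] by (simp add: \<gamma>_def)
 let ?\<tau> = "\<lambda>h. (1 / \<gamma> h) \<cdot>\<^sub>m A h"
 have \<tau>N: "?\<tau> n = \<rho> n" if "n \<in> N" for n
  using \<beta>1[OF that] AN[OF that] by (auto simp: \<gamma>_def intro!: eq_matI)
 moreover have "rp H d ?\<tau>"
 proof (rule rpI)
  show "?\<tau> h \<in> carrier_mat d d" if "h \<in> H" for h using Ac[OF that] by simp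
  show "?\<tau> 1 = 1\<^sub>m d" using \<tau>N[OF subgrp_one[OF sN]] r(2) by simp
  fix g h assume g: "g \<in> H" and h: "h \<in> H"
  have "?\<tau> g * ?\<tau> h = (1 / \<gamma> g * (1 / \<gamma> h)) \<cdot>\<^sub>m (A g * A h)" by (rule smult_mult_smult[OF Ac[OF g] Ac[OF h]])
  also have "\<dots> = (1 / \<gamma> g * (1 / \<gamma> h) * \<alpha> g h) \<cdot>\<^sub>m A (g * h)" unfolding \<alpha>[OF g h] smult_smult_mat ..
  also have "1 / \<gamma> g * (1 / \<gamma> h) * \<alpha> g h = 1 / \<gamma> (g * h)"
   using \<gamma>[OF g h] \<gamma>0[OF g] \<gamma>0[OF h] \<gamma>0[OF Hm[OF g h]] by (simp add: field_simps)
  finally show "?\<tau> (g * h) = ?\<tau> g * ?\<tau> h" by simp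
 qed
 ultimately show ?thesis by (intro exI[of _ ?\<tau>]) auto
qed

text \<open>The determinant of a representation of \<open>N\<close> is a linear character, so the
  bound \<open>m\<close> on the orders of linear characters supplies the determinant condition of
  \<open>extension\<close>.\<close>

lemma Irr_extend:
 assumes H: "subgrp H" and N: "nsub N H" and idx: "card H = card N * p ^ a" and p: "prime p"
  and \<theta>: "\<theta> \<in> Irr N" and inv: "\<And>h. h \<in> H \<Longrightarrow> cnj h \<theta> = \<theta>" and pd: "\<not> p dvd deg \<theta>"
  and m: "coprime m p" "\<forall>\<mu>. lin N \<mu> \<longrightarrow> (\<forall>n\<in>N. \<mu> n ^ m = 1)"
 shows "\<exists>\<psi>\<in>Irr H. \<forall>n\<in>N. \<psi> n = \<theta> n"
proof -
 note sN = nsubD(1)[OF N] and NH = nsubD(2)[OF N]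
 obtain d \<rho> where \<rho>: "irp N d \<rho>" "\<And>g. g \<in> N \<Longrightarrow> \<theta> g = mat_trace (\<rho> g)" by (rule IrrE[OF \<theta>]) blast
 have "deg \<theta> = d" by (rule deg_eqI) (use trace_one_rep[OF irpD(1)[OF \<rho>(1)]] \<rho>(2)[OF subgrp_one[OF sN]] in simp)
 then have pd': "\<not> p dvd d" using pd by simp
 have inv': "mat_trace (\<rho> (cj h n)) = mat_trace (\<rho> n)" if h: "h \<in> H" and n: "n \<in> N" for h n
 proof -
  have "\<theta> (cj h n) = cnj (inverse h) \<theta> n" by (simp add: cnj_def)
  then show ?thesis using inv[OF subgrp_inverse[OF H h]] \<rho>(2) n nsubD(3)[OF N h n] by simp
 qed
 have dm: "det (\<rho> n) ^ m = 1" if "n \<in> N" for n using m(2)[rule_format, OF det_lin[OF irpD(1)[OF \<rho>(1)]] that] .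
 obtain \<tau> where \<tau>: "rp H d \<tau>" "\<forall>n\<in>N. \<tau> n = \<rho> n" using extension[OF H N idx p \<rho>(1) inv' pd' m(1) dm] by blast
 have "irp N d \<tau>"
 proof (rule irpI[OF rp_subset[OF \<tau>(1) NH] irpD(2)[OF \<rho>(1)]])
  fix W assume "subsp d W" "\<And>g w. g \<in> N \<Longrightarrow> w \<in> W \<Longrightarrow> \<tau> g *\<^sub>v w \<in> W"
  then show "W = {0\<^sub>v d} \<or> W = carrier_vec d" using irpD(3)[OF \<rho>(1)] \<tau>(2) by metis
 qed
 from IrrI[OF irp_if_restrict[OF \<tau>(1) this NH]] have "character (mon H) \<tau> \<in> Irr H" .
 moreover have "character (mon H) \<tau> n = \<theta> n" if "n \<in> N" for n using that NH \<tau>(2) \<rho>(2) by (auto simp: character_mon)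
 ultimately show ?thesis by blast
qed

subsection \<open>Linear characters\<close>

text \<open>The quotient by \<open>D\<close> is abelian, so its irreducible characters have degree
  1; if all of them were 1 at a non-trivial element, the regular character would not vanish
  there.\<close>

lemma lin_ex:
 fixes G :: "'g::grp set"
 assumes G: "subgrp G" and D: "nsub D G" "D \<noteq> G" and comm: "\<And>x y. x \<in> G \<Longrightarrow> y \<in> G \<Longrightarrow> x * y * inverse x * inverse y \<in> D"
 shows "\<exists>\<mu>. lin G \<mu> \<and> (\<exists>x\<in>G. \<mu> x \<noteq> 1)"
proof -
 obtain \<phi> :: "'g \<Rightarrow> nat perm" where \<phi>: "homo G \<phi>" "ker G \<phi> = D" by (rule quotient_ex[OF G D(1)])
 let ?A = "\<phi> ` G"
 have A: "subgrp ?A" by (rule homo_image_subgrp[OF \<phi>(1) G order_refl])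
 have cA: "u * v = v * u" if uv: "u \<in> ?A" "v \<in> ?A" for u v
 proof -
  obtain x y where xy: "x \<in> G" "y \<in> G" "u = \<phi> x" "v = \<phi> y" using uv by blast
  have "inverse (x * y) * (y * x) \<in> D"
   using comm[OF subgrp_inverse[OF G xy(2)] subgrp_inverse[OF G xy(1)]] by (simp add: mult.assoc)
  then have "\<phi> (x * y) = \<phi> (y * x)" using homo_eq_iff[OF \<phi>(1), of "x * y" "y * x"] \<phi>(2) xy G by (simp add: subgrp_mult)
  then show ?thesis using homo_mult[OF \<phi>(1)] xy by simp
 qed
 obtain x where x: "x \<in> G" "x \<notin> D" using D nsubD(2) by blast
 then have x1: "\<phi> x \<noteq> 1" using \<phi>(2) by (auto simp: ker_def)
 have deg1: "\<chi> 1 = 1" if \<chi>: "\<chi> \<in> Irr ?A" for \<chi>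
 proof -
  obtain d \<rho> where \<rho>: "irp ?A d \<rho>" "\<And>g. g \<in> ?A \<Longrightarrow> \<chi> g = mat_trace (\<rho> g)" by (rule IrrE[OF \<chi>]) blast
  have "d = 1" by (rule abelian_degree[OF \<rho>(1) cA])
  then show ?thesis using trace_one_rep[OF irpD(1)[OF \<rho>(1)]] \<rho>(2)[OF subgrp_one[OF A]] by simp
 qed
 have "\<exists>\<chi>\<in>Irr ?A. \<chi> (\<phi> x) \<noteq> 1"
 proof (rule ccontr)
  assume "\<not> ?thesis"
  then have "(\<Sum>\<chi>\<in>Irr ?A. \<chi> 1 * \<chi> (\<phi> x)) = (\<Sum>\<chi>\<in>Irr ?A. \<chi> 1 * \<chi> 1)" using deg1 by (intro sum.cong) auto
  then show False using Irr_regular(2)[OF A] x(1) x1 A by simp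
 qed
 then obtain \<chi> where \<chi>: "\<chi> \<in> Irr ?A" "\<chi> (\<phi> x) \<noteq> 1" by blast
 have "lin ?A \<chi>" by (rule Irr_lin[OF \<chi>(1) deg1[OF \<chi>(1)] A])
 then have "lin G (\<lambda>g. \<chi> (\<phi> g))" using homo_mult[OF \<phi>(1)] homo_one[OF \<phi>(1)] by (simp add: lin_def)
 then show ?thesis using \<chi>(2) x(1) by blast
qed

lemma lin_power_fun: "lin H \<mu> \<Longrightarrow> lin H (\<lambda>h. \<mu> h ^ k)"
 by (simp add: lin_def power_mult_distrib)

text \<open>If \<open>n\<close> is the order of \<open>\<mu>\<close> and \<open>p\<close> a prime
  divisor of \<open>n\<close>, the power of \<open>\<mu>\<close> with exponent
  \<open>n div p\<close> has order \<open>p\<close>.\<close>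

lemma lin_prime_order:
 assumes G: "subgrp G" and \<mu>: "lin G \<mu>" and x: "x \<in> G" "\<mu> x \<noteq> 1"
 shows "\<exists>p \<nu>. prime p \<and> lin G \<nu> \<and> (\<exists>x\<in>G. \<nu> x \<noteq> 1) \<and> (\<forall>x\<in>G. \<nu> x ^ p = 1)"
proof -
 let ?P = "\<lambda>n. n > 0 \<and> (\<forall>x\<in>G. \<mu> x ^ n = 1)"
 define n where "n = (LEAST n. ?P n)"
 have "?P (card G)" using G lin_power_card[OF \<mu> G] by auto
 then have n: "?P n" unfolding n_def by (rule LeastI)
 have "n \<noteq> 1" using n x by auto
 then obtain p where p: "prime p" "p dvd n" using prime_factor_nat by blast
 then obtain k where k: "n = p * k" by blast
 have k0: "k > 0" "k < n" using n k p(1) prime_gt_1_nat[OF p(1)] by auto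
 have "\<not> ?P k" using not_less_Least[of k ?P] k0(2) unfolding n_def by blast
 then have "\<exists>x\<in>G. \<mu> x ^ k \<noteq> 1" using k0(1) by blast
 moreover have "\<forall>x\<in>G. (\<mu> x ^ k) ^ p = 1" using n k by (simp add: power_mult[symmetric] mult.commute)
 ultimately show ?thesis using p(1) lin_power_fun[OF \<mu>, of k] by blast
qed

section \<open>Groups with Galois conjugate characters\<close>

subsection \<open>Groups whose equal-degree characters are power conjugate\<close>

text \<open>Galois conjugacy restated by power maps; up to \<open>gcs_solv\<close> the hypothesis on
  the group enters in this form.\<close>

definition gcs :: "'g::grp set \<Rightarrow> bool" where
 "gcs G \<longleftrightarrow> (\<forall>\<chi>\<in>Irr G. \<forall>\<psi>\<in>Irr G. deg \<chi> \<noteq> 1 \<longrightarrow> deg \<chi> = deg \<psi> \<longrightarrow>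
  (\<exists>k. coprime k (card G) \<and> (\<forall>g\<in>G. \<psi> g = \<chi> (g ^ k))))"

lemma gcsE:
 assumes "gcs G" "\<chi> \<in> Irr G" "\<psi> \<in> Irr G" "deg \<chi> \<noteq> 1" "deg \<chi> = deg \<psi>"
 obtains k where "coprime k (card G)" "\<forall>g\<in>G. \<psi> g = \<chi> (g ^ k)"
 using assms unfolding gcs_def by blast

text \<open>Since \<open>k\<close> is prime to the order of \<open>P\<close>, the map
  \<open>x \<mapsto> x ^ k\<close> permutes \<open>P\<close>.\<close>

lemma gcs_sum_eq:
 assumes G: "subgrp G" "gcs G" and \<chi>: "\<chi> \<in> Irr G" "\<psi> \<in> Irr G" "deg \<chi> \<noteq> 1" "deg \<chi> = deg \<psi>"
  and P: "subgrp P" "P \<subseteq> G"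
 shows "(\<Sum>x\<in>P. \<chi> x) = (\<Sum>x\<in>P. \<psi> x)"
proof -
 obtain k where k: "coprime k (card G)" "\<forall>g\<in>G. \<psi> g = \<chi> (g ^ k)" by (rule gcsE[OF G(2) \<chi>])
 have "coprime k (card P)" by (rule coprime_divisors[OF dvd_refl subgrp_card_dvd[OF G(1) P] k(1)])
 then obtain l where l: "[k * l = Suc 0] (mod card P)" using cong_solve_coprime_nat by blast
 have kl: "x ^ (k * l) = x" if "x \<in> P" for x
  using power_cong_exp[OF subgrp_power_card[OF P(1) that] l] by simp
 have "bij_betw (\<lambda>x. x ^ k) P P"
 proof (rule bij_betw_byWitness[where f' = "\<lambda>x. x ^ l"])
  show "\<forall>x\<in>P. (x ^ k) ^ l = x" using kl by (simp add: power_mult)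
  show "\<forall>x\<in>P. (x ^ l) ^ k = x" using kl by (metis mult.commute power_mult)
 qed (use P(1) subgrp_power in auto)
 from sum.reindex_bij_betw[OF this, of \<chi>] have "(\<Sum>x\<in>P. \<chi> (x ^ k)) = (\<Sum>x\<in>P. \<chi> x)" .
 then show ?thesis using k(2) P(2) by (simp add: subset_iff)
qed

text \<open>If \<open>p\<close> did not divide the degree, twisting by a power of the determinant makes the determinant of order
 prime to \<open>p\<close>; comparing the determinants of the conjugate characters \<open>\<chi>\<close> and \<open>\<nu> \<chi>\<close> on cyclic subgroups
 then forces \<open>\<nu> = 1\<close>.\<close>

lemma gcs_degree_dvd:
 assumes G: "subgrp G" "gcs G" and p: "prime p" and \<nu>: "lin G \<nu>" "\<exists>x\<in>G. \<nu> x \<noteq> 1" "\<And>x. x \<in> G \<Longrightarrow> \<nu> x ^ p = 1"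
  and \<chi>: "\<chi> \<in> Irr G" "deg \<chi> \<noteq> 1"
 shows "p dvd deg \<chi>"
proof (rule ccontr)
 assume nd: "\<not> p dvd deg \<chi>"
 obtain d \<rho> where \<rho>: "irp G d \<rho>" "\<And>g. g \<in> G \<Longrightarrow> \<chi> g = mat_trace (\<rho> g)" by (rule IrrE[OF \<chi>(1)]) blast
 have dd: "deg \<chi> = d" by (rule deg_eqI) (use trace_one_rep[OF irpD(1)[OF \<rho>(1)]] \<rho>(2)[OF subgrp_one[OF G(1)]] in simp)
 have cG: "card G \<noteq> 0" using subgrp_card_pos[OF G(1)] by simp
 obtain m where m: "card G = p ^ multiplicity p (card G) * m" "\<not> p dvd m"
  using multiplicity_decompose'[of "card G" p] cG p not_prime_unit by blast
 define q where "q = p ^ multiplicity p (card G)"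
 have q0: "q > 0" using p by (simp add: q_def prime_gt_0_nat)
 have "coprime d p" using nd dd p by (simp add: coprime_prime_iff)
 then have "coprime d q" unfolding q_def by (simp add: coprime_power_right_iff)
 then obtain i where i: "[d * i = Suc 0] (mod q)" using cong_solve_coprime_nat by blast
 \<comment> \<open>\<open>j\<close> is minus the inverse of \<open>d\<close> modulo the
   \<open>p\<close>-part \<open>q\<close> of the group order, so \<open>q\<close> divides
   \<open>d * j + 1\<close>. Twisting by the \<open>j\<close>-th power of the determinant raises the
   determinant to this exponent and so makes its order prime to \<open>p\<close>.\<close>
 define j where "j = i * (q - 1)"
 have "[d * i * (q - 1) + 1 = Suc 0 * (q - 1) + 1] (mod q)" by (intro cong_add cong_mult i cong_refl)
 moreover have "Suc 0 * (q - 1) + 1 = q" using q0 by simp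
 ultimately have qd: "q dvd d * j + 1" by (simp add: j_def mult.assoc cong_def dvd_eq_mod_eq_0)
 define \<delta> where "\<delta> h = det (\<rho> h)" for h
 have \<delta>: "lin G \<delta>" unfolding \<delta>_def by (rule det_lin[OF irpD(1)[OF \<rho>(1)]])
 define \<rho>' where "\<rho>' h = (\<delta> h ^ j) \<cdot>\<^sub>m \<rho> h" for h
 have \<rho>': "irp G d \<rho>'" unfolding \<rho>'_def by (rule twist_irp[OF \<rho>(1) lin_power_fun[OF \<delta>] G(1)])
 note r' = rpD[OF irpD(1)[OF \<rho>']]
 have det': "det (\<rho>' h) ^ m = 1" if h: "h \<in> G" for h
 proof -
  have "det (\<rho>' h) = (\<delta> h ^ j) ^ d * \<delta> h"
   unfolding \<rho>'_def \<delta>_def using rpD(1)[OF irpD(1)[OF \<rho>(1)] h] by simp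
  also have "\<dots> = \<delta> h ^ (d * j + 1)" by (simp add: power_mult[symmetric] mult.commute)
  finally have "det (\<rho>' h) ^ m = \<delta> h ^ ((d * j + 1) * m)" by (simp only: power_mult)
  moreover have "card G dvd (d * j + 1) * m" using qd m(1) unfolding q_def by (metis mult_dvd_mono dvd_refl)
  then obtain s where "(d * j + 1) * m = card G * s" by blast
  ultimately show ?thesis using lin_power_card[OF \<delta> G(1) h] by (simp only: power_mult power_one)
 qed
 let ?\<chi> = "character (mon G) \<rho>'"
 have c1: "?\<chi> \<in> Irr G" by (rule IrrI[OF \<rho>'])
 have c2: "(\<lambda>h. \<nu> h * ?\<chi> h) \<in> Irr G" by (rule Irr_twist[OF c1 \<nu>(1) G(1)])
 have one: "?\<chi> 1 = of_nat d" using trace_one_rep[OF irpD(1)[OF \<rho>']] G(1) by (simp add: character_mon)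
 have d1: "deg ?\<chi> = d" using one by (rule deg_eqI)
 have d2: "deg (\<lambda>h. \<nu> h * ?\<chi> h) = d" by (rule deg_eqI) (simp add: one lin_one[OF \<nu>(1)])
 have "deg ?\<chi> \<noteq> 1" "deg ?\<chi> = deg (\<lambda>h. \<nu> h * ?\<chi> h)" using d1 d2 dd \<chi>(2) by simp_all
 then obtain k where "coprime k (card G)" and k: "\<forall>g\<in>G. \<nu> g * ?\<chi> g = ?\<chi> (g ^ k)"
  by (rule gcsE[OF G(2) c1 c2])
 have "\<nu> g = 1" if g: "g \<in> G" for g
 proof -
  \<comment> \<open>On the cyclic group generated by \<open>g\<close> the map
    \<open>h \<mapsto> h ^ k\<close> is a homomorphism, so both sides of the conjugacy relation are
    characters of representations, and their determinants can be compared.\<close>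
  let ?C = "cyc g (card G)"
  note C = cyc_card[OF G(1) g]
  have CG: "x \<in> G" if "x \<in> ?C" for x using C(2) that by blast
  have pw: "(x * y) ^ k = x ^ k * y ^ k" if xy: "x \<in> ?C" "y \<in> ?C" for x y
  proof -
   obtain a b where "x = g ^ a" "y = g ^ b" using xy by (auto simp: cyc_def)
   then show ?thesis by (simp add: power_add[symmetric] power_mult[symmetric] distrib_right)
  qed
  have A: "rp ?C d (\<lambda>h. \<nu> h \<cdot>\<^sub>m \<rho>' h)" by (rule rp_subset[OF twist_rp[OF irpD(1)[OF \<rho>'] \<nu>(1)] C(2)])
  have B: "rp ?C d (\<lambda>h. \<rho>' (h ^ k))"
  proof (rule rpI)
   show "\<rho>' (x ^ k) \<in> carrier_mat d d" if "x \<in> ?C" for x by (rule r'(1)[OF subgrp_power[OF G(1) CG[OF that]]])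
   show "\<rho>' (1 ^ k) = 1\<^sub>m d" using r'(2) by simp
   show "\<rho>' ((x * y) ^ k) = \<rho>' (x ^ k) * \<rho>' (y ^ k)" if "x \<in> ?C" "y \<in> ?C" for x y
    unfolding pw[OF that] by (rule r'(3)[OF subgrp_power[OF G(1) CG[OF that(1)]] subgrp_power[OF G(1) CG[OF that(2)]]])
  qed
  have tr: "mat_trace (\<nu> h \<cdot>\<^sub>m \<rho>' h) = mat_trace (\<rho>' (h ^ k))" if h: "h \<in> ?C" for h
   using bspec[OF k CG[OF h]] CG[OF h] subgrp_power[OF G(1) CG[OF h]] mat_trace_smult[OF r'(1)[OF CG[OF h]]] by (simp add: character_mon)
  have gC: "g \<in> ?C" using C(3)[of 1] by simp
  have "det (\<nu> g \<cdot>\<^sub>m \<rho>' g) = det (\<rho>' (g ^ k))"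
   by (rule abelian_det_eq[OF C(1) _ A B tr gC]) (auto intro: cyc_commute)
  moreover have "det (\<nu> g \<cdot>\<^sub>m \<rho>' g) = \<nu> g ^ d * det (\<rho>' g)" using r'(1)[OF g] by simp
  ultimately have "(\<nu> g ^ d * det (\<rho>' g)) ^ m = det (\<rho>' (g ^ k)) ^ m" by simp
  then have "\<nu> g ^ (d * m) = 1"
   using det'[OF g] det'[OF subgrp_power[OF G(1) g]] by (simp add: power_mult_distrib power_mult)
  moreover have "coprime (d * m) p" using nd dd m(2) p by (simp add: coprime_prime_iff prime_dvd_mult_iff)
  ultimately show ?thesis using coprime_powers_1[OF _ \<nu>(3)[OF g]] by blast
 qed
 then show False using \<nu>(2) by blast
qed

text \<open>A finite group of functions under the pointwise product whose exponent divides
  \<open>m\<close> has no element of order \<open>p\<close>. Its members vanish outside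
  \<open>K\<close>, which \<open>inverse 0 = 0\<close> respects. It will be the group of linear
  characters of \<open>K\<close> fixed by a Sylow \<open>p\<close>-subgroup.\<close>

lemma function_group_card_coprime:
 fixes L :: "('g \<Rightarrow> complex) set"
 assumes p: "prime p" and fin: "finite L" and one: "(\<lambda>h. if h \<in> K then 1 else 0) \<in> L"
  and mult: "\<And>f g. f \<in> L \<Longrightarrow> g \<in> L \<Longrightarrow> (\<lambda>h. f h * g h) \<in> L"
  and inv: "\<And>f. f \<in> L \<Longrightarrow> (\<lambda>h. inverse (f h)) \<in> L"
  and zero: "\<And>f h. f \<in> L \<Longrightarrow> f h = 0 \<longleftrightarrow> h \<notin> K"
  and m: "coprime m p" "\<And>f h. f \<in> L \<Longrightarrow> h \<in> K \<Longrightarrow> f h ^ m = 1"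
 shows "\<not> p dvd card L"
proof
 assume "p dvd card L"
 then obtain k where k: "card L = p * k" by blast
 define M :: "('g \<Rightarrow> complex) monoid" where
  "M = \<lparr>carrier = L, monoid.mult = (\<lambda>f g h. f h * g h), one = (\<lambda>h. if h \<in> K then 1 else 0)\<rparr>"
 have c: "carrier M = L" "\<And>f g. f \<otimes>\<^bsub>M\<^esub> g = (\<lambda>h. f h * g h)" "\<one>\<^bsub>M\<^esub> = (\<lambda>h. if h \<in> K then 1 else 0)"
  by (simp_all add: M_def)
 have grp: "group M"
 proof (rule groupI)
  fix f assume f: "f \<in> carrier M"
  then have fL: "f \<in> L" by (simp add: c)
  show "\<one>\<^bsub>M\<^esub> \<otimes>\<^bsub>M\<^esub> f = f" using zero[OF fL] by (auto simp: c)
  have "(\<lambda>h. inverse (f h)) \<otimes>\<^bsub>M\<^esub> f = \<one>\<^bsub>M\<^esub>" using zero[OF fL] by (auto simp: c)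
  then show "\<exists>y\<in>carrier M. y \<otimes>\<^bsub>M\<^esub> f = \<one>\<^bsub>M\<^esub>" using inv[OF fL] by (metis c(1))
 qed (use one mult in \<open>auto simp: c mult.assoc\<close>)
 have "\<exists>S. subgroup S M \<and> card S = p ^ 1"
  by (rule sylow_thm[OF p grp]) (use k fin in \<open>auto simp: Coset.order_def c\<close>)
 then obtain S where S: "subgroup S M" "card S = p" by auto
 have "1 < card S" using S(2) p prime_gt_1_nat by simp
 then have "\<not> S \<subseteq> {\<one>\<^bsub>M\<^esub>}" using card_mono[of "{\<one>\<^bsub>M\<^esub>}" S] by auto
 then obtain f where f: "f \<in> S" "f \<noteq> \<one>\<^bsub>M\<^esub>" by blast
 have fL: "f \<in> L" using subgroup.subset[OF S(1)] f(1) by (auto simp: c)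
 interpret S: group "M\<lparr>carrier := S\<rparr>" by (rule group.subgroup_imp_group[OF grp S(1)])
 have "f [^]\<^bsub>M\<lparr>carrier := S\<rparr>\<^esub> Coset.order (M\<lparr>carrier := S\<rparr>) = \<one>\<^bsub>M\<lparr>carrier := S\<rparr>\<^esub>"
  by (rule S.pow_order_eq_1) (use f in simp)
 then have "f [^]\<^bsub>M\<lparr>carrier := S\<rparr>\<^esub> p = \<one>\<^bsub>M\<^esub>" by (simp add: Coset.order_def S(2))
 moreover have "f [^]\<^bsub>M\<lparr>carrier := S\<rparr>\<^esub> n = (\<lambda>h. if h \<in> K then f h ^ n else 0)" for n :: nat
 proof (induction n)
  case 0
  show ?case by (rule HOL.ext) (simp add: c)
 next
  case (Suc n)
  then show ?case by (auto simp: c)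
 qed
 ultimately have fp: "(\<lambda>h. if h \<in> K then f h ^ p else 0) = (\<lambda>h. if h \<in> K then 1 else 0)" by (simp add: c)
 have "f h = 1" if h: "h \<in> K" for h
  using fun_cong[OF fp, of h] h coprime_powers_1[OF m(2)[OF fL h] _ m(1)] by simp
 then have "f = \<one>\<^bsub>M\<^esub>" using zero[OF fL] by (auto simp: c)
 then show False using f(2) by simp
qed

text \<open>Generating \<open>K\<close> by the elements of order prime to \<open>p\<close> serves
  two ends: the index of \<open>K\<close> is a power of \<open>p\<close>, and the linear characters
  of \<open>K\<close> have order prime to \<open>p\<close>, as \<open>Irr_extend\<close>
  requires.\<close>

lemma gcs_coprime_residual:
 assumes G: "subgrp G" "gcs G" and p: "prime p" and \<nu>: "lin G \<nu>" "\<exists>x\<in>G. \<nu> x \<noteq> 1" "\<And>x. x \<in> G \<Longrightarrow> \<nu> x ^ p = 1"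
 shows "\<exists>K a. nsub K G \<and> card G = card K * p ^ a \<and> \<not> p dvd card K"
proof -
 define S where "S = {x\<in>G. p'el p x}"
 have SG: "S \<subseteq> G" by (auto simp: S_def)
 define K where "K = genin G S"
 have K: "subgrp K" "K \<subseteq> G" "S \<subseteq> K" unfolding K_def using genin_subgrp[OF G(1) SG] by auto
 have least: "K \<subseteq> L" if "subgrp L" "L \<subseteq> K" "S \<subseteq> L" for L
  unfolding K_def by (rule genin_least) (use that K(2) in auto)
 have nK: "nsub K G"
 proof (rule nsubI[OF K(1,2)])
  fix g x assume g: "g \<in> G" and x: "x \<in> K"
  have "K \<subseteq> {x\<in>K. cj g x \<in> K}"
  proof (rule least)
   show "subgrp {x\<in>K. cj g x \<in> K}"
    by (rule subgrpI) (use K(1) in \<open>auto simp: cj_mult subgrp_mult\<close>)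
   show "S \<subseteq> {x\<in>K. cj g x \<in> K}"
   proof
    fix s assume s: "s \<in> S"
    have "cj g s \<in> S" using s subgrp_cj[OF G(1) g] by (auto simp: S_def)
    then show "s \<in> {x\<in>K. cj g x \<in> K}" using s K(3) by blast
   qed
  qed auto
  then show "cj g x \<in> K" using x by blast
 qed
 obtain a where a: "card G = card K * p ^ a"
 proof -
  have "\<exists>k. card G = card K * p ^ k"
  proof (rule prime_power_index[OF G(1) p K(1,2)])
   fix r R assume R: "prime r" "r \<noteq> p" "syl r G R"
   have "x \<in> S" if "x \<in> R" for x using syl_p'el[OF p R that] sylD(2)[OF R(3)] that by (auto simp: S_def)
   then show "R \<subseteq> K" using K(3) by blast
  qed
  then show ?thesis using that by blast
 qed
 have cG: "card G \<noteq> 0" using subgrp_card_pos[OF G(1)] by simp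
 obtain m where m: "card G = p ^ multiplicity p (card G) * m" "\<not> p dvd m"
  using multiplicity_decompose'[of "card G" p] cG p not_prime_unit by blast
 have mp: "coprime m p" using m(2) p by (simp add: coprime_prime_iff)
 have root: "\<mu> n ^ m = 1" if \<mu>: "lin K \<mu>" and n: "n \<in> K" for \<mu> n
 proof -
  have "K \<subseteq> {x\<in>K. \<mu> x ^ m = 1}"
  proof (rule least)
   show "subgrp {x\<in>K. \<mu> x ^ m = 1}" by (rule nsubD(1)[OF lin_ker_nsub[OF lin_power_fun[OF \<mu>] K(1)]])
   show "S \<subseteq> {x\<in>K. \<mu> x ^ m = 1}"
   proof
    fix s assume s: "s \<in> S"
    then have sK: "s \<in> K" and sG: "s \<in> G" using K(3) by (auto simp: S_def)
    obtain l where l: "coprime l p" "s ^ l = 1" using s by (auto simp: S_def p'el_def)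
    have "(s ^ m) ^ (p ^ multiplicity p (card G)) = s ^ card G" by (subst m(1)) (simp add: power_mult[symmetric] mult.commute)
    then have 1: "(s ^ m) ^ (p ^ multiplicity p (card G)) = 1" using subgrp_power_card[OF G(1) sG] by simp
    have 2: "(s ^ m) ^ l = 1" using l(2) by (metis mult.commute power_mult power_one)
    have "s ^ m = 1" by (rule power_coprime_eq_1[OF 1 2]) (use l(1) in \<open>simp add: coprime_commute\<close>)
    then have "\<mu> s ^ m = 1" using lin_power[OF \<mu> K(1) sK, of m] lin_one[OF \<mu>] by simp
    then show "s \<in> {x\<in>K. \<mu> x ^ m = 1}" using sK by blast
   qed
  qed auto
  then show ?thesis using n by blast
 qed
 obtain P where P: "syl p G P" using syl_ex[OF G(1) p] by blast
 note sP = sylD(1,2)[OF P]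
 have KP: "setmul K P = G" by (rule setmul_syl_eq[OF G(1) p nK a P])
 have Pn: "P \<subseteq> nrm K" using nsub_le_nrm[OF nK] sP(2) by blast
 define F where "F = {\<theta>\<in>Irr K. \<forall>g\<in>P. cnj g \<theta> = \<theta>}"
 have fin: "finite (Irr K)" by (rule Irr_regular(1)[OF K(1)])
 have fF: "finite F" using fin by (simp add: F_def)
 have "[(\<Sum>\<theta>\<in>Irr K. deg \<theta> ^ 2) = (\<Sum>\<theta> | \<theta> \<in> Irr K \<and> (\<forall>g\<in>P. cnj g \<theta> = \<theta>). deg \<theta> ^ 2)] (mod p)"
  by (rule weighted_fixed_points_cong[OF sP(1) sylD(4)[OF P] p fin acts_cnj[OF Pn]]) simp
 then have c1: "[card K = (\<Sum>\<theta>\<in>F. deg \<theta> ^ 2)] (mod p)" using sum_deg_squares[OF K(1)] by (simp add: F_def)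
 \<comment> \<open>A fixed character of degree prime to \<open>p\<close> is invariant under all of
   \<open>G\<close>, extends to \<open>G\<close> and is therefore linear by
   \<open>gcs_degree_dvd\<close>; so modulo \<open>p\<close> the sum of squares counts linear
   characters.\<close>
 have dsq: "[deg \<theta> ^ 2 = (if deg \<theta> = 1 then 1 else 0)] (mod p)" if \<theta>: "\<theta> \<in> F" for \<theta>
 proof (cases "p dvd deg \<theta>")
  case True
  then have "deg \<theta> \<noteq> 1" using p by (metis not_prime_1 nat_dvd_1_iff_1)
  moreover have "p dvd deg \<theta> ^ 2" using True by (simp add: dvd_power_same power2_eq_square)
  ultimately show ?thesis by (simp add: cong_0_iff)
 next
  case False
  have \<theta>I: "\<theta> \<in> Irr K" and \<theta>P: "\<And>g. g \<in> P \<Longrightarrow> cnj g \<theta> = \<theta>" using \<theta> by (auto simp: F_def)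
  have inv: "cnj h \<theta> = \<theta>" if "h \<in> G" for h
  proof -
   have "h \<in> setmul K P" using KP \<open>h \<in> G\<close> by simp
   then obtain k y where ky: "k \<in> K" "y \<in> P" "h = k * y" by (elim setmulE)
   show ?thesis unfolding ky(3) cnj_mult \<theta>P[OF ky(2)] by (rule cnj_inner[OF K(1) \<theta>I ky(1)])
  qed
  obtain \<psi> where \<psi>: "\<psi> \<in> Irr G" "\<forall>n\<in>K. \<psi> n = \<theta> n" using Irr_extend[OF G(1) nK a p \<theta>I inv False mp] root by blast
  have "deg \<psi> = deg \<theta>" using \<psi>(2) K(1) by (simp add: deg_def)
  then have "deg \<theta> = 1" using gcs_degree_dvd[OF G p \<nu> \<psi>(1)] False by metis
  then show ?thesis by simp
 qed
 define L where "L = {\<theta>\<in>F. deg \<theta> = 1}"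
 have "[(\<Sum>\<theta>\<in>F. deg \<theta> ^ 2) = (\<Sum>\<theta>\<in>F. if deg \<theta> = 1 then 1 else 0)] (mod p)" by (rule cong_sum) (rule dsq)
 moreover have "(\<Sum>\<theta>\<in>F. if deg \<theta> = 1 then 1 else 0) = card L" using fF by (simp add: L_def sum.If_cases Int_def)
 ultimately have cL: "[card K = card L] (mod p)" using c1 cong_trans by metis
 have Llin: "lin K \<theta>" "\<theta> \<in> Irr K" "\<And>g. g \<in> P \<Longrightarrow> cnj g \<theta> = \<theta>" if "\<theta> \<in> L" for \<theta>
 proof -
  have t: "\<theta> \<in> Irr K" "deg \<theta> = 1" using that by (auto simp: L_def F_def)
  have "\<theta> 1 = 1" using deg_Irr(1)[OF t(1) K(1)] t(2) by simp
  then show "lin K \<theta>" using Irr_lin[OF t(1) _ K(1)] by blast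
 qed (use that in \<open>auto simp: L_def F_def\<close>)
 have LI: "\<theta> \<in> L" if "\<theta> \<in> Irr K" "\<theta> 1 = 1" "\<And>g. g \<in> P \<Longrightarrow> cnj g \<theta> = \<theta>" for \<theta>
  using that deg_eqI[of \<theta> 1] by (auto simp: L_def F_def)
 have "\<not> p dvd card L"
 proof (rule function_group_card_coprime[OF p, where K = K and m = m])
  show "finite L" using fF by (simp add: L_def)
  have l1: "lin K (\<lambda>h. 1)" by (simp add: lin_def)
  show "(\<lambda>h. if h \<in> K then 1 else 0) \<in> L"
  proof (rule LI[OF lin_Irr[OF l1 K(1)]])
   fix g assume "g \<in> P"
   then have g: "g \<in> nrm K" using Pn by blast
   have "cj (inverse g) x \<in> K \<longleftrightarrow> x \<in> K" for x
    using nrm_cj[OF g, of "cj (inverse g) x"] nrm_cj[OF nrm_inverse[OF g], of x] by auto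
   then show "cnj g (\<lambda>h. if h \<in> K then 1 else 0) = (\<lambda>h. if h \<in> K then 1 else 0)" by (simp add: cnj_def)
  qed (use K(1) in simp)
  show "(\<lambda>h. f h * g h) \<in> L" if f: "f \<in> L" and g: "g \<in> L" for f g
  proof (rule LI[OF Irr_twist[OF Llin(2)[OF g] Llin(1)[OF f] K(1)]])
   show "f 1 * g 1 = 1" using lin_one[OF Llin(1)[OF f]] lin_one[OF Llin(1)[OF g]] by simp
   show "cnj x (\<lambda>h. f h * g h) = (\<lambda>h. f h * g h)" if "x \<in> P" for x
    using Llin(3)[OF f that] Llin(3)[OF g that] by (metis (no_types) cnj_def)
  qed
  show zero: "f h = 0 \<longleftrightarrow> h \<notin> K" if f: "f \<in> L" for f h
   using Irr_zero[OF Llin(2)[OF f], of h] lin_nz[OF Llin(1)[OF f] K(1), of h] by blast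
  show "(\<lambda>h. inverse (f h)) \<in> L" if f: "f \<in> L" for f
  proof (rule LI)
   have "lin K (\<lambda>h. inverse (f h))" using Llin(1)[OF f] by (simp add: lin_def)
   from lin_Irr[OF this K(1)] have "(\<lambda>h. if h \<in> K then inverse (f h) else 0) \<in> Irr K" .
   moreover have "(\<lambda>h. if h \<in> K then inverse (f h) else 0) = (\<lambda>h. inverse (f h))" using Irr_zero[OF Llin(2)[OF f]] by auto
   ultimately show "(\<lambda>h. inverse (f h)) \<in> Irr K" by simp
   show "inverse (f 1) = 1" using lin_one[OF Llin(1)[OF f]] by simp
   show "cnj x (\<lambda>h. inverse (f h)) = (\<lambda>h. inverse (f h))" if "x \<in> P" for x
    using Llin(3)[OF f that] by (metis (no_types) cnj_def)
  qed
  show "f h ^ m = 1" if "f \<in> L" "h \<in> K" for f h by (rule root[OF Llin(1)[OF that(1)] that(2)])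
 qed (rule mp)
 then have "\<not> p dvd card K" using cL cong_dvd_iff by blast
 then show ?thesis using nK a by blast
qed

text \<open>If \<open>Q\<close> were non-trivial, the degree of \<open>\<theta>\<close> would be
  divisible by \<open>p\<close>: restricting an extension of \<open>\<theta>\<close> to
  \<open>Q\<close>, the non-linear constituents have degrees divisible by \<open>p\<close>, and the
  linear characters share one multiplicity while their number is a multiple of \<open>p\<close>. But
  the degree of \<open>\<theta>\<close> divides the order of \<open>K\<close>.\<close>

lemma gcs_stabilizer:
 assumes G: "subgrp G" "gcs G" and p: "prime p" and K: "nsub K G" "\<not> p dvd card K" and P: "syl p G P" and KP: "setmul K P = G"
  and \<theta>: "\<theta> \<in> Irr K" "deg \<theta> \<noteq> 1"
 shows "stab G \<theta> = K"
proof -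
 define T where "T = stab G \<theta>"
 define Q where "Q = T \<inter> P"
 note sK = nsubD(1)[OF K(1)] and KG = nsubD(2)[OF K(1)] and sP = sylD(1,2)[OF P]
 have sT: "subgrp T" "T \<subseteq> G" unfolding T_def using stab_subgrp[OF G(1)] stab_le by auto
 have KT: "K \<subseteq> T" unfolding T_def by (rule le_stab[OF K(1) \<theta>(1)])
 have sQ: "subgrp Q" unfolding Q_def by (rule subgrp_Int[OF sT(1) sP(1)])
 have Kp: "coprime (card K) p" using K(2) p by (simp add: coprime_prime_iff)
 have decomp: "\<exists>k\<in>K. \<exists>y\<in>Q. t = k * y" if t: "t \<in> T" for t
 proof -
  have "t \<in> setmul K P" using t sT(2) KP by blast
  then obtain k y where ky: "k \<in> K" "y \<in> P" "t = k * y" by (elim setmulE)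
  have "y \<in> T" using t ky KT subgrp_mult_left_iff[OF sT(1), of k y] by blast
  then show ?thesis using ky by (auto simp: Q_def)
 qed
 have KQ1: "x = 1" if x: "x \<in> K" "x \<in> Q" for x
 proof (rule pel_p'el_trivial[OF p])
  show "pel p x" using pgrp_pel[OF sylD(3)[OF P]] x(2) by (simp add: Q_def)
  show "p'el p x" by (rule coprime_card_p'el[OF sK Kp x(1)])
 qed
 have "Q = {1}"
 proof (rule ccontr)
  assume Q1: "Q \<noteq> {1}"
  have nKT: "nsub K T" by (rule nsubI[OF sK KT]) (use nsubD(3)[OF K(1)] sT(2) in blast)
  have "card Q dvd card P" by (rule subgrp_card_dvd[OF sP(1) sQ]) (simp add: Q_def)
  then obtain b where b: "card Q = p ^ b" using sylD(4)[OF P] divides_primepow_nat[OF p] by metis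
  have pQ: "pgrp p Q" unfolding pgrp_def using sQ b by blast
  have "setmul K Q = T"
  proof (intro equalityI subsetI)
   fix x assume "x \<in> setmul K Q"
   then obtain k y where "k \<in> K" "y \<in> Q" "x = k * y" by (elim setmulE)
   then show "x \<in> T" using KT sT(1) by (auto simp: Q_def subgrp_mult)
  next
   fix x assume "x \<in> T"
   then show "x \<in> setmul K Q" using decomp setmulI by metis
  qed
  moreover have "K \<inter> Q = {1}" using KQ1 sK sQ by auto
  ultimately have cT: "card T = card K * p ^ b" using card_setmul[OF sK sQ] b by simp
  have pd: "\<not> p dvd deg \<theta>"
   using Irr_degree_dvd[OF sK \<theta>(1) deg_Irr(1)[OF \<theta>(1) sK]] K(2) dvd_trans by blast
  have invT: "cnj h \<theta> = \<theta>" if "h \<in> T" for h using that by (simp add: T_def stab_def)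
  obtain \<psi> where \<psi>: "\<psi> \<in> Irr T" "\<forall>n\<in>K. \<psi> n = \<theta> n"
   using Irr_extend[OF sT(1) nKT cT p \<theta>(1) invT pd Kp] lin_power_card[OF _ sK] by blast
  \<comment> \<open>The projection of \<open>T\<close>, the semidirect product of \<open>K\<close>
    and \<open>Q\<close>, onto \<open>Q\<close>; it inflates linear characters of \<open>Q\<close>
    to \<open>T\<close>.\<close>
  define \<pi> where "\<pi> t = (SOME y. y \<in> Q \<and> (\<exists>k\<in>K. t = k * y))" for t
  have \<pi>: "\<pi> (k * y) = y" if ky: "k \<in> K" "y \<in> Q" for k y
  proof -
   have "y' = y" if y': "y' \<in> Q" "k' \<in> K" "k * y = k' * y'" for y' k'
   proof -
    have "inverse k' * k = y' * inverse y"
     using y'(3) by (metis grp_inverse_mult_cancel grp_right_inverse mult.assoc mult_1_right)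
    moreover have "inverse k' * k \<in> K" using ky(1) y'(2) sK by (simp add: subgrp_closed)
    moreover have "y' * inverse y \<in> Q" using ky(2) y'(1) sQ by (simp add: subgrp_closed)
    ultimately have "y' * inverse y = 1" using KQ1 by metis
    then show ?thesis by (metis grp_inverse_inverse grp_inverse_unique grp_inverse_eq_iff)
   qed
   moreover have "\<exists>z. z \<in> Q \<and> (\<exists>k'\<in>K. k * y = k' * z)" using ky by blast
   from someI_ex[OF this] have "\<pi> (k * y) \<in> Q \<and> (\<exists>k'\<in>K. k * y = k' * \<pi> (k * y))" unfolding \<pi>_def .
   ultimately show ?thesis by blast
  qed
  have \<pi>Q: "\<pi> y = y" if "y \<in> Q" for y using \<pi>[OF subgrp_one[OF sK] that] by simp
  have \<pi>K: "\<pi> k = 1" if "k \<in> K" for k using \<pi>[OF that subgrp_one[OF sQ]] by simp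
  have \<pi>in: "\<pi> t \<in> Q" if "t \<in> T" for t using decomp[OF that] \<pi> by auto
  have \<pi>m: "\<pi> (s * t) = \<pi> s * \<pi> t" if s: "s \<in> T" and t: "t \<in> T" for s t
  proof -
   obtain k y where ky: "k \<in> K" "y \<in> Q" "s = k * y" using decomp[OF s] by blast
   obtain l z where lz: "l \<in> K" "z \<in> Q" "t = l * z" using decomp[OF t] by blast
   have "y \<in> T" using ky(2) by (simp add: Q_def)
   then have "k * cj y l \<in> K" using nsubD(3)[OF nKT _ lz(1)] ky(1) sK by (simp add: subgrp_mult)
   moreover have "y * z \<in> Q" using ky(2) lz(2) sQ by (simp add: subgrp_mult)
   moreover have "s * t = (k * cj y l) * (y * z)" unfolding ky(3) lz(3) cj_def by (simp add: mult.assoc)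
   ultimately have "\<pi> (s * t) = y * z" using \<pi> by metis
   then show ?thesis using \<pi>[OF ky(1,2)] \<pi>[OF lz(1,2)] ky(3) lz(3) by simp
  qed
  \<comment> \<open>The twist is by the inverse character, so that the sum of
    \<open>\<Psi> \<mu>\<close> over \<open>Q\<close> is \<open>card Q\<close> times the
    multiplicity of \<open>\<mu>\<close> in \<open>\<psi>\<close>.\<close>
  define \<Psi> where "\<Psi> \<mu> = (\<lambda>t. \<mu> (inverse (\<pi> t)) * \<psi> t)" for \<mu>
  have \<Psi>: "\<Psi> \<mu> \<in> Irr T" "\<And>k. k \<in> K \<Longrightarrow> \<Psi> \<mu> k = \<theta> k" if \<mu>: "lin Q \<mu>" for \<mu>
  proof -
   have "lin T (\<lambda>t. \<mu> (inverse (\<pi> t)))"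
    unfolding lin_def
   proof (intro conjI ballI)
    fix s t assume s: "s \<in> T" and t: "t \<in> T"
    show "\<mu> (inverse (\<pi> (s * t))) = \<mu> (inverse (\<pi> s)) * \<mu> (inverse (\<pi> t))"
     using lin_mult[OF \<mu> subgrp_inverse[OF sQ \<pi>in[OF t]] subgrp_inverse[OF sQ \<pi>in[OF s]]] \<pi>m[OF s t]
     by (simp add: mult.commute)
   qed (use \<pi>K[OF subgrp_one[OF sK]] lin_one[OF \<mu>] in simp)
   from Irr_twist[OF \<psi>(1) this sT(1)] show "\<Psi> \<mu> \<in> Irr T" unfolding \<Psi>_def .
   show "\<Psi> \<mu> k = \<theta> k" if "k \<in> K" for k using \<pi>K[OF that] lin_one[OF \<mu>] \<psi>(2) that by (simp add: \<Psi>_def)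
  qed
  have TP: "setmul T P = G"
  proof
   show "setmul T P \<subseteq> G" by (rule setmul_subset[OF G(1) sT(2) sP(2)])
   show "G \<subseteq> setmul T P" unfolding KP[symmetric] using KT by (auto elim!: setmulE intro: setmulI)
  qed
  have "\<exists>\<chi>\<in>Irr G. card T * deg \<chi> = card G * deg \<theta> \<and>
    of_nat (card T) * (\<Sum>x\<in>P. \<chi> x) = of_nat (card G) * (of_nat (card Q) * ip Q \<psi> \<mu>)" if \<mu>: "lin Q \<mu>" for \<mu>
  proof -
   obtain \<chi> where \<chi>: "\<chi> \<in> Irr G" "card T * deg \<chi> = card G * deg \<theta>"
    "\<forall>g\<in>G. of_nat (card T) * \<chi> g = (\<Sum>h | h \<in> G \<and> cj h g \<in> T. \<Psi> \<mu> (cj h g))"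
    using clifford_induce[OF G(1) K(1) \<theta>(1) T_def \<Psi>[OF \<mu>]] by blast
   have "of_nat (card T) * (\<Sum>x\<in>P. \<chi> x) = of_nat (card G) * (\<Sum>x\<in>T \<inter> P. \<Psi> \<mu> x)"
    by (rule mackey_sum[OF G(1) sT sP TP \<Psi>(1)[OF \<mu>]]) (use \<chi>(3) in blast)
   also have "(\<Sum>x\<in>T \<inter> P. \<Psi> \<mu> x) = (\<Sum>x\<in>Q. \<psi> x * \<mu> (inverse x))"
    unfolding Q_def[symmetric] by (rule sum.cong[OF refl]) (simp add: \<Psi>_def \<pi>Q mult.commute)
   also have "\<dots> = of_nat (card Q) * ip Q \<psi> \<mu>" using sQ by (simp add: ip_def)
   finally show ?thesis using \<chi>(1,2) by blast
  qed
  then obtain X where X: "\<And>\<mu>. lin Q \<mu> \<Longrightarrow> X \<mu> \<in> Irr G" "\<And>\<mu>. lin Q \<mu> \<Longrightarrow> card T * deg (X \<mu>) = card G * deg \<theta>"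
   "\<And>\<mu>. lin Q \<mu> \<Longrightarrow> of_nat (card T) * (\<Sum>x\<in>P. X \<mu> x) = of_nat (card G) * (of_nat (card Q) * ip Q \<psi> \<mu>)"
   by metis
  have cT0: "card T > 0" and cG0: "card G > 0" and cQ0: "card Q > 0" using sT(1) G(1) sQ by auto
  \<comment> \<open>The two induced characters have the same degree, which is not 1, and so equal
    sums over \<open>P\<close>; these sums are the multiplicities up to a common factor.\<close>
  have ipeq: "ip Q \<psi> \<mu> = ip Q \<psi> \<mu>'" if \<mu>: "lin Q \<mu>" "lin Q \<mu>'" for \<mu> \<mu>'
  proof -
   have "card T * deg (X \<mu>) = card T * deg (X \<mu>')" using X(2)[OF \<mu>(1)] X(2)[OF \<mu>(2)] by simp
   then have de: "deg (X \<mu>) = deg (X \<mu>')" using cT0 by simp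
   have "deg (X \<mu>) \<noteq> 1"
   proof
    assume "deg (X \<mu>) = 1"
    then have e: "card T = card G * deg \<theta>" using X(2)[OF \<mu>(1)] by simp
    have "2 \<le> deg \<theta>" using \<theta>(2) deg_Irr(2)[OF \<theta>(1) sK] by simp
    then have "card G * 2 \<le> card T" unfolding e by (rule mult_le_mono2)
    moreover have "card T \<le> card G" using sT(2) G(1) by (intro card_mono) auto
    ultimately show False using cG0 by simp
   qed
   from gcs_sum_eq[OF G X(1)[OF \<mu>(1)] X(1)[OF \<mu>(2)] this de sP]
   have "(of_nat (card G) * (of_nat (card Q) * ip Q \<psi> \<mu>) :: complex) = of_nat (card G) * (of_nat (card Q) * ip Q \<psi> \<mu>')"
    unfolding X(3)[OF \<mu>(1), symmetric] X(3)[OF \<mu>(2), symmetric] by simp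
   then show ?thesis using cG0 cQ0 by simp
  qed
  have QT: "Q \<subseteq> T" by (simp add: Q_def)
  obtain n where n: "\<And>y. y \<in> Q \<Longrightarrow> \<psi> y = (\<Sum>\<mu>\<in>Irr Q. of_nat (n \<mu>) * \<mu> y)" "\<And>\<mu>. \<mu> \<in> Irr Q \<Longrightarrow> ip Q \<psi> \<mu> = of_nat (n \<mu>)"
   using Irr_restrict[OF sT(1) sQ QT \<psi>(1)] by blast
  define Lq where "Lq = {\<mu>\<in>Irr Q. deg \<mu> = 1}"
  have fQ: "finite (Irr Q)" by (rule Irr_regular(1)[OF sQ])
  have Llin: "lin Q \<mu>" if "\<mu> \<in> Lq" for \<mu>
   using that Irr_lin[OF _ _ sQ, of \<mu>] deg_Irr(1)[OF _ sQ, of \<mu>] by (simp add: Lq_def)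
  have "\<exists>c. \<forall>\<mu>\<in>Lq. n \<mu> = c"
  proof (cases "Lq = {}")
   case False
   then obtain \<mu>0 where \<mu>0: "\<mu>0 \<in> Lq" by blast
   have "n \<mu> = n \<mu>0" if "\<mu> \<in> Lq" for \<mu>
   proof -
    have "of_nat (n \<mu>) = (of_nat (n \<mu>0) :: complex)"
     using ipeq[OF Llin[OF that] Llin[OF \<mu>0]] n(2) that \<mu>0 by (simp add: Lq_def)
    then show ?thesis by (simp only: of_nat_eq_iff)
   qed
   then show ?thesis by blast
  qed simp
  then obtain c where c: "\<And>\<mu>. \<mu> \<in> Lq \<Longrightarrow> n \<mu> = c" by blast
  have pnl: "p dvd deg \<mu>" if \<mu>: "\<mu> \<in> Irr Q - Lq" for \<mu>
   by (rule pgrp_degree_dvd[OF p pQ]) (use \<mu> in \<open>auto simp: Lq_def\<close>)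
  have LI: "Lq \<subseteq> Irr Q" by (auto simp: Lq_def)
  have pL: "p dvd card Lq" unfolding Lq_def by (rule pgrp_linear_count[OF p pQ Q1])
  have "(of_nat (deg \<theta>) :: complex) = (\<Sum>\<mu>\<in>Irr Q. of_nat (n \<mu>) * of_nat (deg \<mu>))"
   using n(1)[OF subgrp_one[OF sQ]] \<psi>(2) deg_Irr(1)[OF \<theta>(1) sK] deg_Irr(1)[OF _ sQ] subgrp_one[OF sK] by simp
  then have "(of_nat (deg \<theta>) :: complex) = of_nat (\<Sum>\<mu>\<in>Irr Q. n \<mu> * deg \<mu>)" by simp
  then have "deg \<theta> = (\<Sum>\<mu>\<in>Irr Q. n \<mu> * deg \<mu>)" by (simp only: of_nat_eq_iff)
  also have "\<dots> = (\<Sum>\<mu>\<in>Irr Q - Lq. n \<mu> * deg \<mu>) + (\<Sum>\<mu>\<in>Lq. n \<mu> * deg \<mu>)" by (rule sum.subset_diff[OF LI fQ])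
  also have "(\<Sum>\<mu>\<in>Lq. n \<mu> * deg \<mu>) = (\<Sum>\<mu>\<in>Lq. c)" by (rule sum.cong[OF refl]) (use c in \<open>simp add: Lq_def\<close>)
  finally have "deg \<theta> = (\<Sum>\<mu>\<in>Irr Q - Lq. n \<mu> * deg \<mu>) + card Lq * c" by simp
  moreover have "p dvd (\<Sum>\<mu>\<in>Irr Q - Lq. n \<mu> * deg \<mu>)" by (rule dvd_sum) (use pnl in simp)
  ultimately have "p dvd deg \<theta>" using pL by simp
  then show False using pd by simp
 qed
 then have "T \<subseteq> K" using decomp by auto
 then show ?thesis using KT by (simp add: T_def)
qed

lemma power_mult_commute:
 fixes x y :: "'a::monoid_mult"
 assumes "x * y = y * x" shows "(x * y) ^ n = x ^ n * y ^ n"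
proof (induction n)
 case (Suc n)
 have "(x * y) ^ Suc n = x * (y * x ^ n) * y ^ n" using Suc by (simp add: mult.assoc)
 also have "y * x ^ n = x ^ n * y" using power_commuting_commutes[of x y n] assms by simp
 finally show ?case by (simp add: mult.assoc)
qed simp

text \<open>\<open>D\<close> is the derived subgroup of \<open>K\<close>, described as the common
  kernel of its linear characters. Solvability climbs from \<open>D\<close>, where
  \<open>fpf_solv\<close> applies, over the abelian quotient to \<open>K\<close> and over the
  \<open>p\<close>-power index to \<open>G\<close>.\<close>

theorem gcs_solv:
 fixes G :: "nat perm set"
 assumes G: "subgrp G" "gcs G" and \<mu>: "lin G \<mu>" "x0 \<in> G" "\<mu> x0 \<noteq> 1"
 shows "solv G"
proof -
 obtain p \<nu> where p: "prime p" and \<nu>: "lin G \<nu>" "\<exists>x\<in>G. \<nu> x \<noteq> 1" "\<And>x. x \<in> G \<Longrightarrow> \<nu> x ^ p = 1"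
  using lin_prime_order[OF G(1) \<mu>] by blast
 obtain K a where K: "nsub K G" "card G = card K * p ^ a" "\<not> p dvd card K" using gcs_coprime_residual[OF G p \<nu>] by blast
 note sK = nsubD(1)[OF K(1)] and KG = nsubD(2)[OF K(1)]
 have Kp: "coprime (card K) p" using K(3) p by (simp add: coprime_prime_iff)
 obtain P where P: "syl p G P" using syl_ex[OF G(1) p] by blast
 have KP: "setmul K P = G" by (rule setmul_syl_eq[OF G(1) p K(1,2) P])
 define D where "D = {y\<in>K. \<forall>\<mu>. lin K \<mu> \<longrightarrow> \<mu> y = 1}"
 have sD: "subgrp D"
 proof (rule subgrpI)
  show "finite D" using sK by (simp add: D_def)
  have "\<mu> 1 = 1" if "lin K \<mu>" for \<mu> by (rule lin_one[OF that])
  then show "1 \<in> D" using subgrp_one[OF sK] by (simp add: D_def)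
  fix u v assume u: "u \<in> D" and v: "v \<in> D"
  have "\<mu> (u * v) = 1" if "lin K \<mu>" for \<mu>
  proof -
   have "\<mu> u = 1" "\<mu> v = 1" using u v that by (simp_all add: D_def)
   then show ?thesis using lin_mult[OF that, of u v] u v by (simp add: D_def)
  qed
  then show "u * v \<in> D" using u v subgrp_mult[OF sK] by (simp add: D_def)
 qed
 have DK: "D \<subseteq> K" by (auto simp: D_def)
 have nDG: "nsub D G"
 proof (rule nsubI[OF sD])
  show "D \<subseteq> G" using DK KG by blast
  fix g y assume g: "g \<in> G" and y: "y \<in> D"
  have "\<mu> (cj g y) = 1" if \<mu>: "lin K \<mu>" for \<mu>
  proof -
   have "lin K (\<lambda>k. \<mu> (cj g k))" using \<mu> nsubD(3)[OF K(1) g] by (simp add: lin_def cj_mult)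
   then have "(\<lambda>k. \<mu> (cj g k)) y = 1" using y unfolding D_def by blast
   then show ?thesis by simp
  qed
  then show "cj g y \<in> D" using nsubD(3)[OF K(1) g] y DK by (auto simp: D_def)
 qed
 have nDK: "nsub D K" by (rule nsubI[OF sD DK]) (use nsubD(3)[OF nDG] KG in blast)
 have "p dvd card G"
 proof (rule ccontr)
  assume "\<not> p dvd card G"
  then have "coprime (card G) p" using p by (simp add: coprime_prime_iff)
  then have "\<nu> x = 1" if "x \<in> G" for x using coprime_powers_1[OF lin_power_card[OF \<nu>(1) G(1) that] \<nu>(3)[OF that]] by blast
  then show False using \<nu>(2) by blast
 qed
 then obtain x where x: "x \<in> G" "x \<noteq> 1" "x ^ p = 1" using cauchy_pel[OF G(1) p] by blast
 have p1: "y = 1" if "y \<in> K" "y ^ p = 1" for y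
  by (rule power_coprime_eq_1[OF subgrp_power_card[OF sK that(1)] that(2) Kp])
 have xK: "x \<notin> K" using p1 x by blast
 \<comment> \<open>Either a linear constituent on \<open>K\<close> makes the sum of
   \<open>\<chi>\<close> over \<open>D\<close> non-zero, which puts \<open>D\<close> into the
   kernel, or \<open>\<chi>\<close> is induced from the stabilizer \<open>K\<close> of a constituent
   and vanishes at both \<open>x\<close> and \<open>x * y\<close>.\<close>
 have const: "\<chi> (x * y) = \<chi> x" if \<chi>: "\<chi> \<in> Irr G" and y: "y \<in> D" for \<chi> y
 proof (cases "\<exists>\<theta>\<in>Irr K. deg \<theta> = 1 \<and> ip K \<chi> \<theta> \<noteq> 0")
  case True
  then obtain \<theta> where \<theta>: "\<theta> \<in> Irr K" "deg \<theta> = 1" "ip K \<chi> \<theta> \<noteq> 0" by blast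
  have "lin K \<theta>" using Irr_lin[OF \<theta>(1) _ sK] deg_Irr(1)[OF \<theta>(1) sK] \<theta>(2) by simp
  then have \<theta>D: "\<theta> z = 1" if "z \<in> D" for z using that by (simp add: D_def)
  let ?one = "\<lambda>h. if h \<in> D then 1 else 0 :: complex"
  have one: "?one \<in> Irr D" by (rule lin_Irr[OF _ sD]) (simp add: lin_def)
  have ipD: "ip D f ?one = (\<Sum>z\<in>D. f z) / of_nat (card D)" for f
   unfolding ip_def using subgrp_inverse[OF sD] by simp
  have "ip D \<theta> ?one \<noteq> 0" unfolding ipD using \<theta>D sD by simp
  from ip_restrict_pos[OF G(1) sK KG sD DK \<chi> \<theta>(1) one \<theta>(3) this] have "(\<Sum>z\<in>D. \<chi> z) \<noteq> 0" unfolding ipD by auto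
  then show ?thesis by (rule Irr_normal_sum[OF G(1) nDG \<chi> _ x(1) y])
 next
  case False
  obtain n where n: "\<And>k. k \<in> K \<Longrightarrow> \<chi> k = (\<Sum>\<theta>\<in>Irr K. of_nat (n \<theta>) * \<theta> k)" "\<And>\<theta>. \<theta> \<in> Irr K \<Longrightarrow> ip K \<chi> \<theta> = of_nat (n \<theta>)"
   using Irr_restrict[OF G(1) sK KG \<chi>] by blast
  have "\<chi> 1 \<noteq> 0" using deg_Irr[OF \<chi> G(1)] by simp
  then have "\<exists>\<theta>\<in>Irr K. n \<theta> \<noteq> 0" using n(1)[OF subgrp_one[OF sK]] by (metis (no_types, lifting) mult_eq_0_iff of_nat_0 sum.neutral)
  then obtain \<theta> where \<theta>: "\<theta> \<in> Irr K" "ip K \<chi> \<theta> \<noteq> 0" using n(2) by auto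
  then have "deg \<theta> \<noteq> 1" using False by blast
  from gcs_stabilizer[OF G p K(1,3) P KP \<theta>(1) this] have st: "K = stab G \<theta>" by simp
  obtain \<chi>' where \<chi>': "\<forall>g\<in>G. of_nat (card K) * \<chi>' g = (\<Sum>h | h \<in> G \<and> cj h g \<in> K. \<theta> (cj h g))"
   "\<forall>\<eta>\<in>Irr G. ip K \<eta> \<theta> \<noteq> 0 \<longrightarrow> \<eta> = \<chi>'"
   using clifford_induce[OF G(1) K(1) \<theta>(1) st \<theta>(1)] by blast
  have eq: "\<chi> = \<chi>'" using \<chi>'(2) \<chi> \<theta>(2) by blast
  have van: "\<chi> g = 0" if g: "g \<in> G" "g \<notin> K" for g
  proof -
   have "cj h g \<notin> K" if h: "h \<in> G" for h
   proof
    assume "cj h g \<in> K"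
    from nsubD(3)[OF K(1) subgrp_inverse[OF G(1) h] this] show False using g(2) by simp
   qed
   then have E: "{h. h \<in> G \<and> cj h g \<in> K} = {}" by blast
   have "of_nat (card K) * \<chi>' g = (\<Sum>h | h \<in> G \<and> cj h g \<in> K. \<theta> (cj h g))" using \<chi>'(1) g(1) by blast
   then have "of_nat (card K) * \<chi> g = 0" unfolding E eq by simp
   then show ?thesis using sK by simp
  qed
  have yK: "y \<in> K" using y DK by blast
  then have "x * y \<in> G" "x * y \<notin> K" using x(1) KG G(1) xK subgrp_mult_right_iff[OF sK yK, of x] by (auto simp: subgrp_mult)
  then show ?thesis using van x(1) xK by simp
 qed
 have "D \<inter> cent {x} = {1}"
 proof (intro equalityI subsetI)
  fix y assume y: "y \<in> D \<inter> cent {x}"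
  then have yD: "y \<in> D" and xy: "x * y = y * x" by (simp_all add: cent_def)
  have yG: "y \<in> G" using yD DK KG by blast
  have xyG: "x * y \<in> G" by (rule subgrp_mult[OF G(1) x(1) yG])
  \<comment> \<open>Second orthogonality counts the same number of elements conjugating
    \<open>x * y\<close> to \<open>x\<close> as centralizing \<open>x\<close>, which is positive. So
    \<open>x * y\<close> has order \<open>p\<close> like \<open>x\<close>, and commutation leaves
    \<open>y ^ p = 1\<close>.\<close>
  have "of_nat (card {g\<in>G. cj g (x * y) = x}) = (\<Sum>\<chi>\<in>Irr G. \<chi> (x * y) * \<chi> (inverse x))"
   by (rule Irr_second_orth[OF G(1) xyG x(1), symmetric])
  also have "\<dots> = (\<Sum>\<chi>\<in>Irr G. \<chi> x * \<chi> (inverse x))" by (rule sum.cong[OF refl]) (simp add: const[OF _ yD])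
  also have "\<dots> = of_nat (card {g\<in>G. cj g x = x})" by (rule Irr_second_orth[OF G(1) x(1) x(1)])
  finally have ce: "card {g\<in>G. cj g (x * y) = x} = card {g\<in>G. cj g x = x}" by (simp only: of_nat_eq_iff)
  have o1: "1 \<in> {g\<in>G. cj g x = x}" using G(1) by simp
  have "finite {g\<in>G. cj g x = x}" using G(1) by simp
  then have "card {g\<in>G. cj g x = x} \<noteq> 0" by (metis o1 card_0_eq empty_iff)
  then have "{g\<in>G. cj g (x * y) = x} \<noteq> {}" using ce by (metis card.empty)
  then obtain g where g: "cj g (x * y) = x" by blast
  have "cj g ((x * y) ^ p) = 1" unfolding cj_power g by (rule x(3))
  then have "x ^ p * y ^ p = 1" using power_mult_commute[OF xy, of p] by simp
  then have "y ^ p = 1" using x(3) by simp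
  then show "y \<in> {1}" using p1 yD DK by blast
 qed (use sD in auto)
 moreover have "x \<in> nrm D" using nsub_le_nrm[OF nDG] x(1) by blast
 ultimately have "solv D" using fpf_solv[OF p sD x(3)] by blast
 moreover have "\<forall>u\<in>K. \<forall>v\<in>K. u * v * inverse u * inverse v \<in> D"
  using lin_commutator[OF _ sK] sK by (auto simp: D_def subgrp_closed)
 ultimately have "solv K" using solv.ext[OF _ nDK sK] by blast
 then show ?thesis by (rule solv_prime_power_index[OF p _ G(1) K(1,2)])
qed

subsection \<open>Galois conjugation of characters\<close>

lemma cyclotomic_field_add:
 assumes "x \<in> cyclotomic_field n" "y \<in> cyclotomic_field n" shows "x + y \<in> cyclotomic_field n"
proof -
 obtain p q where "x = poly (map_poly of_rat p) (cis (2 * pi / real n))" "y = poly (map_poly of_rat q) (cis (2 * pi / real n))"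
  using assms by (auto simp: cyclotomic_field_def)
 then have "x + y = poly (map_poly of_rat p + map_poly of_rat q) (cis (2 * pi / real n))" by simp
 also have "map_poly of_rat p + map_poly of_rat q = (map_poly of_rat (p + q) :: complex poly)"
  by (rule poly_eqI) (simp add: coeff_map_poly of_rat_add)
 finally show ?thesis unfolding cyclotomic_field_def by blast
qed

lemma root_in_cyclotomic_field: "cis (2 * pi / real n) ^ j \<in> cyclotomic_field n"
proof -
 have "map_poly of_rat (Polynomial.monom 1 j) = (Polynomial.monom 1 j :: complex poly)"
  by (rule poly_eqI) (simp add: coeff_map_poly)
 then have "cis (2 * pi / real n) ^ j = poly (map_poly of_rat (Polynomial.monom 1 j)) (cis (2 * pi / real n))"
  by (simp add: poly_monom)
 then show ?thesis unfolding cyclotomic_field_def by blast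
qed

lemma root_of_unity_power:
 assumes "n > 0" "z ^ n = 1" obtains j where "j < n" "z = cis (2 * pi / real n) ^ j"
proof -
 have "z \<in> (\<lambda>k. cis (2 * pi * real k / real n)) ` {..<n}"
  using bij_betw_roots_unity[OF assms(1)] assms(2) by (simp add: bij_betw_def)
 then obtain j where "j < n" "z = cis (2 * pi * real j / real n)" by auto
 moreover have "cis (2 * pi / real n) ^ j = cis (2 * pi * real j / real n)" by (simp add: DeMoivre mult.commute)
 ultimately show ?thesis using that by simp
qed

lemma root_of_unity_power_eq_1:
 assumes "0 < j" "j < n" shows "cis (2 * pi / real n) ^ j \<noteq> 1"
proof
 assume a: "cis (2 * pi / real n) ^ j = 1"
 have n: "n > 0" using assms by simp
 have "cis (2 * pi * real j / real n) = cis (2 * pi * real 0 / real n)" using a by (simp add: DeMoivre mult.commute)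
 moreover have "inj_on (\<lambda>k. cis (2 * pi * real k / real n)) {..<n}" using bij_betw_roots_unity[OF n] by (simp add: bij_betw_def)
 ultimately have "j = 0" using assms n by (auto dest!: inj_onD[where x = j and y = 0])
 then show False using assms by simp
qed

text \<open>\<open>\<sigma>\<close> sends a primitive root of unity to a power of it, with exponent
  prime to \<open>n\<close> by injectivity. Lists of roots of unity are the form in which
  \<open>char_root_sum\<close> delivers character values.\<close>

lemma galois_power:
 assumes n: "n > 0" and \<sigma>: "\<sigma> \<in> galois_cyclotomic n"
 obtains k where "coprime k n" "\<And>zs. (\<forall>z\<in>set zs. z ^ n = 1) \<Longrightarrow> \<sigma> (\<Sum>z\<leftarrow>zs. z) = (\<Sum>z\<leftarrow>zs. z ^ k)"
proof -
 let ?\<zeta> = "cis (2 * pi / real n)"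
 note in_field = root_in_cyclotomic_field[of n]
 have inj: "inj_on \<sigma> (cyclotomic_field n)" and one: "\<sigma> 1 = 1"
  and add: "\<And>x y. x \<in> cyclotomic_field n \<Longrightarrow> y \<in> cyclotomic_field n \<Longrightarrow> \<sigma> (x + y) = \<sigma> x + \<sigma> y"
  and mult: "\<And>x y. x \<in> cyclotomic_field n \<Longrightarrow> y \<in> cyclotomic_field n \<Longrightarrow> \<sigma> (x * y) = \<sigma> x * \<sigma> y"
  using \<sigma> by (auto simp: galois_cyclotomic_def bij_betw_def)
 have pw: "\<sigma> (?\<zeta> ^ j) = \<sigma> ?\<zeta> ^ j" for j
 proof (induction j)
  case (Suc j)
  then show ?case using mult[OF in_field[of 1] in_field[of j]] by simp
 qed (simp add: one)
 have \<zeta>n: "?\<zeta> ^ n = 1" using n by (simp add: DeMoivre)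
 have \<sigma>n: "\<sigma> ?\<zeta> ^ n = 1" using pw[of n] \<zeta>n one by simp
 obtain k where "k < n" and k: "\<sigma> ?\<zeta> = ?\<zeta> ^ k" by (rule root_of_unity_power[OF n \<sigma>n])
 have "coprime k n"
 proof (rule ccontr)
  assume "\<not> coprime k n"
  define g where "g = gcd k n"
  have "g \<noteq> 1" using \<open>\<not> coprime k n\<close> by (simp add: g_def coprime_iff_gcd_eq_1)
  moreover have "g \<noteq> 0" using n by (simp add: g_def)
  ultimately have g: "1 < g" by simp
  have "g dvd k" "g dvd n" by (simp_all add: g_def)
  \<comment> \<open>With a common divisor \<open>g\<close> of \<open>k\<close> and \<open>n\<close>,
    the power of the primitive root with exponent \<open>n' = n div g\<close> would be mapped to 1
    although it differs from 1.\<close>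
  then obtain k' n' where k': "k = g * k'" and n': "n = g * n'" by (elim dvdE)
  have n'0: "0 < n'" using n n' by (cases n') auto
  moreover have "1 * n' < g * n'" by (rule mult_strict_right_mono[OF g n'0])
  ultimately have n'0: "0 < n'" "n' < n" using n' by simp_all
  have "k * n' = n * k'" unfolding k' n' by (simp add: mult_ac)
  have "\<sigma> (?\<zeta> ^ n') = ?\<zeta> ^ (k * n')" using pw[of n'] k by (simp add: power_mult)
  also have "\<dots> = 1" unfolding \<open>k * n' = n * k'\<close> power_mult \<zeta>n by simp
  finally have "\<sigma> (?\<zeta> ^ n') = \<sigma> (?\<zeta> ^ 0)" using one by simp
  then have "?\<zeta> ^ n' = ?\<zeta> ^ 0" by (rule inj_onD[OF inj _ in_field in_field])
  then show False using root_of_unity_power_eq_1[OF n'0] by simp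
 qed
 moreover have root: "z \<in> cyclotomic_field n \<and> \<sigma> z = z ^ k" if z: "z ^ n = 1" for z
 proof -
  obtain j where "j < n" "z = ?\<zeta> ^ j" by (rule root_of_unity_power[OF n z])
  then show ?thesis using pw[of j] k in_field[of j] by (simp add: power_mult[symmetric] mult.commute)
 qed
 have "0 + 0 \<in> cyclotomic_field n"
  unfolding cyclotomic_field_def by (auto intro!: exI[of _ 0])
 then have z0: "0 \<in> cyclotomic_field n" by simp
 have s0: "\<sigma> 0 = 0" using add[OF z0 z0] by simp
 have "(\<Sum>z\<leftarrow>zs. z) \<in> cyclotomic_field n \<and> \<sigma> (\<Sum>z\<leftarrow>zs. z) = (\<Sum>z\<leftarrow>zs. z ^ k)" if "\<forall>z\<in>set zs. z ^ n = 1" for zs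
  using that
 proof (induction zs)
  case (Cons z zs)
  then have IH: "(\<Sum>z\<leftarrow>zs. z) \<in> cyclotomic_field n" "\<sigma> (\<Sum>z\<leftarrow>zs. z) = (\<Sum>z\<leftarrow>zs. z ^ k)" by auto
  have z: "z \<in> cyclotomic_field n" "\<sigma> z = z ^ k" using root[of z] Cons.prems by auto
  show ?case using cyclotomic_field_add[OF z(1) IH(1)] add[OF z(1) IH(1)] z(2) IH(2) by simp
 qed (simp add: z0 s0)
 ultimately show ?thesis using that by blast
qed

subsection \<open>Transfer to permutation groups\<close>

text \<open>The left regular action, moved to the natural numbers by \<open>perm_of\<close>.\<close>

lemma cayley:
 fixes G :: "('a, 'b) monoid_scheme"
 assumes "group G" "finite (carrier G)"
 obtains \<phi> :: "'a \<Rightarrow> nat perm" where "inj_on \<phi> (carrier G)"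
  "\<And>x y. x \<in> carrier G \<Longrightarrow> y \<in> carrier G \<Longrightarrow> \<phi> (x \<otimes>\<^bsub>G\<^esub> y) = \<phi> x * \<phi> y"
proof -
 interpret group G by (rule assms(1))
 obtain e :: "'a \<Rightarrow> nat" where e: "inj_on e (carrier G)" using finite_imp_inj_to_nat_seg[OF assms(2)] by blast
 define \<phi> where "\<phi> g = perm_of e (carrier G) (\<lambda>x. g \<otimes>\<^bsub>G\<^esub> x)" for g
 have bij: "bij_betw (\<lambda>x. g \<otimes>\<^bsub>G\<^esub> x) (carrier G) (carrier G)" if "g \<in> carrier G" for g
  by (rule bij_betw_byWitness[where f' = "\<lambda>x. inv\<^bsub>G\<^esub> g \<otimes>\<^bsub>G\<^esub> x"]) (use that in \<open>auto simp: m_assoc[symmetric]\<close>)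
 have "\<phi> (x \<otimes>\<^bsub>G\<^esub> y) = \<phi> x * \<phi> y" if "x \<in> carrier G" "y \<in> carrier G" for x y
  unfolding \<phi>_def by (rule perm_of_comp[OF assms(2) e bij bij bij]) (use that in \<open>auto simp: m_assoc\<close>)
 moreover have "inj_on \<phi> (carrier G)"
 proof (rule inj_onI)
  fix x y assume xy: "x \<in> carrier G" "y \<in> carrier G" "\<phi> x = \<phi> y"
  have val: "Perm.apply (\<phi> g) (e \<one>\<^bsub>G\<^esub>) = e g" if "g \<in> carrier G" for g
   unfolding \<phi>_def perm_of_apply[OF assms(2) e bij[OF that]] using that inv_into_f_f[OF e one_closed] by simp
  show "x = y" using val[OF xy(1)] val[OF xy(2)] xy inj_onD[OF e] by metis
 qed
 ultimately show ?thesis using that by blast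
qed

lemma mon_inv:
 assumes "subgrp H" "x \<in> H" shows "inv\<^bsub>mon H\<^esub> x = inverse x"
 by (rule group.inv_equality[OF group_mon[OF assms(1)]]) (use assms in \<open>auto simp: subgrp_inverse\<close>)

lemma solv_derived:
 assumes H: "subgrp H"
 shows "solv S \<Longrightarrow> S \<subseteq> H \<Longrightarrow> \<exists>n. (derived (mon H) ^^ n) S \<subseteq> {1}"
proof (induction rule: solv.induct)
 case triv
 then show ?case by (intro exI[of _ 0]) simp
next
 case (ext N S)
 interpret group "mon H" by (rule group_mon[OF H])
 have NS: "subgrp N" "N \<subseteq> S" using nsubD[OF ext.hyps(2)] by auto
 then have NH: "N \<subseteq> H" using ext.prems by blast
 obtain n where n: "(derived (mon H) ^^ n) N \<subseteq> {1}" using ext.IH[OF NH] by blast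
 have "derived_set (mon H) S \<subseteq> N"
  using ext.hyps(4) ext.prems by (auto simp: mon_inv[OF H] subset_iff)
 then have "derived (mon H) S \<subseteq> N"
  unfolding derived_def by (rule generate_subgroup_incl[OF _ subgroup_mon[OF H NS(1) NH]])
 from order_trans[OF mono_exp_of_derived[OF this, of n] n]
 have "(derived (mon H) ^^ Suc n) S \<subseteq> {1}" by (simp add: funpow_Suc_right del: funpow.simps)
 then show ?case by blast
qed

text \<open>Character values are sums of roots of unity of order dividing the group order, hence
  dividing the possibly larger \<open>n\<close> of the Galois conjugacy; there
  \<open>galois_power\<close> replaces the automorphism by a power map.\<close>

lemma gcs_if_GC_star:
 fixes G :: "('a, 'b) monoid_scheme" and \<phi> :: "'a \<Rightarrow> 'g::grp"
 assumes gc: "GC_star_group G" and inj: "inj_on \<phi> (carrier G)"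
  and hom: "\<And>x y. x \<in> carrier G \<Longrightarrow> y \<in> carrier G \<Longrightarrow> \<phi> (x \<otimes>\<^bsub>G\<^esub> y) = \<phi> x * \<phi> y"
  and one: "\<phi> \<one>\<^bsub>G\<^esub> = 1" and H: "subgrp (\<phi> ` carrier G)"
 shows "gcs (\<phi> ` carrier G)"
 unfolding gcs_def
proof (intro ballI impI)
 let ?H = "\<phi> ` carrier G"
 interpret group G using gc by (simp add: GC_star_group_def)
 have tr: "irr_char G (\<lambda>g. if g \<in> carrier G then \<chi> (\<phi> g) else 0)" if \<chi>: "\<chi> \<in> Irr ?H" for \<chi>
 proof -
  obtain d \<rho> where \<rho>: "irp ?H d \<rho>" "\<And>g. g \<in> ?H \<Longrightarrow> \<chi> g = mat_trace (\<rho> g)" by (rule IrrE[OF \<chi>]) blast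
  have "is_irred_rep G d (\<lambda>x. \<rho> (\<phi> x))" by (rule irr_pullback[OF \<rho>(1)]) (simp_all add: one hom)
  moreover have "(\<lambda>g. if g \<in> carrier G then \<chi> (\<phi> g) else 0) = character G (\<lambda>x. \<rho> (\<phi> x))"
   using \<rho>(2) by (auto simp: character_def)
  ultimately show ?thesis unfolding irr_char_def by blast
 qed
 fix \<chi> \<psi> assume \<chi>: "\<chi> \<in> Irr ?H" and \<psi>: "\<psi> \<in> Irr ?H" and d: "deg \<chi> \<noteq> 1" "deg \<chi> = deg \<psi>"
 let ?\<chi> = "\<lambda>g. if g \<in> carrier G then \<chi> (\<phi> g) else 0" and ?\<psi> = "\<lambda>g. if g \<in> carrier G then \<psi> (\<phi> g) else 0"
 have "char_degree G ?\<chi> = of_nat (deg \<chi>)" "char_degree G ?\<psi> = of_nat (deg \<psi>)"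
  using deg_Irr(1)[OF \<chi> H] deg_Irr(1)[OF \<psi> H] by (simp_all add: char_degree_def one)
 moreover have "of_nat (deg \<chi>) \<noteq> (1::complex)" using d(1) by (metis of_nat_1 of_nat_eq_iff)
 ultimately have "galois_conjugate G ?\<chi> ?\<psi>"
  using gc tr[OF \<chi>] tr[OF \<psi>] d(2) unfolding GC_star_group_def by metis
 then obtain n \<sigma> where n: "n > 0" "card (carrier G) dvd n" and \<sigma>: "\<sigma> \<in> galois_cyclotomic n"
  and eq: "\<forall>g\<in>carrier G. ?\<psi> g = \<sigma> (?\<chi> g)" unfolding galois_conjugate_def by blast
 have cH: "card ?H dvd n" using n(2) card_image[OF inj] by simp
 obtain k where k: "coprime k n" "\<And>zs. (\<forall>z\<in>set zs. z ^ n = 1) \<Longrightarrow> \<sigma> (\<Sum>z\<leftarrow>zs. z) = (\<Sum>z\<leftarrow>zs. z ^ k)"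
  by (rule galois_power[OF n(1) \<sigma>]) blast
 have "coprime k (card ?H)" by (rule coprime_divisors[OF dvd_refl cH k(1)])
 moreover have "\<psi> h = \<chi> (h ^ k)" if h: "h \<in> ?H" for h
 proof -
  obtain g where g: "g \<in> carrier G" "h = \<phi> g" using h by blast
  obtain zs where zs: "\<forall>z\<in>set zs. z ^ card ?H = 1" "\<forall>k. \<chi> (h ^ k) = (\<Sum>z\<leftarrow>zs. z ^ k)"
   using char_root_sum[OF H \<chi> h] by blast
  have zn: "\<forall>z\<in>set zs. z ^ n = 1" using zs(1) cH by (auto simp: power_mult elim!: dvdE)
  have "\<chi> (h ^ 1) = (\<Sum>z\<leftarrow>zs. z ^ 1)" using zs(2) by blast
  then have "\<chi> h = (\<Sum>z\<leftarrow>zs. z)" by simp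
  moreover have "\<psi> h = \<sigma> (\<chi> h)" using eq g by auto
  ultimately have "\<psi> h = (\<Sum>z\<leftarrow>zs. z ^ k)" using k(2)[OF zn] by simp
  then show ?thesis using zs(2) by simp
 qed
 ultimately show "\<exists>k. coprime k (card ?H) \<and> (\<forall>g\<in>?H. \<psi> g = \<chi> (g ^ k))" by blast
qed

theorem theorem3p9:
 fixes G :: "('a, 'b) monoid_scheme"
 assumes "group G" and "finite (carrier G)"
  and "GC_star_group G"
  and "\<not> solvable G"
 shows "derived G (carrier G) = carrier G"
proof (rule ccontr)
 assume neq: "derived G (carrier G) \<noteq> carrier G"
 interpret group G by (rule assms(1))
 obtain \<phi> :: "'a \<Rightarrow> nat perm" where inj: "inj_on \<phi> (carrier G)"
  and hom: "\<And>x y. x \<in> carrier G \<Longrightarrow> y \<in> carrier G \<Longrightarrow> \<phi> (x \<otimes>\<^bsub>G\<^esub> y) = \<phi> x * \<phi> y"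
  by (rule cayley[OF assms(1,2)]) blast
 let ?H = "\<phi> ` carrier G" and ?D = "\<phi> ` derived G (carrier G)"
 have one: "\<phi> \<one>\<^bsub>G\<^esub> = 1" using hom[OF one_closed one_closed] by (metis grp_mult_eq_left l_one one_closed)
 have img: "subgrp (\<phi> ` S)" if S: "subgroup S G" for S
 proof (rule subgrpI)
  show "finite (\<phi> ` S)" using assms(2) subgroup.subset[OF S] finite_subset by blast
  show "1 \<in> \<phi> ` S" using one subgroup.one_closed[OF S] by (metis image_eqI)
  fix u v assume "u \<in> \<phi> ` S" "v \<in> \<phi> ` S"
  then obtain x y where xy: "x \<in> S" "y \<in> S" "u = \<phi> x" "v = \<phi> y" by blast
  then have "u * v = \<phi> (x \<otimes>\<^bsub>G\<^esub> y)" using hom subgroup.mem_carrier[OF S] by simp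
  then show "u * v \<in> \<phi> ` S" using subgroup.m_closed[OF S xy(1,2)] by blast
 qed
 have H: "subgrp ?H" by (rule img[OF subgroup_self])
 have sD: "subgrp ?D" by (rule img[OF derived_is_subgroup[OF order_refl]])
 have DG: "derived G (carrier G) \<subseteq> carrier G" by (rule derived_in_carrier[OF order_refl])
 have inv: "\<phi> (inv\<^bsub>G\<^esub> x) = inverse (\<phi> x)" if x: "x \<in> carrier G" for x
 proof -
  have "\<phi> x * \<phi> (inv\<^bsub>G\<^esub> x) = 1" using hom[OF x inv_closed[OF x]] r_inv[OF x] one by simp
  then show ?thesis by (rule grp_inverse_unique[symmetric])
 qed
 have comm: "u * v * inverse u * inverse v \<in> ?D" if uv: "u \<in> ?H" "v \<in> ?H" for u v
 proof -
  obtain x y where xy: "x \<in> carrier G" "y \<in> carrier G" "u = \<phi> x" "v = \<phi> y" using uv by blast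
  have "x \<otimes>\<^bsub>G\<^esub> y \<otimes>\<^bsub>G\<^esub> inv\<^bsub>G\<^esub> x \<otimes>\<^bsub>G\<^esub> inv\<^bsub>G\<^esub> y \<in> derived G (carrier G)"
   unfolding derived_def by (rule generate.incl) (use xy in blast)
  moreover have "\<phi> (x \<otimes>\<^bsub>G\<^esub> y \<otimes>\<^bsub>G\<^esub> inv\<^bsub>G\<^esub> x \<otimes>\<^bsub>G\<^esub> inv\<^bsub>G\<^esub> y) = u * v * inverse u * inverse v"
   using xy hom inv by simp
  ultimately show ?thesis by (metis image_eqI)
 qed
 have nD: "nsub ?D ?H"
 proof (rule nsubI[OF sD])
  show "?D \<subseteq> ?H" using DG by blast
  fix g x assume g: "g \<in> ?H" and x: "x \<in> ?D"
  have "x \<in> ?H" using x DG by blast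
  then have "(g * x * inverse g * inverse x) * x \<in> ?D" using comm[OF g] x subgrp_mult[OF sD] by blast
  then show "cj g x \<in> ?D" by (simp add: cj_def mult.assoc)
 qed
 have "?D \<noteq> ?H" using neq inj_on_image_eq_iff[OF inj DG order_refl] by blast
 \<comment> \<open>A proper derived subgroup leaves a non-trivial abelian quotient, hence a linear
   character other than the trivial one.\<close>
 then obtain \<mu> x where \<mu>: "lin ?H \<mu>" "x \<in> ?H" "\<mu> x \<noteq> 1" using lin_ex[OF H nD _ comm] by blast
 have "solv ?H" by (rule gcs_solv[OF H gcs_if_GC_star[OF assms(3) inj hom one H] \<mu>])
 then obtain n where n: "(derived (mon ?H) ^^ n) ?H \<subseteq> {1}" using solv_derived[OF H] by blast
 interpret M: group "mon ?H" by (rule group_mon[OF H])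
 have sH: "subgroup ?H (mon ?H)" using M.subgroup_self by simp
 have "1 \<in> (derived (mon ?H) ^^ n) ?H" using subgroup.one_closed[OF M.exp_of_derived_is_subgroup[OF sH, of n]] by simp
 then have "(derived (mon ?H) ^^ n) ?H = {\<one>\<^bsub>mon ?H\<^esub>}" using n by auto
 then have sol: "solvable_seq (mon ?H) (\<phi> ` carrier G)" by (rule M.trivial_derived_seq_imp_solvable[OF sH])
 interpret group_hom G "mon ?H" \<phi>
  by unfold_locales (use hom in \<open>auto simp: hom_def\<close>)
 have "solvable G" unfolding solvable_def by (rule solvable_img_imp_solvable[OF subgroup_self inj sol])
 then show False using assms(4) by simp
qed

end
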